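(* Let $v_h, v \in V$ and $M_h, M \in L^{p'}(\Omega;\mathbf{R}^m)$ ($h\in\mathbf{N}$) satisfy $$v_h \to v \ \text{ weakly in } V, \qquad M_h \to M \ \text{ weakly in } L^{p'}(\Omega;\mathbf{R}^m)$$ as $h\to\infty$, and assume that there is some $g \in V'$ such that $$\mathrm{div}_X M_h = g \quad \text{in } V' \quad\text{for every } h .$$ Then $$(M_h, X v_h)_{\mathbf{R}^m} \to (M, Xv)_{\mathbf{R}^m} \quad \text{in } \mathcal{D}'(\Omega) \text{ as } h\to\infty .$$
   Context: Setting. $\Omega$ is a bounded domain of $\mathbf{R}^n$, $2\le p<\infty$, $p'=p/(p-1)$. $X=(X_1,\dots,X_m)$, $m\le n$, is a family of vector fields $X_j(x)=\sum_{i=1}^n c_{ji}(x)\partial_i$, identified with $(c_{j1},\dots,c_{jn})$, defined and Lipschitz continuous on an open neighborhood $\Omega_0$ of $\overline\Omega$. Let $d$ be the Carnot-Carathéodory distance induced by $X$: $d(x,y)$ is the infimum of the $\tau\ge 0$ for which there is an absolutely continuous curve $\gamma:[0,\tau]\to\Omega_0$ from $x$ to $y$ with $\gamma'(s)=\sum_j b_j(s)X_j(\gamma(s))$ a.e., $b_j$ measurable, $\sum_j b_j^2\le 1$ ($d(x,y)=\infty$ if there is none). Put $B_d(x,r)=\{y\in\Omega_0: d(x,y)<r\}$, and let $|\cdot|$ of a set be Lebesgue measure. Standing assumptions: (H1) $d(x,y)<\infty$ for all $x,y\in\Omega_0$, and $d$ is continuous with respect to the usual topology of $\mathbf{R}^n$;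 (H2) for any compact $K\subset\Omega_0$ there exist $r_K,C_K>0$ with $|B_d(x,2r)|\le C_K|B_d(x,r)|$ for all $x\in K$, $r<r_K$; (H3) there exist constants $c,C>0$ such that for every ball $B=B_d(\overline x,r)$ with $cB:=B_d(\overline x,cr)\subseteq\Omega_0$, every $u\in\mathrm{Lip}(c\overline B)$ and every $x\in\overline B$, $$\Big|u(x)-\frac1{|B|}\int_B u(y)\,dy\Big|\le C\int_{cB}|Xu(y)|\frac{d(x,y)}{|B_d(x,d(x,y))|}\,dy;$$ (LIC) there is a Lebesgue null set $Z_X\subset\Omega$ such that $X_1(x),\dots,X_m(x)$ are linearly independent for every $x\in\Omega\setminus Z_X$. Function spaces. For $u\in L^1(\Omega)$, $Xu=(X_1u,\dots,X_mu)$ is understood in the sense of distributions: $\langle X_ju,\varphi\rangle=\int_\Omega u\,X_j^T\varphi\,dx$ for $\varphi\in \mathbf{C}_c^\infty(\Omega)$, where $X_j^T\varphi=-\sum_{i=1}^n\partial_i(c_{ji}\varphi)$. $W^{1,p}_X(\Omega)=\{u\in L^p(\Omega): X_ju\in L^p(\Omega),\ j=1,\dots,m\}$ with norm $(\int_\Omega|u|^p+\int_\Omega|Xu|^p)^{1/p}$; $V:=W^{1,p}_{X,0}(\Omega)$ is the closure of $\mathbf{C}^1_c(\Omega)\cap W^{1,p}_X(\Omega)$ in $W^{1,p}_X(\Omega)$, normed equivalently by $\|u\|_V=(\int_\Omega|Xu|^p\,dx)^{1/p}$; $V'=W^{-1,p'}_X(\Omega)$ is its dual. For $M\in L^{p'}(\Omega;\mathbf{R}^m)$,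 $\mathrm{div}_XM=\sum_{j=1}^mX_j^TM_j$ (note the sign) is the element of $V'$ given by $\langle\mathrm{div}_XM,v\rangle_{V'\times V}=\int_\Omega(M,Xv)_{\mathbf{R}^m}dx$, $v\in V$. *)

theory Defs
  imports "HOL-Analysis.Analysis"
begin

text \<open>The family of vector fields is \<open>X :: 'm \<Rightarrow> real^'n \<Rightarrow> real^'n\<close>, with
  coefficients \<open>c\<^sub>j\<^sub>i(x) = X j x $ i\<close>. Functions on an open set \<open>\<Omega>\<close> are represented by total
  functions of which only the values on \<open>\<Omega>\<close> matter; elements of Lebesgue and Sobolev spaces are
  represented by functions, without passing to the quotient by equality almost everywhere.\<close>

section \<open>Lebesgue spaces, duals, weak convergence\<close>

definition Lp :: "real \<Rightarrow> (real^'n) set \<Rightarrow> (real^'n \<Rightarrow> 'b::euclidean_space) set" where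
  "Lp p \<Omega> = {f. f \<in> borel_measurable (lebesgue_on \<Omega>) \<and>
                 integrable (lebesgue_on \<Omega>) (\<lambda>x. norm (f x) powr p)}"

definition Lp_norm :: "real \<Rightarrow> (real^'n) set \<Rightarrow> (real^'n \<Rightarrow> 'b::euclidean_space) \<Rightarrow> real" where
  "Lp_norm p \<Omega> f = (LINT x|lebesgue_on \<Omega>. norm (f x) powr p) powr (1 / p)"

text \<open>Topological dual of a linear space \<open>S\<close> of functions with (semi)norm \<open>N\<close>. Boundedness forces
  a functional to agree on functions whose difference has \<open>N\<close>-norm zero. Only the values of
  functionals on \<open>S\<close> are relevant.\<close>

definition dual_space ::
    "('a \<Rightarrow> 'b::real_vector) set \<Rightarrow> (('a \<Rightarrow> 'b) \<Rightarrow> real) \<Rightarrow> (('a \<Rightarrow> 'b) \<Rightarrow> real) set" where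
  "dual_space S N = {L.
     (\<forall>u\<in>S. \<forall>v\<in>S. L (\<lambda>x. u x + v x) = L u + L v) \<and>
     (\<forall>a. \<forall>u\<in>S. L (\<lambda>x. a *\<^sub>R u x) = a * L u) \<and>
     (\<exists>C. \<forall>u\<in>S. \<bar>L u\<bar> \<le> C * N u)}"

definition weakly_converges ::
    "('a \<Rightarrow> 'b::real_vector) set \<Rightarrow> (('a \<Rightarrow> 'b) \<Rightarrow> real) \<Rightarrow>
      (nat \<Rightarrow> 'a \<Rightarrow> 'b) \<Rightarrow> ('a \<Rightarrow> 'b) \<Rightarrow> bool" where
  "weakly_converges S N f g \<longleftrightarrow> (\<forall>L\<in>dual_space S N. (\<lambda>h. L (f h)) \<longlonglongrightarrow> L g)"

section \<open>Test functions and distributional derivatives along the vector fields\<close>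

definition partial_deriv :: "'n \<Rightarrow> (real^'n \<Rightarrow> real) \<Rightarrow> real^'n \<Rightarrow> real" where
  "partial_deriv i f x = deriv (\<lambda>t. f (x + t *\<^sub>R axis i 1)) 0"

primrec C_k :: "nat \<Rightarrow> (real^'n \<Rightarrow> real) \<Rightarrow> bool" where
  "C_k 0 f \<longleftrightarrow> continuous_on UNIV f"
| "C_k (Suc k) f \<longleftrightarrow> f differentiable_on UNIV \<and> (\<forall>i. C_k k (partial_deriv i f))"

text \<open>Functions with compact support in \<open>\<Omega>\<close>, extended by zero to the whole space.\<close>

definition compact_support_in :: "(real^'n) set \<Rightarrow> (real^'n \<Rightarrow> real) \<Rightarrow> bool" where
  "compact_support_in \<Omega> \<phi> \<longleftrightarrow>
     compact (closure {x. \<phi> x \<noteq> 0}) \<and> closure {x. \<phi> x \<noteq> 0} \<subseteq> \<Omega>"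

definition C1c :: "(real^'n) set \<Rightarrow> (real^'n \<Rightarrow> real) set" where
  "C1c \<Omega> = {\<phi>. C_k 1 \<phi> \<and> compact_support_in \<Omega> \<phi>}"

definition Cinfc :: "(real^'n) set \<Rightarrow> (real^'n \<Rightarrow> real) set" where
  "Cinfc \<Omega> = {\<phi>. (\<forall>k. C_k k \<phi>) \<and> compact_support_in \<Omega> \<phi>}"

text \<open>The partial derivatives below exist almost everywhere, as the coefficients are Lipschitz
  continuous; the value on the exceptional null set is irrelevant.\<close>

definition X_transpose ::
    "('m \<Rightarrow> real^'n \<Rightarrow> real^'n) \<Rightarrow> 'm \<Rightarrow> (real^'n \<Rightarrow> real) \<Rightarrow> real^'n \<Rightarrow> real" where
  "X_transpose X j \<phi> x = - (\<Sum>i\<in>UNIV. partial_deriv i (\<lambda>y. X j y $ i * \<phi> y) x)"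

text \<open>The distributions \<open>X\<^sub>j u\<close> on \<open>\<Omega>\<close> are represented by the components of the locally integrable
  function \<open>G\<close>. By uniqueness almost everywhere, \<open>Xgrad\<close> picks a representative.\<close>

definition has_Xgrad ::
    "(real^'n) set \<Rightarrow> ('m::finite \<Rightarrow> real^'n \<Rightarrow> real^'n) \<Rightarrow>
      (real^'n \<Rightarrow> real) \<Rightarrow> (real^'n \<Rightarrow> real^'m) \<Rightarrow> bool" where
  "has_Xgrad \<Omega> X u G \<longleftrightarrow>
     (\<forall>K. compact K \<and> K \<subseteq> \<Omega> \<longrightarrow> integrable (lebesgue_on K) G) \<and>
     (\<forall>\<phi>\<in>Cinfc \<Omega>. \<forall>j.
        (LINT x|lebesgue_on \<Omega>. G x $ j * \<phi> x) =
        (LINT x|lebesgue_on \<Omega>. u x * X_transpose X j \<phi> x))"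

definition Xgrad ::
    "(real^'n) set \<Rightarrow> ('m::finite \<Rightarrow> real^'n \<Rightarrow> real^'n) \<Rightarrow>
      (real^'n \<Rightarrow> real) \<Rightarrow> real^'n \<Rightarrow> real^'m" where
  "Xgrad \<Omega> X u = (SOME G. has_Xgrad \<Omega> X u G)"

section \<open>Sobolev spaces\<close>

definition W1p ::
    "real \<Rightarrow> (real^'n) set \<Rightarrow> ('m::finite \<Rightarrow> real^'n \<Rightarrow> real^'n) \<Rightarrow> (real^'n \<Rightarrow> real) set" where
  "W1p p \<Omega> X = {u \<in> Lp p \<Omega>. \<exists>G \<in> Lp p \<Omega>. has_Xgrad \<Omega> X u G}"

definition W1p_norm ::
    "real \<Rightarrow> (real^'n) set \<Rightarrow> ('m::finite \<Rightarrow> real^'n \<Rightarrow> real^'n) \<Rightarrow> (real^'n \<Rightarrow> real) \<Rightarrow> real" where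
  "W1p_norm p \<Omega> X u =
     ((LINT x|lebesgue_on \<Omega>. \<bar>u x\<bar> powr p) +
      (LINT x|lebesgue_on \<Omega>. norm (Xgrad \<Omega> X u x) powr p)) powr (1 / p)"

definition W1p0 ::
    "real \<Rightarrow> (real^'n) set \<Rightarrow> ('m::finite \<Rightarrow> real^'n \<Rightarrow> real^'n) \<Rightarrow> (real^'n \<Rightarrow> real) set" where
  "W1p0 p \<Omega> X = {u \<in> W1p p \<Omega> X.
     \<forall>e>0. \<exists>\<phi> \<in> C1c \<Omega> \<inter> W1p p \<Omega> X. W1p_norm p \<Omega> X (\<lambda>x. u x - \<phi> x) < e}"

definition W1p0_norm ::
    "real \<Rightarrow> (real^'n) set \<Rightarrow> ('m::finite \<Rightarrow> real^'n \<Rightarrow> real^'n) \<Rightarrow> (real^'n \<Rightarrow> real) \<Rightarrow> real" where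
  "W1p0_norm p \<Omega> X u = Lp_norm p \<Omega> (Xgrad \<Omega> X u)"

definition divX ::
    "(real^'n) set \<Rightarrow> ('m::finite \<Rightarrow> real^'n \<Rightarrow> real^'n) \<Rightarrow>
      (real^'n \<Rightarrow> real^'m) \<Rightarrow> (real^'n \<Rightarrow> real) \<Rightarrow> real" where
  "divX \<Omega> X M v = (LINT x|lebesgue_on \<Omega>. M x \<bullet> Xgrad \<Omega> X v x)"

text \<open>Convergence in \<open>\<D>'(\<Omega>)\<close> of distributions given by functions.\<close>

definition converges_in_distributions ::
    "(real^'n) set \<Rightarrow> (nat \<Rightarrow> real^'n \<Rightarrow> real) \<Rightarrow> (real^'n \<Rightarrow> real) \<Rightarrow> bool" where
  "converges_in_distributions \<Omega> f g \<longleftrightarrow>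
     (\<forall>\<phi>\<in>Cinfc \<Omega>. (\<lambda>h. LINT x|lebesgue_on \<Omega>. f h x * \<phi> x)
        \<longlonglongrightarrow> (LINT x|lebesgue_on \<Omega>. g x * \<phi> x))"

section \<open>The Carnot-Caratheodory distance\<close>

text \<open>\<open>D\<close> is a finite set of (endpoints of) pairwise disjoint open intervals.\<close>

definition abs_cont_on :: "real set \<Rightarrow> (real \<Rightarrow> 'a::real_normed_vector) \<Rightarrow> bool" where
  "abs_cont_on I f \<longleftrightarrow>
     (\<forall>e>0. \<exists>\<delta>>0. \<forall>D. finite D \<and> (\<forall>(s,t)\<in>D. s \<le> t \<and> {s..t} \<subseteq> I) \<and>
        disjoint_family_on (\<lambda>(s,t). {s<..<t}) D \<and> (\<Sum>(s,t)\<in>D. t - s) < \<delta>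
        \<longrightarrow> (\<Sum>(s,t)\<in>D. norm (f t - f s)) < e)"

definition subunit_curve ::
    "(real^'n) set \<Rightarrow> ('m::finite \<Rightarrow> real^'n \<Rightarrow> real^'n) \<Rightarrow> real \<Rightarrow> (real \<Rightarrow> real^'n) \<Rightarrow> bool" where
  "subunit_curve \<Omega>0 X \<tau> \<gamma> \<longleftrightarrow>
     abs_cont_on {0..\<tau>} \<gamma> \<and> \<gamma> ` {0..\<tau>} \<subseteq> \<Omega>0 \<and>
     (\<exists>b :: real \<Rightarrow> real^'m.
        b \<in> borel_measurable (lebesgue_on {0..\<tau>}) \<and>
        (\<forall>s\<in>{0..\<tau>}. (\<Sum>j\<in>UNIV. (b s $ j)\<^sup>2) \<le> 1) \<and>
        (AE s in lebesgue_on {0..\<tau>}.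
           (\<gamma> has_vector_derivative (\<Sum>j\<in>UNIV. b s $ j *\<^sub>R X j (\<gamma> s))) (at s within {0..\<tau>})))"

text \<open>In \<open>ennreal\<close> the infimum of the empty set is \<open>\<infinity>\<close>.\<close>

definition cc_dist ::
    "(real^'n) set \<Rightarrow> ('m::finite \<Rightarrow> real^'n \<Rightarrow> real^'n) \<Rightarrow> real^'n \<Rightarrow> real^'n \<Rightarrow> ennreal" where
  "cc_dist \<Omega>0 X x y =
     Inf {ennreal \<tau> |\<tau>. 0 \<le> \<tau> \<and> (\<exists>\<gamma>. subunit_curve \<Omega>0 X \<tau> \<gamma> \<and> \<gamma> 0 = x \<and> \<gamma> \<tau> = y)}"

definition cc_ball ::
    "(real^'n) set \<Rightarrow> ('m::finite \<Rightarrow> real^'n \<Rightarrow> real^'n) \<Rightarrow> real^'n \<Rightarrow> ennreal \<Rightarrow> (real^'n) set" where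
  "cc_ball \<Omega>0 X x r = {y \<in> \<Omega>0. cc_dist \<Omega>0 X x y < r}"

definition cc_cball ::
    "(real^'n) set \<Rightarrow> ('m::finite \<Rightarrow> real^'n \<Rightarrow> real^'n) \<Rightarrow> real^'n \<Rightarrow> ennreal \<Rightarrow> (real^'n) set" where
  "cc_cball \<Omega>0 X x r = {y \<in> \<Omega>0. cc_dist \<Omega>0 X x y \<le> r}"

section \<open>Standing assumptions\<close>

definition hyp_H1 :: "(real^'n) set \<Rightarrow> ('m::finite \<Rightarrow> real^'n \<Rightarrow> real^'n) \<Rightarrow> bool" where
  "hyp_H1 \<Omega>0 X \<longleftrightarrow>
     (\<forall>x\<in>\<Omega>0. \<forall>y\<in>\<Omega>0. cc_dist \<Omega>0 X x y < \<infinity>) \<and>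
     continuous_on (\<Omega>0 \<times> \<Omega>0) (\<lambda>(x, y). cc_dist \<Omega>0 X x y)"

definition hyp_H2 :: "(real^'n) set \<Rightarrow> ('m::finite \<Rightarrow> real^'n \<Rightarrow> real^'n) \<Rightarrow> bool" where
  "hyp_H2 \<Omega>0 X \<longleftrightarrow>
     (\<forall>K. compact K \<and> K \<subseteq> \<Omega>0 \<longrightarrow>
        (\<exists>rK>0. \<exists>CK>0. \<forall>x\<in>K. \<forall>r. 0 < r \<and> r < rK \<longrightarrow>
           emeasure lebesgue (cc_ball \<Omega>0 X x (ennreal (2 * r)))
             \<le> ennreal CK * emeasure lebesgue (cc_ball \<Omega>0 X x (ennreal r))))"

text \<open>The integral on the right-hand side may be infinite, hence the integral with values in
  \<open>ennreal\<close>; the single point \<open>y = x\<close> does not contribute (\<open>0 / 0 = 0\<close>). \<open>Lip\<close> refers to the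
  Euclidean metric; \<open>u\<close> is a total function whose values off the closed ball of radius \<open>c r\<close> are
  meant to be irrelevant, i.e. \<open>c \<ge> 1\<close> in all satisfiable instances. The closed balls are those of
  \<open>cc_dist\<close>; since it is a length distance, under \<open>hyp_H1\<close> they are the closures in \<open>\<Omega>0\<close> of the
  open balls. By definition of \<open>cc_ball\<close> the premise \<open>cB \<subseteq> \<Omega>0\<close> always holds.\<close>

definition hyp_H3 :: "(real^'n) set \<Rightarrow> ('m::finite \<Rightarrow> real^'n \<Rightarrow> real^'n) \<Rightarrow> bool" where
  "hyp_H3 \<Omega>0 X \<longleftrightarrow>
     (\<exists>c>0. \<exists>C>0. \<forall>z\<in>\<Omega>0. \<forall>r>0.
        (let B = cc_ball \<Omega>0 X z (ennreal r);
             cB = cc_ball \<Omega>0 X z (ennreal (c * r))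
         in cB \<subseteq> \<Omega>0 \<longrightarrow>
           (\<forall>u. (\<exists>L. L-lipschitz_on (cc_cball \<Omega>0 X z (ennreal (c * r))) u) \<longrightarrow>
             (\<forall>x\<in>cc_cball \<Omega>0 X z (ennreal r).
                ennreal \<bar>u x - (LINT y|lebesgue_on B. u y) / measure lebesgue B\<bar>
                \<le> ennreal C *
                  (\<integral>\<^sup>+ y. ennreal (norm (Xgrad cB X u y)) *
                      (cc_dist \<Omega>0 X x y /
                       emeasure lebesgue (cc_ball \<Omega>0 X x (cc_dist \<Omega>0 X x y)))
                    \<partial>lebesgue_on cB)))))"

definition hyp_LIC :: "(real^'n) set \<Rightarrow> ('m::finite \<Rightarrow> real^'n \<Rightarrow> real^'n) \<Rightarrow> bool" where
  "hyp_LIC \<Omega> X \<longleftrightarrow>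
     (\<exists>Z. Z \<subseteq> \<Omega> \<and> Z \<in> null_sets lebesgue \<and>
        (\<forall>x\<in>\<Omega> - Z. inj (\<lambda>j. X j x) \<and> independent (range (\<lambda>j. X j x))))"

end

theory Submission
  imports Defs
begin

text \<open>Put \<open>w\<^sub>h = v\<^sub>h - v\<close> and let \<open>\<phi>\<close> be a test function. As all \<open>M\<^sub>h\<close> have the same divergence \<open>g\<close>,
  \[ \int \varphi\, M_h \cdot X w_h = g(\varphi w_h) - \int w_h\, M_h \cdot X \varphi, \qquad
     g(\varphi w_h) = \int \varphi\, M_0 \cdot X w_h + \int w_h\, M_0 \cdot X \varphi . \]
  The weakly convergent \<open>M\<^sub>h\<close> are bounded, so everything tends to \<open>0\<close> once \<open>w\<^sub>h\<close> tends to \<open>0\<close> strongly in \<open>L\<^sup>p\<close>.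
  For this compactness, (H3) bounds the distance of \<open>w\<^sub>h\<close> from its means over balls of radius \<open>r\<close> by a kernel
  operator applied to \<open>X w\<^sub>h\<close>, whose \<open>L\<^sup>p\<close> norm is \<open>O(r)\<close> by doubling and Schur's test. For fixed \<open>r\<close> the means tend to \<open>0\<close>
  pointwise and boundedly, because (H3) on a large ball also gives a Poincare inequality on \<open>V\<close>, by which integration
  over a Borel set is a continuous functional on \<open>V\<close>.

  The distributions \<open>X\<^sub>j u\<close> are tested against classical derivatives of Lipschitz functions, hence these have to
  exist almost everywhere and to obey integration by parts.\<close>

section \<open>Differentiability of Lipschitz functions\<close>

text \<open>Among the terms above, only the one with w_h M_h . X phi multiplies two varying
  sequences, and no derivative falls on w_h there; hence strong convergence of w_h itself, and not
  of X w_h, closes the argument. Expressing g through the fixed field M_0 turns g(phi w_h) into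
  explicit functionals of w_h that are visibly bounded. (H3) speaks of Lipschitz functions only. The
  compactness argument therefore runs on C^1_c functions whose distance to w_h in W^{1,p} tends to
  0, and it works with their classical gradients. These must agree with the distributional ones,
  also on balls that cut through the support. As the coefficients are merely Lipschitz, this
  agreement rests on differentiating a coefficient times a test function almost everywhere. The
  order O(r) comes from dyadic shells: doubling lets shell n of a ball of radius r contribute at
  most a constant times r 2^-n to the integral of the kernel.\<close>

lemma quotient_interval:
  fixes F :: "real \<Rightarrow> real"
  assumes F: "continuous_on UNIV F" and fr: "\<exists>\<^sub>F h in at 0. (F (x + h) - F x) / h < \<alpha>" and d: "0 < d"
  shows "\<exists>a r. x \<in> ball a r \<and> r < d \<and> F (a + r) - F (a - r) < \<alpha> * (2 * r) \<and> ball a r \<subseteq> ball x d"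
proof -
  have contF: "isCont F y" for y
    using F by (simp add: continuous_on_eq_continuous_at)
  have "\<forall>\<^sub>F h in at (0::real). h \<noteq> 0 \<and> \<bar>h\<bar> < d"
    unfolding eventually_at by (intro exI[of _ d]) (use d in auto)
  from frequently_eventually_frequently[OF fr this]
  obtain h where h: "(F (x + h) - F x) / h < \<alpha>" "h \<noteq> 0" "\<bar>h\<bar> < d"
    by (auto dest: frequently_ex)
  show ?thesis
  proof (cases "h > 0")
    case True
    \<comment> \<open>The given quotient belongs to an interval with x at one end. Strict inequality
      and continuity of F leave room to push that end beyond x by \<delta>, so that x becomes an
      interior point; the ball is centred at the midpoint of the enlarged interval.\<close>
    have g0: "F (x + h) - F (x - 0) - \<alpha> * (h + 0) < 0"
      using h True by (simp add: field_simps)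
    have "isCont (\<lambda>\<delta>. F (x + h) - F (x - \<delta>) - \<alpha> * (h + \<delta>)) 0"
      by (intro continuous_intros isCont_o2[OF _ contF])
    then have "((\<lambda>\<delta>. F (x + h) - F (x - \<delta>) - \<alpha> * (h + \<delta>)) \<longlongrightarrow> F (x + h) - F (x - 0) - \<alpha> * (h + 0)) (at_right 0)"
      unfolding isCont_def by (rule filterlim_mono[OF _ order_refl at_le[OF subset_UNIV]])
    then have "\<forall>\<^sub>F \<delta> in at_right 0. F (x + h) - F (x - \<delta>) - \<alpha> * (h + \<delta>) < 0"
      using g0 by (rule order_tendstoD(2))
    moreover have "\<forall>\<^sub>F \<delta> in at_right (0::real). 0 < \<delta> \<and> \<delta> < d - h"
      using h True unfolding eventually_at_right_field by (intro exI[of _ "d - \<bar>h\<bar>"]) auto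
    ultimately have "\<forall>\<^sub>F \<delta> in at_right 0. F (x + h) - F (x - \<delta>) - \<alpha> * (h + \<delta>) < 0 \<and> 0 < \<delta> \<and> \<delta> < d - h"
      by (rule eventually_conj)
    then obtain \<delta> where \<delta>: "F (x + h) - F (x - \<delta>) - \<alpha> * (h + \<delta>) < 0" "0 < \<delta>" "\<delta> < d - h"
      using eventually_happens'[OF trivial_limit_at_right_real] by blast
    have e: "(2*x+h-\<delta>)/2 + (h+\<delta>)/2 = x + h" "(2*x+h-\<delta>)/2 - (h+\<delta>)/2 = x - \<delta>" by (simp_all add: field_simps)
    show ?thesis
      by (intro exI[of _ "(2*x+h-\<delta>)/2"] exI[of _ "(h+\<delta>)/2"], unfold e)
         (use \<delta> True h in \<open>auto simp: dist_real_def field_simps abs_if split: if_splits\<close>)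
  next
    case False
    then have neg: "h < 0" using h by auto
    have g0: "F (x + 0) - F (x + h) - \<alpha> * (0 - h) < 0"
      using h neg by (simp add: field_simps)
    have "isCont (\<lambda>\<delta>. F (x + \<delta>) - F (x + h) - \<alpha> * (\<delta> - h)) 0"
      by (intro continuous_intros isCont_o2[OF _ contF])
    then have "((\<lambda>\<delta>. F (x + \<delta>) - F (x + h) - \<alpha> * (\<delta> - h)) \<longlongrightarrow> F (x + 0) - F (x + h) - \<alpha> * (0 - h)) (at_right 0)"
      unfolding isCont_def by (rule filterlim_mono[OF _ order_refl at_le[OF subset_UNIV]])
    then have "\<forall>\<^sub>F \<delta> in at_right 0. F (x + \<delta>) - F (x + h) - \<alpha> * (\<delta> - h) < 0"
      using g0 by (rule order_tendstoD(2))
    moreover have "\<forall>\<^sub>F \<delta> in at_right (0::real). 0 < \<delta> \<and> \<delta> < d + h"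
      using h neg unfolding eventually_at_right_field by (intro exI[of _ "d - \<bar>h\<bar>"]) auto
    ultimately have "\<forall>\<^sub>F \<delta> in at_right 0. F (x + \<delta>) - F (x + h) - \<alpha> * (\<delta> - h) < 0 \<and> 0 < \<delta> \<and> \<delta> < d + h"
      by (rule eventually_conj)
    then obtain \<delta> where \<delta>: "F (x + \<delta>) - F (x + h) - \<alpha> * (\<delta> - h) < 0" "0 < \<delta>" "\<delta> < d + h"
      using eventually_happens'[OF trivial_limit_at_right_real] by blast
    have e: "(2*x+h+\<delta>)/2 + (\<delta>-h)/2 = x + \<delta>" "(2*x+h+\<delta>)/2 - (\<delta>-h)/2 = x + h" by (simp_all add: field_simps)
    show ?thesis
      by (intro exI[of _ "(2*x+h+\<delta>)/2"] exI[of _ "(\<delta>-h)/2"], unfold e)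
         (use \<delta> neg h in \<open>auto simp: dist_real_def field_simps abs_if split: if_splits\<close>)
  qed
qed

text \<open>Vitali's theorem accepts arbitrarily small balls that merely contain the point to be
  covered, and \<open>quotient_interval\<close> supplies them. A cover by large quotients arises
  from the same statement for \<open>- F\<close>.\<close>

lemma vitali_quotient_cover:
  fixes F :: "real \<Rightarrow> real"
  assumes F: "continuous_on UNIV F" and fr: "\<And>x. x \<in> E \<Longrightarrow> \<exists>\<^sub>F h in at 0. (F (x + h) - F x) / h < \<alpha>"
    and U: "open U" "E \<subseteq> U"
  obtains C where "countable C" "disjoint_family_on (\<lambda>(a,r). ball a r) C" 
    "(\<Union>(a,r)\<in>C. ball a r) \<subseteq> U" "\<And>a r. (a,r) \<in> C \<Longrightarrow> 0 < r \<and> F (a + r) - F (a - r) < \<alpha> * (2 * r)"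
    "E - (\<Union>(a,r)\<in>C. ball a r) \<in> null_sets lebesgue"
proof -
  let ?K = "{(a,r). 0 < r \<and> ball a r \<subseteq> U \<and> F (a + r) - F (a - r) < \<alpha> * (2 * r)}"
  have "\<exists>i. i \<in> ?K \<and> x \<in> ball (fst i) (snd i) \<and> snd i < d" if x: "x \<in> E" and d: "0 < d" for x d
  proof -
    obtain e where e: "0 < e" "ball x e \<subseteq> U" using U x by (metis open_contains_ball subsetD)
    obtain a r where ar: "x \<in> ball a r" "r < min d e" "F (a + r) - F (a - r) < \<alpha> * (2 * r)" "ball a r \<subseteq> ball x (min d e)"
      using quotient_interval[OF F fr[OF x], of "min d e"] d e by auto
    have "0 < r" using ar(1) by (metis ball_eq_empty empty_iff not_less)
    moreover have "ball a r \<subseteq> U" using ar(4) e(2) by (meson order_trans subset_ball min.cobounded2)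
    ultimately have "(a,r) \<in> ?K" using ar by auto
    then show ?thesis using ar by (intro exI[of _ "(a,r)"]) auto
  qed
  then obtain C where C: "countable C" "C \<subseteq> ?K"
     "pairwise (\<lambda>i j. disjnt (ball (fst i) (snd i)) (ball (fst j) (snd j))) C"
     "negligible(E - (\<Union>i \<in> C. ball (fst i) (snd i)))"
    by (rule Vitali_covering_theorem_balls[of E ?K fst snd])
  show ?thesis
  proof
    show "countable C" by fact
    show "disjoint_family_on (\<lambda>(a,r). ball a r) C"
      using C(3) unfolding disjoint_family_on_def pairwise_def disjnt_def by (auto simp: case_prod_beta)
    show "(\<Union>(a,r)\<in>C. ball a r) \<subseteq> U" using C(2) by blast
    show "0 < r \<and> F (a + r) - F (a - r) < \<alpha> * (2 * r)" if "(a,r) \<in> C" for a r using that C(2) by blast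
    show "E - (\<Union>(a,r)\<in>C. ball a r) \<in> null_sets lebesgue"
      using C(4) by (simp add: negligible_iff_null_sets case_prod_beta)
  qed
qed

lemma emeasure_interval_measure_ball:
  fixes F :: "real \<Rightarrow> real"
  assumes "mono F" "continuous_on UNIV F" "0 < r"
  shows "emeasure (interval_measure F) (ball a r) = ennreal (F (a + r) - F (a - r))"
proof -
  let ?M = "interval_measure F"
  have Icc: "emeasure ?M {x..y} = ennreal (F y - F x)" if "x \<le> y" for x y
    using emeasure_interval_measure_Icc[OF that _ assms(2)] monoD[OF assms(1)] by auto
  \<comment> \<open>F is continuous, so its Stieltjes measure has no atoms.\<close>
  have "{a - r, a + r} \<in> null_sets ?M"
  proof -
    have "{y} \<in> null_sets ?M" for y
      using Icc[of y y] by (intro null_setsI) auto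
    then have "{a - r} \<union> {a + r} \<in> null_sets ?M" by (intro null_sets.Un)
    then show ?thesis by (simp add: insert_commute)
  qed
  then have "emeasure ?M (ball a r \<union> {a - r, a + r}) = emeasure ?M (ball a r)"
    by (intro emeasure_Un_null_set) auto
  also have "ball a r \<union> {a - r, a + r} = {a - r..a + r}"
    using assms(3) by (auto simp: dist_real_def)
  finally show ?thesis using Icc[of "a - r" "a + r"] assms(3) by simp
qed

text \<open>Two Vitali coverings are nested: balls with small difference quotients cover almost all of \<open>E\<close> inside
  an open set, and within their union \<open>U\<close> balls with large quotients cover it again. Comparing the
  Stieltjes measure of \<open>U\<close> from both sides forces \<open>E\<close> to be null.\<close>

lemma mono_derivates_null:
  fixes F :: "real \<Rightarrow> real"
  assumes F: "mono F" "continuous_on UNIV F" and E: "E \<in> sets borel" "bounded E" and "\<alpha> < \<beta>"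
    and lo: "\<And>x. x \<in> E \<Longrightarrow> \<exists>\<^sub>F h in at 0. (F (x + h) - F x) / h < \<alpha>"
    and hi: "\<And>x. x \<in> E \<Longrightarrow> \<exists>\<^sub>F h in at 0. (F (x + h) - F x) / h > \<beta>"
  shows "emeasure lborel E = 0"
proof (cases "E = {}")
  case False
  then obtain x where "x \<in> E" by auto
  then obtain h where h: "(F (x + h) - F x) / h < \<alpha>" using lo frequently_ex by blast
  \<comment> \<open>Monotonicity makes all quotients nonnegative, which forces \<alpha> > 0; both
    slopes can then serve as factors in \<open>ennreal\<close>.\<close>
  have "0 \<le> (F (x + h) - F x) / h"
    using monoD[OF F(1), of x "x+h"] monoD[OF F(1), of "x+h" x] by (cases h "0::real" rule: linorder_cases) (auto simp: field_simps)
  then have \<alpha>: "0 < \<alpha>" "0 < \<beta>" using h \<open>\<alpha> < \<beta>\<close> by auto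
  let ?M = "interval_measure F"
  have fin: "emeasure lborel E < \<infinity>" using emeasure_bounded_finite[OF E(2)] .
  \<comment> \<open>The error e is the excess of an open set over E. As E is bounded, its measure is
    finite, and e -> 0 will leave \<beta> |E| at most \<alpha> |E|.\<close>
  have ineq: "ennreal \<beta> * emeasure lborel E \<le> ennreal \<alpha> * (emeasure lborel E + ennreal e)" if e: "0 < e" for e
  proof -
    obtain O' where O': "open O'" "E \<subseteq> O'" "emeasure lborel (O' - E) < ennreal e"
      using outer_regular_lborel[OF E(1) e] by blast
    obtain C where C: "countable C" "disjoint_family_on (\<lambda>(a,r). ball a r) C" 
      "(\<Union>(a,r)\<in>C. ball a r) \<subseteq> O'" "\<And>a r. (a,r) \<in> C \<Longrightarrow> 0 < r \<and> F (a + r) - F (a - r) < \<alpha> * (2 * r)"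
      "E - (\<Union>(a,r)\<in>C. ball a r) \<in> null_sets lebesgue"
      using vitali_quotient_cover[OF F(2) lo O'(1,2)] by blast
    define U where "U = (\<Union>(a,r)\<in>C. ball a r)"
    have U: "open U" unfolding U_def by (auto intro!: open_UN)
    have hi': "\<exists>\<^sub>F h in at 0. ((- F (x + h)) - (- F x)) / h < - \<beta>" if "x \<in> E \<inter> U" for x
      using hi[of x] that by (auto elim!: frequently_elim1 simp: diff_divide_distrib)
    have cm: "continuous_on UNIV (\<lambda>x. - F x)" using F(2) by (intro continuous_intros)
    obtain D where D: "countable D" "disjoint_family_on (\<lambda>(a,r). ball a r) D" 
      "(\<Union>(a,r)\<in>D. ball a r) \<subseteq> U" "\<And>a r. (a,r) \<in> D \<Longrightarrow> 0 < r \<and> (- F (a + r)) - (- F (a - r)) < - \<beta> * (2 * r)"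
      "E \<inter> U - (\<Union>(a,r)\<in>D. ball a r) \<in> null_sets lebesgue"
      using vitali_quotient_cover[of "\<lambda>x. - F x" "E \<inter> U" "-\<beta>" U, OF cm hi' U(1)] by (metis inf_le2)
    have sum: "emeasure N (\<Union>(a,r)\<in>C'. ball a r) = (\<integral>\<^sup>+i. emeasure N (ball (fst i) (snd i)) \<partial>count_space C')"
      if "countable C'" "disjoint_family_on (\<lambda>(a,r). ball a r) C'" "sets N = sets borel" for C' and N :: "real measure"
      using emeasure_UN_countable[of C' "\<lambda>(a,r). ball a r" N] that by (auto simp: case_prod_beta)
    have s1: "emeasure ?M U \<le> ennreal \<alpha> * emeasure lborel U"
    proof -
      have "emeasure ?M U = (\<integral>\<^sup>+i. emeasure ?M (ball (fst i) (snd i)) \<partial>count_space C)"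
        unfolding U_def by (rule sum[OF C(1,2)]) simp
      also have "\<dots> \<le> (\<integral>\<^sup>+i. ennreal \<alpha> * emeasure lborel (ball (fst i) (snd i)) \<partial>count_space C)"
      proof (intro nn_integral_mono)
        fix i assume "i \<in> space (count_space C)"
        then have i: "0 < snd i" "F (fst i + snd i) - F (fst i - snd i) < \<alpha> * (2 * snd i)"
          using C(4)[of "fst i" "snd i"] by auto
        have "ball (fst i) (snd i) = {fst i - snd i <..< fst i + snd i}" by (auto simp: dist_real_def)
        then have "emeasure lborel (ball (fst i) (snd i)) = ennreal (2 * snd i)" using i by simp
        then show "emeasure ?M (ball (fst i) (snd i)) \<le> ennreal \<alpha> * emeasure lborel (ball (fst i) (snd i))"
          using i \<alpha> emeasure_interval_measure_ball[OF F i(1), of "fst i"] by (simp add: ennreal_mult'[symmetric] ennreal_leI)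
      qed
      also have "\<dots> = ennreal \<alpha> * (\<integral>\<^sup>+i. emeasure lborel (ball (fst i) (snd i)) \<partial>count_space C)"
        by (rule nn_integral_cmult) simp
      also have "(\<integral>\<^sup>+i. emeasure lborel (ball (fst i) (snd i)) \<partial>count_space C) = emeasure lborel U"
        unfolding U_def by (rule sum[OF C(1,2), symmetric]) simp
      finally show ?thesis .
    qed
    let ?V = "\<Union>(a,r)\<in>D. ball a r"
    have s2: "ennreal \<beta> * emeasure lborel ?V \<le> emeasure ?M ?V"
    proof -
      have "ennreal \<beta> * emeasure lborel ?V = ennreal \<beta> * (\<integral>\<^sup>+i. emeasure lborel (ball (fst i) (snd i)) \<partial>count_space D)"
        by (subst sum[OF D(1,2)]) auto
      also have "\<dots> = (\<integral>\<^sup>+i. ennreal \<beta> * emeasure lborel (ball (fst i) (snd i)) \<partial>count_space D)"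
        by (rule nn_integral_cmult[symmetric]) simp
      also have "\<dots> \<le> (\<integral>\<^sup>+i. emeasure ?M (ball (fst i) (snd i)) \<partial>count_space D)"
      proof (intro nn_integral_mono)
        fix i assume "i \<in> space (count_space D)"
        then have i: "0 < snd i" "F (fst i + snd i) - F (fst i - snd i) > \<beta> * (2 * snd i)"
          using D(4)[of "fst i" "snd i"] by auto
        have "ball (fst i) (snd i) = {fst i - snd i <..< fst i + snd i}" by (auto simp: dist_real_def)
        then have "emeasure lborel (ball (fst i) (snd i)) = ennreal (2 * snd i)" using i by simp
        then show "ennreal \<beta> * emeasure lborel (ball (fst i) (snd i)) \<le> emeasure ?M (ball (fst i) (snd i))"
          using i \<alpha> emeasure_interval_measure_ball[OF F i(1), of "fst i"] by (simp add: ennreal_mult'[symmetric] ennreal_leI)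
      qed
      also have "\<dots> = emeasure ?M ?V"
        by (rule sum[OF D(1,2), symmetric]) simp
      finally show ?thesis .
    qed
    have V: "open ?V" by (auto intro!: open_UN)
    have "emeasure lborel E \<le> emeasure lborel ?V"
    proof -
      have "E \<subseteq> ?V \<union> ((E - U) \<union> (E \<inter> U - ?V))" by auto
      then have "emeasure lebesgue E \<le> emeasure lebesgue (?V \<union> ((E - U) \<union> (E \<inter> U - ?V)))"
        using V C(5) D(5) by (intro emeasure_mono sets.Un) (auto simp: U_def null_setsD2)
      also have "\<dots> = emeasure lebesgue ?V"
        using V C(5) D(5) by (intro emeasure_Un_null_set null_sets.Un) (auto simp: U_def)
      finally show ?thesis using E V by simp
    qed
    then have "ennreal \<beta> * emeasure lborel E \<le> ennreal \<beta> * emeasure lborel ?V"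
      by (intro mult_left_mono) auto
    also have "\<dots> \<le> emeasure ?M ?V" by (rule s2)
    also have "\<dots> \<le> emeasure ?M U" using D(3) U by (intro emeasure_mono) auto
    also have "\<dots> \<le> ennreal \<alpha> * emeasure lborel U" by (rule s1)
    also have "ennreal \<alpha> * emeasure lborel U \<le> ennreal \<alpha> * (emeasure lborel E + ennreal e)"
    proof (rule mult_left_mono)
    have "emeasure lborel U \<le> emeasure lborel (E \<union> (O' - E))"
      using C(3) O' E U by (intro emeasure_mono) (auto simp: U_def)
    also have "\<dots> \<le> emeasure lborel E + emeasure lborel (O' - E)"
      using O' E by (intro emeasure_subadditive) auto
    also have "\<dots> \<le> emeasure lborel E + ennreal e" using O'(3) by (intro add_left_mono) auto
    finally show "emeasure lborel U \<le> emeasure lborel E + ennreal e" .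
    qed simp
    finally show ?thesis .
  qed
  obtain m where m: "emeasure lborel E = ennreal m" "0 \<le> m" using fin by (cases "emeasure lborel E") auto
  have *: "\<beta> * m \<le> \<alpha> * (m + e)" if "0 < e" for e
    using ineq[OF that] \<alpha> m that by (simp add: ennreal_mult'[symmetric] ennreal_plus[symmetric] del: ennreal_plus)
  have "(\<beta> - \<alpha>) * m \<le> \<alpha> * e" if "0 < e" for e
    using *[OF that] by (simp add: algebra_simps)
  \<comment> \<open>For m > 0 this value of e would bound (\<beta> - \<alpha>) m by half of
    itself.\<close>
  from this[of "(\<beta> - \<alpha>) * m / (2*\<alpha>)"] \<open>\<alpha> < \<beta>\<close> \<alpha> have "\<not> 0 < m" by (auto simp: field_simps)
  then show ?thesis using m by auto
qed auto

text \<open>Adding \<open>L * x\<close> makes f nondecreasing and shifts every difference quotient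
  by L, so the monotone case applies with both slopes shifted.\<close>

lemma lipschitz_derivates_null:
  fixes f :: "real \<Rightarrow> real"
  assumes f: "L-lipschitz_on UNIV f" and E: "E \<in> sets borel" "bounded E" and "\<alpha> < \<beta>"
    and lo: "\<And>x. x \<in> E \<Longrightarrow> \<exists>\<^sub>F h in at 0. (f (x + h) - f x) / h < \<alpha>"
    and hi: "\<And>x. x \<in> E \<Longrightarrow> \<exists>\<^sub>F h in at 0. (f (x + h) - f x) / h > \<beta>"
  shows "emeasure lborel E = 0"
proof (rule mono_derivates_null[where F = "\<lambda>x. f x + L * x" and \<alpha> = "\<alpha> + L" and \<beta> = "\<beta> + L"])
  have "\<bar>f x - f y\<bar> \<le> L * \<bar>x - y\<bar>" for x y
    using lipschitz_onD[OF f, of x y] by (simp add: dist_real_def)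
  then have "f x - f y \<le> L * (y - x)" if "x \<le> y" for x y
    using that by (metis abs_le_D1 abs_minus_commute abs_of_nonneg diff_ge_0_iff_ge)
  then show "mono (\<lambda>x. f x + L * x)"
    by (intro monoI) (smt (verit) right_diff_distrib)
  show "continuous_on UNIV (\<lambda>x. f x + L * x)"
    using lipschitz_on_continuous_on[OF f] by (intro continuous_intros)
  have ne: "\<forall>\<^sub>F h in at (0::real). h \<noteq> 0" by (simp add: eventually_at_filter)
  show "\<exists>\<^sub>F h in at 0. (f (x + h) + L * (x + h) - (f x + L * x)) / h < \<alpha> + L" if "x \<in> E" for x
    using frequently_eventually_frequently[OF lo[OF that] ne] by (rule frequently_elim1) (auto simp: diff_divide_distrib add_divide_distrib distrib_left)
  show "\<exists>\<^sub>F h in at 0. (f (x + h) + L * (x + h) - (f x + L * x)) / h > \<beta> + L" if "x \<in> E" for x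
    using frequently_eventually_frequently[OF hi[OF that] ne] by (rule frequently_elim1) (auto simp: diff_divide_distrib add_divide_distrib distrib_left)
qed (use assms in auto)

text \<open>If lower and upper limit differed, two rationals would fit strictly between them, and q
  would pass below the smaller and above the larger arbitrarily close to 0. The levels are rational
  because one null set per pair of levels has to be removed later.\<close>

lemma frequently_limit_if_not_oscillating:
  fixes q :: "real \<Rightarrow> real"
  assumes bd: "\<forall>\<^sub>F h in at 0. \<bar>q h\<bar> \<le> L"
    and no: "\<And>\<alpha> \<beta>. \<alpha> \<in> \<rat> \<Longrightarrow> \<beta> \<in> \<rat> \<Longrightarrow> \<alpha> < \<beta> \<Longrightarrow>
      \<not> ((\<exists>\<^sub>F h in at 0. q h < \<alpha>) \<and> (\<exists>\<^sub>F h in at 0. q h > \<beta>))"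
  shows "\<exists>D. (q \<longlongrightarrow> D) (at 0)"
proof -
  let ?l = "Liminf (at 0) (\<lambda>h. ereal (q h))" and ?u = "Limsup (at 0) (\<lambda>h. ereal (q h))"
  have nb: "at (0::real) \<noteq> bot" by simp
  have "?l = ?u"
  proof (rule ccontr)
    assume "?l \<noteq> ?u"
    then have "?l < ?u" using Liminf_le_Limsup[OF nb] by (metis order_le_less)
    then obtain \<alpha>' where a: "?l < ereal (real_of_rat \<alpha>')" "ereal (real_of_rat \<alpha>') < ?u" using ereal_dense3 by blast
    then obtain \<beta>' where b: "ereal (real_of_rat \<alpha>') < ereal (real_of_rat \<beta>')" "ereal (real_of_rat \<beta>') < ?u" using ereal_dense3 by blast
    have "\<exists>\<^sub>F h in at 0. q h < real_of_rat \<alpha>'"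
    proof (rule ccontr)
      assume "\<not> ?thesis"
      then have "\<forall>\<^sub>F h in at 0. ereal (real_of_rat \<alpha>') \<le> ereal (q h)"
        unfolding frequently_def by (simp add: not_less)
      from Liminf_bounded[OF this] a(1) show False by simp
    qed
    moreover have "\<exists>\<^sub>F h in at 0. q h > real_of_rat \<beta>'"
    proof (rule ccontr)
      assume "\<not> ?thesis"
      then have "\<forall>\<^sub>F h in at 0. ereal (q h) \<le> ereal (real_of_rat \<beta>')"
        unfolding frequently_def by (simp add: not_less)
      from Limsup_bounded[OF this] b(2) show False by simp
    qed
    ultimately show False using no[of "real_of_rat \<alpha>'" "real_of_rat \<beta>'"] b(1) by (auto simp: Rats_def)
  qed
  moreover have "ereal (- L) \<le> ?l"
    by (rule Liminf_bounded) (use bd in \<open>auto elim!: eventually_mono\<close>)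
  moreover have "?u \<le> ereal L"
    by (rule Limsup_bounded) (use bd in \<open>auto elim!: eventually_mono\<close>)
  ultimately have *: "?l = ?u" "ereal (- L) \<le> ?u" "?u \<le> ereal L" by simp_all
  then have "\<bar>?u\<bar> \<noteq> \<infinity>" by (cases ?u) simp_all
  then obtain D where "?u = ereal D" by (auto simp: ereal_real' dest: sym)
  then have D: "?l = ereal D" "?u = ereal D" using * by simp_all
  have "((\<lambda>h. ereal (q h)) \<longlongrightarrow> ereal D) (at 0)"
    using Liminf_eq_Limsup[OF nb D] .
  then show ?thesis by auto
qed

text \<open>Averaging over the translates of \<open>E\<close> along \<open>e\<close> replaces a Fubini decomposition of the space.\<close>

lemma emeasure_lborel_zero_if_lines_null:
  fixes E :: "'a::euclidean_space set"
  assumes E[measurable]: "E \<in> sets borel"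
    and "\<And>x. emeasure lborel {t\<in>{0..1}. x + t *\<^sub>R e \<in> E} = 0"
  shows "emeasure lborel E = 0"
proof -
  have shift: "emeasure lborel E = (\<integral>\<^sup>+x. indicator E (x + t *\<^sub>R e) \<partial>lborel)" for t
  proof -
    have "emeasure lborel E = (\<integral>\<^sup>+x. indicator E x \<partial>lborel)" by simp
    also have "\<dots> = (\<integral>\<^sup>+x. indicator E x \<partial>distr lborel borel ((+) (t *\<^sub>R e)))"
      by (simp add: lborel_distr_plus)
    also have "\<dots> = (\<integral>\<^sup>+x. indicator E (t *\<^sub>R e + x) \<partial>lborel)"
      by (subst nn_integral_distr) auto
    finally show ?thesis by (simp add: add.commute)
  qed
  have "emeasure lborel E = (\<integral>\<^sup>+t. indicator {0..1::real} t * emeasure lborel E \<partial>lborel)"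
    by (simp add: nn_integral_multc)
  also have "\<dots> = (\<integral>\<^sup>+t. (\<integral>\<^sup>+x. indicator {0..1::real} t * indicator E (x + t *\<^sub>R e) \<partial>lborel) \<partial>lborel)"
    by (rule nn_integral_cong, subst shift, rule nn_integral_cmult[symmetric]) simp
  also have "\<dots> = (\<integral>\<^sup>+x. (\<integral>\<^sup>+t. indicator {0..1::real} t * indicator E (x + t *\<^sub>R e) \<partial>lborel) \<partial>lborel)"
    by (rule lborel_pair.Fubini') simp
  also have "\<dots> = (\<integral>\<^sup>+x. 0 \<partial>(lborel :: 'a measure))"
  proof (rule nn_integral_cong)
    fix x
    have "(\<integral>\<^sup>+t. indicator {0..1::real} t * indicator E (x + t *\<^sub>R e) \<partial>lborel)
      = (\<integral>\<^sup>+t. indicator {t\<in>{0..1}. x + t *\<^sub>R e \<in> E} t \<partial>lborel)"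
      by (intro nn_integral_cong) (auto split: split_indicator)
    also have "\<dots> = 0" by (subst nn_integral_indicator) (use assms(2) in auto)
    finally show "(\<integral>\<^sup>+t. indicator {0..1::real} t * indicator E (x + t *\<^sub>R e) \<partial>lborel) = 0" .
  qed
  finally show ?thesis by simp
qed

text \<open>For a pair of rational levels, the points whose quotients oscillate across both of them
  form a Borel set that meets every segment in direction e in a null set, by the result on the line.
  Outside the countable union of these sets the quotients converge.\<close>

lemma lipschitz_AE_directional_derivative:
  fixes f :: "'a::euclidean_space \<Rightarrow> real"
  assumes f: "L-lipschitz_on UNIV f"
  shows "AE x in lborel. \<exists>D. ((\<lambda>t. f (x + t *\<^sub>R e)) has_field_derivative D) (at 0)"
proof -
  define q where "q x h = (f (x + h *\<^sub>R e) - f x) / h" for x h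
  have lip: "\<bar>f x - f y\<bar> \<le> L * norm (x - y)" for x y
    using lipschitz_onD[OF f, of x y] by (simp add: dist_norm)
  have contf: "continuous_on UNIV f" by (rule lipschitz_on_continuous_on[OF f])
  have contq1: "continuous_on UNIV (\<lambda>x. q x h)" if "h \<noteq> 0" for h
    unfolding q_def using that by (intro continuous_intros continuous_on_compose2[OF contf]) auto
  have contq2: "continuous_on (-{0}) (q x)" for x
    unfolding q_def by (intro continuous_intros continuous_on_compose2[OF contf]) auto
  \<comment> \<open>For fixed h the quotient is continuous in x, so these sets are open and
    \<open>E \<alpha> \<beta>\<close>, their countable intersection, is Borel.\<close>
  define S where "S \<alpha> \<beta> n = (\<Union>h\<in>{h\<in>\<rat>. h \<noteq> 0 \<and> \<bar>h\<bar> < 1 / real (Suc n)}. {x. q x h < \<alpha>}) \<inter>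
     (\<Union>h\<in>{h\<in>\<rat>. h \<noteq> 0 \<and> \<bar>h\<bar> < 1 / real (Suc n)}. {x. q x h > \<beta>})" for \<alpha> \<beta> n
  define E where "E \<alpha> \<beta> = (\<Inter>n. S \<alpha> \<beta> n)" for \<alpha> \<beta>
  have "open (S \<alpha> \<beta> n)" for \<alpha> \<beta> n
    unfolding S_def by (intro open_Int open_UN ballI open_Collect_less contq1 continuous_intros) auto
  then have Em: "E \<alpha> \<beta> \<in> sets borel" for \<alpha> \<beta>
    unfolding E_def by (intro sets.countable_INT) auto
  have freq: "(\<exists>\<^sub>F h in at 0. P h)" if "\<And>n. \<exists>h\<in>\<rat>. h \<noteq> 0 \<and> \<bar>h\<bar> < 1 / real (Suc n) \<and> P h" for P
    unfolding frequently_def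
  proof
    assume "\<forall>\<^sub>F h in at 0. \<not> P h"
    then obtain d where d: "d > 0" "\<And>h. h \<noteq> 0 \<Longrightarrow> \<bar>h\<bar> < d \<Longrightarrow> \<not> P h"
      by (auto simp: eventually_at dist_real_def)
    obtain n where "1 / real (Suc n) < d" using d(1) nat_approx_posE by blast
    with d that[of n] show False by force
  qed
  have null: "E \<alpha> \<beta> \<in> null_sets lborel" if "\<alpha> < \<beta>" for \<alpha> \<beta>
  proof -
    have "emeasure lborel {t\<in>{0..1}. x + t *\<^sub>R e \<in> E \<alpha> \<beta>} = 0" for x
    proof (rule lipschitz_derivates_null[where f = "\<lambda>t. f (x + t *\<^sub>R e)" and L = "L * norm e" and \<alpha> = \<alpha> and \<beta> = \<beta>])
      show "(L * norm e)-lipschitz_on UNIV (\<lambda>t. f (x + t *\<^sub>R e))"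
      proof (rule lipschitz_onI)
        fix s t :: real
        have "(x + s *\<^sub>R e) - (x + t *\<^sub>R e) = (s - t) *\<^sub>R e" by (simp add: scaleR_diff_left)
        then show "dist (f (x + s *\<^sub>R e)) (f (x + t *\<^sub>R e)) \<le> L * norm e * dist s t"
          using lip[of "x + s *\<^sub>R e" "x + t *\<^sub>R e"] by (simp add: dist_real_def mult.commute mult.left_commute)
      qed (use lipschitz_on_nonneg[OF f] in auto)
      show "{t\<in>{0..1}. x + t *\<^sub>R e \<in> E \<alpha> \<beta>} \<in> sets borel"
        using Em by measurable
      show "bounded {t\<in>{0..1::real}. x + t *\<^sub>R e \<in> E \<alpha> \<beta>}"
        by (rule bounded_subset[OF bounded_closed_interval[of 0 1]]) auto
      fix t assume t: "t \<in> {t\<in>{0..1}. x + t *\<^sub>R e \<in> E \<alpha> \<beta>}"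
      have eq: "(f (x + (t + h) *\<^sub>R e) - f (x + t *\<^sub>R e)) / h = q (x + t *\<^sub>R e) h" for h
        by (simp add: q_def algebra_simps)
      have mem: "x + t *\<^sub>R e \<in> S \<alpha> \<beta> n" for n using t by (auto simp: E_def)
      show "\<exists>\<^sub>F h in at 0. (f (x + (t + h) *\<^sub>R e) - f (x + t *\<^sub>R e)) / h < \<alpha>"
        unfolding eq using mem by (intro freq) (auto simp: S_def)
      show "\<exists>\<^sub>F h in at 0. (f (x + (t + h) *\<^sub>R e) - f (x + t *\<^sub>R e)) / h > \<beta>"
        unfolding eq using mem by (intro freq) (auto simp: S_def)
    qed fact
    then have "emeasure lborel (E \<alpha> \<beta>) = 0" by (rule emeasure_lborel_zero_if_lines_null[OF Em])
    then show ?thesis using Em by (auto intro: null_setsI)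
  qed
  \<comment> \<open>Rational increments lose nothing: away from 0 the quotient is continuous in the
    increment, so an increment with quotient in the open set T has rational neighbours with the same
    property.\<close>
  have ratfreq: "\<exists>h\<in>\<rat>. h \<noteq> 0 \<and> \<bar>h\<bar> < 1 / real (Suc n) \<and> q x h \<in> T" if "\<exists>\<^sub>F h in at 0. q x h \<in> T" "open T" for x T n
  proof -
    have "\<forall>\<^sub>F h in at (0::real). h \<noteq> 0 \<and> \<bar>h\<bar> < 1 / real (Suc n)"
      unfolding eventually_at by (intro exI[of _ "1 / real (Suc n)"]) auto
    from frequently_eventually_frequently[OF that(1) this]
    obtain h where h: "q x h \<in> T" "h \<noteq> 0" "\<bar>h\<bar> < 1 / real (Suc n)" by (auto dest: frequently_ex)
    have "open ((-{0}) \<inter> q x -` T)"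
      using continuous_on_open_vimage[of "-{0}" "q x"] contq2[of x] that(2) by (auto simp: Int_commute)
    then have "open (((-{0}) \<inter> q x -` T) \<inter> ball 0 (1 / real (Suc n)))" (is "open ?W") by blast
    moreover have "h \<in> ?W" using h by (auto simp: dist_real_def)
    ultimately obtain e where e: "0 < e" "ball h e \<subseteq> ?W" by (metis open_contains_ball)
    obtain r where r: "r \<in> \<rat>" "h < r" "r < h + e" using Rats_dense_in_real[of h "h + e"] e(1) by auto
    then have "r \<in> ball h e" by (auto simp: dist_real_def)
    then show ?thesis using e(2) r(1) by (intro bexI[of _ r]) (auto simp: dist_real_def)
  qed
  have "AE x in lborel. \<forall>p\<in>{p\<in>\<rat>\<times>\<rat>. fst p < snd p}. x \<notin> E (fst p) (snd p)"
  proof (subst AE_ball_countable)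
    show "countable {p\<in>\<rat>\<times>(\<rat>::real set). fst p < snd p}"
      by (rule countable_subset[of _ "\<rat>\<times>\<rat>"]) (auto intro: countable_rat)
    show "\<forall>p\<in>{p\<in>\<rat>\<times>(\<rat>::real set). fst p < snd p}. AE x in lborel. x \<notin> E (fst p) (snd p)"
      using null AE_not_in by blast
  qed
  then show ?thesis
  proof (rule AE_mp, intro AE_I2 impI)
    fix x assume x: "\<forall>p\<in>{p\<in>\<rat>\<times>\<rat>. fst p < snd p}. x \<notin> E (fst p) (snd p)"
    have "\<exists>D. (q x \<longlongrightarrow> D) (at 0)"
    proof (rule frequently_limit_if_not_oscillating)
      show "\<forall>\<^sub>F h in at 0. \<bar>q x h\<bar> \<le> L * norm e"
      proof (rule eventually_at_filter[THEN iffD2], rule always_eventually, intro allI impI)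
        fix h :: real assume "h \<noteq> 0"
        then show "\<bar>q x h\<bar> \<le> L * norm e"
          using lip[of "x + h *\<^sub>R e" x] by (simp add: q_def field_simps abs_mult)
      qed
      fix \<alpha> \<beta> :: real assume ab: "\<alpha> \<in> \<rat>" "\<beta> \<in> \<rat>" "\<alpha> < \<beta>"
      show "\<not> ((\<exists>\<^sub>F h in at 0. q x h < \<alpha>) \<and> (\<exists>\<^sub>F h in at 0. q x h > \<beta>))"
      proof
        assume as: "(\<exists>\<^sub>F h in at 0. q x h < \<alpha>) \<and> (\<exists>\<^sub>F h in at 0. q x h > \<beta>)"
        have "x \<in> S \<alpha> \<beta> n" for n
          using ratfreq[of x "{..<\<alpha>}" n] ratfreq[of x "{\<beta><..}" n] as by (auto simp: S_def)
        then have "x \<in> E \<alpha> \<beta>" by (auto simp: E_def)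
        then show False using x ab by force
      qed
    qed
    then show "\<exists>D. ((\<lambda>t. f (x + t *\<^sub>R e)) has_field_derivative D) (at 0)"
      unfolding has_field_derivative_iff q_def by simp
  qed
qed

section \<open>Smooth test functions\<close>

text \<open>\<open>partial_deriv\<close> has a value at every point, even where no derivative
  exists. The product rule and statements almost everywhere need the existence itself, which this
  predicate adds.\<close>

definition has_pd :: "'n \<Rightarrow> (real^'n \<Rightarrow> real) \<Rightarrow> real \<Rightarrow> real^'n \<Rightarrow> bool" where
  "has_pd i f D x \<longleftrightarrow> ((\<lambda>t. f (x + t *\<^sub>R axis i 1)) has_field_derivative D) (at 0)"

lemma has_pd_unique: "has_pd i f D x \<Longrightarrow> partial_deriv i f x = D"
  unfolding has_pd_def partial_deriv_def by (rule DERIV_imp_deriv)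

lemma has_pd_mult:
  "has_pd i f D x \<Longrightarrow> has_pd i g E x \<Longrightarrow> has_pd i (\<lambda>x. f x * g x) (D * g x + E * f x) x"
  unfolding has_pd_def using DERIV_mult by fastforce

lemma has_pd_const: "has_pd i (\<lambda>x. c) 0 x"
  unfolding has_pd_def by simp

lemma differentiable_has_pd:
  fixes f :: "real^'n \<Rightarrow> real"
  assumes "f differentiable (at x)"
  shows "has_pd i f (partial_deriv i f x) x"
proof -
  obtain f' where f': "(f has_derivative f') (at x)"
    using assms by (auto simp: differentiable_def)
  interpret bounded_linear f' using f' by (rule has_derivative_bounded_linear)
  have "((\<lambda>t. x + t *\<^sub>R axis i 1) has_derivative (\<lambda>t. t *\<^sub>R axis i 1)) (at (0::real))"
    by (auto intro!: derivative_eq_intros)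
  then have "((\<lambda>t. f (x + t *\<^sub>R axis i 1)) has_derivative (\<lambda>t. f' (t *\<^sub>R axis i 1))) (at 0)"
    by (rule has_derivative_compose[of "\<lambda>t. x + t *\<^sub>R axis i 1" "\<lambda>t. t *\<^sub>R axis i 1" 0 UNIV f f']) (use f' in simp)
  then have "has_pd i f (f' (axis i 1)) x"
    unfolding has_pd_def has_field_derivative_def by (simp add: scaleR mult_commute_abs)
  then show ?thesis using has_pd_unique by metis
qed

lemma C_k_Suc_has_pd: "C_k (Suc k) f \<Longrightarrow> has_pd i f (partial_deriv i f x) x"
  by (intro differentiable_has_pd) (auto simp: differentiable_on_def)

lemma C_k_SucD: "C_k (Suc k) f \<Longrightarrow> C_k k f"
proof (induction k arbitrary: f)
  case 0
  then show ?case by (simp add: differentiable_imp_continuous_on)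
next
  case (Suc k)
  then show ?case by (metis C_k.simps(2))
qed

lemma C_k_continuous: "C_k k f \<Longrightarrow> continuous_on UNIV f"
  by (induction k) (auto intro: C_k_SucD simp: differentiable_imp_continuous_on)

lemma C_k_const: "C_k k (\<lambda>x::real^'n. c)"
proof (induction k arbitrary: c)
  case (Suc k)
  have "partial_deriv i (\<lambda>x::real^'n. c) = (\<lambda>x. 0)" for i using has_pd_unique[OF has_pd_const] by fastforce
  then show ?case using Suc by auto
qed simp

lemma C_k_add: "C_k k f \<Longrightarrow> C_k k g \<Longrightarrow> C_k k (\<lambda>x. f x + g x)"
proof (induction k arbitrary: f g)
  case (Suc k)
  have "partial_deriv i (\<lambda>x. f x + g x) = (\<lambda>x. partial_deriv i f x + partial_deriv i g x)" for i
    using C_k_Suc_has_pd[OF Suc.prems(1), of i] C_k_Suc_has_pd[OF Suc.prems(2), of i]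
    by (intro ext has_pd_unique) (auto simp: has_pd_def intro!: DERIV_add)
  then show ?case using Suc by (auto intro!: differentiable_on_add)
qed (auto intro: continuous_intros)

lemma C_k_mult: "C_k k f \<Longrightarrow> C_k k g \<Longrightarrow> C_k k (\<lambda>x. f x * g x)"
proof (induction k arbitrary: f g)
  case (Suc k)
  have "partial_deriv i (\<lambda>x. f x * g x) = (\<lambda>x. partial_deriv i f x * g x + partial_deriv i g x * f x)" for i
    using C_k_Suc_has_pd[OF Suc.prems(1), of i] C_k_Suc_has_pd[OF Suc.prems(2), of i]
    by (intro ext has_pd_unique has_pd_mult) auto
  moreover have "C_k k f" "C_k k g" using Suc.prems C_k_SucD by auto
  ultimately show ?case using Suc by (auto intro!: differentiable_on_mult C_k_add)
qed (auto intro: continuous_intros)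

lemma C_k_prod: "finite A \<Longrightarrow> (\<And>a. a \<in> A \<Longrightarrow> C_k k (f a)) \<Longrightarrow> C_k k (\<lambda>x. \<Prod>a\<in>A. f a x)"
  by (induction A rule: finite_induct) (auto intro: C_k_mult C_k_const)

section \<open>Flat functions and bumps on boxes\<close>

text \<open>The polynomial factor closes this class of flat functions under differentiation, so a
  single induction reaches derivatives of every order.\<close>

definition exp_inv :: "real poly \<Rightarrow> real \<Rightarrow> real" where
  "exp_inv p t = (if t > 0 then poly p (1 / t) * exp (- 1 / t) else 0)"

lemma poly_exp_tendsto_0: "((\<lambda>s. poly p s * exp (- s)) \<longlongrightarrow> (0::real)) at_top"
proof -
  have "((\<lambda>s. \<Sum>i\<le>degree p. coeff p i * (s ^ i / exp s)) \<longlongrightarrow> (\<Sum>i\<le>degree p. coeff p i * 0)) at_top"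
    by (intro tendsto_intros tendsto_power_div_exp_0)
  moreover have "(\<lambda>s. \<Sum>i\<le>degree p. coeff p i * (s ^ i / exp s)) = (\<lambda>s. poly p s * exp (- s))"
    by (simp add: fun_eq_iff poly_altdef sum_distrib_right exp_minus divide_inverse mult.assoc)
  ultimately show ?thesis by simp
qed

lemma exp_inv_tendsto_0: "(exp_inv p \<longlongrightarrow> 0) (at 0)"
proof -
  have "((\<lambda>t. poly p (inverse t) * exp (- inverse t)) \<longlongrightarrow> (0::real)) (at_right 0)"
    by (rule filterlim_compose[OF poly_exp_tendsto_0 filterlim_inverse_at_top_right])
  then have "(exp_inv p \<longlongrightarrow> 0) (at_right 0)"
    by (rule Lim_transform_eventually) (auto simp: exp_inv_def eventually_at_filter divide_inverse)
  moreover have "(exp_inv p \<longlongrightarrow> 0) (at_left 0)"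
    by (rule Lim_transform_eventually[OF tendsto_const]) (auto simp: exp_inv_def eventually_at_filter)
  ultimately show ?thesis by (simp add: filterlim_at_split)
qed

lemma DERIV_exp_inv: "(exp_inv p has_field_derivative exp_inv ([:0,0,1:] * (p - pderiv p)) t) (at t)"
proof (cases t "0::real" rule: linorder_cases)
  case less
  have "(exp_inv p has_field_derivative 0) (at t)"
    by (rule has_field_derivative_transform_within[where f="\<lambda>_. 0" and d="-t"]) (use less in \<open>auto simp: exp_inv_def dist_real_def\<close>)
  then show ?thesis using less by (simp add: exp_inv_def)
next
  case equal
  \<comment> \<open>Division by h multiplies the polynomial by its variable, which stands for 1/h.
    The quotient is again in the class and tends to 0.\<close>
  have "exp_inv p h / h = exp_inv ([:0,1:] * p) h" for h
    by (simp add: exp_inv_def)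
  then have "((\<lambda>h. (exp_inv p (0 + h) - exp_inv p 0) / h) \<longlongrightarrow> 0) (at 0)"
    using exp_inv_tendsto_0[of "[:0,1:] * p"] by (simp add: exp_inv_def[of p 0])
  then show ?thesis using equal by (simp add: DERIV_def exp_inv_def[of _ 0])
next
  case greater
  have "((\<lambda>t. poly p (1 / t) * exp (- 1 / t)) has_field_derivative
      (poly (pderiv p) (1/t) * (- 1 / t^2)) * exp (- 1 / t) + poly p (1 / t) * (exp (- 1 / t) * (1 / t^2))) (at t)"
    using greater by (auto intro!: derivative_eq_intros DERIV_chain2[OF poly_DERIV] simp: power2_eq_square field_simps)
  also have "(poly (pderiv p) (1/t) * (- 1 / t^2)) * exp (- 1 / t) + poly p (1 / t) * (exp (- 1 / t) * (1 / t^2))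
     = exp_inv ([:0,0,1:] * (p - pderiv p)) t"
    using greater by (simp add: exp_inv_def power2_eq_square field_simps)
  finally show ?thesis
    by (rule has_field_derivative_transform_within[where d=t]) (use greater in \<open>auto simp: exp_inv_def dist_real_def\<close>)
qed

text \<open>The polynomial is arbitrary for the sake of the induction: each partial derivative is a
  constant times a function of the same shape with another polynomial.\<close>

lemma C_k_exp_inv_coordinate: "C_k k (\<lambda>x::real^'n. exp_inv p (c * x$i + b))"
proof (induction k arbitrary: p)
  case 0
  have "continuous_on UNIV (exp_inv p)"
    by (intro continuous_at_imp_continuous_on ballI DERIV_isCont[OF DERIV_exp_inv])
  then have "continuous_on UNIV (\<lambda>x::real^'n. exp_inv p (c * x$i + b))"
    by (rule continuous_on_compose2) (auto intro!: continuous_intros)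
  then show ?case by simp
next
  case (Suc k)
  let ?q = "[:0,0,1:] * (p - pderiv p)"
  have d: "((\<lambda>x::real^'n. exp_inv p (c * x$i + b)) has_derivative (\<lambda>h. (c * h$i) * exp_inv ?q (c * x$i + b))) (at x)" for x
    by (rule DERIV_compose_FDERIV[OF DERIV_exp_inv]) (auto intro!: derivative_eq_intros bounded_linear.has_derivative[OF bounded_linear_vec_nth])
  then have "(\<lambda>x::real^'n. exp_inv p (c * x$i + b)) differentiable_on UNIV"
    by (auto simp: differentiable_on_def differentiable_def)
  moreover have "partial_deriv j (\<lambda>x::real^'n. exp_inv p (c * x$i + b)) =
    (\<lambda>x. (if i = j then c else 0) * exp_inv ?q (c * x$i + b))" for j
  proof (rule ext, rule has_pd_unique, unfold has_pd_def)
    fix x :: "real^'n"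
    have "((\<lambda>t. c * (x + t *\<^sub>R axis j 1) $ i + b) has_field_derivative (if i = j then c else 0)) (at 0)"
      by (auto intro!: derivative_eq_intros simp: axis_def)
    from DERIV_chain2[OF DERIV_exp_inv this, of p]
    show "((\<lambda>t. exp_inv p (c * (x + t *\<^sub>R axis j 1) $ i + b)) has_field_derivative
           (if i = j then c else 0) * exp_inv ?q (c * x $ i + b)) (at 0)"
      by (simp add: mult.commute)
  qed
  ultimately show ?case
    using Suc by (simp del: mult_pCons_left mult_pCons_right add: C_k_mult C_k_const)
qed

text \<open>For k > 0 the i-th pair of factors is positive exactly between a_i and b_i, and there
  each factor is exp(-1/(k s)) for some s > 0. Growing k drives it to 1, so the bumps tend to the
  indicator of the open box, from inside the box and without mollification.\<close>

definition box_bump :: "real^'n \<Rightarrow> real^'n \<Rightarrow> nat \<Rightarrow> real^'n \<Rightarrow> real" where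
  "box_bump a b k x = (\<Prod>i\<in>UNIV. exp_inv 1 (real k * x$i + (- real k * a$i)) * exp_inv 1 (- real k * x$i + real k * b$i))"

lemma exp_inv_1_bounds: "0 \<le> exp_inv 1 t" "exp_inv 1 t \<le> 1"
  by (auto simp: exp_inv_def)

lemma box_bump_bounds: "0 \<le> box_bump a b k x" "box_bump a b k x \<le> 1"
  unfolding box_bump_def
  by (auto intro!: prod_nonneg prod_le_1 mult_le_one mult_nonneg_nonneg exp_inv_1_bounds)

lemma box_bump_tendsto: "(\<lambda>k. box_bump a b k x) \<longlonglongrightarrow> indicator (box a b) x"
proof -
  have lim: "(\<lambda>k. exp_inv 1 (real k * s)) \<longlonglongrightarrow> (if s > 0 then 1 else 0)" for s
  proof (cases "s > 0")
    case True
    have "(\<lambda>k. exp (- (1/s) * inverse (real k))) \<longlonglongrightarrow> exp (- (1/s) * 0)"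
      by (intro tendsto_intros LIMSEQ_inverse_real_of_nat lim_inverse_n)
    then have "(\<lambda>k. exp (- (1/s) * inverse (real k))) \<longlonglongrightarrow> 1" by simp
    then have "(\<lambda>k. exp_inv 1 (real k * s)) \<longlonglongrightarrow> 1"
      by (rule Lim_transform_eventually, intro eventually_sequentiallyI[of 1])
         (use True in \<open>auto simp: exp_inv_def field_simps\<close>)
    then show ?thesis using True by simp
  next
    case False
    then have "exp_inv 1 (real k * s) = 0" for k
      by (auto simp: exp_inv_def mult_le_0_iff not_less zero_less_mult_iff)
    then show ?thesis using False by simp
  qed
  have "(\<lambda>k. \<Prod>i\<in>UNIV. exp_inv 1 (real k * (x$i - a$i)) * exp_inv 1 (real k * (b$i - x$i)))
     \<longlonglongrightarrow> (\<Prod>i\<in>UNIV. (if x$i - a$i > 0 then 1 else 0) * (if b$i - x$i > 0 then 1 else 0))"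
    by (intro tendsto_prod tendsto_mult lim)
  moreover have "(\<Prod>i\<in>UNIV. (if x$i - a$i > 0 then 1 else 0) * (if b$i - x$i > 0 then 1 else 0)) = (indicator (box a b) x :: real)"
    by (auto simp: indicator_def mem_box_cart prod_zero_iff)
  ultimately show ?thesis by (simp add: box_bump_def algebra_simps)
qed

lemma box_bump_support: "{x. box_bump a b k x \<noteq> 0} \<subseteq> box a b"
proof
  fix x assume "x \<in> {x. box_bump a b k x \<noteq> 0}"
  then have "exp_inv 1 (real k * x$i + (- real k * a$i)) \<noteq> 0 \<and> exp_inv 1 (- real k * x$i + real k * b$i) \<noteq> 0" for i
    by (auto simp: box_bump_def prod_zero_iff)
  then have "real k * x$i + (- real k * a$i) > 0 \<and> - real k * x$i + real k * b$i > 0" for i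
    unfolding exp_inv_def by meson
  then have "real k * (x$i - a$i) > 0 \<and> real k * (b$i - x$i) > 0" for i
    by (simp add: algebra_simps)
  then show "x \<in> box a b" by (simp add: mem_box_cart zero_less_mult_iff)
qed

lemma box_bump_Cinfc:
  assumes "cbox a b \<subseteq> \<Omega>"
  shows "box_bump a b k \<in> Cinfc \<Omega>"
proof -
  have "C_k n (box_bump a b k)" for n
    unfolding box_bump_def[abs_def] by (intro C_k_prod C_k_mult C_k_exp_inv_coordinate) auto
  moreover have "closure {x. box_bump a b k x \<noteq> 0} \<subseteq> cbox a b"
    using box_bump_support[of a b k] box_subset_cbox by (intro closure_minimal) (auto intro: closed_cbox)
  ultimately show ?thesis
    using assms by (auto simp: Cinfc_def compact_support_in_def intro: compact_closure[THEN iffD2] bounded_subset[OF bounded_cbox]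
        closure_subset[THEN subsetD])
qed

section \<open>The fundamental lemma of the calculus of variations\<close>

text \<open>The positive and the negative part of a Borel version of f are densities of two measures
  that agree on open boxes, a generator stable under intersections. The measures coincide, and with
  them the densities. Since \<open>ennreal\<close> sends negative numbers to 0, it takes the
  positive part by itself.\<close>

lemma integrable_zero_on_boxes_AE:
  fixes f :: "'a::euclidean_space \<Rightarrow> real"
  assumes f: "integrable lebesgue f" and z: "\<And>a b. (LINT x|lebesgue. indicator (box a b) x * f x) = 0"
  shows "AE x in lebesgue. f x = 0"
proof -
  obtain g where g[measurable]: "g \<in> borel_measurable lborel" and eq: "AE x in lborel. f x = g x"
    using completion_ex_borel_measurable_real[of f lborel] f by auto
  have eq': "AE x in lebesgue. f x = g x" using eq by (rule AE_completion)
  have "integrable lebesgue g"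
    by (rule integrable_cong_AE_imp[OF f]) (use eq' in \<open>auto intro!: measurable_completion\<close>)
  then have ig: "integrable lborel g" by (simp add: integrable_completion)
  have zg: "(LINT x|lborel. indicator (box a b) x * g x) = 0" for a b
  proof -
    have "(LINT x|lborel. indicator (box a b) x * g x) = (LINT x|lebesgue. indicator (box a b) x * g x)"
      by (rule integral_completion[symmetric]) measurable
    also have "\<dots> = (LINT x|lebesgue. indicator (box a b) x * f x)"
    proof (intro integral_cong_AE borel_measurable_times)
      show "g \<in> borel_measurable lebesgue" by (rule measurable_completion) fact
    qed (use eq' f in \<open>auto intro!: borel_measurable_indicator\<close>)
    finally show ?thesis using z by simp
  qed
  let ?M1 = "density lborel (\<lambda>x. ennreal (g x))" and ?M2 = "density lborel (\<lambda>x. ennreal (- g x))"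
  have em: "emeasure (density lborel (\<lambda>x. ennreal (h x))) (box a b) = ennreal (LINT x|lborel. indicator (box a b) x * max 0 (h x))"
    if h: "integrable lborel h" for h and a b :: 'a
  proof -
    have "emeasure (density lborel (\<lambda>x. ennreal (h x))) (box a b) = (\<integral>\<^sup>+x. ennreal (indicator (box a b) x * max 0 (h x)) \<partial>lborel)"
      using h by (subst emeasure_density) (auto intro!: nn_integral_cong simp: max_def ennreal_neg split: split_indicator)
    also have "\<dots> = ennreal (LINT x|lborel. indicator (box a b) x * max 0 (h x))"
      using h by (intro nn_integral_eq_integral integrable_real_mult_indicator[where f="\<lambda>x. max 0 (h x)", simplified mult.commute]) auto
    finally show ?thesis .
  qed
  have "?M1 = ?M2"
  proof (rule measure_eqI_generator_eq)
    let ?E = "range (\<lambda>(a, b). box a b::'a set)"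
    show "Int_stable ?E" by (auto simp: Int_stable_def box_Int_box)
    show "?E \<subseteq> Pow UNIV" "sets ?M1 = sigma_sets UNIV ?E" "sets ?M2 = sigma_sets UNIV ?E"
      by (simp_all add: borel_eq_box)
    let ?A = "\<lambda>n::nat. box (- (real n *\<^sub>R One)) (real n *\<^sub>R One) :: 'a set"
    show "range ?A \<subseteq> ?E" "(\<Union>i. ?A i) = UNIV" unfolding UN_box_eq_UNIV by auto
    show "emeasure ?M1 (?A i) \<noteq> \<infinity>" for i using em[OF ig] by simp
    fix X assume "X \<in> ?E"
    then obtain a b where X: "X = box a b" by auto
    have i1: "integrable lborel (\<lambda>x. indicator (box a b) x * max 0 (h x))" if "integrable lborel h" for h :: "'a \<Rightarrow> real"
      using that integrable_real_mult_indicator[of "box a b" lborel "\<lambda>x. max 0 (h x)"] by (simp add: mult.commute)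
    have "(LINT x|lborel. indicator (box a b) x * max 0 (g x)) - (LINT x|lborel. indicator (box a b) x * max 0 (- g x))
       = (LINT x|lborel. indicator (box a b) x * max 0 (g x) - indicator (box a b) x * max 0 (- g x))"
      using ig by (intro Bochner_Integration.integral_diff[symmetric] i1) auto
    also have "\<dots> = (LINT x|lborel. indicator (box a b) x * g x)"
      by (intro Bochner_Integration.integral_cong) (auto simp: max_def split: split_indicator)
    finally show "emeasure ?M1 X = emeasure ?M2 X"
      using zg X em[OF ig] em[of "\<lambda>x. - g x"] ig by simp
  qed
  then have "AE x in lborel. ennreal (g x) = ennreal (- g x)"
    by (rule sigma_finite_measure.density_unique[OF sigma_finite_lborel, rotated 2]) simp_all
  then have "AE x in lborel. g x = 0"
  proof (rule AE_mp, intro AE_I2 impI)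
    fix x assume *: "ennreal (g x) = ennreal (- g x)"
    show "g x = 0"
    proof (cases "0 \<le> g x")
      case True
      then have "ennreal (g x) = 0" using * by (simp add: ennreal_neg)
      then show ?thesis using True by (simp add: ennreal_eq_0_iff)
    next
      case False
      then have "ennreal (- g x) = 0" using * by (simp add: ennreal_neg)
      then show ?thesis using False by (simp add: ennreal_eq_0_iff)
    qed
  qed
  then have "AE x in lborel. f x = 0" using eq by eventually_elim simp
  then show ?thesis by (rule AE_completion)
qed

lemma integrable_mult_compact_support:
  fixes f \<phi> :: "'a::euclidean_space \<Rightarrow> real"
  assumes f: "integrable (lebesgue_on K) f" and K: "compact K" and \<phi>: "continuous_on UNIV \<phi>" "\<And>x. x \<notin> K \<Longrightarrow> \<phi> x = 0"
  shows "integrable lebesgue (\<lambda>x. f x * \<phi> x)"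
proof -
  have Ks: "K \<in> sets lebesgue" using K by (simp add: compact_imp_closed lmeasurable_compact fmeasurableD)
  have "bounded (\<phi> ` K)" using K \<phi>(1) by (meson compact_continuous_image compact_imp_bounded continuous_on_subset subset_UNIV)
  then obtain B where B: "\<And>x. x \<in> K \<Longrightarrow> \<bar>\<phi> x\<bar> \<le> B" by (auto simp: bounded_iff)
  have B': "\<bar>\<phi> x\<bar> \<le> max B 0" for x using B[of x] \<phi>(2)[of x] by (cases "x \<in> K") auto
  have i: "integrable lebesgue (\<lambda>x. indicator K x * f x)"
    using f Ks by (simp add: integrable_restrict_space)
  have [measurable]: "\<phi> \<in> borel_measurable lebesgue"
    using \<phi>(1) by (intro measurable_completion) (simp add: borel_measurable_continuous_onI)
  have "integrable lebesgue (\<lambda>x. \<phi> x * (indicator K x * f x))"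
    by (rule Bochner_Integration.integrable_bound[OF integrable_mult_right[OF i, of "max B 0"]])
       (use i B' in \<open>auto simp: abs_mult intro!: mult_right_mono\<close>)
  moreover have "\<phi> x * (indicator K x * f x) = f x * \<phi> x" for x
    using \<phi>(2)[of x] by (auto split: split_indicator)
  ultimately show ?thesis by simp
qed

text \<open>The bumps are bounded by 1 and tend to the indicator of an open box, so f has integral 0
  over every open box whose closed box lies in \<open>\<Omega>\<close>. As f is only locally
  integrable, it is cut off to one box of a countable cover at a time.\<close>

lemma zero_against_Cinfc_AE:
  fixes f :: "real^'n \<Rightarrow> real"
  assumes \<Omega>: "open \<Omega>" and f: "\<And>K. compact K \<Longrightarrow> K \<subseteq> \<Omega> \<Longrightarrow> integrable (lebesgue_on K) f"
    and z: "\<And>\<phi>. \<phi> \<in> Cinfc \<Omega> \<Longrightarrow> (LINT x|lebesgue_on \<Omega>. f x * \<phi> x) = 0"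
  shows "AE x in lebesgue_on \<Omega>. f x = 0"
proof -
  have \<Omega>s: "\<Omega> \<in> sets lebesgue" using \<Omega> by simp
  have box0: "(LINT x|lebesgue. indicator (box a b) x * f x) = 0" if ab: "cbox a b \<subseteq> \<Omega>" for a b
  proof -
    have i: "integrable lebesgue (\<lambda>x. indicator (cbox a b) x * f x)"
      using f[OF compact_cbox ab] by (simp add: integrable_restrict_space)
    have zk: "(LINT x|lebesgue. box_bump a b k x * (indicator (cbox a b) x * f x)) = 0" for k
    proof -
      have "(LINT x|lebesgue_on \<Omega>. f x * box_bump a b k x) = (LINT x|lebesgue. box_bump a b k x * (indicator (cbox a b) x * f x))"
        using \<Omega>s ab box_bump_support[of a b k] box_subset_cbox[of a b]
        by (subst integral_restrict_space)
           (auto intro!: Bochner_Integration.integral_cong simp: subset_iff split: split_indicator)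
      then show ?thesis using z[OF box_bump_Cinfc[OF ab, of k]] by simp
    qed
    have "(\<lambda>k. LINT x|lebesgue. box_bump a b k x * (indicator (cbox a b) x * f x)) \<longlonglongrightarrow>
       (LINT x|lebesgue. indicator (box a b) x * (indicator (cbox a b) x * f x))"
    proof (rule integral_dominated_convergence[where w="\<lambda>x. \<bar>indicator (cbox a b) x * f x\<bar>"])
      have "continuous_on UNIV (box_bump a b k)" for k
        using box_bump_Cinfc[of a b UNIV k] by (auto simp: Cinfc_def intro: C_k_continuous)
      then have "box_bump a b k \<in> borel_measurable lebesgue" for k
        by (intro measurable_completion) (simp add: borel_measurable_continuous_onI)
      then show "(\<lambda>x. box_bump a b k x * (indicator (cbox a b) x * f x)) \<in> borel_measurable lebesgue" for k
        by (intro borel_measurable_times[OF _ borel_measurable_integrable[OF i]]) (auto intro!: borel_measurable_indicator)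
      show "(\<lambda>x. indicator (box a b) x * (indicator (cbox a b) x * f x)) \<in> borel_measurable lebesgue"
        by (intro borel_measurable_times[OF _ borel_measurable_integrable[OF i]]) (auto intro!: borel_measurable_indicator)
      show "AE x in lebesgue. (\<lambda>k. box_bump a b k x * (indicator (cbox a b) x * f x)) \<longlonglongrightarrow>
         indicator (box a b) x * (indicator (cbox a b) x * f x)"
        by (intro AE_I2 tendsto_mult box_bump_tendsto tendsto_const)
      show "AE x in lebesgue. norm (box_bump a b k x * (indicator (cbox a b) x * f x)) \<le> \<bar>indicator (cbox a b) x * f x\<bar>" for k
        using box_bump_bounds[of a b k] by (intro AE_I2) (auto simp: abs_mult intro!: mult_left_le_one_le)
    qed (use i in auto)
    then have "(LINT x|lebesgue. indicator (box a b) x * (indicator (cbox a b) x * f x)) = 0"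
      by (simp add: zk LIMSEQ_const_iff)
    moreover have "indicator (box a b) x * (indicator (cbox a b) x * f x) = indicator (box a b) x * f x" for x
      using box_subset_cbox[of a b] by (auto split: split_indicator)
    ultimately show ?thesis by simp
  qed
  have AEbox: "AE x in lebesgue. x \<in> cbox c d \<longrightarrow> f x = 0" if cd: "cbox c d \<subseteq> \<Omega>" for c d
  proof -
    have i: "integrable lebesgue (\<lambda>x. indicator (cbox c d) x * f x)"
      using f[OF compact_cbox cd] by (simp add: integrable_restrict_space)
    have i': "integrable lebesgue (\<lambda>x. indicator (box c d) x * f x)"
    proof (rule Bochner_Integration.integrable_bound[OF i])
      have "(\<lambda>x. indicator (box c d) x * (indicator (cbox c d) x * f x)) \<in> borel_measurable lebesgue"
        by (intro borel_measurable_times[OF _ borel_measurable_integrable[OF i]]) (auto intro!: borel_measurable_indicator)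
      moreover have "indicator (box c d) x * (indicator (cbox c d) x * f x) = indicator (box c d) x * f x" for x
        using box_subset_cbox[of c d] by (auto split: split_indicator)
      ultimately show "(\<lambda>x. indicator (box c d) x * f x) \<in> borel_measurable lebesgue" by simp
    qed (use box_subset_cbox[of c d] in \<open>auto split: split_indicator\<close>)
    have "AE x in lebesgue. indicator (box c d) x * f x = 0"
    proof (rule integrable_zero_on_boxes_AE[OF i'])
      fix a b :: "real^'n"
      \<comment> \<open>Two boxes meet in a box, so testing the cut-off function on a box leads back
        to \<open>box0\<close>.\<close>
      obtain a' b' where ab': "box a b \<inter> box c d = box a' b'" by (rule that[OF box_Int_box])
      have "(LINT x|lebesgue. indicator (box a b) x * (indicator (box c d) x * f x)) = (LINT x|lebesgue. indicator (box a' b') x * f x)"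
        by (intro Bochner_Integration.integral_cong) (auto simp: ab'[symmetric] simp del: box_Int_box split: split_indicator)
      also have "\<dots> = 0"
      proof (cases "box a' b' = {}")
        case False
        then have "cbox a' b' = closure (box a' b')" by (rule closure_box[symmetric])
        also have "\<dots> \<subseteq> cbox c d" using ab' box_subset_cbox[of c d] by (intro closure_minimal) auto
        finally show ?thesis using box0 cd by blast
      qed simp
      finally show "(LINT x|lebesgue. indicator (box a b) x * (indicator (box c d) x * f x)) = 0" .
    qed
    moreover have "AE x in lebesgue. x \<notin> cbox c d - box c d"
      using negligible_frontier_interval by (intro AE_not_in) (simp add: negligible_iff_null_sets)
    ultimately show ?thesis by eventually_elim (auto split: split_indicator_asm)
  qed
  obtain \<D> where D: "countable \<D>" "\<D> \<subseteq> Pow \<Omega>" "\<And>X. X \<in> \<D> \<Longrightarrow> \<exists>a b. X = cbox a b" "\<Union>\<D> = \<Omega>"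
    using open_countable_Union_open_cbox[OF \<Omega>] by metis
  have "AE x in lebesgue. \<forall>X\<in>\<D>. x \<in> X \<longrightarrow> f x = 0"
  proof (subst AE_ball_countable[OF D(1)], intro ballI)
    fix X assume "X \<in> \<D>"
    then obtain c d where "X = cbox c d" "cbox c d \<subseteq> \<Omega>" using D by blast
    then show "AE x in lebesgue. x \<in> X \<longrightarrow> f x = 0" using AEbox by blast
  qed
  then have "AE x in lebesgue. x \<in> \<Omega> \<longrightarrow> f x = 0" by eventually_elim (use D(4) in blast)
  then show ?thesis using \<Omega>s by (simp add: AE_restrict_space_iff)
qed

section \<open>Integration by parts for Lipschitz functions\<close>

lemma partial_deriv_outside_support:
  assumes "x \<notin> closure {x. f x \<noteq> 0}"
  shows "has_pd i f 0 x" "partial_deriv i f x = 0"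
proof -
  obtain e where e: "0 < e" "ball x e \<subseteq> - closure {x. f x \<noteq> 0}"
    using assms by (metis ComplI closed_closure open_Compl open_contains_ball)
  have z: "f y = 0" if "dist x y < e" for y
    using e(2) that closure_subset[of "{x. f x \<noteq> 0}"] by (auto simp: subset_iff)
  show "has_pd i f 0 x" unfolding has_pd_def
  proof (rule has_field_derivative_transform_within[where f="\<lambda>_. 0" and d=e])
    show "0 = f (x + t *\<^sub>R axis i 1)" if "dist t 0 < e" for t
      using that by (intro z[symmetric]) (simp add: dist_norm norm_axis_1)
  qed (use e in auto)
  then show "partial_deriv i f x = 0" by (rule has_pd_unique)
qed

lemma has_derivative_sum_partial_deriv:
  fixes f :: "real^'n \<Rightarrow> real"
  assumes f': "(f has_derivative f') (at x)"
  shows "f' h = (\<Sum>i\<in>UNIV. h $ i * partial_deriv i f x)"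
proof -
  interpret bounded_linear f' using f' by (rule has_derivative_bounded_linear)
  have "partial_deriv i f x = f' (axis i 1)" for i
  proof (rule has_pd_unique)
    have "((\<lambda>t. x + t *\<^sub>R axis i 1) has_derivative (\<lambda>t. t *\<^sub>R axis i 1)) (at (0::real))"
      by (auto intro!: derivative_eq_intros)
    then have "((\<lambda>t. f (x + t *\<^sub>R axis i 1)) has_derivative (\<lambda>t. f' (t *\<^sub>R axis i 1))) (at 0)"
      by (rule has_derivative_compose[of "\<lambda>t. x + t *\<^sub>R axis i 1" "\<lambda>t. t *\<^sub>R axis i 1" 0 UNIV f f']) (use f' in simp)
    then show "has_pd i f (f' (axis i 1)) x"
      unfolding has_pd_def has_field_derivative_def by (simp add: scaleR mult_commute_abs)
  qed
  moreover have "h = (\<Sum>i\<in>UNIV. h $ i *\<^sub>R axis i 1)"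
    using basis_expansion[of h] by (simp add: scalar_mult_eq_scaleR)
  then have "f' h = f' (\<Sum>i\<in>UNIV. h $ i *\<^sub>R axis i 1)" by (rule arg_cong)
  then have "f' h = (\<Sum>i\<in>UNIV. h $ i * f' (axis i 1))" by (simp add: sum scaleR)
  ultimately show ?thesis by simp
qed

lemma bounded_continuous_compact_support:
  fixes f :: "real^'n \<Rightarrow> real"
  assumes "continuous_on UNIV f" "compact K" "\<And>x. x \<notin> K \<Longrightarrow> f x = 0"
  obtains B where "0 \<le> B" "\<And>x. \<bar>f x\<bar> \<le> B"
proof -
  have "bounded (f ` K)" using assms by (meson compact_continuous_image compact_imp_bounded continuous_on_subset subset_UNIV)
  then obtain B where B: "\<And>x. x \<in> K \<Longrightarrow> \<bar>f x\<bar> \<le> B" by (auto simp: bounded_iff)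
  have "\<bar>f x\<bar> \<le> max B 0" for x using B[of x] assms(3)[of x] by (cases "x \<in> K") auto
  then show ?thesis by (intro that[of "max B 0"]) auto
qed

lemma C1_compact_support_lipschitz:
  fixes f :: "real^'n \<Rightarrow> real"
  assumes f: "C_k 1 f" and K: "compact (closure {x. f x \<noteq> 0})"
  obtains L where "L-lipschitz_on UNIV f"
proof -
  have "\<exists>B\<ge>0. \<forall>x. \<bar>partial_deriv i f x\<bar> \<le> B" for i
  proof -
    have "continuous_on UNIV (partial_deriv i f)" using f by (simp add: One_nat_def)
    from bounded_continuous_compact_support[OF this K partial_deriv_outside_support(2)] show ?thesis by metis
  qed
  then obtain B where B: "\<And>i. B i \<ge> 0" "\<And>i x. \<bar>partial_deriv i f x\<bar> \<le> B i" by metis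
  have "\<exists>f'. (f has_derivative f') (at x)" for x
    using f by (auto simp: One_nat_def differentiable_on_def differentiable_def)
  then obtain f' where f': "\<And>x. (f has_derivative f' x) (at x)" by metis
  have "norm (f x - f y) \<le> (\<Sum>i\<in>UNIV. B i) * norm (x - y)" for x y
  proof (rule differentiable_bound[where S=UNIV and f'=f'])
    show "onorm (f' x) \<le> (\<Sum>i\<in>UNIV. B i)" for x
    proof (rule onorm_le)
      fix h :: "real^'n"
      have "norm (f' x h) \<le> (\<Sum>i\<in>UNIV. \<bar>partial_deriv i f x * h $ i\<bar>)"
        unfolding has_derivative_sum_partial_deriv[OF f'] real_norm_def by (subst mult.commute) (rule sum_abs)
      also have "\<dots> \<le> (\<Sum>i\<in>UNIV. B i * norm h)"
        by (intro sum_mono) (auto simp: abs_mult intro!: mult_mono B component_le_norm_cart)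
      finally show "norm (f' x h) \<le> (\<Sum>i\<in>UNIV. B i) * norm h" by (simp add: sum_distrib_right)
    qed
  qed (use f' in auto)
  then have "(\<Sum>i\<in>UNIV. B i)-lipschitz_on UNIV f"
    by (intro lipschitz_onI) (auto simp: dist_norm sum_nonneg B)
  then show ?thesis by (rule that)
qed

text \<open>The function a is controlled on S only, while the product has to be Lipschitz on the
  whole space. If one of two points lies outside the support, \<phi> vanishes there and no
  difference of values of a enters.\<close>

lemma lipschitz_times_C1_compact_support:
  fixes a \<phi> :: "real^'n \<Rightarrow> real"
  assumes a: "L-lipschitz_on S a" and \<phi>: "C_k 1 \<phi>" and K: "compact (closure {x. \<phi> x \<noteq> 0})" "closure {x. \<phi> x \<noteq> 0} \<subseteq> S"
  obtains L' where "L'-lipschitz_on UNIV (\<lambda>x. a x * \<phi> x)"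
proof -
  let ?K = "closure {x. \<phi> x \<noteq> 0}"
  obtain M where M: "M-lipschitz_on UNIV \<phi>" using C1_compact_support_lipschitz[OF \<phi> K(1)] .
  obtain B where B: "0 \<le> B" "\<And>x. \<bar>\<phi> x\<bar> \<le> B"
    using bounded_continuous_compact_support[of \<phi> ?K] C_k_continuous[OF \<phi>] K closure_subset[of "{x. \<phi> x \<noteq> 0}"] by blast
  have "bounded (a ` ?K)"
    using lipschitz_on_continuous_on[OF a] K by (meson compact_continuous_image compact_imp_bounded continuous_on_subset)
  then obtain A' where A': "\<And>x. x \<in> ?K \<Longrightarrow> \<bar>a x\<bar> \<le> A'" by (auto simp: bounded_iff)
  define A where "A = max A' 0"
  have A: "0 \<le> A" "\<And>x. x \<in> ?K \<Longrightarrow> \<bar>a x\<bar> \<le> A" using A' by (auto simp: A_def le_max_iff_disj)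
  have M0: "0 \<le> M" and L0: "0 \<le> L" using M a lipschitz_on_nonneg by auto
  have \<phi>l: "\<bar>\<phi> x - \<phi> y\<bar> \<le> M * dist x y" for x y using lipschitz_onD[OF M, of x y] by (simp add: dist_real_def)
  have z: "\<phi> x = 0" if "x \<notin> ?K" for x using that closure_subset[of "{x. \<phi> x \<noteq> 0}"] by auto
  have one: "\<bar>a x * \<phi> x - a y * \<phi> y\<bar> \<le> (A * M + L * B) * dist x y" if x: "x \<in> ?K" for x y
  proof (cases "y \<in> ?K")
    case True
    have "a x * \<phi> x - a y * \<phi> y = a x * (\<phi> x - \<phi> y) + (a x - a y) * \<phi> y" by (simp add: algebra_simps)
    also have "\<bar>\<dots>\<bar> \<le> \<bar>a x\<bar> * \<bar>\<phi> x - \<phi> y\<bar> + \<bar>a x - a y\<bar> * \<bar>\<phi> y\<bar>"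
      by (metis abs_mult abs_triangle_ineq)
    also have "\<dots> \<le> A * (M * dist x y) + (L * dist x y) * B"
    proof (intro add_mono mult_mono)
      show "\<bar>a x - a y\<bar> \<le> L * dist x y"
        using lipschitz_onD[OF a, of x y] x True K by (auto simp: dist_real_def)
    qed (use A x \<phi>l B L0 M0 in auto)
    finally show ?thesis by (simp add: algebra_simps)
  next
    case False
    then have "\<bar>a x * \<phi> x - a y * \<phi> y\<bar> = \<bar>a x\<bar> * \<bar>\<phi> x - \<phi> y\<bar>" using z[OF False] by (simp add: abs_mult)
    also have "\<dots> \<le> A * (M * dist x y)" using A x \<phi>l M0 by (intro mult_mono) auto
    also have "\<dots> \<le> (A * M + L * B) * dist x y" using L0 B by (simp add: algebra_simps)
    finally show ?thesis .
  qed
  have "(A * M + L * B)-lipschitz_on UNIV (\<lambda>x. a x * \<phi> x)"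
  proof (rule lipschitz_onI)
    fix x y
    consider "x \<in> ?K" | "y \<in> ?K" | "x \<notin> ?K" "y \<notin> ?K" by blast
    then show "dist (a x * \<phi> x) (a y * \<phi> y) \<le> (A * M + L * B) * dist x y"
    proof cases
      case 1 then show ?thesis using one by (simp add: dist_real_def)
    next
      case 2 then show ?thesis using one[of y x] by (simp add: dist_real_def abs_minus_commute dist_commute)
    next
      case 3 then show ?thesis using z[OF 3(1)] z[OF 3(2)] A(1) M0 L0 B(1) by simp
    qed
  qed (use A M0 L0 B in auto)
  then show ?thesis by (rule that)
qed

lemma lebesgue_measurable_AE:
  fixes f g :: "'a::euclidean_space \<Rightarrow> 'b::topological_space"
  assumes g: "g \<in> borel_measurable lebesgue" and eq: "AE x in lebesgue. f x = g x"
  shows "f \<in> borel_measurable lebesgue"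
proof (rule borel_measurableI)
  fix S :: "'b set" assume "open S"
  then have A: "g -` S \<inter> space lebesgue \<in> sets lebesgue" by (intro measurable_sets[OF g]) auto
  have "AE x in lebesgue. x \<in> g -` S \<inter> space lebesgue \<longleftrightarrow> x \<in> f -` S \<inter> space lebesgue"
    using eq by eventually_elim auto
  then show "f -` S \<inter> space lebesgue \<in> sets lebesgue"
    by (rule completion.in_sets_AE[OF _ A]) simp
qed

lemma integral_lebesgue_translate:
  fixes f :: "'a::euclidean_space \<Rightarrow> real"
  assumes [measurable]: "f \<in> borel_measurable borel"
  shows "(LINT x|lebesgue. f (x + c)) = (LINT x|lebesgue. f x)"
proof -
  have "(LINT x|lebesgue. f x) = (LINT x|lborel. f x)" by (rule integral_completion) simp
  also have "\<dots> = (LINT x|distr lborel borel ((+) c). f x)" by (simp add: lborel_distr_plus)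
  also have "\<dots> = (LINT x|lborel. f (c + x))" by (rule integral_distr) auto
  also have "\<dots> = (LINT x|lebesgue. f (c + x))" by (rule integral_completion[symmetric]) simp
  finally show ?thesis by (simp add: add.commute)
qed

lemma continuous_lebesgue_measurable: "continuous_on UNIV f \<Longrightarrow> (f::'a::euclidean_space \<Rightarrow> 'b::topological_space) \<in> borel_measurable lebesgue"
  by (intro measurable_completion) (simp add: borel_measurable_continuous_onI)

lemma integrable_lebesgue_indicator_compact:
  fixes K :: "'a::euclidean_space set"
  assumes "compact K"
  shows "integrable lebesgue (indicat_real K)"
proof -
  have "integrable lborel (indicat_real K)"
    using assms by (intro integrable_real_indicator emeasure_compact_finite) (auto intro: borel_compact)
  then show ?thesis
    using assms by (subst integrable_completion) (auto intro!: borel_measurable_indicator borel_compact)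
qed

lemma continuous_compact_support_integrable:
  fixes f :: "real^'n \<Rightarrow> real"
  assumes "continuous_on UNIV f" "compact K" "\<And>x. x \<notin> K \<Longrightarrow> f x = 0"
  shows "integrable lebesgue f"
proof -
  have "integrable (lebesgue_on K) (\<lambda>x. 1::real)"
    using assms(2) integrable_lebesgue_indicator_compact[OF assms(2)]
    by (subst integrable_restrict_space) (auto intro!: borel_compact)
  from integrable_mult_compact_support[OF this assms(2,1)] assms(3) show ?thesis by simp
qed

context
  fixes F :: "real^'n \<Rightarrow> real" and L :: real
  assumes F: "L-lipschitz_on UNIV F"
begin

lemma lipschitz_AE_has_pd: "AE x in lebesgue. has_pd i F (partial_deriv i F x) x"
proof (rule AE_completion)
  show "AE x in lborel. has_pd i F (partial_deriv i F x) x"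
    using lipschitz_AE_directional_derivative[OF F, of "axis i 1"]
    by eventually_elim (metis has_pd_def has_pd_unique)
qed

lemma has_pd_bound: "has_pd i F D x \<Longrightarrow> \<bar>D\<bar> \<le> L"
proof -
  assume "has_pd i F D x"
  then have lim: "((\<lambda>h. (F (x + h *\<^sub>R axis i 1) - F x) / h) \<longlongrightarrow> D) (at 0)"
    by (simp add: has_pd_def has_field_derivative_iff)
  then have "((\<lambda>h. \<bar>(F (x + h *\<^sub>R axis i 1) - F x) / h\<bar>) \<longlongrightarrow> \<bar>D\<bar>) (at 0)" by (rule tendsto_rabs)
  moreover have "\<forall>\<^sub>F h in at 0. \<bar>(F (x + h *\<^sub>R axis i 1) - F x) / h\<bar> \<le> L"
    unfolding eventually_at_filter
  proof (rule always_eventually, intro allI impI)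
    fix h :: real assume "h \<noteq> 0"
    then show "\<bar>(F (x + h *\<^sub>R axis i 1) - F x) / h\<bar> \<le> L"
      using lipschitz_onD[OF F, of "x + h *\<^sub>R axis i 1" x] by (simp add: dist_norm norm_axis_1 field_simps abs_mult)
  qed
  ultimately show ?thesis by (rule tendsto_upperbound) simp
qed

lemma lipschitz_AE_partial_deriv_bound: "AE x in lebesgue. \<bar>partial_deriv i F x\<bar> \<le> L"
  using lipschitz_AE_has_pd[of i] by eventually_elim (rule has_pd_bound)

text \<open>A sequence of increments in place of the limit h -> 0 gives access to dominated
  convergence and to measurability of pointwise limits.\<close>

lemma lipschitz_difference_quotient:
  "AE x in lebesgue. (\<lambda>n. (F (x + (1 / real (Suc n)) *\<^sub>R axis i 1) - F x) * real (Suc n)) \<longlonglongrightarrow> partial_deriv i F x"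
  using lipschitz_AE_has_pd[of i]
proof eventually_elim
  case (elim x)
  then have "((\<lambda>h. (F (x + h *\<^sub>R axis i 1) - F x) / h) \<longlongrightarrow> partial_deriv i F x) (at 0)"
    by (simp add: has_pd_def has_field_derivative_iff)
  then have "(\<lambda>n. (F (x + (1 / real (Suc n)) *\<^sub>R axis i 1) - F x) / (1 / real (Suc n))) \<longlonglongrightarrow> partial_deriv i F x"
    by (rule filterlim_compose) (auto simp: filterlim_at simp del: of_nat_Suc intro!: LIMSEQ_Suc[OF lim_1_over_n])
  then show ?case by simp
qed

lemma lipschitz_measurable: "F \<in> borel_measurable borel"
  using lipschitz_on_continuous_on[OF F] by (simp add: borel_measurable_continuous_onI)

lemma lipschitz_partial_deriv_measurable: "partial_deriv i F \<in> borel_measurable lebesgue"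
proof (rule lebesgue_measurable_AE)
  note lipschitz_measurable[measurable]
  have "(\<lambda>x. lim (\<lambda>n. (F (x + (1 / real (Suc n)) *\<^sub>R axis i 1) - F x) * real (Suc n))) \<in> borel_measurable lborel"
    by measurable
  then show "(\<lambda>x. lim (\<lambda>n. (F (x + (1 / real (Suc n)) *\<^sub>R axis i 1) - F x) * real (Suc n))) \<in> borel_measurable lebesgue"
    by (rule measurable_completion)
  show "AE x in lebesgue. partial_deriv i F x = lim (\<lambda>n. (F (x + (1 / real (Suc n)) *\<^sub>R axis i 1) - F x) * real (Suc n))"
    using lipschitz_difference_quotient[of i] by eventually_elim (simp add: limI)
qed

text \<open>Every difference quotient has integral 0 by translation invariance, and dominated
  convergence passes this on to the derivative.\<close>

lemma lipschitz_integral_partial_deriv_eq_0: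
  assumes bd: "bounded {x. F x \<noteq> 0}"
  shows "(LINT x|lebesgue. partial_deriv i F x) = 0"
proof -
  note lipschitz_measurable[measurable]
  let ?q = "\<lambda>n x. (F (x + (1 / real (Suc n)) *\<^sub>R axis i 1) - F x) * real (Suc n)"
  obtain R where R: "\<And>x. F x \<noteq> 0 \<Longrightarrow> norm x \<le> R" using bd by (auto simp: bounded_iff)
  have contF: "continuous_on UNIV F" by (rule lipschitz_on_continuous_on[OF F])
  have Fi: "integrable lebesgue F"
    by (rule continuous_compact_support_integrable[OF contF compact_cball[of 0 R]]) (use R in force)
  have meas: "?q n \<in> borel_measurable lebesgue" for n
    by (rule measurable_completion) measurable
  have shift_int: "integrable lebesgue (\<lambda>x. F (x + c))" for c
  proof -
    have "continuous_on UNIV (\<lambda>x. F (x + c))"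
      by (intro continuous_on_compose2[OF contF] continuous_intros) auto
    moreover have "F (x + c) = 0" if "x \<notin> cball (-c) R" for x
      using R[of "x + c"] that by (auto simp: dist_norm norm_minus_commute add.commute)
    ultimately show ?thesis by (rule continuous_compact_support_integrable[OF _ compact_cball])
  qed
  have q0: "(LINT x|lebesgue. ?q n x) = 0" for n
    using Fi shift_int integral_lebesgue_translate[OF lipschitz_measurable]
    by (simp del: of_nat_Suc)
  have "(\<lambda>n. LINT x|lebesgue. ?q n x) \<longlonglongrightarrow> (LINT x|lebesgue. partial_deriv i F x)"
  \<comment> \<open>Increments are at most 1, so all quotients vanish outside the ball of radius
    \<open>R + 1\<close>; inside, the Lipschitz constant bounds them.\<close>
  proof (rule integral_dominated_convergence[where w="\<lambda>x. indicator (cball 0 (R + 1)) x * L"])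
    show "integrable lebesgue (\<lambda>x::real^'n. indicator (cball 0 (R + 1)) x * L)"
      by (intro integrable_mult_left integrable_lebesgue_indicator_compact compact_cball)
    show "AE x in lebesgue. norm (?q n x) \<le> indicator (cball 0 (R + 1)) x * L" for n
    proof (rule AE_I2)
      fix x :: "real^'n"
      let ?h = "1 / real (Suc n)"
      have "\<bar>F (x + ?h *\<^sub>R axis i 1) - F x\<bar> \<le> L * ?h"
        using lipschitz_onD[OF F, of "x + ?h *\<^sub>R axis i 1" x] by (simp add: dist_norm norm_axis_1)
      then have "\<bar>F (x + ?h *\<^sub>R axis i 1) - F x\<bar> * real (Suc n) \<le> L * ?h * real (Suc n)"
        by (intro mult_right_mono) auto
      then have le: "norm (?q n x) \<le> L" by (simp add: abs_mult del: of_nat_Suc)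
      show "norm (?q n x) \<le> indicator (cball 0 (R + 1)) x * L"
      proof (cases "x \<in> cball 0 (R + 1)")
        case False
        then have n: "norm x > R + 1" by simp
        have "norm x \<le> norm (x + ?h *\<^sub>R axis i 1) + norm (?h *\<^sub>R (axis i 1 :: real^'n))"
          by (metis add_diff_cancel norm_triangle_ineq4)
        also have "norm (?h *\<^sub>R (axis i 1 :: real^'n)) \<le> 1" by (simp add: norm_axis_1)
        finally have "F (x + ?h *\<^sub>R axis i 1) = 0" using R[of "x + ?h *\<^sub>R axis i 1"] n by linarith
        moreover have "F x = 0" using R[of x] n by linarith
        ultimately show ?thesis using False by simp
      qed (use le in simp)
    qed
  qed (use meas lipschitz_partial_deriv_measurable lipschitz_difference_quotient in auto)
  then show ?thesis by (simp only: q0) (simp add: LIMSEQ_const_iff)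
qed

end

lemma lipschitz_partial_deriv_times_integrable:
  fixes a u :: "real^'n \<Rightarrow> real"
  assumes a: "L-lipschitz_on UNIV a" and u: "integrable lebesgue u"
  shows "integrable lebesgue (\<lambda>x. u x * partial_deriv i a x)"
proof (rule Bochner_Integration.integrable_bound[OF integrable_mult_right[OF u, of L]])
  show "(\<lambda>x. u x * partial_deriv i a x) \<in> borel_measurable lebesgue"
    using u by (intro borel_measurable_times lipschitz_partial_deriv_measurable[OF a]) auto
  show "AE x in lebesgue. norm (u x * partial_deriv i a x) \<le> norm (L * u x)"
    using lipschitz_AE_partial_deriv_bound[OF a, of i]
  proof eventually_elim
    case (elim x)
    then have "\<bar>u x\<bar> * \<bar>partial_deriv i a x\<bar> \<le> \<bar>u x\<bar> * \<bar>L\<bar>" by (intro mult_left_mono) auto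
    then show ?case by (simp add: abs_mult mult.commute)
  qed
qed

text \<open>The product of a and u is Lipschitz with bounded support, so its partial derivative has
  integral 0. The product rule holds wherever a has a partial derivative, that is, almost
  everywhere.\<close>

lemma integration_by_parts_lipschitz_C1:
  fixes a u :: "real^'n \<Rightarrow> real"
  assumes a: "L-lipschitz_on UNIV a" and u: "C_k 1 u" "compact (closure {x. u x \<noteq> 0})"
  shows "(LINT x|lebesgue. u x * partial_deriv i a x) = - (LINT x|lebesgue. a x * partial_deriv i u x)"
proof -
  obtain L' where L': "L'-lipschitz_on UNIV (\<lambda>x. a x * u x)"
    using lipschitz_times_C1_compact_support[OF a u] by auto
  have cu: "continuous_on UNIV u" "continuous_on UNIV (partial_deriv i u)"
    using C_k_continuous[OF u(1)] u(1) by (auto simp: One_nat_def)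
  have zu: "u x = 0" "partial_deriv i u x = 0" if "x \<notin> closure {x. u x \<noteq> 0}" for x
    using that closure_subset[of "{x. u x \<noteq> 0}"] partial_deriv_outside_support(2)[OF that] by auto
  have ca: "continuous_on UNIV a" by (rule lipschitz_on_continuous_on[OF a])
  have i1: "integrable lebesgue (\<lambda>x. u x * partial_deriv i a x)"
    by (rule lipschitz_partial_deriv_times_integrable[OF a continuous_compact_support_integrable[OF cu(1) u(2) zu(1)]])
  have i2: "integrable lebesgue (\<lambda>x. a x * partial_deriv i u x)"
  proof (rule continuous_compact_support_integrable[OF _ u(2)])
    show "continuous_on UNIV (\<lambda>x. a x * partial_deriv i u x)" using ca cu(2) by (rule continuous_on_mult)
    show "a x * partial_deriv i u x = 0" if "x \<notin> closure {x. u x \<noteq> 0}" for x by (simp only: zu(2)[OF that] mult_zero_right)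
  qed
  have "bounded {x. a x * u x \<noteq> 0}"
    using compact_imp_bounded[OF u(2)] by (rule bounded_subset) (use closure_subset[of "{x. u x \<noteq> 0}"] in auto)
  then have "0 = (LINT x|lebesgue. partial_deriv i (\<lambda>x. a x * u x) x)"
    by (rule lipschitz_integral_partial_deriv_eq_0[OF L', symmetric])
  also have "\<dots> = (LINT x|lebesgue. u x * partial_deriv i a x + a x * partial_deriv i u x)"
  proof (rule integral_cong_AE)
    show "AE x in lebesgue. partial_deriv i (\<lambda>x. a x * u x) x = u x * partial_deriv i a x + a x * partial_deriv i u x"
      using lipschitz_AE_has_pd[OF a, of i]
    proof eventually_elim
      case (elim x)
      have "has_pd i u (partial_deriv i u x) x" using C_k_Suc_has_pd[of 0 u] u(1) by (simp add: One_nat_def)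
      from has_pd_unique[OF has_pd_mult[OF elim this]] show ?case by (simp add: mult.commute)
    qed
  qed (use i1 i2 lipschitz_partial_deriv_measurable[OF L'] in auto)
  also have "\<dots> = (LINT x|lebesgue. u x * partial_deriv i a x) + (LINT x|lebesgue. a x * partial_deriv i u x)"
    using i1 i2 by (rule Bochner_Integration.integral_add)
  finally show ?thesis by simp
qed

section \<open>Distributional gradients along Lipschitz vector fields\<close>

text \<open>The gradient along the fields in the classical sense. \<open>Xgrad\<close> is a choice,
  determined up to null sets; this is a definite function, and for u in C^1 with support inside
  \<open>\<Omega>0\<close> it is Borel.\<close>

definition Xcl :: "('m::finite \<Rightarrow> real^'n \<Rightarrow> real^'n) \<Rightarrow> (real^'n \<Rightarrow> real) \<Rightarrow> real^'n \<Rightarrow> real^'m" where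
  "Xcl X u x = (\<chi> j. \<Sum>i\<in>UNIV. X j x $ i * partial_deriv i u x)"

lemma Xcl_outside_support: "x \<notin> closure {x. u x \<noteq> 0} \<Longrightarrow> Xcl X u x = 0"
  by (simp add: Xcl_def partial_deriv_outside_support(2) vec_eq_iff)

lemma integral_lebesgue_on_eq:
  fixes f :: "real^'n \<Rightarrow> real"
  assumes "S \<in> sets lebesgue" "\<And>x. x \<notin> S \<Longrightarrow> f x = 0"
  shows "(LINT x|lebesgue_on S. f x) = (LINT x|lebesgue. f x)"
proof -
  have "(\<lambda>x. indicator S x *\<^sub>R f x) = f" using assms(2) by (auto simp: fun_eq_iff split: split_indicator)
  then show ?thesis using integral_restrict_space[of S lebesgue f] assms(1) by simp
qed

lemma integrable_lebesgue_on_eq: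
  fixes f :: "real^'n \<Rightarrow> real"
  assumes "S \<in> sets lebesgue" "\<And>x. x \<notin> S \<Longrightarrow> f x = 0"
  shows "integrable (lebesgue_on S) f \<longleftrightarrow> integrable lebesgue f"
proof -
  have "(\<lambda>x. indicator S x *\<^sub>R f x) = f" using assms(2) by (auto simp: fun_eq_iff split: split_indicator)
  then show ?thesis using integrable_restrict_space[of S lebesgue f] assms(1) by simp
qed

lemma integrable_lebesgue_on_subset:
  fixes f :: "real^'n \<Rightarrow> 'b::{banach, second_countable_topology}"
  assumes f: "integrable (lebesgue_on S) f" and S: "S \<in> sets lebesgue" "K \<in> sets lebesgue" "K \<subseteq> S"
  shows "integrable (lebesgue_on K) f"
proof -
  have "integrable lebesgue (\<lambda>x. indicator K x *\<^sub>R (indicator S x *\<^sub>R f x))"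
    by (rule integrable_mult_indicator[OF S(2)]) (use f S in \<open>simp add: integrable_restrict_space\<close>)
  moreover have "(\<lambda>x. indicator K x *\<^sub>R (indicator S x *\<^sub>R f x)) = (\<lambda>x. indicator K x *\<^sub>R f x)"
    using S by (auto simp: fun_eq_iff split: split_indicator)
  ultimately show ?thesis using S by (simp only: integrable_restrict_space sets.Int_space_eq2)
qed

text \<open>This makes the choice in \<open>Xgrad\<close> harmless. It follows from the fundamental
  lemma applied to each component of the difference, which is locally integrable by the definition
  of \<open>has_Xgrad\<close>.\<close>

lemma has_Xgrad_unique:
  assumes \<Omega>: "open \<Omega>" and G: "has_Xgrad \<Omega> X u G" and H: "has_Xgrad \<Omega> X u H"
  shows "AE x in lebesgue_on \<Omega>. G x = (H x :: real^'m)"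
proof -
  have \<Omega>s: "\<Omega> \<in> sets lebesgue" using \<Omega> by simp
  have comp: "integrable (lebesgue_on K) (\<lambda>x. G x $ j)" "integrable (lebesgue_on K) (\<lambda>x. H x $ j)"
    if "compact K" "K \<subseteq> \<Omega>" for K j
    using G H that by (auto simp: has_Xgrad_def intro!: integrable_bounded_linear[OF bounded_linear_vec_nth])
  have "AE x in lebesgue_on \<Omega>. G x $ j - H x $ j = 0" for j
  proof (rule zero_against_Cinfc_AE[OF \<Omega>])
    show "integrable (lebesgue_on K) (\<lambda>x. G x $ j - H x $ j)" if "compact K" "K \<subseteq> \<Omega>" for K
      using comp[OF that] by (rule Bochner_Integration.integrable_diff)
    fix \<phi> assume \<phi>: "\<phi> \<in> Cinfc \<Omega>"
    then have c: "continuous_on UNIV \<phi>" "compact (closure {x. \<phi> x \<noteq> 0})" "closure {x. \<phi> x \<noteq> 0} \<subseteq> \<Omega>"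
      by (auto simp: Cinfc_def compact_support_in_def intro: C_k_continuous)
    have z: "\<phi> x = 0" if "x \<notin> closure {x. \<phi> x \<noteq> 0}" for x
      using that closure_subset[of "{x. \<phi> x \<noteq> 0}"] by auto
    have zO: "\<phi> x = 0" if "x \<notin> \<Omega>" for x using that c(3) z by blast
    have i: "integrable (lebesgue_on \<Omega>) (\<lambda>x. G x $ j * \<phi> x)" "integrable (lebesgue_on \<Omega>) (\<lambda>x. H x $ j * \<phi> x)"
      using integrable_mult_compact_support[OF comp(1)[OF c(2,3)] c(2,1) z]
        integrable_mult_compact_support[OF comp(2)[OF c(2,3)] c(2,1) z] zO
      by (simp_all add: integrable_lebesgue_on_eq[OF \<Omega>s])
    have "(LINT x|lebesgue_on \<Omega>. (G x $ j - H x $ j) * \<phi> x) =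
       (LINT x|lebesgue_on \<Omega>. G x $ j * \<phi> x) - (LINT x|lebesgue_on \<Omega>. H x $ j * \<phi> x)"
      using i by (subst Bochner_Integration.integral_diff[symmetric]) (auto simp: algebra_simps)
    also have "\<dots> = 0" using G H \<phi> by (simp add: has_Xgrad_def)
    finally show "(LINT x|lebesgue_on \<Omega>. (G x $ j - H x $ j) * \<phi> x) = 0" .
  qed
  then have "AE x in lebesgue_on \<Omega>. \<forall>j\<in>UNIV. G x $ j - H x $ j = 0"
    by (intro AE_finite_allI) auto
  then show ?thesis by eventually_elim (simp add: vec_eq_iff)
qed

lemma has_Xgrad_Xgrad: "has_Xgrad \<Omega> X u G \<Longrightarrow> has_Xgrad \<Omega> X u (Xgrad \<Omega> X u)"
  unfolding Xgrad_def by (rule someI[of "has_Xgrad \<Omega> X u"])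

lemma Xgrad_AE_eq: "open \<Omega> \<Longrightarrow> has_Xgrad \<Omega> X u G \<Longrightarrow> AE x in lebesgue_on \<Omega>. Xgrad \<Omega> X u x = G x"
  using has_Xgrad_unique has_Xgrad_Xgrad by blast

section \<open>Calculus of the gradient along Lipschitz fields\<close>

locale lipschitz_fields =
  fixes \<Omega>0 :: "(real^'n) set" and X :: "'m::finite \<Rightarrow> real^'n \<Rightarrow> real^'n"
  assumes open_\<Omega>0: "open \<Omega>0" and lipschitz_X: "\<And>j. \<exists>L. L-lipschitz_on \<Omega>0 (X j)"
begin

lemma coeff_lipschitz: "\<exists>L. L-lipschitz_on \<Omega>0 (\<lambda>x. X j x $ i)"
proof -
  obtain L where L: "L-lipschitz_on \<Omega>0 (X j)" using lipschitz_X by blast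
  have "L-lipschitz_on \<Omega>0 (\<lambda>x. X j x $ i)"
  proof (rule lipschitz_onI)
    show "dist (X j x $ i) (X j y $ i) \<le> L * dist x y" if "x \<in> \<Omega>0" "y \<in> \<Omega>0" for x y
      using lipschitz_onD[OF L that] dist_vec_nth_le[of "X j x" i "X j y"] by linarith
  qed (use lipschitz_on_nonneg[OF L] in auto)
  then show ?thesis by blast
qed

lemma coeff_continuous: "continuous_on \<Omega>0 (\<lambda>x. X j x $ i)"
  using coeff_lipschitz lipschitz_on_continuous_on by blast

lemma coeff_times_lipschitz:
  assumes "C_k 1 \<phi>" "compact_support_in U \<phi>" "U \<subseteq> \<Omega>0"
  obtains L where "L-lipschitz_on UNIV (\<lambda>x. X j x $ i * \<phi> x)"
proof -
  obtain L where L: "L-lipschitz_on \<Omega>0 (\<lambda>x. X j x $ i)" using coeff_lipschitz by blast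
  show ?thesis
    by (rule lipschitz_times_C1_compact_support[OF L assms(1)]) (use assms that in \<open>auto simp: compact_support_in_def\<close>)
qed

lemma X_transpose_outside_support:
  assumes "x \<notin> closure {x. \<phi> x \<noteq> 0}"
  shows "X_transpose X j \<phi> x = 0"
proof -
  have "{y. X j y $ i * \<phi> y \<noteq> 0} \<subseteq> {x. \<phi> x \<noteq> 0}" for i by auto
  then have "x \<notin> closure {y. X j y $ i * \<phi> y \<noteq> 0}" for i using assms closure_mono by blast
  then show ?thesis by (simp add: X_transpose_def partial_deriv_outside_support(2))
qed

lemma CinfcD:
  assumes "\<phi> \<in> Cinfc U"
  shows "C_k k \<phi>" "compact_support_in U \<phi>" "continuous_on UNIV \<phi>" "compact (closure {x. \<phi> x \<noteq> 0})"
    "closure {x. \<phi> x \<noteq> 0} \<subseteq> U" "x \<notin> closure {x. \<phi> x \<noteq> 0} \<Longrightarrow> \<phi> x = 0" "x \<notin> U \<Longrightarrow> \<phi> x = 0"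
  using assms closure_subset[of "{x. \<phi> x \<noteq> 0}"]
  by (auto simp: Cinfc_def compact_support_in_def intro: C_k_continuous)

lemma X_transpose_zero:
  assumes "\<phi> \<in> Cinfc U" "x \<notin> U"
  shows "X_transpose X j \<phi> x = 0"
  using CinfcD(5)[OF assms(1)] assms(2) by (intro X_transpose_outside_support) blast

text \<open>A coefficient times a test function is Lipschitz, so its partial derivatives are bounded
  almost everywhere and integrability of u is enough.\<close>

lemma integrable_times_X_transpose:
  assumes \<phi>: "\<phi> \<in> Cinfc U" and U: "open U" "U \<subseteq> \<Omega>0" and u: "integrable (lebesgue_on U) u"
  shows "integrable lebesgue (\<lambda>x. u x * X_transpose X j \<phi> x)"
proof -
  have "integrable lebesgue (\<lambda>x. (indicator U x * u x) * partial_deriv i (\<lambda>y. X j y $ i * \<phi> y) x)" for i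
  proof -
    obtain L where "L-lipschitz_on UNIV (\<lambda>x. X j x $ i * \<phi> x)"
      using coeff_times_lipschitz[OF CinfcD(1,2)[OF \<phi>] U(2)] .
    then show ?thesis
      by (rule lipschitz_partial_deriv_times_integrable) (use u U in \<open>simp add: integrable_restrict_space\<close>)
  qed
  then have "integrable lebesgue (\<lambda>x. - (\<Sum>i\<in>UNIV. (indicator U x * u x) * partial_deriv i (\<lambda>y. X j y $ i * \<phi> y) x))"
    by (intro integrable_minus Bochner_Integration.integrable_sum) auto
  moreover have "- (\<Sum>i\<in>UNIV. (indicator U x * u x) * partial_deriv i (\<lambda>y. X j y $ i * \<phi> y) x) = u x * X_transpose X j \<phi> x" for x
  proof (cases "x \<in> U")
    case True
    then show ?thesis by (simp add: X_transpose_def sum_distrib_left)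
  next
    case False
    then have "X_transpose X j \<phi> x = 0" using CinfcD(5)[OF \<phi>] by (intro X_transpose_outside_support) auto
    then show ?thesis using False by simp
  qed
  ultimately show ?thesis by simp
qed

lemma Xcl_continuous: "C_k 1 u \<Longrightarrow> continuous_on \<Omega>0 (\<lambda>x. Xcl X u x $ j)"
  unfolding Xcl_def by (auto simp: One_nat_def intro!: continuous_intros coeff_continuous intro: continuous_on_subset)

lemma Xcl_bounded:
  assumes u: "C_k 1 u" and K: "compact (closure {x. u x \<noteq> 0})" "closure {x. u x \<noteq> 0} \<subseteq> \<Omega>0"
  obtains B where "0 \<le> B" "\<And>x. norm (Xcl X u x) \<le> B"
proof -
  let ?K = "closure {x. u x \<noteq> 0}"
  have "\<exists>B\<ge>0. \<forall>x\<in>?K. \<bar>Xcl X u x $ j\<bar> \<le> B" for j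
  proof -
    have "bounded ((\<lambda>x. Xcl X u x $ j) ` ?K)"
      using Xcl_continuous[OF u] K by (meson compact_continuous_image compact_imp_bounded continuous_on_subset)
    then obtain B where "\<And>x. x \<in> ?K \<Longrightarrow> \<bar>Xcl X u x $ j\<bar> \<le> B" by (auto simp: bounded_iff)
    then show ?thesis by (intro exI[of _ "max B 0"]) (auto simp: le_max_iff_disj)
  qed
  then obtain B where B: "\<And>j. 0 \<le> B j" "\<And>j x. x \<in> ?K \<Longrightarrow> \<bar>Xcl X u x $ j\<bar> \<le> B j" by metis
  have "norm (Xcl X u x) \<le> (\<Sum>j\<in>UNIV. B j)" for x
  proof (cases "x \<in> ?K")
    case True
    have "norm (Xcl X u x) \<le> (\<Sum>j\<in>UNIV. \<bar>Xcl X u x $ j\<bar>)" by (rule norm_le_l1_cart)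
    also have "\<dots> \<le> (\<Sum>j\<in>UNIV. B j)" using B True by (intro sum_mono) auto
    finally show ?thesis .
  next
    case False
    then show ?thesis using B by (simp add: Xcl_outside_support sum_nonneg)
  qed
  then show ?thesis using B(1) by (intro that[of "\<Sum>j\<in>UNIV. B j"]) (auto intro: sum_nonneg)
qed

lemma Xcl_borel:
  assumes u: "C_k 1 u" and K: "closure {x. u x \<noteq> 0} \<subseteq> \<Omega>0"
  shows "Xcl X u \<in> borel_measurable borel"
proof -
  have m: "(\<lambda>x. indicator \<Omega>0 x *\<^sub>R (Xcl X u x $ j)) \<in> borel_measurable borel" for j
    using Xcl_continuous[OF u] open_\<Omega>0 by (intro borel_measurable_continuous_on_indicator) auto
  have "indicator \<Omega>0 x *\<^sub>R (Xcl X u x $ j) = Xcl X u x $ j" for x j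
  proof (cases "x \<in> \<Omega>0")
    case False
    then have "Xcl X u x = 0" using K by (intro Xcl_outside_support) blast
    then show ?thesis by simp
  qed simp
  then have "(\<lambda>x. Xcl X u x $ j) \<in> borel_measurable borel" for j using m[of j] by presburger
  then have "(\<lambda>x. \<Sum>j\<in>UNIV. (Xcl X u x $ j) *\<^sub>R (axis j 1 :: real^'m)) \<in> borel_measurable borel"
    by (intro borel_measurable_sum borel_measurable_scaleR borel_measurable_const)
  moreover have "(\<Sum>j\<in>UNIV. (y $ j) *\<^sub>R axis j 1) = y" for y :: "real^'m"
    using basis_expansion[of y] by (simp add: scalar_mult_eq_scaleR)
  ultimately show ?thesis by simp
qed

text \<open>In the integration by parts the Lipschitz factor is a coefficient times the test
  function, and u is the C^1 factor. The support of u may leave U, since the test function cuts off;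
  this is used on the balls of (H3), which the support may cross.\<close>

lemma has_Xgrad_C1:
  assumes U: "open U" "U \<subseteq> \<Omega>0" and u: "C_k 1 u" "compact (closure {x. u x \<noteq> 0})"
  shows "has_Xgrad U X u (Xcl X u)"
  unfolding has_Xgrad_def
proof (intro conjI allI impI ballI)
  fix K assume K: "compact K \<and> K \<subseteq> U"
  then have Ks: "K \<in> sets lebesgue" by (auto intro!: borel_compact)
  show "integrable (lebesgue_on K) (Xcl X u)"
    unfolding integrable_iff_component[OF Ks]
  proof
    fix j
    have c: "continuous_on K (\<lambda>x. Xcl X u x $ j)" 
      using Xcl_continuous[OF u(1)] K U by (meson continuous_on_subset order_trans)
    have "integrable lborel (\<lambda>x. indicator K x *\<^sub>R (Xcl X u x $ j))"
      using borel_integrable_compact[OF _ c] K by simp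
    then have "integrable lebesgue (\<lambda>x. indicator K x *\<^sub>R (Xcl X u x $ j))"
      by (subst integrable_completion) auto
    then show "integrable (lebesgue_on K) (\<lambda>x. Xcl X u x $ j)" using Ks by (simp add: integrable_restrict_space)
  qed
next
  fix \<phi> j assume \<phi>: "\<phi> \<in> Cinfc U"
  note p = CinfcD[OF \<phi>]
  have Us: "U \<in> sets lebesgue" using U by simp
  have cu: "continuous_on UNIV u" "\<And>i. continuous_on UNIV (partial_deriv i u)"
    using C_k_continuous[OF u(1)] u(1) by (auto simp: One_nat_def)
  have zu: "u x = 0" if "x \<notin> closure {x. u x \<noteq> 0}" for x
    using that closure_subset[of "{x. u x \<noteq> 0}"] by auto
  let ?a = "\<lambda>i x. X j x $ i * \<phi> x"
  have L: "\<exists>L. L-lipschitz_on UNIV (?a i)" for i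
    using coeff_times_lipschitz[OF p(1,2) U(2)] by blast
  have iu: "integrable lebesgue u" by (rule continuous_compact_support_integrable[OF cu(1) u(2) zu])
  have i1: "integrable lebesgue (\<lambda>x. u x * partial_deriv i (?a i) x)" for i
    using L[of i] lipschitz_partial_deriv_times_integrable[OF _ iu] by blast
  have i2: "integrable lebesgue (\<lambda>x. ?a i x * partial_deriv i u x)" for i
  proof (rule continuous_compact_support_integrable[OF _ p(4)])
    show "continuous_on UNIV (\<lambda>x. ?a i x * partial_deriv i u x)"
      using L[of i] by (metis continuous_on_mult[OF lipschitz_on_continuous_on cu(2)])
    show "?a i x * partial_deriv i u x = 0" if "x \<notin> closure {x. \<phi> x \<noteq> 0}" for x
      using p(6)[OF that] by simp
  qed
  have ibp: "(LINT x|lebesgue. u x * partial_deriv i (?a i) x) = - (LINT x|lebesgue. ?a i x * partial_deriv i u x)" for i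
    using L[of i] integration_by_parts_lipschitz_C1[OF _ u] by blast
  have "(LINT x|lebesgue_on U. Xcl X u x $ j * \<phi> x) = (LINT x|lebesgue. Xcl X u x $ j * \<phi> x)"
    using p(7) by (intro integral_lebesgue_on_eq[OF Us]) simp
  also have "\<dots> = (LINT x|lebesgue. (\<Sum>i\<in>UNIV. ?a i x * partial_deriv i u x))"
    by (intro Bochner_Integration.integral_cong) (auto simp: Xcl_def sum_distrib_right sum_distrib_left mult_ac)
  also have "\<dots> = (\<Sum>i\<in>UNIV. LINT x|lebesgue. ?a i x * partial_deriv i u x)"
    using i2 by (intro Bochner_Integration.integral_sum)
  also have "\<dots> = - (\<Sum>i\<in>UNIV. LINT x|lebesgue. u x * partial_deriv i (?a i) x)"
    using ibp by (simp add: sum_negf)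
  also have "\<dots> = - (LINT x|lebesgue. (\<Sum>i\<in>UNIV. u x * partial_deriv i (?a i) x))"
    using i1 by (subst Bochner_Integration.integral_sum) auto
  also have "\<dots> = (LINT x|lebesgue. - (\<Sum>i\<in>UNIV. u x * partial_deriv i (?a i) x))" by simp
  also have "\<dots> = (LINT x|lebesgue. u x * X_transpose X j \<phi> x)"
    by (intro Bochner_Integration.integral_cong) (auto simp: X_transpose_def sum_distrib_left)
  also have "\<dots> = (LINT x|lebesgue_on U. u x * X_transpose X j \<phi> x)"
    by (intro integral_lebesgue_on_eq[OF Us, symmetric]) (auto simp: X_transpose_zero[OF \<phi>])
  finally show "(LINT x|lebesgue_on U. Xcl X u x $ j * \<phi> x) = (LINT x|lebesgue_on U. u x * X_transpose X j \<phi> x)" .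
qed

lemma has_Xgrad_linear:
  assumes U: "open U" "U \<subseteq> \<Omega>0" and u: "integrable (lebesgue_on U) u" "has_Xgrad U X u G" 
    and v: "integrable (lebesgue_on U) v" "has_Xgrad U X v H"
  shows "has_Xgrad U X (\<lambda>x. a * u x + b * v x) (\<lambda>x. a *\<^sub>R G x + b *\<^sub>R H x)"
  unfolding has_Xgrad_def
proof (intro conjI allI impI ballI)
  fix K assume "compact K \<and> K \<subseteq> U"
  then show "integrable (lebesgue_on K) (\<lambda>x. a *\<^sub>R G x + b *\<^sub>R H x)"
    using u(2) v(2) by (auto simp: has_Xgrad_def)
next
  fix \<phi> j assume \<phi>: "\<phi> \<in> Cinfc U"
  note p = CinfcD[OF \<phi>]
  have Us: "U \<in> sets lebesgue" using U by simp
  have i: "integrable (lebesgue_on U) (\<lambda>x. G x $ j * \<phi> x)" if "has_Xgrad U X w G" for w and G :: "real^'n \<Rightarrow> real^'m"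
  proof -
    have "integrable (lebesgue_on (closure {x. \<phi> x \<noteq> 0})) (\<lambda>x. G x $ j)"
      using that p(4,5) by (auto simp: has_Xgrad_def intro!: integrable_bounded_linear[OF bounded_linear_vec_nth])
    from integrable_mult_compact_support[OF this p(4,3) p(6)]
    show ?thesis using p(7) by (simp add: integrable_lebesgue_on_eq[OF Us])
  qed
  have t: "integrable (lebesgue_on U) (\<lambda>x. w x * X_transpose X j \<phi> x)" if "integrable (lebesgue_on U) w" for w
    using integrable_times_X_transpose[OF \<phi> U that, of j]
    by (subst integrable_lebesgue_on_eq[OF Us]) (auto simp: X_transpose_zero[OF \<phi>])
  have "(LINT x|lebesgue_on U. (a *\<^sub>R G x + b *\<^sub>R H x) $ j * \<phi> x) =
     (LINT x|lebesgue_on U. a * (G x $ j * \<phi> x) + b * (H x $ j * \<phi> x))"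
    by (intro Bochner_Integration.integral_cong) (auto simp: algebra_simps)
  also have "\<dots> = a * (LINT x|lebesgue_on U. G x $ j * \<phi> x) + b * (LINT x|lebesgue_on U. H x $ j * \<phi> x)"
    using i[OF u(2)] i[OF v(2)] by simp
  also have "\<dots> = a * (LINT x|lebesgue_on U. u x * X_transpose X j \<phi> x) + b * (LINT x|lebesgue_on U. v x * X_transpose X j \<phi> x)"
    using u(2) v(2) \<phi> by (simp add: has_Xgrad_def)
  also have "\<dots> = (LINT x|lebesgue_on U. a * (u x * X_transpose X j \<phi> x) + b * (v x * X_transpose X j \<phi> x))"
    using t[OF u(1)] t[OF v(1)] by simp
  also have "\<dots> = (LINT x|lebesgue_on U. (a * u x + b * v x) * X_transpose X j \<phi> x)"
    by (intro Bochner_Integration.integral_cong) (auto simp: algebra_simps)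
  finally show "(LINT x|lebesgue_on U. (a *\<^sub>R G x + b *\<^sub>R H x) $ j * \<phi> x) =
      (LINT x|lebesgue_on U. (a * u x + b * v x) * X_transpose X j \<phi> x)" .
qed

lemma Cinfc_mult:
  assumes "\<phi> \<in> Cinfc U" "\<psi> \<in> Cinfc V"
  shows "(\<lambda>x. \<phi> x * \<psi> x) \<in> Cinfc V"
proof -
  have s: "closure {x. \<phi> x * \<psi> x \<noteq> 0} \<subseteq> closure {x. \<psi> x \<noteq> 0}" by (intro closure_mono) auto
  have "bounded {x. \<psi> x \<noteq> 0}" using CinfcD(4)[OF assms(2)] by simp
  then have "bounded {x. \<phi> x * \<psi> x \<noteq> 0}" by (rule bounded_subset) auto
  then have "compact (closure {x. \<phi> x * \<psi> x \<noteq> 0})" by simp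
  then show ?thesis using s assms by (auto simp: Cinfc_def compact_support_in_def intro!: C_k_mult)
qed

text \<open>The Leibniz rule differentiates \<phi> and a coefficient times \<psi>. The second factor
  is merely Lipschitz, which limits the identity to almost every point.\<close>

lemma X_transpose_mult_AE:
  assumes \<phi>: "\<phi> \<in> Cinfc U" and \<psi>: "\<psi> \<in> Cinfc U" and U: "U \<subseteq> \<Omega>0"
  shows "AE x in lebesgue. X_transpose X j (\<lambda>x. \<phi> x * \<psi> x) x = \<phi> x * X_transpose X j \<psi> x - \<psi> x * (Xcl X \<phi> x $ j)"
proof -
  have "AE x in lebesgue. has_pd i (\<lambda>x. X j x $ i * \<psi> x) (partial_deriv i (\<lambda>x. X j x $ i * \<psi> x) x) x" for i
  proof -
    obtain L where "L-lipschitz_on UNIV (\<lambda>x. X j x $ i * \<psi> x)" using coeff_times_lipschitz[OF CinfcD(1,2)[OF \<psi>] U] .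
    then show ?thesis by (rule lipschitz_AE_has_pd)
  qed
  then have "AE x in lebesgue. \<forall>i\<in>UNIV. has_pd i (\<lambda>x. X j x $ i * \<psi> x) (partial_deriv i (\<lambda>x. X j x $ i * \<psi> x) x) x"
    by (intro AE_finite_allI) auto
  then show ?thesis
  proof eventually_elim
    case (elim x)
    have "partial_deriv i (\<lambda>y. X j y $ i * (\<phi> y * \<psi> y)) x = 
       \<phi> x * partial_deriv i (\<lambda>y. X j y $ i * \<psi> y) x + \<psi> x * (X j x $ i * partial_deriv i \<phi> x)" for i
    proof -
      have "has_pd i \<phi> (partial_deriv i \<phi> x) x" using C_k_Suc_has_pd[OF CinfcD(1)[OF \<phi>, of "Suc 0"]] .
      from has_pd_unique[OF has_pd_mult[OF this elim[rule_format, of i, OF UNIV_I]]]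
      show ?thesis by (simp add: algebra_simps)
    qed
    then show ?case
      by (simp add: X_transpose_def Xcl_def sum.distrib sum_distrib_left)
  qed
qed

text \<open>The product \<phi> \<psi> is again a test function. Testing the gradient of u with it
  and expanding its transposed derivative by the Leibniz rule yields both terms.\<close>

lemma has_Xgrad_mult:
  assumes U: "open U" "U \<subseteq> \<Omega>0" and u: "integrable (lebesgue_on U) u" "has_Xgrad U X u G" and \<phi>: "\<phi> \<in> Cinfc U"
  shows "has_Xgrad U X (\<lambda>x. \<phi> x * u x) (\<lambda>x. \<phi> x *\<^sub>R G x + u x *\<^sub>R Xcl X \<phi> x)"
  unfolding has_Xgrad_def
proof (intro conjI allI impI ballI)
  note p = CinfcD[OF \<phi>]
  have Us: "U \<in> sets lebesgue" using U by simp
  obtain B1 where B1: "0 \<le> B1" "\<And>x. \<bar>\<phi> x\<bar> \<le> B1" using bounded_continuous_compact_support[OF p(3,4,6)] by blast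
  obtain B2 where B2: "0 \<le> B2" "\<And>x. norm (Xcl X \<phi> x) \<le> B2" using Xcl_bounded[OF p(1,4)] p(5) U by blast
  have mX: "Xcl X \<phi> \<in> borel_measurable lebesgue" using Xcl_borel[OF p(1)] p(5) U by (intro measurable_completion) auto
  have m\<phi>: "\<phi> \<in> borel_measurable lebesgue" by (rule continuous_lebesgue_measurable[OF p(3)])
  { fix K assume K: "compact K \<and> K \<subseteq> U"
    then have Ks: "K \<in> sets lebesgue" by (auto intro!: borel_compact)
    have iG: "integrable (lebesgue_on K) G" using u(2) K by (auto simp: has_Xgrad_def)
    have iu: "integrable (lebesgue_on K) u" by (rule integrable_lebesgue_on_subset[OF u(1) Us Ks]) (use K in auto)
    show "integrable (lebesgue_on K) (\<lambda>x. \<phi> x *\<^sub>R G x + u x *\<^sub>R Xcl X \<phi> x)"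
    proof (rule Bochner_Integration.integrable_add)
      show "integrable (lebesgue_on K) (\<lambda>x. \<phi> x *\<^sub>R G x)"
        by (rule Bochner_Integration.integrable_bound[OF integrable_scaleR_right[OF iG, of B1]])
           (use iG m\<phi> B1 in \<open>auto intro!: borel_measurable_scaleR mult_right_mono intro: measurable_restrict_space1\<close>)
      show "integrable (lebesgue_on K) (\<lambda>x. u x *\<^sub>R Xcl X \<phi> x)"
        by (rule Bochner_Integration.integrable_bound[OF integrable_mult_right[OF iu, of B2]])
           (use iu mX B2 in \<open>auto simp: mult.commute[of B2] abs_mult intro!: AE_I2 borel_measurable_scaleR mult_left_mono intro: measurable_restrict_space1\<close>)
    qed }
  fix \<psi> j assume \<psi>: "\<psi> \<in> Cinfc U"
  note q = CinfcD[OF \<psi>]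
  note \<phi>\<psi> = Cinfc_mult[OF \<phi> \<psi>]
  note r = CinfcD[OF \<phi>\<psi>]
  have iu: "integrable lebesgue (\<lambda>x. indicator U x * u x)" using u(1) Us by (simp add: integrable_restrict_space)
  have iGf: "integrable (lebesgue_on U) (\<lambda>x. G x $ j * (\<phi> x * \<psi> x))"
  proof -
    have "integrable (lebesgue_on (closure {x. \<phi> x * \<psi> x \<noteq> 0})) (\<lambda>x. G x $ j)"
      using u(2) r(4,5) by (auto simp: has_Xgrad_def intro!: integrable_bounded_linear[OF bounded_linear_vec_nth])
    from integrable_mult_compact_support[OF this r(4,3) r(6)]
    show ?thesis using r(7) by (simp add: integrable_lebesgue_on_eq[OF Us])
  qed
  obtain B3 where B3: "0 \<le> B3" "\<And>x. \<bar>\<psi> x\<bar> \<le> B3" using bounded_continuous_compact_support[OF q(3,4,6)] by blast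
  have iux: "integrable (lebesgue_on U) (\<lambda>x. u x * (Xcl X \<phi> x $ j * \<psi> x))"
  proof (rule Bochner_Integration.integrable_bound[OF integrable_mult_right[OF u(1), of "B2 * B3"]])
    have "(\<lambda>x. Xcl X \<phi> x $ j * \<psi> x) \<in> borel_measurable lebesgue"
      by (intro borel_measurable_times continuous_lebesgue_measurable[OF q(3)] measurable_compose[OF mX]
          borel_measurable_continuous_onI continuous_intros)
    then show "(\<lambda>x. u x * (Xcl X \<phi> x $ j * \<psi> x)) \<in> borel_measurable (lebesgue_on U)"
      by (rule borel_measurable_times[OF borel_measurable_integrable[OF u(1)] measurable_restrict_space1])
    show "AE x in lebesgue_on U. norm (u x * (Xcl X \<phi> x $ j * \<psi> x)) \<le> norm (B2 * B3 * u x)"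
    proof (rule AE_I2)
      fix x
      have "\<bar>Xcl X \<phi> x $ j\<bar> * \<bar>\<psi> x\<bar> \<le> B2 * B3"
        using B2 B3 component_le_norm_cart[of "Xcl X \<phi> x" j] by (intro mult_mono) (auto intro: order_trans)
      then have "\<bar>u x\<bar> * (\<bar>Xcl X \<phi> x $ j\<bar> * \<bar>\<psi> x\<bar>) \<le> \<bar>u x\<bar> * (B2 * B3)" by (intro mult_left_mono) auto
      then show "norm (u x * (Xcl X \<phi> x $ j * \<psi> x)) \<le> norm (B2 * B3 * u x)"
        using B2(1) B3(1) by (simp add: abs_mult mult_ac)
    qed
  qed
  have t: "integrable (lebesgue_on U) (\<lambda>x. u x * X_transpose X j (\<lambda>x. \<phi> x * \<psi> x) x)"
    using integrable_times_X_transpose[OF \<phi>\<psi> U u(1), of j]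
    by (subst integrable_lebesgue_on_eq[OF Us]) (auto simp: X_transpose_zero[OF \<phi>\<psi>])
  have i\<phi>u: "integrable (lebesgue_on U) (\<lambda>x. \<phi> x * u x)"
    by (rule Bochner_Integration.integrable_bound[OF integrable_mult_right[OF u(1), of B1]])
       (use u(1) m\<phi> B1 in \<open>auto simp: abs_mult intro!: borel_measurable_times mult_right_mono intro: measurable_restrict_space1\<close>)
  have t': "integrable (lebesgue_on U) (\<lambda>x. (\<phi> x * u x) * X_transpose X j \<psi> x)"
    using integrable_times_X_transpose[OF \<psi> U i\<phi>u, of j]
    by (subst integrable_lebesgue_on_eq[OF Us]) (auto simp: X_transpose_zero[OF \<psi>])
  have "(LINT x|lebesgue_on U. (\<phi> x *\<^sub>R G x + u x *\<^sub>R Xcl X \<phi> x) $ j * \<psi> x) =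
     (LINT x|lebesgue_on U. G x $ j * (\<phi> x * \<psi> x) + u x * (Xcl X \<phi> x $ j * \<psi> x))"
    by (intro Bochner_Integration.integral_cong) (auto simp: algebra_simps)
  also have "\<dots> = (LINT x|lebesgue_on U. G x $ j * (\<phi> x * \<psi> x)) + (LINT x|lebesgue_on U. u x * (Xcl X \<phi> x $ j * \<psi> x))"
    using iGf iux by (rule Bochner_Integration.integral_add)
  also have "(LINT x|lebesgue_on U. G x $ j * (\<phi> x * \<psi> x)) = (LINT x|lebesgue_on U. u x * X_transpose X j (\<lambda>x. \<phi> x * \<psi> x) x)"
    using u(2) \<phi>\<psi> by (simp add: has_Xgrad_def)
  also have "(LINT x|lebesgue_on U. u x * X_transpose X j (\<lambda>x. \<phi> x * \<psi> x) x) + (LINT x|lebesgue_on U. u x * (Xcl X \<phi> x $ j * \<psi> x))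
     = (LINT x|lebesgue_on U. u x * X_transpose X j (\<lambda>x. \<phi> x * \<psi> x) x + u x * (Xcl X \<phi> x $ j * \<psi> x))"
    using t iux by (rule Bochner_Integration.integral_add[symmetric])
  also have "\<dots> = (LINT x|lebesgue_on U. \<phi> x * u x * X_transpose X j \<psi> x)"
  proof (rule integral_cong_AE)
    have "AE x in lebesgue_on U. X_transpose X j (\<lambda>x. \<phi> x * \<psi> x) x = \<phi> x * X_transpose X j \<psi> x - \<psi> x * (Xcl X \<phi> x $ j)"
      by (subst AE_restrict_space_iff) (use X_transpose_mult_AE[OF \<phi> \<psi> U(2), of j] Us in \<open>auto elim!: eventually_mono\<close>)
    then show "AE x in lebesgue_on U. u x * X_transpose X j (\<lambda>x. \<phi> x * \<psi> x) x + u x * (Xcl X \<phi> x $ j * \<psi> x) = \<phi> x * u x * X_transpose X j \<psi> x"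
    proof eventually_elim
      case (elim x)
      show ?case unfolding elim by (simp add: algebra_simps)
    qed
  qed (use t t' iux in auto)
  finally show "(LINT x|lebesgue_on U. (\<phi> x *\<^sub>R G x + u x *\<^sub>R Xcl X \<phi> x) $ j * \<psi> x) =
     (LINT x|lebesgue_on U. \<phi> x * u x * X_transpose X j \<psi> x)" .
qed

end

section \<open>Uniform boundedness and Lebesgue spaces\<close>

text \<open>Gliding hump: the signs of the summands \<open>3\<^sup>-\<^sup>n l\<^sub>n\<close> are chosen so that the partial sum is large at \<open>f (h n)\<close>, and
  the remaining tail can cancel at most half of that value.\<close>

lemma weakly_convergent_norm_bounded:
  fixes f :: "nat \<Rightarrow> 'a \<Rightarrow> 'b::real_vector"
  assumes weak: "weakly_converges S N f g" and fS: "\<And>h. f h \<in> S" and N0: "\<And>u. u \<in> S \<Longrightarrow> 0 \<le> N u"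
    and norming: "\<And>h. \<exists>l\<in>dual_space S N. (\<forall>u\<in>S. \<bar>l u\<bar> \<le> N u) \<and> l (f h) = N (f h)"
  obtains B where "0 \<le> B" "\<And>h. N (f h) \<le> B"
proof (rule ccontr)
  assume "\<not> thesis"
  then have unb: "\<exists>h. N (f h) > B" if "0 \<le> B" for B using that \<open>\<And>B. 0 \<le> B \<Longrightarrow> (\<And>h. N (f h) \<le> B) \<Longrightarrow> thesis\<close> by (meson not_less)
  \<comment> \<open>The growth 4^n beats the weights 3^-n of the series: their product (4/3)^n is
    unbounded.\<close>
  have "\<forall>n::nat. \<exists>h. N (f h) > 4 ^ n" by (intro allI unb) simp
  then obtain h where h: "\<And>n::nat. N (f (h n)) > 4 ^ n" by metis
  obtain l where l: "\<And>n. l n \<in> dual_space S N" "\<And>n u. u \<in> S \<Longrightarrow> \<bar>l n u\<bar> \<le> N u" "\<And>n. l n (f (h n)) = N (f (h n))"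
  proof -
    have "\<forall>n. \<exists>l. l \<in> dual_space S N \<and> (\<forall>u\<in>S. \<bar>l u\<bar> \<le> N u) \<and> l (f (h n)) = N (f (h n))"
      using norming by blast
    from choice[OF this] show thesis using that by blast
  qed
  \<comment> \<open>The new summand receives the sign that the sum so far has at
    \<open>f (h n)\<close>, so the two cannot cancel there.\<close>
  define x where "x = rec_nat (\<lambda>_. 0) (\<lambda>n y u. y u + (if 0 \<le> y (f (h n)) then 1 else -1) * (1/3)^n * l n u)"
  define d where "d n u = (if 0 \<le> x n (f (h n)) then 1 else -1) * (1/3)^n * l n u" for n u
  have x0: "x 0 u = 0" and xS: "x (Suc n) u = x n u + d n u" for n u
    by (simp_all add: x_def d_def)
  have xsum: "x n u = (\<Sum>k<n. d k u)" for n u by (induction n) (simp_all add: x0 xS)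
  have db: "\<bar>d n u\<bar> \<le> (1/3)^n * N u" if "u \<in> S" for n u
    using l(2)[OF that, of n] by (simp add: d_def abs_mult divide_right_mono)
  have geo: "summable (\<lambda>n. (1/3)^n * c)" for c :: real by (intro summable_mult2 summable_geometric) simp
  have ds: "summable (\<lambda>n. d n u)" if "u \<in> S" for u
    by (rule summable_rabs_cancel, rule summable_comparison_test'[OF geo[of "N u"], of 0]) (use db[OF that] in auto)
  have dlin: "d n (\<lambda>x. u x + v x) = d n u + d n v" if "u \<in> S" "v \<in> S" for n u v
    using l(1)[of n] that by (simp add: dual_space_def d_def algebra_simps)
  have dsc: "d n (\<lambda>x. a *\<^sub>R u x) = a * d n u" if "u \<in> S" for n u a
    using l(1)[of n] that by (simp add: dual_space_def d_def)
  define L where "L u = (\<Sum>n. d n u)" for u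
  have tail: "\<bar>L u - x n u\<bar> \<le> (3/2) * (1/3)^n * N u" if "u \<in> S" for n u
  proof -
    have "L u - x n u = (\<Sum>k. d (k + n) u)"
      unfolding L_def xsum using suminf_minus_initial_segment[OF ds[OF that], of n] by simp
    also have "\<bar>\<dots>\<bar> \<le> (\<Sum>k. (1/3)^(k + n) * N u)"
    proof (rule order_trans[OF summable_rabs])
      show s: "summable (\<lambda>k. \<bar>d (k + n) u\<bar>)"
        by (rule summable_comparison_test'[OF summable_ignore_initial_segment[OF geo[of "N u"], of n], of 0]) (use db[OF that] in auto)
      show "(\<Sum>k. \<bar>d (k + n) u\<bar>) \<le> (\<Sum>k. (1/3)^(k + n) * N u)"
        by (rule suminf_le[OF _ s summable_ignore_initial_segment[OF geo]]) (rule db[OF that])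
    qed
    also have "(\<Sum>k. (1/3)^(k + n) * N u) = (\<Sum>k. (1/3)^k * ((1/3)^n * N u))"
      by (simp add: power_add mult_ac)
    also have "\<dots> = (\<Sum>k. (1/3)^k) * ((1/3)^n * N u)"
      by (rule suminf_mult2[symmetric]) (rule summable_geometric, simp)
    also have "(\<Sum>k. (1/3::real)^k) = 3/2" by (subst suminf_geometric) auto
    finally show ?thesis by simp
  qed
  have "L \<in> dual_space S N"
    unfolding dual_space_def
  proof (intro CollectI conjI ballI allI exI)
    show "L (\<lambda>x. u x + v x) = L u + L v" if "u \<in> S" "v \<in> S" for u v
      unfolding L_def using that by (simp add: dlin suminf_add[OF ds ds])
    show "L (\<lambda>x. a *\<^sub>R u x) = a * L u" if "u \<in> S" for a u
      unfolding L_def using that by (simp add: dsc suminf_mult[OF ds])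
    show "\<bar>L u\<bar> \<le> (3/2) * N u" if "u \<in> S" for u
      using tail[OF that, of 0] by (simp add: x0)
  qed
  then have "(\<lambda>h. L (f h)) \<longlonglongrightarrow> L g" using weak by (simp add: weakly_converges_def)
  then have "Bseq (\<lambda>h. L (f h))" by (intro convergent_imp_Bseq convergentI)
  then obtain C where C: "\<And>h. \<bar>L (f h)\<bar> \<le> C" by (auto simp: Bseq_def)
  have low: "\<bar>L (f (h n))\<bar> \<ge> (1/2) * (4/3)^n" for n
  proof -
    let ?u = "f (h n)"
    have "\<bar>x (Suc n) ?u\<bar> \<ge> (1/3)^n * N ?u"
      using N0[OF fS, of "h n"] by (auto simp: xS d_def l(3))
    \<comment> \<open>The factor 3/2 of \<open>tail\<close> is the full geometric sum; the shift to
      \<open>Suc n\<close> turns it into 1/2.\<close>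
    moreover have "\<bar>L ?u - x (Suc n) ?u\<bar> \<le> (1/2) * (1/3)^n * N ?u" using tail[OF fS, of "h n" "Suc n"] by simp
    ultimately have "\<bar>L ?u\<bar> \<ge> (1/3)^n * N ?u - (1/2) * (1/3)^n * N ?u" by linarith
    moreover have "(1/3)^n * N ?u \<ge> (1/3)^n * 4^n" using h[of n] by (intro mult_left_mono) auto
    moreover have "(1/3)^n * 4^n = (4/3::real)^n" by (simp add: power_mult_distrib[symmetric])
    ultimately show ?thesis by linarith
  qed
  obtain n where "2 * C < (4/3)^n" using real_arch_pow[of "4/3" "2 * C"] by auto
  with low[of n] C[of "h n"] show False by linarith
qed

section \<open>Hoelder's inequality and the spaces L^p\<close>

lemma powr_add_le:
  fixes a b p :: real
  assumes "0 \<le> a" "0 \<le> b" "0 \<le> p"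
  shows "(a + b) powr p \<le> 2 powr p * (a powr p + b powr p)"
proof -
  have "(a + b) powr p \<le> (2 * max a b) powr p" using assms by (intro powr_mono2) auto
  also have "\<dots> = 2 powr p * (max a b) powr p" using assms by (simp add: powr_mult)
  also have "(max a b) powr p \<le> a powr p + b powr p" by (auto simp: max_def)
  finally show ?thesis by simp
qed

lemma integrable_powr_add:
  fixes f g :: "'a \<Rightarrow> 'b::euclidean_space"
  assumes [measurable]: "f \<in> borel_measurable M" "g \<in> borel_measurable M" and p: "0 \<le> p"
    and f: "integrable M (\<lambda>x. norm (f x) powr p)" and g: "integrable M (\<lambda>x. norm (g x) powr p)"
  shows "integrable M (\<lambda>x. norm (f x + g x) powr p)"
proof (rule Bochner_Integration.integrable_bound)
  show "integrable M (\<lambda>x. 2 powr p * (norm (f x) powr p + norm (g x) powr p))" using f g by simp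
  show "AE x in M. norm (norm (f x + g x) powr p) \<le> norm (2 powr p * (norm (f x) powr p + norm (g x) powr p))"
  proof (rule AE_I2)
    fix x
    have "norm (f x + g x) powr p \<le> (norm (f x) + norm (g x)) powr p" using p by (intro powr_mono2 norm_triangle_ineq) auto
    also have "\<dots> \<le> 2 powr p * (norm (f x) powr p + norm (g x) powr p)" by (rule powr_add_le) (use p in auto)
    finally show "norm (norm (f x + g x) powr p) \<le> norm (2 powr p * (norm (f x) powr p + norm (g x) powr p))" by simp
  qed
qed measurable

lemma Holder:
  fixes f g :: "'a \<Rightarrow> 'b::euclidean_space"
  assumes [measurable]: "f \<in> borel_measurable M" "g \<in> borel_measurable M" and pq: "1 < p" "1 < q" "1/p + 1/q = 1"
    and f: "integrable M (\<lambda>x. norm (f x) powr p)" and g: "integrable M (\<lambda>x. norm (g x) powr q)"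
  shows "integrable M (\<lambda>x. norm (f x) * norm (g x))"
    and "(LINT x|M. norm (f x) * norm (g x)) \<le> (LINT x|M. norm (f x) powr p) powr (1/p) * (LINT x|M. norm (g x) powr q) powr (1/q)"
proof -
  have young: "a * b \<le> a powr p / p + b powr q / q" if "0 \<le> a" "0 \<le> b" for a b :: real
    using Youngs_inequality[of p q a b] pq that by simp
  show i: "integrable M (\<lambda>x. norm (f x) * norm (g x))"
  proof (rule Bochner_Integration.integrable_bound)
    show "integrable M (\<lambda>x. norm (f x) powr p / p + norm (g x) powr q / q)" using f g by simp
    show "AE x in M. norm (norm (f x) * norm (g x)) \<le> norm (norm (f x) powr p / p + norm (g x) powr q / q)"
      using young pq by (intro AE_I2) (auto intro: order_trans[OF _ abs_ge_self])
  qed measurable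
  define a where "a = (LINT x|M. norm (f x) powr p)"
  define b where "b = (LINT x|M. norm (g x) powr q)"
  have a0: "0 \<le> a" "0 \<le> b" by (simp_all add: a_def b_def)
  show "(LINT x|M. norm (f x) * norm (g x)) \<le> a powr (1/p) * b powr (1/q)"
  proof (cases "a = 0 \<or> b = 0")
    case True
    then have "(AE x in M. norm (f x) powr p = 0) \<or> (AE x in M. norm (g x) powr q = 0)"
      using integral_nonneg_eq_0_iff_AE[OF f] integral_nonneg_eq_0_iff_AE[OF g] by (auto simp: a_def b_def)
    then have "AE x in M. norm (f x) * norm (g x) = 0" by (auto elim: eventually_mono)
    then have "(LINT x|M. norm (f x) * norm (g x)) = 0" by (rule integral_eq_zero_AE)
    then show ?thesis by simp
  next
    case False
    then have ab: "0 < a" "0 < b" using a0 by auto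
    define A where "A = a powr (1/p)"
    define B where "B = b powr (1/q)"
    have AB: "0 < A" "0 < B" "A powr p = a" "B powr q = b" using ab pq by (auto simp: A_def B_def powr_powr)
    \<comment> \<open>Young's inequality is applied to f and g scaled to norm 1; after integration
      the bound is 1/p + 1/q = 1 times the two norms.\<close>
    have "norm (f x) * norm (g x) \<le> A * B * (norm (f x) powr p / (p * a) + norm (g x) powr q / (q * b))" for x
    proof -
      have "(norm (f x) / A) * (norm (g x) / B) \<le> (norm (f x) / A) powr p / p + (norm (g x) / B) powr q / q"
        using AB by (intro young) auto
      also have "\<dots> = norm (f x) powr p / (p * a) + norm (g x) powr q / (q * b)"
        using AB by (simp add: powr_divide mult.commute)
      finally have "A * B * ((norm (f x) / A) * (norm (g x) / B)) \<le> A * B * (norm (f x) powr p / (p * a) + norm (g x) powr q / (q * b))"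
        using AB by (intro mult_left_mono) auto
      then show ?thesis using AB by simp
    qed
    then have "(LINT x|M. norm (f x) * norm (g x)) \<le> (LINT x|M. A * B * (norm (f x) powr p / (p * a) + norm (g x) powr q / (q * b)))"
      using i f g by (intro integral_mono) auto
    also have "\<dots> = A * B * (a / (p * a) + b / (q * b))"
      using f g by (simp add: a_def b_def)
    also have "\<dots> = A * B * (1/p + 1/q)" using ab by simp
    finally show ?thesis using pq by (simp add: A_def B_def)
  qed
qed

lemma Holder_inner:
  fixes f g :: "'a \<Rightarrow> 'b::euclidean_space"
  assumes [measurable]: "f \<in> borel_measurable M" "g \<in> borel_measurable M" and pq: "1 < p" "1 < q" "1/p + 1/q = 1"
    and f: "integrable M (\<lambda>x. norm (f x) powr p)" and g: "integrable M (\<lambda>x. norm (g x) powr q)"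
  shows "integrable M (\<lambda>x. f x \<bullet> g x)"
    and "\<bar>LINT x|M. f x \<bullet> g x\<bar> \<le> (LINT x|M. norm (f x) powr p) powr (1/p) * (LINT x|M. norm (g x) powr q) powr (1/q)"
proof -
  note H = Holder[OF assms]
  show i: "integrable M (\<lambda>x. f x \<bullet> g x)"
    by (rule Bochner_Integration.integrable_bound[OF H(1)]) (auto simp: Cauchy_Schwarz_ineq2)
  have "\<bar>LINT x|M. f x \<bullet> g x\<bar> \<le> (LINT x|M. \<bar>f x \<bullet> g x\<bar>)" by (rule integral_abs_bound)
  also have "\<dots> \<le> (LINT x|M. norm (f x) * norm (g x))"
    using i H(1) by (intro integral_mono) (auto simp: Cauchy_Schwarz_ineq2)
  also note H(2)
  finally show "\<bar>LINT x|M. f x \<bullet> g x\<bar> \<le> (LINT x|M. norm (f x) powr p) powr (1/p) * (LINT x|M. norm (g x) powr q) powr (1/q)" .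
qed

text \<open>The bound on g reads \<open>\<le> 1\<close> because g = 0 is chosen when f vanishes
  almost everywhere; otherwise the norm of g is 1.\<close>

lemma Holder_norming:
  fixes f :: "'a \<Rightarrow> 'b::euclidean_space"
  assumes [measurable]: "f \<in> borel_measurable M" and pq: "1 < p" "1 < q" "1/p + 1/q = 1"
    and f: "integrable M (\<lambda>x. norm (f x) powr p)"
  obtains g where "g \<in> borel_measurable M" "integrable M (\<lambda>x. norm (g x) powr q)"
    "(LINT x|M. norm (g x) powr q) powr (1/q) \<le> 1"
    "(LINT x|M. f x \<bullet> g x) = (LINT x|M. norm (f x) powr p) powr (1/p)"
proof -
  define a where "a = (LINT x|M. norm (f x) powr p)"
  have "0 \<le> a" by (simp add: a_def)
  have e: "(p - 1) * q = p" using pq by (simp add: field_simps)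
  show ?thesis
  proof (cases "a = 0")
    case True
    then show ?thesis by (intro that[of "\<lambda>_. 0"]) (auto simp: a_def)
  next
    case False
    then have a: "0 < a" using \<open>0 \<le> a\<close> by simp
    define A where "A = a powr (1/p)"
    have A: "0 < A" "A powr p = a" using a pq by (auto simp: A_def powr_powr)
    \<comment> \<open>The extremal function of Hoelder's inequality: g is parallel to f, and |g|^q
      is proportional to |f|^p. The exponent p - 2 may be negative, but where f vanishes
      \<open>powr\<close> returns 0.\<close>
    define g where "g x = (norm (f x) powr (p - 2) / A powr (p - 1)) *\<^sub>R f x" for x
    have [measurable]: "g \<in> borel_measurable M" unfolding g_def by measurable
    have ng: "norm (g x) = norm (f x) powr (p - 1) / A powr (p - 1)" for x
    proof (cases "f x = 0")
      case False
      then have "norm (f x) powr (p - 1) = norm (f x) powr (p - 2) * norm (f x) powr 1" by (subst powr_add[symmetric]) simp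
      then show ?thesis using False by (simp add: g_def)
    qed (simp add: g_def)
    have ngq: "norm (g x) powr q = norm (f x) powr p / a" for x
      using A e by (simp add: ng powr_divide powr_powr)
    have fg: "f x \<bullet> g x = norm (f x) powr p / A powr (p - 1)" for x
    proof (cases "f x = 0")
      case False
      then have "norm (f x) powr p = norm (f x) powr (p - 2) * norm (f x) powr 2" by (subst powr_add[symmetric]) simp
      then show ?thesis using False by (simp add: g_def power2_norm_eq_inner[symmetric])
    qed (simp add: g_def)
    show ?thesis
    proof (rule that[of g])
      show "integrable M (\<lambda>x. norm (g x) powr q)" unfolding ngq using f by simp
      show "(LINT x|M. norm (g x) powr q) powr (1/q) \<le> 1" unfolding ngq using a by (simp add: a_def[symmetric])
      have "a / A powr (p - 1) = A powr p / A powr (p - 1)" using A by simp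
      also have "\<dots> = A" using A(1) by (simp add: powr_diff[symmetric] flip: powr_diff)
      finally show "(LINT x|M. f x \<bullet> g x) = (LINT x|M. norm (f x) powr p) powr (1/p)"
        unfolding fg by (simp add: a_def[symmetric] A_def)
    qed measurable
  qed
qed

lemma Lp_D: "f \<in> Lp p \<Omega> \<Longrightarrow> f \<in> borel_measurable (lebesgue_on \<Omega>)"
  "f \<in> Lp p \<Omega> \<Longrightarrow> integrable (lebesgue_on \<Omega>) (\<lambda>x. norm (f x) powr p)"
  by (auto simp: Lp_def)

lemma Lp_norm_nonneg: "0 \<le> Lp_norm p \<Omega> f" by (simp add: Lp_norm_def)

lemma Lp_scaleR: "f \<in> Lp p \<Omega> \<Longrightarrow> (\<lambda>x. a *\<^sub>R f x) \<in> Lp p \<Omega>"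
  by (auto simp: Lp_def powr_mult)

lemma Lp_add: "0 \<le> p \<Longrightarrow> f \<in> Lp p \<Omega> \<Longrightarrow> g \<in> Lp p \<Omega> \<Longrightarrow> (\<lambda>x. f x + g x) \<in> Lp p \<Omega>"
  by (auto simp: Lp_def intro!: integrable_powr_add)

lemma Lp_bounded_scaleR:
  assumes "f \<in> Lp p \<Omega>" "a \<in> borel_measurable lebesgue" "\<And>x. \<bar>a x\<bar> \<le> (B::real)" "0 \<le> p"
  shows "(\<lambda>x. a x *\<^sub>R f x) \<in> Lp p \<Omega>"
proof -
  have [measurable]: "a \<in> borel_measurable (lebesgue_on \<Omega>)" "f \<in> borel_measurable (lebesgue_on \<Omega>)"
    using assms Lp_D(1) by (auto intro: measurable_restrict_space1)
  have "integrable (lebesgue_on \<Omega>) (\<lambda>x. norm (a x *\<^sub>R f x) powr p)"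
  proof (rule Bochner_Integration.integrable_bound[OF integrable_mult_right[OF Lp_D(2)[OF assms(1)], of "B powr p"]])
    show "AE x in lebesgue_on \<Omega>. norm (norm (a x *\<^sub>R f x) powr p) \<le> norm (B powr p * norm (f x) powr p)"
      using assms(3,4) by (intro AE_I2) (auto simp: powr_mult intro!: mult_right_mono powr_mono2)
  qed measurable
  then show ?thesis by (simp add: Lp_def)
qed

lemma Lp_times_bounded:
  fixes b :: "real^'n \<Rightarrow> 'b::euclidean_space"
  assumes "f \<in> Lp p \<Omega>" "b \<in> borel_measurable lebesgue" "\<And>x. norm (b x) \<le> B" "0 \<le> p"
  shows "(\<lambda>x. f x *\<^sub>R b x) \<in> Lp p \<Omega>"
proof -
  have [measurable]: "b \<in> borel_measurable (lebesgue_on \<Omega>)" "f \<in> borel_measurable (lebesgue_on \<Omega>)"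
    using assms Lp_D(1) by (auto intro: measurable_restrict_space1)
  have "integrable (lebesgue_on \<Omega>) (\<lambda>x. norm (f x *\<^sub>R b x) powr p)"
  proof (rule Bochner_Integration.integrable_bound[OF integrable_mult_left[OF Lp_D(2)[OF assms(1)], of "B powr p"]])
    show "AE x in lebesgue_on \<Omega>. norm (norm (f x *\<^sub>R b x) powr p) \<le> norm (norm (f x) powr p * B powr p)"
      using assms(3,4) by (intro AE_I2) (auto simp: powr_mult intro!: mult_left_mono powr_mono2)
  qed measurable
  then show ?thesis by (simp add: Lp_def)
qed

lemma Lp_cong_AE:
  assumes \<Omega>: "\<Omega> \<in> sets lebesgue" and f: "f \<in> Lp p \<Omega>" and eq: "AE x in lebesgue_on \<Omega>. g x = f x"
  shows "g \<in> Lp p \<Omega>"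
proof -
  have [measurable]: "f \<in> borel_measurable (lebesgue_on \<Omega>)" by (rule Lp_D(1)[OF f])
  have "AE x in lebesgue. x \<in> \<Omega> \<longrightarrow> g x = f x" using eq \<Omega> by (simp add: AE_restrict_space_iff)
  then have "AE x in lebesgue. indicator \<Omega> x *\<^sub>R g x = indicator \<Omega> x *\<^sub>R f x"
    by eventually_elim (auto split: split_indicator)
  moreover have "(\<lambda>x. indicator \<Omega> x *\<^sub>R f x) \<in> borel_measurable lebesgue"
    using Lp_D(1)[OF f] \<Omega> by (subst (asm) borel_measurable_restrict_space_iff) auto
  ultimately have "(\<lambda>x. indicator \<Omega> x *\<^sub>R g x) \<in> borel_measurable lebesgue" by (rule lebesgue_measurable_AE[rotated])
  then have [measurable]: "g \<in> borel_measurable (lebesgue_on \<Omega>)"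
    using \<Omega> by (subst borel_measurable_restrict_space_iff) auto
  have "integrable (lebesgue_on \<Omega>) (\<lambda>x. norm (g x) powr p)"
    by (rule integrable_cong_AE_imp[OF Lp_D(2)[OF f]]) (use eq in \<open>auto elim: eventually_mono\<close>)
  then show ?thesis by (simp add: Lp_def)
qed

lemma Lp_norm_cong_AE:
  assumes "f \<in> Lp p \<Omega>" "g \<in> Lp p \<Omega>" "AE x in lebesgue_on \<Omega>. g x = f x"
  shows "Lp_norm p \<Omega> g = Lp_norm p \<Omega> f"
proof -
  note [measurable] = Lp_D(1)[OF assms(1)] Lp_D(1)[OF assms(2)]
  have "(LINT x|lebesgue_on \<Omega>. norm (g x) powr p) = (LINT x|lebesgue_on \<Omega>. norm (f x) powr p)"
    by (intro integral_cong_AE) (use assms(3) in \<open>auto elim: eventually_mono\<close>)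
  then show ?thesis by (simp add: Lp_norm_def)
qed

lemma Lp_Holder:
  assumes "f \<in> Lp p \<Omega>" "g \<in> Lp q \<Omega>" "1 < p" "1 < q" "1/p + 1/q = 1"
  shows "integrable (lebesgue_on \<Omega>) (\<lambda>x. f x \<bullet> g x)"
    and "\<bar>LINT x|lebesgue_on \<Omega>. f x \<bullet> g x\<bar> \<le> Lp_norm p \<Omega> f * Lp_norm q \<Omega> g"
  using Holder_inner[of f "lebesgue_on \<Omega>" g p q] assms by (auto simp: Lp_def Lp_norm_def)

lemma Lp_norming:
  assumes "f \<in> Lp p \<Omega>" "1 < p" "1 < q" "1/p + 1/q = 1"
  obtains g where "g \<in> Lp q \<Omega>" "Lp_norm q \<Omega> g \<le> 1" "(LINT x|lebesgue_on \<Omega>. f x \<bullet> g x) = Lp_norm p \<Omega> f"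
proof (rule Holder_norming[of f "lebesgue_on \<Omega>" p q])
  fix g assume "g \<in> borel_measurable (lebesgue_on \<Omega>)" "integrable (lebesgue_on \<Omega>) (\<lambda>x. norm (g x) powr q)"
    "(LINT x|lebesgue_on \<Omega>. norm (g x) powr q) powr (1/q) \<le> 1"
    "(LINT x|lebesgue_on \<Omega>. f x \<bullet> g x) = (LINT x|lebesgue_on \<Omega>. norm (f x) powr p) powr (1/p)"
  then show thesis by (intro that[of g]) (auto simp: Lp_def Lp_norm_def)
qed (use assms in \<open>auto simp: Lp_def\<close>)

lemma Lp_inner_dual:
  assumes "g \<in> Lp q \<Omega>" "1 < p" "1 < q" "1/p + 1/q = 1"
  shows "(\<lambda>f. LINT x|lebesgue_on \<Omega>. f x \<bullet> g x) \<in> dual_space (Lp p \<Omega>) (Lp_norm p \<Omega>)"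
  unfolding dual_space_def
proof (intro CollectI conjI ballI allI exI)
  note H = Lp_Holder[OF _ assms]
  show "(LINT x|lebesgue_on \<Omega>. (u x + v x) \<bullet> g x) = (LINT x|lebesgue_on \<Omega>. u x \<bullet> g x) + (LINT x|lebesgue_on \<Omega>. v x \<bullet> g x)"
    if "u \<in> Lp p \<Omega>" "v \<in> Lp p \<Omega>" for u v
    using H(1)[OF that(1)] H(1)[OF that(2)] by (simp add: inner_add_left)
  show "(LINT x|lebesgue_on \<Omega>. (a *\<^sub>R u x) \<bullet> g x) = a * (LINT x|lebesgue_on \<Omega>. u x \<bullet> g x)" for a u
    by simp
  show "\<bar>LINT x|lebesgue_on \<Omega>. u x \<bullet> g x\<bar> \<le> Lp_norm q \<Omega> g * Lp_norm p \<Omega> u" if "u \<in> Lp p \<Omega>" for u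
    using H(2)[OF that] by (simp add: mult.commute)
qed

lemma weakly_convergent_Lp_bounded:
  assumes "weakly_converges (Lp p \<Omega>) (Lp_norm p \<Omega>) f g" "\<And>h. f h \<in> Lp p \<Omega>" "1 < p" "1 < q" "1/p + 1/q = 1"
  obtains B where "0 \<le> B" "\<And>h. Lp_norm p \<Omega> (f h) \<le> B"
proof (rule weakly_convergent_norm_bounded[OF assms(1,2)])
  fix h
  obtain g where g: "g \<in> Lp q \<Omega>" "Lp_norm q \<Omega> g \<le> 1" "(LINT x|lebesgue_on \<Omega>. f h x \<bullet> g x) = Lp_norm p \<Omega> (f h)"
    using Lp_norming[OF assms(2,3,4,5)] .
  have "\<bar>LINT x|lebesgue_on \<Omega>. u x \<bullet> g x\<bar> \<le> Lp_norm p \<Omega> u" if "u \<in> Lp p \<Omega>" for u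
  proof -
    have "\<bar>LINT x|lebesgue_on \<Omega>. u x \<bullet> g x\<bar> \<le> Lp_norm p \<Omega> u * Lp_norm q \<Omega> g" by (rule Lp_Holder(2)[OF that g(1) assms(3-5)])
    also have "\<dots> \<le> Lp_norm p \<Omega> u * 1" using g(2) Lp_norm_nonneg by (intro mult_left_mono) auto
    finally show ?thesis by simp
  qed
  then show "\<exists>l\<in>dual_space (Lp p \<Omega>) (Lp_norm p \<Omega>). (\<forall>u\<in>Lp p \<Omega>. \<bar>l u\<bar> \<le> Lp_norm p \<Omega> u) \<and> l (f h) = Lp_norm p \<Omega> (f h)"
    using g(3) Lp_inner_dual[OF g(1) assms(3-5)] by (intro bexI[of _ "\<lambda>f. LINT x|lebesgue_on \<Omega>. f x \<bullet> g x"]) auto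
qed (use that Lp_norm_nonneg in auto)

lemma Lp_imp_integrable:
  fixes f :: "real^'n \<Rightarrow> 'b::euclidean_space"
  assumes \<Omega>: "\<Omega> \<in> lmeasurable" and f: "f \<in> Lp p \<Omega>" and p: "1 \<le> p"
  shows "integrable (lebesgue_on \<Omega>) f"
proof (rule Bochner_Integration.integrable_bound)
  have "integrable (lebesgue_on \<Omega>) (\<lambda>x. 1 :: real)"
    using \<Omega> by (simp add: integrable_restrict_space fmeasurableD lmeasurable_iff_integrable)
  then show "integrable (lebesgue_on \<Omega>) (\<lambda>x. 1 + norm (f x) powr p)" using Lp_D(2)[OF f] by simp
  show "AE x in lebesgue_on \<Omega>. norm (f x) \<le> norm (1 + norm (f x) powr p)"
  proof (rule AE_I2)
    fix x
    show "norm (f x) \<le> norm (1 + norm (f x) powr p)"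
    proof (cases "norm (f x) \<le> 1")
      case False
      then have "norm (f x) powr 1 \<le> norm (f x) powr p" using p by (intro powr_mono) auto
      then show ?thesis using False by simp
    qed (simp add: add_increasing2)
  qed
qed (use Lp_D[OF f] in auto)

section \<open>Carnot-Caratheodory distance\<close>

lemma real_affine_lebesgue_measurable:
  "c \<noteq> 0 \<Longrightarrow> (\<lambda>x::real. t + c * x) \<in> lebesgue \<rightarrow>\<^sub>M lebesgue"
  using lebesgue_affine_measurable[of "\<lambda>_. c" t] by simp

text \<open>The velocity of a curve is prescribed almost everywhere; this carries the condition
  through a shift or a reversal of the parameter.\<close>

lemma AE_lebesgue_real_affine:
  assumes c: "c \<noteq> 0" and P: "AE x in lebesgue. P x"
  shows "AE x in lebesgue. P (t + c * x :: real)"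
proof -
  have "lebesgue = density (distr lebesgue lebesgue (\<lambda>x::real. t + c * x)) (\<lambda>_. ennreal \<bar>c\<bar>)"
    using lebesgue_affine_euclidean[of "\<lambda>_. c" t] c by simp
  then have "AE x in density (distr lebesgue lebesgue (\<lambda>x::real. t + c * x)) (\<lambda>_. ennreal \<bar>c\<bar>). P x" 
    by (rule subst[of lebesgue _ "\<lambda>M. AE x in M. P x", OF _ P])
  then have "AE x in distr lebesgue lebesgue (\<lambda>x::real. t + c * x). P x" using c by (subst (asm) AE_density) auto
  then show ?thesis by (rule AE_distrD[OF real_affine_lebesgue_measurable[OF c]])
qed

section \<open>Absolute continuity under changes of the parameter\<close>

definition interval_families :: "real set \<Rightarrow> real \<Rightarrow> (real \<times> real) set set" where
  "interval_families I \<delta> = {D. finite D \<and> (\<forall>p\<in>D. fst p \<le> snd p \<and> {fst p..snd p} \<subseteq> I) \<and>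
     disjoint_family_on (\<lambda>p. {fst p<..<snd p}) D \<and> (\<Sum>p\<in>D. snd p - fst p) < \<delta>}"

lemma abs_cont_on_iff:
  "abs_cont_on I f \<longleftrightarrow> (\<forall>e>0. \<exists>\<delta>>0. \<forall>D\<in>interval_families I \<delta>. (\<Sum>p\<in>D. norm (f (snd p) - f (fst p))) < e)"
  by (simp add: abs_cont_on_def interval_families_def case_prod_beta' Ball_def)

text \<open>The common core of shift and reflection. The map m acts on whole intervals and not on
  points, since a reflection exchanges the two endpoints.\<close>

lemma abs_cont_on_transfer:
  fixes f g :: "real \<Rightarrow> 'a::real_normed_vector" and m :: "real \<times> real \<Rightarrow> real \<times> real"
  assumes f: "abs_cont_on I f" and m: "inj m"
    and sub: "\<And>s t s' t'. s \<le> t \<Longrightarrow> {s..t} \<subseteq> J \<Longrightarrow> m (s, t) = (s', t') \<Longrightarrow>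
       s' \<le> t' \<and> {s'..t'} \<subseteq> I \<and> t' - s' = t - s \<and> norm (f t' - f s') = norm (g t - g s)"
    and dis: "\<And>s t u v s' t' u' v'. {s<..<t} \<inter> {u<..<v} = {} \<Longrightarrow> m (s, t) = (s', t') \<Longrightarrow> m (u, v) = (u', v') \<Longrightarrow>
       {s'<..<t'} \<inter> {u'<..<v'} = {}"
  shows "abs_cont_on J g"
  unfolding abs_cont_on_iff
proof (intro allI impI)
  fix e :: real assume "0 < e"
  then obtain \<delta> where d: "0 < \<delta>" "\<And>D. D \<in> interval_families I \<delta> \<Longrightarrow> (\<Sum>p\<in>D. norm (f (snd p) - f (fst p))) < e"
    using f unfolding abs_cont_on_iff by blast
  show "\<exists>\<delta>>0. \<forall>D\<in>interval_families J \<delta>. (\<Sum>p\<in>D. norm (g (snd p) - g (fst p))) < e"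
  proof (intro exI[of _ \<delta>] conjI ballI d(1))
    fix D :: "(real \<times> real) set"
    assume "D \<in> interval_families J \<delta>"
    then have D: "finite D" "\<And>p. p \<in> D \<Longrightarrow> fst p \<le> snd p \<and> {fst p..snd p} \<subseteq> J"
        "disjoint_family_on (\<lambda>p. {fst p<..<snd p}) D" "(\<Sum>p\<in>D. snd p - fst p) < \<delta>"
      unfolding interval_families_def by blast+
    have inj: "inj_on m D" using m by (rule inj_on_subset) simp
    have each: "fst (m p) \<le> snd (m p) \<and> {fst (m p)..snd (m p)} \<subseteq> I \<and> snd (m p) - fst (m p) = snd p - fst p
       \<and> norm (f (snd (m p)) - f (fst (m p))) = norm (g (snd p) - g (fst p))" if "p \<in> D" for p
      using sub[of "fst p" "snd p" "fst (m p)" "snd (m p)"] D(2)[OF that] by simp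
    have "m ` D \<in> interval_families I \<delta>"
      unfolding interval_families_def
    proof (intro CollectI conjI ballI)
      show "finite (m ` D)" using D by simp
      show "fst p \<le> snd p" "{fst p..snd p} \<subseteq> I" if "p \<in> m ` D" for p using each that by blast+
      show "disjoint_family_on (\<lambda>p. {fst p<..<snd p}) (m ` D)"
        unfolding disjoint_family_on_def
      proof (intro ballI impI)
        fix p' q' assume "p' \<in> m ` D" "q' \<in> m ` D" "p' \<noteq> q'"
        then obtain p q where pq: "p \<in> D" "q \<in> D" "p' = m p" "q' = m q" "p \<noteq> q" by blast
        then have "{fst p<..<snd p} \<inter> {fst q<..<snd q} = {}"
          using D(3) unfolding disjoint_family_on_def by blast
        from dis[OF this, of "fst (m p)" "snd (m p)" "fst (m q)" "snd (m q)"] 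
        show "{fst p'<..<snd p'} \<inter> {fst q'<..<snd q'} = {}"
          using pq by simp
      qed
      have "(\<Sum>p\<in>m ` D. snd p - fst p) = (\<Sum>p\<in>D. snd p - fst p)"
        using each by (subst sum.reindex[OF inj]) (auto intro!: sum.cong)
      then show "(\<Sum>p\<in>m ` D. snd p - fst p) < \<delta>" using D by simp
    qed
    from d(2)[OF this] have "(\<Sum>p\<in>m ` D. norm (f (snd p) - f (fst p))) < e" .
    moreover have "(\<Sum>p\<in>m ` D. norm (f (snd p) - f (fst p))) = (\<Sum>p\<in>D. norm (g (snd p) - g (fst p)))"
      using each by (subst sum.reindex[OF inj]) (auto intro!: sum.cong)
    ultimately show "(\<Sum>p\<in>D. norm (g (snd p) - g (fst p))) < e" by simp
  qed
qed

lemma abs_cont_on_shift: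
  assumes "abs_cont_on {a..b} f"
  shows "abs_cont_on {a + c..b + c} (\<lambda>s. f (s - c))"
proof (rule abs_cont_on_transfer[OF assms, of "\<lambda>(s,t). (s - c, t - c)"])
  show "inj (\<lambda>(s, t). (s - c, t - c))" by (auto simp: inj_def)
  show "s' \<le> t' \<and> {s'..t'} \<subseteq> {a..b} \<and> t' - s' = t - s \<and> norm (f t' - f s') = norm (f (t - c) - f (s - c))"
    if "s \<le> t" "{s..t} \<subseteq> {a + c..b + c}" "(case (s, t) of (s, t) \<Rightarrow> (s - c, t - c)) = (s', t')" for s t s' t'
    using that by auto
  show "{s'<..<t'} \<inter> {u'<..<v'} = {}"
    if d: "{s<..<t} \<inter> {u<..<v} = {}" and e: "(case (s, t) of (s, t) \<Rightarrow> (s - c, t - c)) = (s', t')"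
      "(case (u, v) of (s, t) \<Rightarrow> (s - c, t - c)) = (u', v')" for s t u v s' t' u' v'
  proof (rule equals0I)
    fix x assume "x \<in> {s'<..<t'} \<inter> {u'<..<v'}"
    then have "x + c \<in> {s<..<t} \<inter> {u<..<v}" using e by auto
    then show False by (simp only: d empty_iff)
  qed
qed

lemma abs_cont_on_reflect:
  assumes "abs_cont_on {a..b} f"
  shows "abs_cont_on {c - b..c - a} (\<lambda>s. f (c - s))"
proof (rule abs_cont_on_transfer[OF assms, of "\<lambda>(s,t). (c - t, c - s)"])
  show "inj (\<lambda>(s, t). (c - t, c - s))" by (auto simp: inj_def)
  show "s' \<le> t' \<and> {s'..t'} \<subseteq> {a..b} \<and> t' - s' = t - s \<and> norm (f t' - f s') = norm (f (c - t) - f (c - s))"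
    if "s \<le> t" "{s..t} \<subseteq> {c - b..c - a}" "(case (s, t) of (s, t) \<Rightarrow> (c - t, c - s)) = (s', t')" for s t s' t'
    using that by (auto simp: norm_minus_commute)
  show "{s'<..<t'} \<inter> {u'<..<v'} = {}"
    if d: "{s<..<t} \<inter> {u<..<v} = {}" and e: "(case (s, t) of (s, t) \<Rightarrow> (c - t, c - s)) = (s', t')"
      "(case (u, v) of (s, t) \<Rightarrow> (c - t, c - s)) = (u', v')" for s t u v s' t' u' v'
  proof (rule equals0I)
    fix x assume "x \<in> {s'<..<t'} \<inter> {u'<..<v'}"
    then have "c - x \<in> {s<..<t} \<inter> {u<..<v}" using e by auto
    then show False by (simp only: d empty_iff)
  qed
qed

text \<open>The map \<open>k\<close> clips to \<open>{a..b}\<close>. It is injective on the intervals that do not collapse to a point, by disjointness.\<close>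

lemma abs_cont_on_clip_sum:
  fixes f :: "real \<Rightarrow> 'a::real_normed_vector"
  assumes fin: "finite D" and D: "\<And>p. p \<in> D \<Longrightarrow> fst p \<le> snd p"
    and dis: "disjoint_family_on (\<lambda>p. {fst p<..<snd p}) D" and sum: "(\<Sum>p\<in>D. snd p - fst p) < \<delta>"
    and clip: "\<And>s t. s \<le> t \<Longrightarrow> k s \<le> k t \<and> k t - k s \<le> t - s"
       "\<And>s. k s \<in> {a..b}"
       "\<And>s. s \<in> {a..b} \<Longrightarrow> k s = s"
    and \<delta>: "\<And>D. D \<in> interval_families {a..b} \<delta> \<Longrightarrow> (\<Sum>p\<in>D. norm (f (snd p) - f (fst p))) < e"
  shows "(\<Sum>p\<in>D. norm (f (k (snd p)) - f (k (fst p)))) < e"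
proof -
  let ?m = "\<lambda>p. (k (fst p), k (snd p))"
  let ?D = "{p\<in>D. k (fst p) < k (snd p)}"
  have sub: "{k s<..<k t} \<subseteq> {s<..<t}" if "s \<le> t" for s t
  proof
    fix x assume x: "x \<in> {k s<..<k t}"
    then have "x \<in> {a..b}" using clip(2)[of s] clip(2)[of t] by auto
    then have "k x = x" by (rule clip(3))
    then show "x \<in> {s<..<t}" using x clip(1)[of x s] clip(1)[of t x] by (metis greaterThanLessThan_iff linorder_not_le)
  qed
  have inj: "inj_on ?m ?D"
  proof (rule inj_onI)
    fix p q assume p: "p \<in> ?D" and q: "q \<in> ?D" and eq: "?m p = ?m q"
    show "p = q"
    proof (rule ccontr)
      assume "p \<noteq> q"
      then have "{fst p<..<snd p} \<inter> {fst q<..<snd q} = {}"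
        using dis p q unfolding disjoint_family_on_def by blast
      moreover have "{k (fst p)<..<k (snd p)} \<subseteq> {fst p<..<snd p} \<inter> {fst q<..<snd q}"
      proof (rule Int_greatest)
        show "{k (fst p)<..<k (snd p)} \<subseteq> {fst p<..<snd p}" by (rule sub) (use D p in auto)
        have "{k (fst q)<..<k (snd q)} \<subseteq> {fst q<..<snd q}" by (rule sub) (use D q in auto)
        moreover have "k (fst q) = k (fst p)" "k (snd q) = k (snd p)" using eq by auto
        ultimately show "{k (fst p)<..<k (snd p)} \<subseteq> {fst q<..<snd q}" by (simp only:)
      qed
      ultimately have "{k (fst p)<..<k (snd p)} = {}" by blast
      then show False using p by (simp add: not_le)
    qed
  qed
  have "(\<Sum>p\<in>D. norm (f (k (snd p)) - f (k (fst p)))) = (\<Sum>p\<in>?D. norm (f (k (snd p)) - f (k (fst p))))"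
  proof (rule sum.mono_neutral_right[OF fin])
    show "\<forall>p\<in>D - ?D. norm (f (k (snd p)) - f (k (fst p))) = 0"
    proof
      fix p assume p: "p \<in> D - ?D"
      then have "k (snd p) = k (fst p)" using clip(1)[OF D, of p] by auto
      then show "norm (f (k (snd p)) - f (k (fst p))) = 0" by simp
    qed
  qed auto
  also have "\<dots> = (\<Sum>p\<in>?m ` ?D. norm (f (snd p) - f (fst p)))"
    by (subst sum.reindex[OF inj]) simp
  also have "\<dots> < e"
  proof (rule \<delta>, unfold interval_families_def, intro CollectI conjI ballI)
    show "finite (?m ` ?D)" using fin by simp
    show "fst p \<le> snd p" if "p \<in> ?m ` ?D" for p using that by auto
    show "{fst p..snd p} \<subseteq> {a..b}" if "p \<in> ?m ` ?D" for p
    proof -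
      obtain q where "p = ?m q" using \<open>p \<in> ?m ` ?D\<close> by blast
      then show ?thesis using clip(2)[of "fst q"] clip(2)[of "snd q"] by auto
    qed
    show "disjoint_family_on (\<lambda>p. {fst p<..<snd p}) (?m ` ?D)"
      unfolding disjoint_family_on_def
    proof (intro ballI impI)
      fix p' q' assume "p' \<in> ?m ` ?D" "q' \<in> ?m ` ?D" "p' \<noteq> q'"
      then obtain p q where pq: "p \<in> ?D" "q \<in> ?D" "p' = ?m p" "q' = ?m q" "p \<noteq> q" by blast
      then have "{fst p<..<snd p} \<inter> {fst q<..<snd q} = {}"
        using dis unfolding disjoint_family_on_def by blast
      moreover have "{k (fst p)<..<k (snd p)} \<subseteq> {fst p<..<snd p}" by (rule sub) (use D pq in auto)
      moreover have "{k (fst q)<..<k (snd q)} \<subseteq> {fst q<..<snd q}" by (rule sub) (use D pq in auto)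
      ultimately have "{k (fst p)<..<k (snd p)} \<inter> {k (fst q)<..<k (snd q)} = {}" by blast
      then show "{fst p'<..<snd p'} \<inter> {fst q'<..<snd q'} = {}" using pq by simp
    qed
    have "(\<Sum>p\<in>?m ` ?D. snd p - fst p) = (\<Sum>p\<in>?D. k (snd p) - k (fst p))"
      by (subst sum.reindex[OF inj]) simp
    also have "\<dots> \<le> (\<Sum>p\<in>?D. snd p - fst p)" using clip(1) D by (intro sum_mono) blast
    also have "\<dots> \<le> (\<Sum>p\<in>D. snd p - fst p)" using fin D by (intro sum_mono2) auto
    finally show "(\<Sum>p\<in>?m ` ?D. snd p - fst p) < \<delta>" using sum by simp
  qed
  finally show ?thesis .
qed

text \<open>An interval may straddle b. Clipping it to \<open>{a..b}\<close> and to
  \<open>{b..c}\<close> splits its increment in two, and neither clipped family has a larger total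
  length, so each half costs at most e/2.\<close>

lemma abs_cont_on_join:
  fixes f :: "real \<Rightarrow> 'a::real_normed_vector"
  assumes f: "abs_cont_on {a..b} f" "abs_cont_on {b..c} f" and abc: "a \<le> b" "b \<le> c"
  shows "abs_cont_on {a..c} f"
  unfolding abs_cont_on_iff
proof (intro allI impI)
  fix e :: real assume "0 < e"
  then have e2: "0 < e / 2" by simp
  obtain \<delta>1 where d1: "0 < \<delta>1" "\<And>D. D \<in> interval_families {a..b} \<delta>1 \<Longrightarrow> (\<Sum>p\<in>D. norm (f (snd p) - f (fst p))) < e / 2"
    using f(1) e2 unfolding abs_cont_on_iff by blast
  obtain \<delta>2 where d2: "0 < \<delta>2" "\<And>D. D \<in> interval_families {b..c} \<delta>2 \<Longrightarrow> (\<Sum>p\<in>D. norm (f (snd p) - f (fst p))) < e / 2"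
    using f(2) e2 unfolding abs_cont_on_iff by blast
  show "\<exists>\<delta>>0. \<forall>D\<in>interval_families {a..c} \<delta>. (\<Sum>p\<in>D. norm (f (snd p) - f (fst p))) < e"
  proof (intro exI[of _ "min \<delta>1 \<delta>2"] conjI ballI)
    fix D :: "(real \<times> real) set"
    assume D: "D \<in> interval_families {a..c} (min \<delta>1 \<delta>2)"
    then have fin: "finite D" and le: "\<And>p. p \<in> D \<Longrightarrow> fst p \<le> snd p"
      and dis: "disjoint_family_on (\<lambda>p. {fst p<..<snd p}) D"
      and s1: "(\<Sum>p\<in>D. snd p - fst p) < \<delta>1" and s2: "(\<Sum>p\<in>D. snd p - fst p) < \<delta>2"
      and ss: "\<And>p. p \<in> D \<Longrightarrow> {fst p..snd p} \<subseteq> {a..c}"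
      by (simp_all add: interval_families_def)
    have ac: "fst p \<in> {a..c} \<and> snd p \<in> {a..c}" if "p \<in> D" for p
      using ss[OF that] le[OF that] by auto
    define k1 where "k1 s = max a (min s b)" for s
    define k2 where "k2 s = min c (max s b)" for s
    have S1: "(\<Sum>p\<in>D. norm (f (k1 (snd p)) - f (k1 (fst p)))) < e / 2"
      by (rule abs_cont_on_clip_sum[OF fin le dis s1 _ _ _ d1(2)]) (use abc in \<open>auto simp: k1_def max_def min_def\<close>)
    have S2: "(\<Sum>p\<in>D. norm (f (k2 (snd p)) - f (k2 (fst p)))) < e / 2"
      by (rule abs_cont_on_clip_sum[OF fin le dis s2 _ _ _ d2(2)]) (use abc in \<open>auto simp: k2_def max_def min_def\<close>)
    have "norm (f (snd p) - f (fst p)) \<le> norm (f (k1 (snd p)) - f (k1 (fst p))) + norm (f (k2 (snd p)) - f (k2 (fst p)))"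
      if p: "p \<in> D" for p
    proof -
      have "f (snd p) - f (fst p) = (f (k1 (snd p)) - f (k1 (fst p))) + (f (k2 (snd p)) - f (k2 (fst p)))"
        using ac[OF p] le[OF p] abc by (cases "snd p \<le> b"; cases "fst p \<le> b") (auto simp: k1_def k2_def max_def min_def)
      then show ?thesis by (metis norm_triangle_ineq)
    qed
    then have "(\<Sum>p\<in>D. norm (f (snd p) - f (fst p))) \<le> (\<Sum>p\<in>D. norm (f (k1 (snd p)) - f (k1 (fst p))) + norm (f (k2 (snd p)) - f (k2 (fst p))))"
      by (intro sum_mono)
    then show "(\<Sum>p\<in>D. norm (f (snd p) - f (fst p))) < e" using S1 S2 by (simp add: sum.distrib)
  qed (use d1 d2 in auto)
qed

lemma abs_cont_on_cong:
  assumes "abs_cont_on I f" "\<And>x. x \<in> I \<Longrightarrow> f x = g x"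
  shows "abs_cont_on I g"
proof -
  have "(\<Sum>p\<in>D. norm (f (snd p) - f (fst p))) = (\<Sum>p\<in>D. norm (g (snd p) - g (fst p)))" if "D \<in> interval_families I \<delta>" for D \<delta>
  proof (rule sum.cong[OF refl])
    fix p assume "p \<in> D"
    then have "fst p \<le> snd p" "{fst p..snd p} \<subseteq> I" using that unfolding interval_families_def by blast+
    then have "fst p \<in> I" "snd p \<in> I" by auto
    then show "norm (f (snd p) - f (fst p)) = norm (g (snd p) - g (fst p))" using assms(2) by simp
  qed
  then show ?thesis using assms(1) unfolding abs_cont_on_iff by (metis (no_types, lifting))
qed

text \<open>The two endpoints form a null set. At the remaining points the derivative within the
  closed interval is a two-sided one, to which the chain rule applies.\<close>

lemma AE_lebesgue_on_Icc_iff: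
  "(AE s in lebesgue_on {a..b::real}. P s) \<longleftrightarrow> (AE s in lebesgue. s \<in> {a<..<b} \<longrightarrow> P s)"
proof -
  have "{a,b} \<in> null_sets lebesgue" using negligible_finite[of "{a,b}"] by (simp add: negligible_iff_null_sets)
  then have ab: "AE s in lebesgue. s \<notin> {a,b}" by (rule AE_not_in)
  have "(AE s in lebesgue_on {a..b}. P s) \<longleftrightarrow> (AE s in lebesgue. s \<in> {a..b} \<longrightarrow> P s)"
    by (subst AE_restrict_space_iff) auto
  also have "\<dots> \<longleftrightarrow> (AE s in lebesgue. s \<in> {a<..<b} \<longrightarrow> P s)"
  proof
    assume "AE s in lebesgue. s \<in> {a..b} \<longrightarrow> P s"
    then show "AE s in lebesgue. s \<in> {a<..<b} \<longrightarrow> P s" by eventually_elim auto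
  next
    assume "AE s in lebesgue. s \<in> {a<..<b} \<longrightarrow> P s"
    with ab show "AE s in lebesgue. s \<in> {a..b} \<longrightarrow> P s" by eventually_elim auto
  qed
  finally show ?thesis .
qed

section \<open>Subunit curves and the metric axioms\<close>

lemma subunit_curve_reverse:
  assumes c: "subunit_curve \<Omega>0 X \<tau> \<gamma>"
  shows "subunit_curve \<Omega>0 X \<tau> (\<lambda>s. \<gamma> (\<tau> - s))"
proof -
  obtain b where b: "b \<in> borel_measurable (lebesgue_on {0..\<tau>})" "\<And>s. s \<in> {0..\<tau>} \<Longrightarrow> (\<Sum>j\<in>UNIV. (b s $ j)\<^sup>2) \<le> 1"
    "AE s in lebesgue_on {0..\<tau>}. (\<gamma> has_vector_derivative (\<Sum>j\<in>UNIV. b s $ j *\<^sub>R X j (\<gamma> s))) (at s within {0..\<tau>})"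
    using c unfolding subunit_curve_def by blast
  have bm: "(\<lambda>x. indicator {0..\<tau>} x *\<^sub>R b x) \<in> borel_measurable lebesgue"
    using b(1) by (subst (asm) borel_measurable_restrict_space_iff) auto
  show ?thesis
    unfolding subunit_curve_def
  proof (intro conjI exI[of _ "\<lambda>s. - b (\<tau> - s)"])
    show "abs_cont_on {0..\<tau>} (\<lambda>s. \<gamma> (\<tau> - s))"
      using abs_cont_on_reflect[of 0 \<tau> \<gamma> \<tau>] c by (simp add: subunit_curve_def)
    show "(\<lambda>s. \<gamma> (\<tau> - s)) ` {0..\<tau>} \<subseteq> \<Omega>0" using c by (auto simp: subunit_curve_def image_subset_iff)
    have "(\<lambda>x. - (indicator {0..\<tau>} (\<tau> + (-1) * x) *\<^sub>R b (\<tau> + (-1) * x))) \<in> borel_measurable lebesgue"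
      using measurable_compose[OF real_affine_lebesgue_measurable bm, of "-1" \<tau>] by (intro borel_measurable_uminus) simp
    moreover have "(\<lambda>x. - (indicator {0..\<tau>} (\<tau> + (-1) * x) *\<^sub>R b (\<tau> + (-1) * x))) = (\<lambda>x. indicator {0..\<tau>} x *\<^sub>R (- b (\<tau> - x)))"
      by (auto simp: fun_eq_iff split: split_indicator)
    ultimately have "(\<lambda>x. indicator {0..\<tau>} x *\<^sub>R (- b (\<tau> - x))) \<in> borel_measurable lebesgue" by (simp only:)
    then show "(\<lambda>s. - b (\<tau> - s)) \<in> borel_measurable (lebesgue_on {0..\<tau>})"
      by (subst borel_measurable_restrict_space_iff) auto
    show "\<forall>s\<in>{0..\<tau>}. (\<Sum>j\<in>UNIV. ((- b (\<tau> - s)) $ j)\<^sup>2) \<le> 1" using b(2) by auto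
    have "AE s in lebesgue. s \<in> {0<..<\<tau>} \<longrightarrow> (\<gamma> has_vector_derivative (\<Sum>j\<in>UNIV. b s $ j *\<^sub>R X j (\<gamma> s))) (at s within {0..\<tau>})"
      using b(3) by (simp only: AE_lebesgue_on_Icc_iff)
    then have "AE s in lebesgue. \<tau> + (-1) * s \<in> {0<..<\<tau>} \<longrightarrow> (\<gamma> has_vector_derivative
        (\<Sum>j\<in>UNIV. b (\<tau> + (-1) * s) $ j *\<^sub>R X j (\<gamma> (\<tau> + (-1) * s)))) (at (\<tau> + (-1) * s) within {0..\<tau>})"
      by (rule AE_lebesgue_real_affine[rotated]) simp
    then show "AE s in lebesgue_on {0..\<tau>}. ((\<lambda>s. \<gamma> (\<tau> - s)) has_vector_derivative
        (\<Sum>j\<in>UNIV. (- b (\<tau> - s)) $ j *\<^sub>R X j (\<gamma> (\<tau> - s)))) (at s within {0..\<tau>})"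
      unfolding AE_lebesgue_on_Icc_iff
    proof eventually_elim
      case (elim s)
      show ?case
      proof
        assume s: "s \<in> {0<..<\<tau>}"
        let ?v = "\<Sum>j\<in>UNIV. b (\<tau> - s) $ j *\<^sub>R X j (\<gamma> (\<tau> - s))"
        have "(\<gamma> has_vector_derivative ?v) (at (\<tau> - s) within {0..\<tau>})" using elim s by simp
        then have "(\<gamma> has_vector_derivative ?v) (at (\<tau> - s))" using s by (subst (asm) at_within_Icc_at) auto
        moreover have "((\<lambda>s. \<tau> - s) has_vector_derivative (-1)) (at s)" by (auto intro!: derivative_eq_intros)
        ultimately have "((\<lambda>s. \<gamma> (\<tau> - s)) has_vector_derivative (- ?v)) (at s)"
          using vector_diff_chain_at[of "\<lambda>s. \<tau> - s" "-1" s \<gamma> ?v] by (simp add: o_def)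
        then have "((\<lambda>s. \<gamma> (\<tau> - s)) has_vector_derivative (- ?v)) (at s within {0..\<tau>})" by (rule has_vector_derivative_at_within)
        then show "((\<lambda>s. \<gamma> (\<tau> - s)) has_vector_derivative
          (\<Sum>j\<in>UNIV. (- b (\<tau> - s)) $ j *\<^sub>R X j (\<gamma> (\<tau> - s)))) (at s within {0..\<tau>})" by (simp add: sum_negf)
      qed
    qed
  qed
qed

lemma subunit_curve_join:
  assumes c1: "subunit_curve \<Omega>0 X \<tau>1 \<gamma>1" and c2: "subunit_curve \<Omega>0 X \<tau>2 \<gamma>2" and t: "0 \<le> \<tau>1" "0 \<le> \<tau>2" and j: "\<gamma>1 \<tau>1 = \<gamma>2 0"
  shows "subunit_curve \<Omega>0 X (\<tau>1 + \<tau>2) (\<lambda>s. if s \<le> \<tau>1 then \<gamma>1 s else \<gamma>2 (s - \<tau>1))" (is "subunit_curve _ _ _ ?\<gamma>")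
proof -
  obtain b1 where b1: "b1 \<in> borel_measurable (lebesgue_on {0..\<tau>1})" "\<And>s. s \<in> {0..\<tau>1} \<Longrightarrow> (\<Sum>j\<in>UNIV. (b1 s $ j)\<^sup>2) \<le> 1"
    "AE s in lebesgue_on {0..\<tau>1}. (\<gamma>1 has_vector_derivative (\<Sum>j\<in>UNIV. b1 s $ j *\<^sub>R X j (\<gamma>1 s))) (at s within {0..\<tau>1})"
    using c1 unfolding subunit_curve_def by blast
  obtain b2 where b2: "b2 \<in> borel_measurable (lebesgue_on {0..\<tau>2})" "\<And>s. s \<in> {0..\<tau>2} \<Longrightarrow> (\<Sum>j\<in>UNIV. (b2 s $ j)\<^sup>2) \<le> 1"
    "AE s in lebesgue_on {0..\<tau>2}. (\<gamma>2 has_vector_derivative (\<Sum>j\<in>UNIV. b2 s $ j *\<^sub>R X j (\<gamma>2 s))) (at s within {0..\<tau>2})"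
    using c2 unfolding subunit_curve_def by blast
  let ?b = "\<lambda>s. if s \<le> \<tau>1 then b1 s else b2 (s - \<tau>1)"
  have m1: "(\<lambda>x. indicator {0..\<tau>1} x *\<^sub>R b1 x) \<in> borel_measurable lebesgue"
    using b1(1) by (subst (asm) borel_measurable_restrict_space_iff) auto
  have m2: "(\<lambda>x. indicator {0..\<tau>2} x *\<^sub>R b2 x) \<in> borel_measurable lebesgue"
    using b2(1) by (subst (asm) borel_measurable_restrict_space_iff) auto
  have m2': "(\<lambda>x. indicator {0..\<tau>2} (-\<tau>1 + 1 * x) *\<^sub>R b2 (-\<tau>1 + 1 * x)) \<in> borel_measurable lebesgue"
    using measurable_compose[OF real_affine_lebesgue_measurable m2, of 1 "-\<tau>1"] by simp
  show ?thesis
    unfolding subunit_curve_def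
  proof (intro conjI exI[of _ ?b])
    show "abs_cont_on {0..\<tau>1 + \<tau>2} ?\<gamma>"
    proof (rule abs_cont_on_join[of 0 \<tau>1])
      show "abs_cont_on {0..\<tau>1} ?\<gamma>"
        by (rule abs_cont_on_cong[of _ \<gamma>1]) (use c1 in \<open>auto simp: subunit_curve_def\<close>)
      have "abs_cont_on {0 + \<tau>1..\<tau>2 + \<tau>1} (\<lambda>s. \<gamma>2 (s - \<tau>1))"
        by (rule abs_cont_on_shift) (use c2 in \<open>auto simp: subunit_curve_def\<close>)
      then have "abs_cont_on {\<tau>1..\<tau>1 + \<tau>2} (\<lambda>s. \<gamma>2 (s - \<tau>1))" by (simp add: add.commute)
      then show "abs_cont_on {\<tau>1..\<tau>1 + \<tau>2} ?\<gamma>"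
        by (rule abs_cont_on_cong) (use j in \<open>auto split: if_splits\<close>)
    qed (use t in auto)
    show "?\<gamma> ` {0..\<tau>1 + \<tau>2} \<subseteq> \<Omega>0" using c1 c2 by (auto simp: subunit_curve_def image_subset_iff)
    have eq: "indicator {0..\<tau>1 + \<tau>2} x *\<^sub>R ?b x =
        indicator {..\<tau>1} x *\<^sub>R (indicator {0..\<tau>1} x *\<^sub>R b1 x) + indicator {\<tau>1<..} x *\<^sub>R (indicator {0..\<tau>2} (-\<tau>1 + 1 * x) *\<^sub>R b2 (-\<tau>1 + 1 * x))" for x
      using t by (auto split: split_indicator)
    have "(\<lambda>x. indicator {0..\<tau>1 + \<tau>2} x *\<^sub>R ?b x) \<in> borel_measurable lebesgue"
      unfolding eq by (intro borel_measurable_add borel_measurable_scaleR[OF _ m1] borel_measurable_scaleR[OF _ m2'] borel_measurable_indicator) auto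
    then show "?b \<in> borel_measurable (lebesgue_on {0..\<tau>1 + \<tau>2})"
      by (subst borel_measurable_restrict_space_iff) auto
    show "\<forall>s\<in>{0..\<tau>1 + \<tau>2}. (\<Sum>j\<in>UNIV. (?b s $ j)\<^sup>2) \<le> 1"
      using b1(2) b2(2) by auto
    have A1: "AE s in lebesgue. s \<in> {0<..<\<tau>1} \<longrightarrow> (\<gamma>1 has_vector_derivative (\<Sum>j\<in>UNIV. b1 s $ j *\<^sub>R X j (\<gamma>1 s))) (at s within {0..\<tau>1})"
      using b1(3) by (simp only: AE_lebesgue_on_Icc_iff)
    have A2: "AE s in lebesgue. s \<in> {0<..<\<tau>2} \<longrightarrow> (\<gamma>2 has_vector_derivative (\<Sum>j\<in>UNIV. b2 s $ j *\<^sub>R X j (\<gamma>2 s))) (at s within {0..\<tau>2})"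
      using b2(3) by (simp only: AE_lebesgue_on_Icc_iff)
    have A2': "AE s in lebesgue. -\<tau>1 + 1 * s \<in> {0<..<\<tau>2} \<longrightarrow> (\<gamma>2 has_vector_derivative
        (\<Sum>j\<in>UNIV. b2 (-\<tau>1 + 1 * s) $ j *\<^sub>R X j (\<gamma>2 (-\<tau>1 + 1 * s)))) (at (-\<tau>1 + 1 * s) within {0..\<tau>2})"
      by (rule AE_lebesgue_real_affine[OF _ A2]) simp
    \<comment> \<open>At the junction the one-sided velocities may differ; it is removed as a null
      set.\<close>
    have "{\<tau>1} \<in> null_sets lebesgue" using negligible_sing by (simp add: negligible_iff_null_sets)
    then have A3: "AE s in lebesgue. s \<notin> {\<tau>1}" by (rule AE_not_in)
    show "AE s in lebesgue_on {0..\<tau>1 + \<tau>2}. (?\<gamma> has_vector_derivative (\<Sum>j\<in>UNIV. ?b s $ j *\<^sub>R X j (?\<gamma> s))) (at s within {0..\<tau>1 + \<tau>2})"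
      unfolding AE_lebesgue_on_Icc_iff using A1 A2' A3
    proof eventually_elim
      case (elim s)
      show ?case
      proof
        assume s: "s \<in> {0<..<\<tau>1 + \<tau>2}"
        have "(?\<gamma> has_vector_derivative (\<Sum>j\<in>UNIV. ?b s $ j *\<^sub>R X j (?\<gamma> s))) (at s)"
        proof (cases "s < \<tau>1")
          case True
          then have "(\<gamma>1 has_vector_derivative (\<Sum>j\<in>UNIV. b1 s $ j *\<^sub>R X j (\<gamma>1 s))) (at s within {0..\<tau>1})"
            using elim(1) s by simp
          then have "(\<gamma>1 has_vector_derivative (\<Sum>j\<in>UNIV. b1 s $ j *\<^sub>R X j (\<gamma>1 s))) (at s)"
            using s True by (subst (asm) at_within_Icc_at) auto
          then have "(?\<gamma> has_vector_derivative (\<Sum>j\<in>UNIV. b1 s $ j *\<^sub>R X j (\<gamma>1 s))) (at s)"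
            by (rule has_vector_derivative_transform_within_open[of _ _ _ "{..<\<tau>1}"]) (use True in auto)
          then show ?thesis using True by simp
        next
          case False
          then have st: "\<tau>1 < s" using elim(3) by simp
          let ?v = "\<Sum>j\<in>UNIV. b2 (s - \<tau>1) $ j *\<^sub>R X j (\<gamma>2 (s - \<tau>1))"
          have "(\<gamma>2 has_vector_derivative ?v) (at (s - \<tau>1) within {0..\<tau>2})"
            using elim(2) s st by simp
          then have "(\<gamma>2 has_vector_derivative ?v) (at (s - \<tau>1))"
            using s st by (subst (asm) at_within_Icc_at) auto
          moreover have "((\<lambda>s. s - \<tau>1) has_vector_derivative 1) (at s)" by (auto intro!: derivative_eq_intros)
          ultimately have "((\<lambda>s. \<gamma>2 (s - \<tau>1)) has_vector_derivative ?v) (at s)"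
            using vector_diff_chain_at[of "\<lambda>s. s - \<tau>1" 1 s \<gamma>2 ?v] by (simp add: o_def)
          then have "(?\<gamma> has_vector_derivative ?v) (at s)"
            by (rule has_vector_derivative_transform_within_open[of _ _ _ "{\<tau>1<..}"]) (use st in auto)
          then show ?thesis using st by simp
        qed
        then show "(?\<gamma> has_vector_derivative (\<Sum>j\<in>UNIV. ?b s $ j *\<^sub>R X j (?\<gamma> s))) (at s within {0..\<tau>1 + \<tau>2})"
          by (rule has_vector_derivative_at_within)
      qed
    qed
  qed
qed

lemma cc_dist_commute: "cc_dist \<Omega>0 X x y = cc_dist \<Omega>0 X y x"
proof -
  have "cc_dist \<Omega>0 X x y \<le> cc_dist \<Omega>0 X y x" for x y
    unfolding cc_dist_def
  proof (rule Inf_superset_mono, safe)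
    fix \<tau> \<gamma> assume "0 \<le> \<tau>" "subunit_curve \<Omega>0 X \<tau> \<gamma>"
    then show "\<exists>\<tau>'. ennreal \<tau> = ennreal \<tau>' \<and> 0 \<le> \<tau>' \<and> (\<exists>\<gamma>'. subunit_curve \<Omega>0 X \<tau>' \<gamma>' \<and> \<gamma>' 0 = \<gamma> \<tau> \<and> \<gamma>' \<tau>' = \<gamma> 0)"
      using subunit_curve_reverse by (intro exI[of _ \<tau>] conjI exI[of _ "\<lambda>s. \<gamma> (\<tau> - s)"]) auto
  qed
  then show ?thesis by (intro antisym)
qed

lemma cc_dist_triangle: "cc_dist \<Omega>0 X x z \<le> cc_dist \<Omega>0 X x y + cc_dist \<Omega>0 X y z"
proof (cases "cc_dist \<Omega>0 X x y = \<infinity> \<or> cc_dist \<Omega>0 X y z = \<infinity>")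
  case False
  show ?thesis
  proof (rule ennreal_le_epsilon)
    fix e :: real assume e: "0 < e"
    \<comment> \<open>The infimum in the distance may not be attained, so curves of almost minimal
      length are joined.\<close>
    have near: "\<exists>\<tau>. 0 \<le> \<tau> \<and> (\<exists>\<gamma>. subunit_curve \<Omega>0 X \<tau> \<gamma> \<and> \<gamma> 0 = a \<and> \<gamma> \<tau> = b) \<and> ennreal \<tau> \<le> cc_dist \<Omega>0 X a b + ennreal (e/2)"
      if "cc_dist \<Omega>0 X a b \<noteq> \<infinity>" for a b
    proof -
      have "cc_dist \<Omega>0 X a b < cc_dist \<Omega>0 X a b + ennreal (e/2)"
        using that e by (cases "cc_dist \<Omega>0 X a b") (auto simp: ennreal_plus[symmetric] ennreal_less_iff simp del: ennreal_plus)
      then obtain w where "w \<in> {ennreal \<tau> |\<tau>. 0 \<le> \<tau> \<and> (\<exists>\<gamma>. subunit_curve \<Omega>0 X \<tau> \<gamma> \<and> \<gamma> 0 = a \<and> \<gamma> \<tau> = b)}"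
          "w < cc_dist \<Omega>0 X a b + ennreal (e/2)"
        by (subst (asm) (1) cc_dist_def) (auto simp: Inf_less_iff)
      then show ?thesis by (auto intro: less_imp_le)
    qed
    obtain \<tau>1 \<gamma>1 where 1: "0 \<le> \<tau>1" "subunit_curve \<Omega>0 X \<tau>1 \<gamma>1" "\<gamma>1 0 = x" "\<gamma>1 \<tau>1 = y" "ennreal \<tau>1 \<le> cc_dist \<Omega>0 X x y + ennreal (e/2)"
      using near[of x y] False by blast
    obtain \<tau>2 \<gamma>2 where 2: "0 \<le> \<tau>2" "subunit_curve \<Omega>0 X \<tau>2 \<gamma>2" "\<gamma>2 0 = y" "\<gamma>2 \<tau>2 = z" "ennreal \<tau>2 \<le> cc_dist \<Omega>0 X y z + ennreal (e/2)"
      using near[of y z] False by blast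
    let ?\<gamma> = "\<lambda>s. if s \<le> \<tau>1 then \<gamma>1 s else \<gamma>2 (s - \<tau>1)"
    have "subunit_curve \<Omega>0 X (\<tau>1 + \<tau>2) ?\<gamma>" using 1 2 by (intro subunit_curve_join) auto
    moreover have "?\<gamma> 0 = x" "?\<gamma> (\<tau>1 + \<tau>2) = z" using 1 2 by auto
    ultimately have "cc_dist \<Omega>0 X x z \<le> ennreal (\<tau>1 + \<tau>2)"
      unfolding cc_dist_def using 1(1) 2(1) by (intro Inf_lower) (auto intro!: exI[of _ "\<tau>1 + \<tau>2"] exI[of _ ?\<gamma>])
    also have "\<dots> = ennreal \<tau>1 + ennreal \<tau>2" using 1 2 by simp
    also have "\<dots> \<le> (cc_dist \<Omega>0 X x y + ennreal (e/2)) + (cc_dist \<Omega>0 X y z + ennreal (e/2))" using 1 2 by (intro add_mono)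
    also have "\<dots> = cc_dist \<Omega>0 X x y + cc_dist \<Omega>0 X y z + (ennreal (e/2) + ennreal (e/2))" by (simp add: ac_simps)
    also have "ennreal (e/2) + ennreal (e/2) = ennreal e" using e by (simp add: ennreal_plus[symmetric] del: ennreal_plus)
    finally show "cc_dist \<Omega>0 X x z \<le> cc_dist \<Omega>0 X x y + cc_dist \<Omega>0 X y z + ennreal e" .
  qed
qed (auto simp: top_add add_top)

lemma cc_dist_self: "x \<in> \<Omega>0 \<Longrightarrow> cc_dist \<Omega>0 X x x = 0"
proof -
  assume x: "x \<in> \<Omega>0"
  have "subunit_curve \<Omega>0 X 0 (\<lambda>_. x)"
    unfolding subunit_curve_def
  proof (intro conjI exI[of _ "\<lambda>_. 0"])
    show "abs_cont_on {0..0} (\<lambda>_. x)" unfolding abs_cont_on_def by (auto intro: exI[of _ 1])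
    show "AE s in lebesgue_on {0..0}. ((\<lambda>_. x) has_vector_derivative (\<Sum>j\<in>UNIV. (0::real^'b) $ j *\<^sub>R X j x)) (at s within {0..0})"
      by simp
  qed (use x in auto)
  then have "cc_dist \<Omega>0 X x x \<le> ennreal 0"
    unfolding cc_dist_def by (intro Inf_lower) (auto intro!: exI[of _ 0] exI[of _ "\<lambda>_. x"])
  then show ?thesis by simp
qed

section \<open>The kernel of the representation formula\<close>

text \<open>Volumes may be infinite: an infinite a has inverse 0, and an infinite b forces a to be
  infinite.\<close>

lemma ennreal_inverse_le:
  fixes a b :: ennreal
  assumes "b \<le> ennreal c * a" "0 < c" "a \<noteq> 0" "b \<noteq> 0"
  shows "inverse a \<le> ennreal c * inverse b"
proof (cases a)
  case (real a')
  then have a': "0 < a'" using assms(3) by (cases "a' = 0") auto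
  show ?thesis
  proof (cases b)
    case (real b')
    then have b': "0 < b'" using assms(4) by (cases "b' = 0") auto
    have "b' \<le> c * a'" using assms(1,2) a' b' real \<open>a = ennreal a'\<close> by (simp add: ennreal_mult[symmetric] ennreal_le_iff)
    then have "inverse a' \<le> c * inverse b'" using a' b' by (simp add: field_simps)
    then show ?thesis using real \<open>a = ennreal a'\<close> a' b' assms(2) by (simp add: inverse_ennreal ennreal_mult'[symmetric] ennreal_leI)
  next
    case top
    have "ennreal c * ennreal a' < top" by (simp add: ennreal_mult_less_top)
    then show ?thesis using assms(1) real top by simp
  qed
qed simp

lemma ennreal_inverse_antimono:
  fixes a b :: ennreal
  assumes "b \<le> a"
  shows "inverse a \<le> inverse b"
proof (cases "b = 0")
  case False
  then have "a \<noteq> 0" using assms by auto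
  then show ?thesis using ennreal_inverse_le[of b 1 a] assms False by simp
qed simp

text \<open>The degenerate divisors do no harm: b = 0 forces a = 0 and 0/0 = 0, while every quotient
  by infinity is 0.\<close>

lemma ennreal_divide_le_of_le_mult:
  fixes a b :: ennreal
  assumes "a \<le> ennreal c * b" "0 < c"
  shows "a / b \<le> ennreal c"
proof (cases "b = 0 \<or> b = \<infinity>")
  case True
  then show ?thesis using assms by (auto simp: top_unique)
next
  case False
  have "a / b \<le> ennreal c * b / b" by (rule divide_right_mono_ennreal) fact
  also have "\<dots> = ennreal c" using False by (simp add: ennreal_mult_divide_eq less_top[symmetric] mult_divide_eq_ennreal)
  finally show ?thesis .
qed

text \<open>Locates a distance in a dyadic shell; n is the least exponent for which the lower bound
  holds.\<close>

lemma dyadic_exists: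
  fixes \<delta> R :: real
  assumes "0 < \<delta>" "\<delta> < R"
  obtains n where "R / 2 ^ Suc n \<le> \<delta>" "\<delta> < R / 2 ^ n"
proof -
  obtain m where "R / \<delta> < 2 ^ m" using real_arch_pow[of 2 "R / \<delta>"] by auto
  then have "R / 2 ^ m \<le> \<delta>" using assms by (simp add: field_simps)
  then have m: "R / 2 ^ Suc m \<le> \<delta>" using assms by (simp add: field_simps)
  define n where "n = (LEAST n. R / 2 ^ Suc n \<le> \<delta>)"
  have 1: "R / 2 ^ Suc n \<le> \<delta>" unfolding n_def by (rule LeastI[of "\<lambda>n. R / 2 ^ Suc n \<le> \<delta>", OF m])
  have 2: "\<delta> < R / 2 ^ n"
  proof (cases n)
    case (Suc k)
    then have "\<not> R / 2 ^ Suc k \<le> \<delta>" using not_less_Least[of k "\<lambda>n. R / 2 ^ Suc n \<le> \<delta>"] by (simp add: n_def)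
    then show ?thesis using Suc by simp
  qed (use assms in simp)
  show ?thesis using that 1 2 .
qed

locale cc_space = lipschitz_fields +
  assumes H1: "hyp_H1 \<Omega>0 X" and H2: "hyp_H2 \<Omega>0 X" and H3: "hyp_H3 \<Omega>0 X"
begin

abbreviation d where "d \<equiv> cc_dist \<Omega>0 X"
abbreviation B where "B \<equiv> cc_ball \<Omega>0 X"

text \<open>The kernel of \<^const>\<open>hyp_H3\<close>; it vanishes where \<open>d x y = 0\<close>, since \<open>0 / 0 = 0\<close>.\<close>

definition ker :: "real^'a \<Rightarrow> real^'a \<Rightarrow> ennreal" where
  "ker x y = (if x \<in> \<Omega>0 \<and> y \<in> \<Omega>0 then d x y / emeasure lborel (B x (d x y)) else 0)"

lemma d_finite: "x \<in> \<Omega>0 \<Longrightarrow> y \<in> \<Omega>0 \<Longrightarrow> d x y < \<infinity>"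
  using H1 by (auto simp: hyp_H1_def)

lemma d_continuous2: "continuous_on (\<Omega>0 \<times> \<Omega>0) (\<lambda>p. d (fst p) (snd p))"
  using H1 by (simp add: hyp_H1_def case_prod_beta')

lemma d_continuous: "x \<in> \<Omega>0 \<Longrightarrow> continuous_on \<Omega>0 (d x)"
  by (rule continuous_on_compose2[OF d_continuous2, of _ "\<lambda>y. (x, y)", simplified]) (auto intro!: continuous_intros)

lemma open_B: "x \<in> \<Omega>0 \<Longrightarrow> open (B x r)"
proof -
  assume x: "x \<in> \<Omega>0"
  have "open (d x -` {..<r} \<inter> \<Omega>0)"
    by (rule continuous_on_open_vimage[OF open_\<Omega>0, THEN iffD1, rule_format]) (simp_all add: d_continuous x)
  moreover have "d x -` {..<r} \<inter> \<Omega>0 = B x r" by (auto simp: cc_ball_def)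
  ultimately show ?thesis by simp
qed

lemma B_subset: "B x r \<subseteq> \<Omega>0" by (auto simp: cc_ball_def)

lemma center_in_B: "x \<in> \<Omega>0 \<Longrightarrow> 0 < r \<Longrightarrow> x \<in> B x r"
  by (simp add: cc_ball_def cc_dist_self)

lemma B_mono: "r \<le> s \<Longrightarrow> B x r \<subseteq> B x s" by (auto simp: cc_ball_def)

lemma emeasure_B_mono: "x \<in> \<Omega>0 \<Longrightarrow> r \<le> s \<Longrightarrow> emeasure lborel (B x r) \<le> emeasure lborel (B x s)"
  using open_B[of x s] by (intro emeasure_mono B_mono) auto

lemma emeasure_B_pos: "x \<in> \<Omega>0 \<Longrightarrow> 0 < r \<Longrightarrow> emeasure lborel (B x r) \<noteq> 0"
proof
  assume x: "x \<in> \<Omega>0" "0 < r" and z: "emeasure lborel (B x r) = 0"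
  have "B x r \<in> null_sets lborel" using z open_B[OF x(1)] by (intro null_setsI) auto
  then have "negligible (B x r)"
    unfolding negligible_iff_null_sets by (rule null_sets_completionI)
  moreover have "B x r \<noteq> {}" using center_in_B[OF x] by blast
  ultimately show False using open_not_negligible[OF open_B[OF x(1)]] by blast
qed

lemma emeasure_lebesgue_B: "x \<in> \<Omega>0 \<Longrightarrow> emeasure lebesgue (B x r) = emeasure lborel (B x r)"
  using open_B by simp

lemma B_swap:
  assumes x: "x \<in> \<Omega>0" and y: "y \<in> \<Omega>0"
  shows "B x (d x y) \<subseteq> B y (2 * d x y)"
proof
  fix z assume z: "z \<in> B x (d x y)"
  have "d y z \<le> d y x + d x z" by (rule cc_dist_triangle)
  also have "d y x = d x y" by (rule cc_dist_commute)
  also have "d x y + d x z < d x y + d x y"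
    using z d_finite[OF x y] by (auto simp: cc_ball_def ennreal_add_left_cancel_less)
  finally show "z \<in> B y (2 * d x y)" using z by (auto simp: cc_ball_def mult_2)
qed

lemma dist_measurable: "(\<lambda>p. if p \<in> \<Omega>0 \<times> \<Omega>0 then d (fst p) (snd p) else 0) \<in> borel_measurable borel"
  using open_\<Omega>0 by (intro borel_measurable_continuous_on_if d_continuous2) (auto intro!: borel_open open_Times)

text \<open>The distance is known to be continuous on pairs from \<open>\<Omega>0\<close> only. Its
  extension by 0 is Borel on the whole product, so measurability of derived functions can be
  computed from it.\<close>

definition dd where "dd x y = (if x \<in> \<Omega>0 \<and> y \<in> \<Omega>0 then d x y else 0)"

lemma dd_measurable [measurable]: "(\<lambda>p. dd (fst p) (snd p)) \<in> borel_measurable (borel \<Otimes>\<^sub>M borel)"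
  using dist_measurable by (simp add: dd_def borel_prod mem_Times_iff)

lemma \<Omega>0_borel [measurable]: "\<Omega>0 \<in> sets borel" using open_\<Omega>0 by simp

lemma dd_measurable' [measurable (raw)]:
  assumes [measurable]: "f \<in> borel_measurable M" "g \<in> borel_measurable M"
  shows "(\<lambda>x. dd (f x) (g x)) \<in> borel_measurable M"
proof -
  have "(\<lambda>x. (f x, g x)) \<in> M \<rightarrow>\<^sub>M borel \<Otimes>\<^sub>M borel" by measurable
  from measurable_compose[OF this dd_measurable] show ?thesis by simp
qed

text \<open>The volume is the integral over z of a jointly measurable indicator, so measurability in
  centre and radius together comes from Tonelli's theorem. The factor
  \<open>indicator \<Omega>0\<close> discards centres outside \<open>\<Omega>0\<close>, about whose
  balls nothing is known.\<close>

lemma emeasure_ball_measurable [measurable (raw)]: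
  assumes [measurable]: "f \<in> borel_measurable M" "r \<in> borel_measurable M"
  shows "(\<lambda>x. emeasure lborel (B (f x) (r x)) * indicator \<Omega>0 (f x)) \<in> borel_measurable M"
proof -
  have "(\<lambda>x. \<integral>\<^sup>+z. indicator \<Omega>0 (f x) * indicator {q. snd q \<in> \<Omega>0 \<and> dd (f (fst q)) (snd q) < r (fst q)} (x, z) \<partial>lborel) \<in> borel_measurable M"
  proof (rule lborel.borel_measurable_nn_integral)
    have "{q \<in> space (M \<Otimes>\<^sub>M lborel). snd q \<in> \<Omega>0 \<and> dd (f (fst q)) (snd q) < r (fst q)} \<in> sets (M \<Otimes>\<^sub>M lborel)"
      by measurable
    then have "(\<lambda>q. indicator \<Omega>0 (f (fst q)) * indicator {q \<in> space (M \<Otimes>\<^sub>M lborel). snd q \<in> \<Omega>0 \<and> dd (f (fst q)) (snd q) < r (fst q)} q :: ennreal)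
      \<in> borel_measurable (M \<Otimes>\<^sub>M lborel)" by measurable
    then show "(\<lambda>(x, z). indicator \<Omega>0 (f x) * indicator {q. snd q \<in> \<Omega>0 \<and> dd (f (fst q)) (snd q) < r (fst q)} (x, z) :: ennreal)
      \<in> borel_measurable (M \<Otimes>\<^sub>M lborel)"
      by (rule measurable_cong[THEN iffD1, rotated]) (auto simp: case_prod_beta split: split_indicator)
  qed
  moreover have "(\<integral>\<^sup>+z. indicator \<Omega>0 (f x) * indicator {q. snd q \<in> \<Omega>0 \<and> dd (f (fst q)) (snd q) < r (fst q)} (x, z) \<partial>lborel)
     = emeasure lborel (B (f x) (r x)) * indicator \<Omega>0 (f x)" for x
  proof (cases "f x \<in> \<Omega>0")
    case True
    then have "(\<integral>\<^sup>+z. indicator \<Omega>0 (f x) * indicator {q. snd q \<in> \<Omega>0 \<and> dd (f (fst q)) (snd q) < r (fst q)} (x, z) \<partial>lborel)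
      = (\<integral>\<^sup>+z. indicator (B (f x) (r x)) z \<partial>lborel)"
      by (intro nn_integral_cong) (auto simp: cc_ball_def dd_def split: split_indicator)
    then show ?thesis using True open_B[OF True] by simp
  qed simp
  ultimately show ?thesis by simp
qed

lemma ker_measurable [measurable (raw)]:
  assumes [measurable]: "f \<in> borel_measurable M" "g \<in> borel_measurable M"
  shows "(\<lambda>x. ker (f x) (g x)) \<in> borel_measurable M"
proof -
  have "ker x y = indicator \<Omega>0 y * (dd x y / (emeasure lborel (B x (dd x y)) * indicator \<Omega>0 x))" for x y
    by (auto simp: ker_def dd_def)
  then show ?thesis by simp
qed

lemma ball_indicator_measurable [measurable (raw)]:
  assumes [measurable]: "f \<in> borel_measurable M" "g \<in> borel_measurable M"
  shows "(\<lambda>x. indicator {y\<in>\<Omega>0. f x \<in> \<Omega>0 \<and> d (f x) y < r} (g x) :: ennreal) \<in> borel_measurable M"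
proof -
  have "(\<lambda>x. indicator {x\<in>space M. f x \<in> \<Omega>0 \<and> g x \<in> \<Omega>0 \<and> dd (f x) (g x) < r} x :: ennreal) \<in> borel_measurable M"
    by measurable
  then show ?thesis
    by (rule measurable_cong[THEN iffD1, rotated]) (auto simp: dd_def split: split_indicator)
qed

section \<open>Integrals of the kernel\<close>

lemma doubling:
  assumes "compact K" "K \<subseteq> \<Omega>0"
  obtains rK CK where "0 < rK" "0 < CK" 
    "\<And>x r. x \<in> K \<Longrightarrow> 0 < r \<Longrightarrow> r < rK \<Longrightarrow> emeasure lborel (B x (ennreal (2 * r))) \<le> ennreal CK * emeasure lborel (B x (ennreal r))"
proof -
  obtain rK CK where "0 < rK" "0 < CK" and *: "\<forall>x\<in>K. \<forall>r. 0 < r \<and> r < rK \<longrightarrow>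
           emeasure lebesgue (B x (ennreal (2 * r))) \<le> ennreal CK * emeasure lebesgue (B x (ennreal r))"
    using H2 assms unfolding hyp_H2_def by blast
  show thesis
  proof (rule that[OF \<open>0 < rK\<close> \<open>0 < CK\<close>])
    fix x r assume x: "x \<in> K" "0 < r" "r < rK"
    then have "x \<in> \<Omega>0" using assms by auto
    then show "emeasure lborel (B x (ennreal (2 * r))) \<le> ennreal CK * emeasure lborel (B x (ennreal r))"
      using *[rule_format, OF x(1), of r] x by (simp add: emeasure_lebesgue_B)
  qed
qed

text \<open>At distances between R / 2^(n+1) and R / 2^n the kernel is at most R / 2^n divided by
  the volume of the smaller ball, and doubling compares this volume with that of the larger one.
  Shell n thus contributes at most CK R / 2^n, and the series sums to 2 CK R.\<close>

lemma ker_integral_right: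
  assumes x: "x \<in> \<Omega>0" and R: "0 < R" "R \<le> rK" and CK: "0 < CK"
    and dbl: "\<And>r. 0 < r \<Longrightarrow> r < rK \<Longrightarrow> emeasure lborel (B x (ennreal (2 * r))) \<le> ennreal CK * emeasure lborel (B x (ennreal r))"
  shows "(\<integral>\<^sup>+y. ker x y * indicator (B x (ennreal R)) y \<partial>lborel) \<le> ennreal (2 * CK * R)"
proof -
  let ?R = "\<lambda>n. R / 2 ^ n"
  let ?T = "\<lambda>n. ennreal (?R n) / emeasure lborel (B x (ennreal (?R (Suc n))))"
  have pt: "ker x y * indicator (B x (ennreal R)) y \<le> (\<Sum>n. ?T n * indicator (B x (ennreal (?R n))) y)" for y
  proof (cases "y \<in> B x (ennreal R)")
    case True
    then have y: "y \<in> \<Omega>0" "d x y < ennreal R" by (auto simp: cc_ball_def)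
    obtain \<delta> where \<delta>: "d x y = ennreal \<delta>" "0 \<le> \<delta>" using d_finite[OF x y(1)] by (cases "d x y") auto
    have k: "ker x y = ennreal \<delta> / emeasure lborel (B x (ennreal \<delta>))" using x y \<delta> by (simp add: ker_def)
    show ?thesis
    proof (cases "\<delta> = 0")
      case True
      then show ?thesis using k by simp
    next
      case False
      then have "0 < \<delta>" "\<delta> < R" using \<delta> y(2) R by (auto simp: ennreal_less_iff)
      then obtain n where n: "?R (Suc n) \<le> \<delta>" "\<delta> < ?R n" by (rule dyadic_exists)
      have "ker x y \<le> ?T n"
        unfolding k divide_ennreal_def
        using n x by (intro mult_mono ennreal_leI ennreal_inverse_antimono emeasure_B_mono) auto
      moreover have "y \<in> B x (ennreal (?R n))" using y n \<delta> by (auto simp: cc_ball_def ennreal_less_iff)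
      ultimately have "ker x y * indicator (B x (ennreal R)) y \<le> ?T n * indicator (B x (ennreal (?R n))) y"
        using True by simp
      also have "\<dots> \<le> (\<Sum>n. ?T n * indicator (B x (ennreal (?R n))) y)"
      proof -
        have "g n \<le> suminf g" for g :: "nat \<Rightarrow> ennreal" using sum_le_suminf[of g "{n}"] by simp
        then show ?thesis .
      qed
      finally show ?thesis .
    qed
  qed simp
  have "(\<integral>\<^sup>+y. ker x y * indicator (B x (ennreal R)) y \<partial>lborel) \<le> (\<integral>\<^sup>+y. (\<Sum>n. ?T n * indicator (B x (ennreal (?R n))) y) \<partial>lborel)"
    by (intro nn_integral_mono pt)
  also have "\<dots> = (\<Sum>n. \<integral>\<^sup>+y. ?T n * indicator (B x (ennreal (?R n))) y \<partial>lborel)"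
    using open_B[OF x] by (intro nn_integral_suminf) auto
  also have "\<dots> = (\<Sum>n. ?T n * emeasure lborel (B x (ennreal (?R n))))"
    using open_B[OF x] by (simp add: nn_integral_cmult_indicator)
  also have "\<dots> \<le> (\<Sum>n. ennreal (R * CK * (1/2) ^ n))"
  proof (intro suminf_le summableI)
    fix n
    \<comment> \<open>Doubling is invoked at radii of at most R / 2; hence R may equal rK although
      \<open>dbl\<close> asks for radii strictly below rK.\<close>
    have "(2::real) ^ 1 \<le> 2 ^ Suc n" by (intro power_increasing) auto
    then have "?R (Suc n) \<le> R / 2" using R by (intro divide_left_mono) auto
    then have "?R (Suc n) < rK" using R by simp
    have "0 < ?R (Suc n)" using R by simp
    have "emeasure lborel (B x (ennreal (2 * ?R (Suc n)))) \<le> ennreal CK * emeasure lborel (B x (ennreal (?R (Suc n))))"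
      by (rule dbl) fact+
    then have "emeasure lborel (B x (ennreal (?R n))) / emeasure lborel (B x (ennreal (?R (Suc n)))) \<le> ennreal CK"
      by (intro ennreal_divide_le_of_le_mult CK) simp
    then have "ennreal (?R n) * (emeasure lborel (B x (ennreal (?R n))) / emeasure lborel (B x (ennreal (?R (Suc n))))) \<le> ennreal (?R n) * ennreal CK"
      by (intro mult_left_mono) auto
    also have "\<dots> = ennreal (R * CK * (1/2) ^ n)" using R CK by (simp add: ennreal_mult[symmetric] power_divide)
    finally show "?T n * emeasure lborel (B x (ennreal (?R n))) \<le> ennreal (R * CK * (1/2) ^ n)"
      by (simp add: divide_ennreal_def mult_ac)
  qed
  also have "\<dots> = ennreal (2 * CK * R)"
  proof (rule suminf_ennreal_eq)
    have "(\<lambda>n. R * CK * (1/2) ^ n) sums (R * CK * (1 / (1 - 1/2)))" by (intro sums_mult geometric_sums) simp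
    then show "(\<lambda>n. R * CK * (1/2) ^ n) sums (2 * CK * R)" by (simp add: mult_ac)
  qed (use R CK in auto)
  finally show ?thesis .
qed

text \<open>The ball about y with radius d(x,y) lies in the ball about x with twice that radius, so
  a single doubling at x compares the two denominators.\<close>

lemma ker_swap:
  assumes x: "x \<in> \<Omega>0" and y: "y \<in> \<Omega>0" and R: "d x y < ennreal rK" and CK: "0 < CK"
    and dbl: "\<And>r. 0 < r \<Longrightarrow> r < rK \<Longrightarrow> emeasure lborel (B x (ennreal (2 * r))) \<le> ennreal CK * emeasure lborel (B x (ennreal r))"
  shows "ker x y \<le> ennreal CK * ker y x"
proof -
  obtain \<delta> where \<delta>: "d x y = ennreal \<delta>" "0 \<le> \<delta>" using d_finite[OF x y] by (cases "d x y") auto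
  have \<delta>': "d y x = ennreal \<delta>" using \<delta> cc_dist_commute by metis
  have k: "ker x y = ennreal \<delta> / emeasure lborel (B x (ennreal \<delta>))" "ker y x = ennreal \<delta> / emeasure lborel (B y (ennreal \<delta>))"
    using x y \<delta> \<delta>' by (simp_all add: ker_def)
  show ?thesis
  proof (cases "\<delta> = 0")
    case True
    then show ?thesis by (simp add: k)
  next
    case False
    then have p: "0 < \<delta>" "\<delta> < rK" using \<delta> R by (auto simp: ennreal_less_iff)
    have "emeasure lborel (B y (ennreal \<delta>)) \<le> emeasure lborel (B x (2 * ennreal \<delta>))"
      using B_swap[OF y x] \<delta>' open_B[OF x] by (intro emeasure_mono) auto
    also have "2 * ennreal \<delta> = ennreal (2 * \<delta>)" using p by (simp add: ennreal_mult)
    also have "emeasure lborel (B x (ennreal (2 * \<delta>))) \<le> ennreal CK * emeasure lborel (B x (ennreal \<delta>))" by (rule dbl[OF p])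
    finally have "inverse (emeasure lborel (B x (ennreal \<delta>))) \<le> ennreal CK * inverse (emeasure lborel (B y (ennreal \<delta>)))"
      using p CK emeasure_B_pos[OF x] emeasure_B_pos[OF y] by (intro ennreal_inverse_le) auto
    then have "ennreal \<delta> * inverse (emeasure lborel (B x (ennreal \<delta>))) \<le> ennreal \<delta> * (ennreal CK * inverse (emeasure lborel (B y (ennreal \<delta>))))"
      by (intro mult_left_mono) auto
    then show ?thesis by (simp add: k divide_ennreal_def mult_ac)
  qed
qed

text \<open>The second bound that Schur's test asks for. Exchanging the arguments of the kernel
  costs one more factor CK, whence the square; the restriction to K keeps the centres x within reach
  of the doubling constant.\<close>

lemma ker_integral_left:
  assumes K: "K \<subseteq> \<Omega>0" and y: "y \<in> K" and R: "0 < R" "R \<le> rK" and CK: "0 < CK"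
    and dbl: "\<And>x r. x \<in> K \<Longrightarrow> 0 < r \<Longrightarrow> r < rK \<Longrightarrow> emeasure lborel (B x (ennreal (2 * r))) \<le> ennreal CK * emeasure lborel (B x (ennreal r))"
  shows "(\<integral>\<^sup>+x. indicator K x * (ker x y * indicator (B x (ennreal R)) y) \<partial>lborel) \<le> ennreal (2 * CK\<^sup>2 * R)"
proof -
  have "(\<integral>\<^sup>+x. indicator K x * (ker x y * indicator (B x (ennreal R)) y) \<partial>lborel)
     \<le> (\<integral>\<^sup>+x. ennreal CK * (ker y x * indicator (B y (ennreal R)) x) \<partial>lborel)"
  proof (rule nn_integral_mono)
    fix x
    show "indicator K x * (ker x y * indicator (B x (ennreal R)) y) \<le> ennreal CK * (ker y x * indicator (B y (ennreal R)) x)"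
    proof (cases "x \<in> K \<and> y \<in> B x (ennreal R)")
      case True
      then have xy: "x \<in> \<Omega>0" "y \<in> \<Omega>0" "d x y < ennreal R" using K y by (auto simp: cc_ball_def)
      then have "d x y < ennreal rK" using R by (meson ennreal_leI less_le_trans)
      then have "ker x y \<le> ennreal CK * ker y x" using xy CK dbl True by (intro ker_swap) auto
      moreover have "x \<in> B y (ennreal R)" using xy cc_dist_commute[of \<Omega>0 X x y] by (simp add: cc_ball_def)
      ultimately show ?thesis using True by simp
    qed auto
  qed
  also have "\<dots> = ennreal CK * (\<integral>\<^sup>+x. ker y x * indicator (B y (ennreal R)) x \<partial>lborel)"
    using open_B[of y] K y by (intro nn_integral_cmult borel_measurable_times_ennreal borel_measurable_indicator) auto
  also have "\<dots> \<le> ennreal CK * ennreal (2 * CK * R)"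
    using K y R CK dbl by (intro mult_left_mono ker_integral_right[where rK=rK]) auto
  also have "\<dots> = ennreal (2 * CK\<^sup>2 * R)" using R CK by (simp add: ennreal_mult[symmetric] power2_eq_square mult_ac)
  finally show ?thesis .
qed

text \<open>In place of continuity of the volume in the centre, a finite cover by balls of half the
  radius is used: every ball of radius r about a point of K contains one of finitely many balls of
  positive volume. The bound is a real number even if those volumes are infinite.\<close>

lemma emeasure_B_lower_bound:
  assumes K: "compact K" "K \<subseteq> \<Omega>0" and r: "0 < r"
  obtains m where "0 < m" "\<And>x. x \<in> K \<Longrightarrow> ennreal m \<le> emeasure lborel (B x (ennreal r))"
proof (cases "K = {}")
  case False
  have "K \<subseteq> (\<Union>x\<in>K. B x (ennreal (r/2)))" using K r center_in_B by (force simp: ennreal_zero_less_divide)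
  moreover have "open (B x (ennreal (r/2)))" if "x \<in> K" for x using open_B K that by auto
  ultimately obtain F where F: "F \<subseteq> K" "finite F" "K \<subseteq> (\<Union>x\<in>F. B x (ennreal (r/2)))"
    using compactE_image[OF K(1), of K "\<lambda>x. B x (ennreal (r/2))"] by blast
  have Fne: "F \<noteq> {}" using F False by auto
  define M where "M = Min ((\<lambda>x. emeasure lborel (B x (ennreal (r/2)))) ` F)"
  have "M \<in> (\<lambda>x. emeasure lborel (B x (ennreal (r/2)))) ` F" unfolding M_def using F Fne by (intro Min_in) auto
  then have M0: "M \<noteq> 0" using F K r emeasure_B_pos by auto
  obtain m where m: "0 < m" "ennreal m \<le> M"
  proof (cases M)
    case (real m')
    then show ?thesis using M0 that[of m'] by (cases "m' = 0") auto
  next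
    case top
    then show ?thesis using that[of 1] by simp
  qed
  show ?thesis
  proof (rule that[OF m(1)])
    fix x assume x: "x \<in> K"
    then obtain z where z: "z \<in> F" "x \<in> B z (ennreal (r/2))" using F by blast
    have "B z (ennreal (r/2)) \<subseteq> B x (ennreal r)"
    proof
      fix w assume w: "w \<in> B z (ennreal (r/2))"
      have "d x w \<le> d z x + d z w" using cc_dist_triangle[of \<Omega>0 X x w z] by (simp add: cc_dist_commute[of \<Omega>0 X x z])
      also have "\<dots> < ennreal (r/2) + ennreal (r/2)" using w z(2) by (intro add_strict_mono) (auto simp: cc_ball_def)
      also have "\<dots> = ennreal r" using r by (simp add: ennreal_plus[symmetric] del: ennreal_plus)
      finally show "w \<in> B x (ennreal r)" using w by (simp add: cc_ball_def)
    qed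
    then have "emeasure lborel (B z (ennreal (r/2))) \<le> emeasure lborel (B x (ennreal r))"
      using open_B x K by (intro emeasure_mono) auto
    moreover have "M \<le> emeasure lborel (B z (ennreal (r/2)))" unfolding M_def using F z by (intro Min_le) auto
    ultimately show "ennreal m \<le> emeasure lborel (B x (ennreal r))" using m(2) by (meson order_trans)
  qed
qed (use that[of 1] in auto)

lemma d_bounded_compact:
  assumes K: "compact K" "K \<subseteq> \<Omega>0"
  obtains D where "0 < D" "\<And>x y. x \<in> K \<Longrightarrow> y \<in> K \<Longrightarrow> d x y < ennreal D"
proof (cases "K = {}")
  case False
  have "compact (K \<times> K)" using K by (intro compact_Times)
  moreover have "continuous_on (K \<times> K) (\<lambda>p. d (fst p) (snd p))"
    using d_continuous2 by (rule continuous_on_subset) (use K in auto)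
  ultimately obtain p where p: "p \<in> K \<times> K" "\<And>q. q \<in> K \<times> K \<Longrightarrow> d (fst q) (snd q) \<le> d (fst p) (snd p)"
    using continuous_attains_sup[of "K \<times> K" "\<lambda>p. d (fst p) (snd p)"] False by blast
  have "d (fst p) (snd p) < \<infinity>" using p(1) K by (intro d_finite) auto
  then obtain D where D: "d (fst p) (snd p) = ennreal D" "0 \<le> D" by (cases "d (fst p) (snd p)") auto
  show ?thesis
  proof (rule that[of "D + 1"])
    show "d x y < ennreal (D + 1)" if "x \<in> K" "y \<in> K" for x y
      using p(2)[of "(x, y)"] that D by (auto intro!: le_less_trans[of "d x y" "ennreal D"] ennreal_lessI)
  qed (use D in auto)
qed (use that[of 1] in auto)

text \<open>Doubling controls the part of the kernel up to distance rK. Farther away the distance is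
  below D and the ball has volume at least m, so the kernel is at most D / m, and K has finite
  volume.\<close>

lemma ker_integral_compact:
  assumes K: "compact K" "K \<subseteq> \<Omega>0"
  obtains S where "0 < S" "\<And>y. y \<in> K \<Longrightarrow> (\<integral>\<^sup>+x. indicator K x * ker x y \<partial>lborel) \<le> ennreal S"
proof -
  obtain rK CK where rC: "0 < rK" "0 < CK" 
    "\<And>x r. x \<in> K \<Longrightarrow> 0 < r \<Longrightarrow> r < rK \<Longrightarrow> emeasure lborel (B x (ennreal (2 * r))) \<le> ennreal CK * emeasure lborel (B x (ennreal r))"
    using doubling[OF K] by blast
  obtain m where m: "0 < m" "\<And>x. x \<in> K \<Longrightarrow> ennreal m \<le> emeasure lborel (B x (ennreal rK))"
    using emeasure_B_lower_bound[OF K rC(1)] by blast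
  obtain D where D: "0 < D" "\<And>x y. x \<in> K \<Longrightarrow> y \<in> K \<Longrightarrow> d x y < ennreal D" using d_bounded_compact[OF K] by blast
  have Kb [measurable]: "K \<in> sets borel" using K by (auto intro: borel_compact)
  have finK: "emeasure lborel K < \<infinity>" using K(1) by (rule emeasure_compact_finite)
  then obtain v where v: "emeasure lborel K = ennreal v" "0 \<le> v" by (cases "emeasure lborel K") auto
  show ?thesis
  proof (rule that[of "2 * CK\<^sup>2 * rK + D / m * v"])
    show "0 < 2 * CK\<^sup>2 * rK + D / m * v" using rC m D v by (intro add_pos_nonneg) auto
    fix y assume y: "y \<in> K"
    have near: "(\<lambda>x. indicator K x * (ker x y * indicator (B x (ennreal rK)) y)) \<in> borel_measurable lborel"
    proof -
      have "(\<lambda>x. indicator K x * (ker x y * indicator {y\<in>\<Omega>0. x \<in> \<Omega>0 \<and> d x y < ennreal rK} y)) \<in> borel_measurable lborel"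
        by measurable
      then show ?thesis
        by (rule measurable_cong[THEN iffD1, rotated]) (use K in \<open>auto simp: cc_ball_def split: split_indicator\<close>)
    qed
    have "(\<integral>\<^sup>+x. indicator K x * ker x y \<partial>lborel)
       \<le> (\<integral>\<^sup>+x. indicator K x * (ker x y * indicator (B x (ennreal rK)) y) + ennreal (D / m) * indicator K x \<partial>lborel)"
    proof (rule nn_integral_mono)
      fix x
      show "indicator K x * ker x y \<le> indicator K x * (ker x y * indicator (B x (ennreal rK)) y) + ennreal (D / m) * indicator K x"
      proof (cases "x \<in> K \<and> y \<notin> B x (ennreal rK)")
        case True
        then have xy: "x \<in> \<Omega>0" "y \<in> \<Omega>0" "ennreal rK \<le> d x y" using K y by (auto simp: cc_ball_def not_less)
        have "ker x y = d x y * inverse (emeasure lborel (B x (d x y)))" using xy by (simp add: ker_def divide_ennreal_def)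
        also have "\<dots> \<le> ennreal D * inverse (ennreal m)"
        proof (intro mult_mono ennreal_inverse_antimono)
          show "d x y \<le> ennreal D" using D(2)[of x y] True y by auto
          have "ennreal m \<le> emeasure lborel (B x (ennreal rK))" using m True by auto
          also have "\<dots> \<le> emeasure lborel (B x (d x y))" by (rule emeasure_B_mono[OF xy(1,3)])
          finally show "ennreal m \<le> emeasure lborel (B x (d x y))" .
        qed auto
        also have "\<dots> = ennreal (D / m)" using D m by (simp add: inverse_ennreal ennreal_mult[symmetric] divide_inverse)
        finally show ?thesis using True by simp
      qed (auto split: split_indicator)
    qed
    also have "\<dots> = (\<integral>\<^sup>+x. indicator K x * (ker x y * indicator (B x (ennreal rK)) y) \<partial>lborel) + (\<integral>\<^sup>+x. ennreal (D / m) * indicator K x \<partial>lborel)"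
      by (rule nn_integral_add[OF near]) measurable
    also have "\<dots> \<le> ennreal (2 * CK\<^sup>2 * rK) + ennreal (D / m) * emeasure lborel K"
      using rC K(2) y by (intro add_mono ker_integral_left[where rK=rK]) (auto simp: nn_integral_cmult_indicator)
    also have "\<dots> = ennreal (2 * CK\<^sup>2 * rK + D / m * v)"
      using rC D m v by (simp add: ennreal_mult[symmetric] ennreal_plus[symmetric] del: ennreal_plus)
    finally show "(\<integral>\<^sup>+x. indicator K x * ker x y \<partial>lborel) \<le> ennreal (2 * CK\<^sup>2 * rK + D / m * v)" .
  qed
qed

end

section \<open>Poincare inequalities\<close>

text \<open>Together with \<open>le_add_powr\<close> this replaces Jensen's inequality for a kernel operator: the optimal choice is
  \<open>t = (W / \<alpha>) powr (1 / p)\<close>.\<close>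

lemma ennreal_powr_optimize:
  fixes W :: ennreal
  assumes s: "0 \<le> s" and \<alpha>: "0 < \<alpha>" and C: "0 < C" and p: "1 < p"
    and le: "\<And>t. 0 < t \<Longrightarrow> ennreal s \<le> ennreal C * (ennreal (t * \<alpha>) + ennreal (t powr (1 - p)) * W)"
  shows "ennreal (s powr p) \<le> ennreal ((2 * C) powr p * \<alpha> powr (p - 1)) * W"
proof (cases W)
  case top
  then show ?thesis using \<alpha> C by (simp add: ennreal_mult_top)
next
  case (real w)
  have le': "s \<le> C * (t * \<alpha> + t powr (1 - p) * w)" if t: "0 < t" for t
  proof -
    have "ennreal C * (ennreal (t * \<alpha>) + ennreal (t powr (1 - p)) * W) = ennreal (C * (t * \<alpha> + t powr (1 - p) * w))"
      using real t \<alpha> C by (simp add: ennreal_mult ennreal_plus)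
    then show ?thesis using le[OF t] real t \<alpha> C by (simp add: ennreal_le_iff)
  qed
  show ?thesis
  proof (cases "w = 0")
    case True
    have "s = 0"
    proof (rule ccontr)
      assume "s \<noteq> 0"
      then have "0 < s" using s by simp
      \<comment> \<open>For w = 0 the optimal t would be 0; the value taken here already yields that
        s is at most s / 2.\<close>
      then have "s \<le> C * ((s / (2 * C * \<alpha>)) * \<alpha>)" using le'[of "s / (2 * C * \<alpha>)"] True \<alpha> C by simp
      also have "\<dots> = s / 2" using \<alpha> C by (simp add: field_simps)
      finally show False using \<open>0 < s\<close> by simp
    qed
    then show ?thesis by simp
  next
    case False
    then have w: "0 < w" using real by simp
    define t where "t = (w / \<alpha>) powr (1/p)"
    have t: "0 < t" "t powr p = w / \<alpha>" using w \<alpha> p by (auto simp: t_def powr_powr)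
    have "t powr (1 - p) = t powr 1 / t powr p" by (rule powr_diff)
    then have "t powr (1 - p) * w = t * \<alpha>" using t w \<alpha> by (simp add: field_simps)
    then have "s \<le> 2 * C * (t * \<alpha>)" using le'[OF t(1)] by (simp add: mult_ac)
    then have "s powr p \<le> (2 * C * (t * \<alpha>)) powr p" using s p by (intro powr_mono2) auto
    also have "\<dots> = (2 * C) powr p * (t powr p * \<alpha> powr p)" using t C \<alpha> by (simp add: powr_mult)
    also have "t powr p * \<alpha> powr p = \<alpha> powr (p - 1) * w" using t \<alpha> by (simp add: powr_diff field_simps)
    finally have "s powr p \<le> (2 * C) powr p * \<alpha> powr (p - 1) * w" by (simp add: mult_ac)
    then show ?thesis using real by (simp add: ennreal_mult'[symmetric] ennreal_leI)
  qed
qed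

text \<open>Either f is at most t, or f/t exceeds 1 and is at most its p-th power. The parameter t
  is kept free for the optimization.\<close>

lemma le_add_powr:
  fixes f t p :: real
  assumes "0 \<le> f" "0 < t" "1 < p"
  shows "f \<le> t + t powr (1 - p) * f powr p"
proof (cases "f \<le> t")
  case False
  then have "(f / t) powr 1 \<le> (f / t) powr p" using assms by (intro powr_mono) auto
  then have "f / t \<le> f powr p / t powr p" using assms False by (simp add: powr_divide)
  then have "f \<le> t * (f powr p / t powr p)" using assms by (simp add: field_simps)
  also have "\<dots> = t powr (1 - p) * f powr p" using assms by (simp add: powr_diff)
  finally show ?thesis using assms by simp
qed (use assms in \<open>auto intro: add_increasing2\<close>)

context cc_space
begin

lemma C1cD:
  assumes "\<phi> \<in> C1c U" "U \<subseteq> \<Omega>0"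
  shows "C_k 1 \<phi>" "compact (closure {x. \<phi> x \<noteq> 0})" "closure {x. \<phi> x \<noteq> 0} \<subseteq> U" "closure {x. \<phi> x \<noteq> 0} \<subseteq> \<Omega>0"
    "continuous_on UNIV \<phi>" "\<phi> \<in> borel_measurable borel" "Xcl X \<phi> \<in> borel_measurable borel"
    "x \<notin> U \<Longrightarrow> \<phi> x = 0" "x \<notin> U \<Longrightarrow> Xcl X \<phi> x = 0"
proof -
  show 1: "C_k 1 \<phi>" "compact (closure {x. \<phi> x \<noteq> 0})" "closure {x. \<phi> x \<noteq> 0} \<subseteq> U"
    using assms by (auto simp: C1c_def compact_support_in_def)
  then show 2: "closure {x. \<phi> x \<noteq> 0} \<subseteq> \<Omega>0" using assms by blast
  show 3: "continuous_on UNIV \<phi>" using C_k_continuous[OF 1(1)] .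
  then show "\<phi> \<in> borel_measurable borel" by (rule borel_measurable_continuous_onI)
  show "Xcl X \<phi> \<in> borel_measurable borel" by (rule Xcl_borel[OF 1(1) 2])
  show "\<phi> x = 0" if "x \<notin> U" using that 1(3) closure_subset[of "{x. \<phi> x \<noteq> 0}"] by blast
  show "Xcl X \<phi> x = 0" if "x \<notin> U" using that 1(3) by (intro Xcl_outside_support) blast
qed

text \<open>On balls of infinite measure \<^const>\<open>measure\<close> is \<open>0\<close> and the mean is \<open>0\<close> by \<open>x / 0 = 0\<close>; the formula and its
  consequences hold with this convention.\<close>

lemma representation_formula:
  obtains c C where "0 < c" "0 < C"
    "\<And>z r x \<phi> U. z \<in> \<Omega>0 \<Longrightarrow> 0 < r \<Longrightarrow> x \<in> \<Omega>0 \<Longrightarrow> d z x \<le> ennreal r \<Longrightarrow> \<phi> \<in> C1c U \<Longrightarrow> U \<subseteq> \<Omega>0 \<Longrightarrow>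
      ennreal \<bar>\<phi> x - (LINT y|lborel. indicator (B z (ennreal r)) y * \<phi> y) / measure lborel (B z (ennreal r))\<bar>
      \<le> ennreal C * (\<integral>\<^sup>+y. ennreal (norm (Xcl X \<phi> y)) * (ker x y * indicator (B z (ennreal (c * r))) y) \<partial>lborel)"
proof -
  from H3[unfolded hyp_H3_def Let_def] obtain c C where cC: "0 < c" "0 < C" and
    H: "\<forall>z\<in>\<Omega>0. \<forall>r>0. B z (ennreal (c * r)) \<subseteq> \<Omega>0 \<longrightarrow>
           (\<forall>u. (\<exists>L. L-lipschitz_on (cc_cball \<Omega>0 X z (ennreal (c * r))) u) \<longrightarrow>
             (\<forall>x\<in>cc_cball \<Omega>0 X z (ennreal r).
                ennreal \<bar>u x - (LINT y|lebesgue_on (B z (ennreal r)). u y) / measure lebesgue (B z (ennreal r))\<bar>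
                \<le> ennreal C *
                  (\<integral>\<^sup>+ y. ennreal (norm (Xgrad (B z (ennreal (c * r))) X u y)) *
                      (d x y / emeasure lebesgue (B x (d x y)))
                    \<partial>lebesgue_on (B z (ennreal (c * r))))))" by blast
  show thesis
  proof (rule that[OF cC])
    fix z r x \<phi> U
    assume as: "z \<in> \<Omega>0" "0 < r" "x \<in> \<Omega>0" "d z x \<le> ennreal r" "\<phi> \<in> C1c U" "U \<subseteq> \<Omega>0"
    note p = C1cD[OF as(5,6)]
    let ?B = "B z (ennreal r)" and ?cB = "B z (ennreal (c * r))"
    have oB: "open ?B" "open ?cB" using open_B[OF as(1)] by auto
    obtain L where "L-lipschitz_on UNIV \<phi>" using C1_compact_support_lipschitz[OF p(1,2)] .
    then have lip: "\<exists>L. L-lipschitz_on (cc_cball \<Omega>0 X z (ennreal (c * r))) \<phi>" using lipschitz_on_subset by blast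
    have xc: "x \<in> cc_cball \<Omega>0 X z (ennreal r)" using as by (simp add: cc_cball_def)
    have h: "ennreal \<bar>\<phi> x - (LINT y|lebesgue_on ?B. \<phi> y) / measure lebesgue ?B\<bar>
                \<le> ennreal C * (\<integral>\<^sup>+ y. ennreal (norm (Xgrad ?cB X \<phi> y)) * (d x y / emeasure lebesgue (B x (d x y))) \<partial>lebesgue_on ?cB)"
      using H[THEN bspec, OF as(1), THEN spec, THEN mp, OF as(2), THEN mp, OF B_subset, THEN spec, THEN mp, OF lip, THEN bspec, OF xc] .
    have "(LINT y|lebesgue_on ?B. \<phi> y) = (LINT y|lebesgue. indicator ?B y * \<phi> y)"
      using oB by (subst integral_restrict_space) auto
    also have "\<dots> = (LINT y|lborel. indicator ?B y * \<phi> y)"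
      using oB p(6) by (intro integral_completion) auto
    finally have e1: "(LINT y|lebesgue_on ?B. \<phi> y) = (LINT y|lborel. indicator ?B y * \<phi> y)" .
    have e2: "measure lebesgue ?B = measure lborel ?B" using oB by (intro measure_completion) auto
    \<comment> \<open>(H3) involves the distributional gradient on the large ball. The support of
      \<phi> may cross the boundary of that ball, which \<open>has_Xgrad_C1\<close> permits.\<close>
    have "AE y in lebesgue_on ?cB. Xgrad ?cB X \<phi> y = Xcl X \<phi> y"
      by (rule Xgrad_AE_eq[OF oB(2) has_Xgrad_C1[OF oB(2) B_subset p(1,2)]])
    then have "(\<integral>\<^sup>+ y. ennreal (norm (Xgrad ?cB X \<phi> y)) * (d x y / emeasure lebesgue (B x (d x y))) \<partial>lebesgue_on ?cB)
      = (\<integral>\<^sup>+ y. ennreal (norm (Xcl X \<phi> y)) * (d x y / emeasure lebesgue (B x (d x y))) \<partial>lebesgue_on ?cB)"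
      by (intro nn_integral_cong_AE) (auto elim: eventually_mono)
    also have "\<dots> = (\<integral>\<^sup>+ y. (ennreal (norm (Xcl X \<phi> y)) * (d x y / emeasure lebesgue (B x (d x y)))) * indicator ?cB y \<partial>lebesgue)"
      using oB by (subst nn_integral_restrict_space) auto
    also have "\<dots> = (\<integral>\<^sup>+ y. (ennreal (norm (Xcl X \<phi> y)) * (d x y / emeasure lebesgue (B x (d x y)))) * indicator ?cB y \<partial>lborel)"
      by (rule nn_integral_completion)
    also have "\<dots> = (\<integral>\<^sup>+y. ennreal (norm (Xcl X \<phi> y)) * (ker x y * indicator ?cB y) \<partial>lborel)"
      using as(3) B_subset[of z "ennreal (c * r)"]
      by (intro nn_integral_cong) (auto simp: ker_def emeasure_lebesgue_B split: split_indicator)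
    finally show "ennreal \<bar>\<phi> x - (LINT y|lborel. indicator ?B y * \<phi> y) / measure lborel ?B\<bar>
      \<le> ennreal C * (\<integral>\<^sup>+y. ennreal (norm (Xcl X \<phi> y)) * (ker x y * indicator ?cB y) \<partial>lborel)"
      using h by (simp only: e1 e2)
  qed
qed

text \<open>Since \<open>\<phi>\<close> vanishes on a ball \<open>E\<close> outside \<open>\<Omega>\<close>, the representation formula on a ball containing \<open>\<Omega>\<close> and \<open>E\<close>
  also controls the mean of \<open>\<phi>\<close>.\<close>

lemma L1_Poincare:
  assumes \<Omega>: "open \<Omega>" "bounded \<Omega>" "closure \<Omega> \<subseteq> \<Omega>0" "\<Omega> \<noteq> {}"
  obtains A where "0 < A"
    "\<And>\<phi>. \<phi> \<in> C1c \<Omega> \<Longrightarrow> (\<integral>\<^sup>+x. indicator \<Omega> x * ennreal \<bar>\<phi> x\<bar> \<partial>lborel) \<le> ennreal A * (\<integral>\<^sup>+y. ennreal (norm (Xcl X \<phi> y)) \<partial>lborel)"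
proof -
  have \<Omega>sub: "\<Omega> \<subseteq> \<Omega>0" using \<Omega>(3) closure_subset by blast
  \<comment> \<open>The ball E needs room in \<open>\<Omega>0\<close> outside the closure of
    \<open>\<Omega>\<close>. Without such room \<open>\<Omega>0\<close> would be open, closed and
    nonempty, hence the whole space, yet bounded.\<close>
  have "\<not> \<Omega>0 \<subseteq> closure \<Omega>"
  proof
    assume "\<Omega>0 \<subseteq> closure \<Omega>"
    then have eq: "\<Omega>0 = closure \<Omega>" using \<Omega>(3) by blast
    then have "closed \<Omega>0" by simp
    then have "\<Omega>0 = UNIV" using open_\<Omega>0 clopen[of \<Omega>0] \<Omega>sub \<Omega>(4) by blast
    moreover have "bounded \<Omega>0" using \<Omega>(2) eq by (simp add: bounded_closure)
    ultimately show False using not_bounded_UNIV by blast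
  qed
  then obtain x0 where x0: "x0 \<in> \<Omega>0 - closure \<Omega>" by blast
  have "open (\<Omega>0 - closure \<Omega>)" using open_\<Omega>0 by (intro open_Diff) auto
  then obtain \<epsilon> where \<epsilon>: "0 < \<epsilon>" "cball x0 \<epsilon> \<subseteq> \<Omega>0 - closure \<Omega>" using x0 by (meson open_contains_cball)
  define E where "E = cball x0 \<epsilon>"
  define K where "K = closure \<Omega> \<union> E"
  have K: "compact K" "K \<subseteq> \<Omega>0" using \<Omega> \<epsilon> by (auto simp: K_def E_def)
  have [measurable]: "K \<in> sets borel" "\<Omega> \<in> sets borel" "E \<in> sets borel" using K \<Omega> by (auto simp: E_def intro: borel_compact)
  have E\<Omega>: "E \<inter> \<Omega> = {}" using \<epsilon>(2) closure_subset[of \<Omega>] by (auto simp: E_def)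
  have "emeasure lborel E < \<infinity>" by (rule emeasure_compact_finite) (simp add: E_def)
  moreover have "emeasure lborel E \<noteq> 0"
  proof
    assume "emeasure lborel E = 0"
    then have "E \<in> null_sets lborel" by (intro null_setsI) auto
    then have "negligible E" unfolding negligible_iff_null_sets by (rule null_sets_completionI)
    then have "negligible (ball x0 \<epsilon>)" by (rule negligible_subset) (auto simp: E_def)
    then show False using open_not_negligible[of "ball x0 \<epsilon>"] \<epsilon>(1) by auto
  qed
  ultimately obtain e where e: "emeasure lborel E = ennreal e" "0 < e"
    by (cases "emeasure lborel E") (auto simp: less_le)
  have "emeasure lborel \<Omega> < \<infinity>" using \<Omega>(2) by (rule emeasure_bounded_finite)
  then obtain v where v: "emeasure lborel \<Omega> = ennreal v" "0 \<le> v" by (cases "emeasure lborel \<Omega>") auto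
  obtain D where D: "0 < D" "\<And>x y. x \<in> K \<Longrightarrow> y \<in> K \<Longrightarrow> d x y < ennreal D" using d_bounded_compact[OF K] by blast
  obtain S where S: "0 < S" "\<And>y. y \<in> K \<Longrightarrow> (\<integral>\<^sup>+x. indicator K x * ker x y \<partial>lborel) \<le> ennreal S" using ker_integral_compact[OF K] by blast
  obtain c C where cC: "0 < c" "0 < C" and rep:
    "\<And>z r x \<phi> U. z \<in> \<Omega>0 \<Longrightarrow> 0 < r \<Longrightarrow> x \<in> \<Omega>0 \<Longrightarrow> d z x \<le> ennreal r \<Longrightarrow> \<phi> \<in> C1c U \<Longrightarrow> U \<subseteq> \<Omega>0 \<Longrightarrow>
      ennreal \<bar>\<phi> x - (LINT y|lborel. indicator (B z (ennreal r)) y * \<phi> y) / measure lborel (B z (ennreal r))\<bar>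
      \<le> ennreal C * (\<integral>\<^sup>+y. ennreal (norm (Xcl X \<phi> y)) * (ker x y * indicator (B z (ennreal (c * r))) y) \<partial>lborel)"
    using representation_formula by blast
  have x0K: "x0 \<in> K" using \<epsilon> by (simp add: K_def E_def)
  show ?thesis
  proof (rule that[of "C * S * (1 + v / e)"])
    show "0 < C * S * (1 + v / e)" using cC S e v by (intro mult_pos_pos add_pos_nonneg) auto
    fix \<phi> assume \<phi>: "\<phi> \<in> C1c \<Omega>"
    note q = C1cD[OF \<phi> \<Omega>sub]
    note [measurable] = q(6) q(7)
    let ?f = "\<lambda>y. ennreal (norm (Xcl X \<phi> y))"
    \<comment> \<open>The ball of radius D about x0 contains K, so one and the same mean serves at
      every point of K.\<close>
    define a where "a = (LINT y|lborel. indicator (B x0 (ennreal D)) y * \<phi> y) / measure lborel (B x0 (ennreal D))"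
    have pt: "ennreal \<bar>\<phi> x - a\<bar> \<le> ennreal C * (\<integral>\<^sup>+y. ?f y * ker x y \<partial>lborel)" if x: "x \<in> K" for x
    proof -
      have "ennreal \<bar>\<phi> x - a\<bar> \<le> ennreal C * (\<integral>\<^sup>+y. ?f y * (ker x y * indicator (B x0 (ennreal (c * D))) y) \<partial>lborel)"
        unfolding a_def using x0 x K D(1) D(2)[OF x0K x] \<phi> \<Omega>sub by (intro rep[of x0 D x \<phi> \<Omega>]) auto
      also have "\<dots> \<le> ennreal C * (\<integral>\<^sup>+y. ?f y * ker x y \<partial>lborel)"
        by (intro mult_left_mono nn_integral_mono) (auto split: split_indicator)
      finally show ?thesis .
    qed
    have "(\<integral>\<^sup>+x. indicator K x * (\<integral>\<^sup>+y. ?f y * ker x y \<partial>lborel) \<partial>lborel) = (\<integral>\<^sup>+x. (\<integral>\<^sup>+y. indicator K x * (?f y * ker x y) \<partial>lborel) \<partial>lborel)"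
      by (intro nn_integral_cong nn_integral_cmult[symmetric]) measurable
    also have "\<dots> = (\<integral>\<^sup>+y. (\<integral>\<^sup>+x. indicator K x * (?f y * ker x y) \<partial>lborel) \<partial>lborel)"
      by (rule lborel_pair.Fubini'[symmetric]) measurable
    also have "\<dots> \<le> (\<integral>\<^sup>+y. ?f y * ennreal S \<partial>lborel)"
    proof (rule nn_integral_mono)
      fix y
      have "(\<integral>\<^sup>+x. indicator K x * (?f y * ker x y) \<partial>lborel) = (\<integral>\<^sup>+x. ?f y * (indicator K x * ker x y) \<partial>lborel)" by (simp add: mult_ac)
      also have "\<dots> = ?f y * (\<integral>\<^sup>+x. indicator K x * ker x y \<partial>lborel)" by (rule nn_integral_cmult) measurable
      also have "\<dots> \<le> ?f y * ennreal S"
      proof (cases "y \<in> \<Omega>")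
        case True
        then have "y \<in> K" using closure_subset by (auto simp: K_def)
        then show ?thesis by (intro mult_left_mono S) auto
      next
        case False
        then show ?thesis using q(9) by simp
      qed
      finally show "(\<integral>\<^sup>+x. indicator K x * (?f y * ker x y) \<partial>lborel) \<le> ?f y * ennreal S" .
    qed
    also have "\<dots> = (\<integral>\<^sup>+y. ?f y \<partial>lborel) * ennreal S" by (rule nn_integral_multc) measurable
    finally have dbl: "(\<integral>\<^sup>+x. indicator K x * (\<integral>\<^sup>+y. ?f y * ker x y \<partial>lborel) \<partial>lborel) \<le> (\<integral>\<^sup>+y. ?f y \<partial>lborel) * ennreal S" .
    let ?Q = "ennreal (C * S) * (\<integral>\<^sup>+y. ?f y \<partial>lborel)"
    have osc: "(\<integral>\<^sup>+x. indicator K x * ennreal \<bar>\<phi> x - a\<bar> \<partial>lborel) \<le> ?Q"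
    proof -
      have "(\<integral>\<^sup>+x. indicator K x * ennreal \<bar>\<phi> x - a\<bar> \<partial>lborel) \<le> (\<integral>\<^sup>+x. ennreal C * (indicator K x * (\<integral>\<^sup>+y. ?f y * ker x y \<partial>lborel)) \<partial>lborel)"
        using pt by (intro nn_integral_mono) (auto split: split_indicator)
      also have "\<dots> = ennreal C * (\<integral>\<^sup>+x. indicator K x * (\<integral>\<^sup>+y. ?f y * ker x y \<partial>lborel) \<partial>lborel)"
        by (rule nn_integral_cmult) measurable
      also have "\<dots> \<le> ennreal C * ((\<integral>\<^sup>+y. ?f y \<partial>lborel) * ennreal S)" by (intro mult_left_mono dbl) auto
      also have "\<dots> = ?Q" using cC S by (simp add: ennreal_mult mult_ac)
      finally show ?thesis .
    qed
    have "ennreal \<bar>a\<bar> * ennreal e = (\<integral>\<^sup>+x. ennreal \<bar>a\<bar> * indicator E x \<partial>lborel)" by (simp add: nn_integral_cmult_indicator e(1))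
    also have "\<dots> \<le> (\<integral>\<^sup>+x. indicator K x * ennreal \<bar>\<phi> x - a\<bar> \<partial>lborel)"
    proof (rule nn_integral_mono)
      fix x show "ennreal \<bar>a\<bar> * indicator E x \<le> indicator K x * ennreal \<bar>\<phi> x - a\<bar>"
      proof (cases "x \<in> E")
        case True
        then have "x \<notin> \<Omega>" using E\<Omega> by blast
        then have "\<phi> x = 0" by (rule q(8))
        then show ?thesis using True by (simp add: K_def)
      qed simp
    qed
    also have "\<dots> \<le> ?Q" by (rule osc)
    finally have ae: "ennreal \<bar>a\<bar> * ennreal e \<le> ?Q" .
    \<comment> \<open>Passing from the volume e of E to the volume v of \<open>\<Omega>\<close>
      produces the factor \<open>v / e\<close> in the constant.\<close>
    have "ennreal \<bar>a\<bar> * ennreal v = (ennreal \<bar>a\<bar> * ennreal e) * ennreal (v / e)"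
      using e v by (simp add: ennreal_mult'[symmetric] ennreal_mult''[symmetric] field_simps)
    also have "\<dots> \<le> ?Q * ennreal (v / e)" by (intro mult_right_mono ae) auto
    finally have av: "ennreal \<bar>a\<bar> * ennreal v \<le> ?Q * ennreal (v / e)" .
    have "(\<integral>\<^sup>+x. indicator \<Omega> x * ennreal \<bar>\<phi> x\<bar> \<partial>lborel) \<le> (\<integral>\<^sup>+x. indicator K x * ennreal \<bar>\<phi> x - a\<bar> + ennreal \<bar>a\<bar> * indicator \<Omega> x \<partial>lborel)"
    proof (rule nn_integral_mono)
      fix x show "indicator \<Omega> x * ennreal \<bar>\<phi> x\<bar> \<le> indicator K x * ennreal \<bar>\<phi> x - a\<bar> + ennreal \<bar>a\<bar> * indicator \<Omega> x"
      proof (cases "x \<in> \<Omega>")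
        case True
        then have "x \<in> K" using closure_subset by (auto simp: K_def)
        moreover have "ennreal \<bar>\<phi> x\<bar> \<le> ennreal (\<bar>\<phi> x - a\<bar> + \<bar>a\<bar>)" by (intro ennreal_leI) auto
        ultimately show ?thesis using True by (simp add: ennreal_plus)
      qed simp
    qed
    also have "\<dots> = (\<integral>\<^sup>+x. indicator K x * ennreal \<bar>\<phi> x - a\<bar> \<partial>lborel) + (\<integral>\<^sup>+x. ennreal \<bar>a\<bar> * indicator \<Omega> x \<partial>lborel)"
      by (rule nn_integral_add) measurable
    also have "(\<integral>\<^sup>+x. ennreal \<bar>a\<bar> * indicator \<Omega> x \<partial>lborel) = ennreal \<bar>a\<bar> * ennreal v" by (simp add: nn_integral_cmult_indicator v(1))
    also have "(\<integral>\<^sup>+x. indicator K x * ennreal \<bar>\<phi> x - a\<bar> \<partial>lborel) + ennreal \<bar>a\<bar> * ennreal v \<le> ?Q + ?Q * ennreal (v / e)"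
      by (intro add_mono osc av)
    also have "\<dots> = ?Q * (1 + ennreal (v / e))" by (simp add: distrib_left)
    also have "1 + ennreal (v / e) = ennreal (1 + v / e)" using v e by (simp add: ennreal_plus)
    also have "?Q * ennreal (1 + v / e) = ennreal (C * S * (1 + v / e)) * (\<integral>\<^sup>+y. ?f y \<partial>lborel)"
      using cC S v e by (subst ennreal_mult) (auto simp: mult_ac)
    finally show "(\<integral>\<^sup>+x. indicator \<Omega> x * ennreal \<bar>\<phi> x\<bar> \<partial>lborel) \<le> ennreal (C * S * (1 + v / e)) * (\<integral>\<^sup>+y. ?f y \<partial>lborel)" .
  qed
qed

text \<open>Schur's test on small balls. The integral of the kernel in y is at most \<alpha> = O(r),
  which gives \<alpha>^(p-1) in a pointwise bound by the kernel applied to the p-th power of the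
  gradient; its integral in x supplies one more factor of order r.\<close>

lemma mean_oscillation_Lp:
  assumes \<Omega>: "open \<Omega>" "bounded \<Omega>" "closure \<Omega> \<subseteq> \<Omega>0" and p: "1 < p"
  obtains r0 Q where "0 < r0" "0 < Q"
    "\<And>\<phi> r. \<phi> \<in> C1c \<Omega> \<Longrightarrow> 0 < r \<Longrightarrow> r \<le> r0 \<Longrightarrow>
      (\<integral>\<^sup>+x. indicator \<Omega> x * ennreal (\<bar>\<phi> x - (LINT y|lborel. indicator (B x (ennreal r)) y * \<phi> y) / measure lborel (B x (ennreal r))\<bar> powr p) \<partial>lborel)
      \<le> ennreal (Q * r powr p) * (\<integral>\<^sup>+y. ennreal (norm (Xcl X \<phi> y) powr p) \<partial>lborel)"
proof -
  have \<Omega>sub: "\<Omega> \<subseteq> \<Omega>0" using \<Omega>(3) closure_subset by blast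
  define K where "K = closure \<Omega>"
  have K: "compact K" "K \<subseteq> \<Omega>0" "\<Omega> \<subseteq> K" using \<Omega> closure_subset by (auto simp: K_def)
  have [measurable]: "K \<in> sets borel" "\<Omega> \<in> sets borel" using K \<Omega> by (auto intro: borel_compact)
  obtain rK CK where rC: "0 < rK" "0 < CK" 
    "\<And>x r. x \<in> K \<Longrightarrow> 0 < r \<Longrightarrow> r < rK \<Longrightarrow> emeasure lborel (B x (ennreal (2 * r))) \<le> ennreal CK * emeasure lborel (B x (ennreal r))"
    using doubling[OF K(1,2)] by blast
  obtain c C where cC: "0 < c" "0 < C" and rep:
    "\<And>z r x \<phi> U. z \<in> \<Omega>0 \<Longrightarrow> 0 < r \<Longrightarrow> x \<in> \<Omega>0 \<Longrightarrow> d z x \<le> ennreal r \<Longrightarrow> \<phi> \<in> C1c U \<Longrightarrow> U \<subseteq> \<Omega>0 \<Longrightarrow>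
      ennreal \<bar>\<phi> x - (LINT y|lborel. indicator (B z (ennreal r)) y * \<phi> y) / measure lborel (B z (ennreal r))\<bar>
      \<le> ennreal C * (\<integral>\<^sup>+y. ennreal (norm (Xcl X \<phi> y)) * (ker x y * indicator (B z (ennreal (c * r))) y) \<partial>lborel)"
    using representation_formula by blast
  \<comment> \<open>(2 C)^p and \<alpha>^(p-1) stem from \<open>ennreal_powr_optimize\<close>, and
    CK \<alpha> from the integral in x; inserting \<alpha> = 2 CK c r leaves Q r^p. The bound
    \<open>rK / c\<close> on r keeps the enlarged radius c r within the range of doubling.\<close>
  define Q where "Q = (2 * C) powr p * (2 * CK * c) powr p * CK"
  show ?thesis
  proof (rule that[of "rK / c" Q])
    show "0 < rK / c" "0 < Q" using rC cC by (auto simp: Q_def)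
    fix \<phi> r assume \<phi>: "\<phi> \<in> C1c \<Omega>" and r: "0 < r" "r \<le> rK / c"
    have cr: "0 < c * r" "c * r \<le> rK" using r cC by (auto simp: field_simps)
    note q = C1cD[OF \<phi> \<Omega>sub]
    note [measurable] = q(6) q(7)
    let ?f = "\<lambda>y. norm (Xcl X \<phi> y)"
    let ?I = "\<lambda>x y. ker x y * indicator (B x (ennreal (c * r))) y"
    let ?A = "\<lambda>x. (LINT y|lborel. indicator (B x (ennreal r)) y * \<phi> y) / measure lborel (B x (ennreal r))"
    define \<alpha> where "\<alpha> = 2 * CK * (c * r)"
    have \<alpha>: "0 < \<alpha>" using rC cr by (simp add: \<alpha>_def)
    define W where "W x = (\<integral>\<^sup>+y. ennreal (?f y powr p) * ?I x y \<partial>lborel)" for x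
    let ?c1 = "ennreal ((2 * C) powr p * \<alpha> powr (p - 1))"
    have Im: "?I x \<in> borel_measurable borel" if "x \<in> \<Omega>0" for x
    proof -
      have [measurable]: "B x (ennreal (c * r)) \<in> sets borel" using open_B[OF that] by simp
      show ?thesis by measurable
    qed
    have pt: "ennreal (\<bar>\<phi> x - ?A x\<bar> powr p) \<le> ?c1 * W x" if x: "x \<in> \<Omega>" for x
    proof (rule ennreal_powr_optimize[OF _ \<alpha> cC(2) p])
      have xK: "x \<in> K" "x \<in> \<Omega>0" using x K by auto
      note [measurable] = Im[OF xK(2)]
      fix t :: real assume t: "0 < t"
      have "ennreal \<bar>\<phi> x - ?A x\<bar> \<le> ennreal C * (\<integral>\<^sup>+y. ennreal (?f y) * ?I x y \<partial>lborel)"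
        using xK(2) r \<phi> \<Omega>sub cc_dist_self[OF xK(2), of X] by (intro rep[of x r x \<phi> \<Omega>]) auto
      also have "(\<integral>\<^sup>+y. ennreal (?f y) * ?I x y \<partial>lborel) \<le> (\<integral>\<^sup>+y. ennreal t * ?I x y + ennreal (t powr (1 - p)) * (ennreal (?f y powr p) * ?I x y) \<partial>lborel)"
      proof (rule nn_integral_mono)
        fix y
        have "ennreal (?f y) \<le> ennreal (t + t powr (1 - p) * ?f y powr p)" by (intro ennreal_leI le_add_powr t p) simp
        also have "\<dots> = ennreal t + ennreal (t powr (1 - p)) * ennreal (?f y powr p)" using t by (simp add: ennreal_mult ennreal_plus)
        finally have "ennreal (?f y) * ?I x y \<le> (ennreal t + ennreal (t powr (1 - p)) * ennreal (?f y powr p)) * ?I x y"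
          by (rule mult_right_mono) simp
        then show "ennreal (?f y) * ?I x y \<le> ennreal t * ?I x y + ennreal (t powr (1 - p)) * (ennreal (?f y powr p) * ?I x y)"
          by (simp only: distrib_right mult.assoc)
      qed
      also have "\<dots> = (\<integral>\<^sup>+y. ennreal t * ?I x y \<partial>lborel) + (\<integral>\<^sup>+y. ennreal (t powr (1 - p)) * (ennreal (?f y powr p) * ?I x y) \<partial>lborel)"
        by (rule nn_integral_add) measurable
      also have "(\<integral>\<^sup>+y. ennreal t * ?I x y \<partial>lborel) = ennreal t * (\<integral>\<^sup>+y. ?I x y \<partial>lborel)"
        by (rule nn_integral_cmult) measurable
      also have "(\<integral>\<^sup>+y. ennreal (t powr (1 - p)) * (ennreal (?f y powr p) * ?I x y) \<partial>lborel) = ennreal (t powr (1 - p)) * W x"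
        unfolding W_def by (rule nn_integral_cmult) measurable
      also have "(\<integral>\<^sup>+y. ?I x y \<partial>lborel) \<le> ennreal \<alpha>"
        unfolding \<alpha>_def using xK rC cr by (intro ker_integral_right[where rK=rK]) auto
      also have "ennreal t * ennreal \<alpha> = ennreal (t * \<alpha>)" using t \<alpha> by (simp add: ennreal_mult)
      finally show "ennreal \<bar>\<phi> x - ?A x\<bar> \<le> ennreal C * (ennreal (t * \<alpha>) + ennreal (t powr (1 - p)) * W x)"
        by (simp add: mult_left_mono add_right_mono)
    qed simp
    \<comment> \<open>For joint measurability the ball is written as a condition on the pair (x, y);
      on K this agrees with the indicator of the ball.\<close>
    let ?J = "\<lambda>x y. indicator K x * (ker x y * indicator {y\<in>\<Omega>0. x \<in> \<Omega>0 \<and> d x y < ennreal (c * r)} y)"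
    have J: "?J x y = indicator K x * ?I x y" for x y
      using K by (auto simp: cc_ball_def split: split_indicator)
    have "(\<integral>\<^sup>+x. indicator \<Omega> x * ennreal (\<bar>\<phi> x - ?A x\<bar> powr p) \<partial>lborel) \<le> (\<integral>\<^sup>+x. ?c1 * (\<integral>\<^sup>+y. ennreal (?f y powr p) * ?J x y \<partial>lborel) \<partial>lborel)"
    proof (rule nn_integral_mono)
      fix x
      show "indicator \<Omega> x * ennreal (\<bar>\<phi> x - ?A x\<bar> powr p) \<le> ?c1 * (\<integral>\<^sup>+y. ennreal (?f y powr p) * ?J x y \<partial>lborel)"
      proof (cases "x \<in> \<Omega>")
        case True
        then have "x \<in> K" using K by auto
        then have "(\<integral>\<^sup>+y. ennreal (?f y powr p) * ?J x y \<partial>lborel) = W x" unfolding W_def J by simp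
        then show ?thesis using pt[OF True] True by simp
      qed simp
    qed
    also have "\<dots> = ?c1 * (\<integral>\<^sup>+x. (\<integral>\<^sup>+y. ennreal (?f y powr p) * ?J x y \<partial>lborel) \<partial>lborel)"
      by (rule nn_integral_cmult) measurable
    also have "(\<integral>\<^sup>+x. (\<integral>\<^sup>+y. ennreal (?f y powr p) * ?J x y \<partial>lborel) \<partial>lborel) = (\<integral>\<^sup>+y. (\<integral>\<^sup>+x. ennreal (?f y powr p) * ?J x y \<partial>lborel) \<partial>lborel)"
      by (rule lborel_pair.Fubini'[symmetric]) measurable
    also have "\<dots> \<le> (\<integral>\<^sup>+y. ennreal (CK * \<alpha>) * ennreal (?f y powr p) \<partial>lborel)"
    proof (rule nn_integral_mono)
      fix y
      have "(\<integral>\<^sup>+x. ennreal (?f y powr p) * ?J x y \<partial>lborel) = ennreal (?f y powr p) * (\<integral>\<^sup>+x. ?J x y \<partial>lborel)"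
        by (rule nn_integral_cmult) measurable
      also have "\<dots> \<le> ennreal (?f y powr p) * ennreal (CK * \<alpha>)"
      proof (cases "y \<in> \<Omega>")
        case True
        then have y: "y \<in> K" using K by auto
        have "(\<integral>\<^sup>+x. ?J x y \<partial>lborel) \<le> ennreal (2 * CK\<^sup>2 * (c * r))"
          unfolding J using K(2) y cr rC by (intro ker_integral_left[where rK=rK]) auto
        also have "2 * CK\<^sup>2 * (c * r) = CK * \<alpha>" by (simp add: \<alpha>_def power2_eq_square)
        finally show ?thesis by (rule mult_left_mono) simp
      next
        case False
        then show ?thesis using q(9) by simp
      qed
      finally show "(\<integral>\<^sup>+x. ennreal (?f y powr p) * ?J x y \<partial>lborel) \<le> ennreal (CK * \<alpha>) * ennreal (?f y powr p)"
        by (simp only: mult.commute)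
    qed
    also have "\<dots> = ennreal (CK * \<alpha>) * (\<integral>\<^sup>+y. ennreal (?f y powr p) \<partial>lborel)" by (rule nn_integral_cmult) measurable
    also have "?c1 * (ennreal (CK * \<alpha>) * (\<integral>\<^sup>+y. ennreal (?f y powr p) \<partial>lborel)) = ennreal (Q * r powr p) * (\<integral>\<^sup>+y. ennreal (?f y powr p) \<partial>lborel)"
    proof -
      have "(2 * C) powr p * \<alpha> powr (p - 1) * (CK * \<alpha>) = (2 * C) powr p * CK * (\<alpha> powr (p - 1) * \<alpha> powr 1)" using \<alpha> by simp
      also have "\<alpha> powr (p - 1) * \<alpha> powr 1 = \<alpha> powr (p - 1 + 1)" by (rule powr_add[symmetric])
      also have "p - 1 + 1 = p" by simp
      also have "\<alpha> powr p = (2 * CK * c) powr p * r powr p" using rC cC r by (simp add: \<alpha>_def powr_mult mult_ac)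
      finally have "(2 * C) powr p * \<alpha> powr (p - 1) * (CK * \<alpha>) = Q * r powr p" by (simp add: Q_def mult_ac)
      then have "?c1 * ennreal (CK * \<alpha>) = ennreal (Q * r powr p)" using rC \<alpha> by (simp add: ennreal_mult[symmetric])
      then show ?thesis by (simp only: mult.assoc[symmetric])
    qed
    finally show "(\<integral>\<^sup>+x. indicator \<Omega> x * ennreal (\<bar>\<phi> x - ?A x\<bar> powr p) \<partial>lborel) \<le> ennreal (Q * r powr p) * (\<integral>\<^sup>+y. ennreal (?f y powr p) \<partial>lborel)"
      by (meson mult_left_mono order_trans zero_le)
  qed
qed

end

section \<open>Compactness and the div-curl argument\<close>

context cc_space
begin

lemma strong_Lp_convergence:
  assumes \<Omega>: "open \<Omega>" "bounded \<Omega>" "closure \<Omega> \<subseteq> \<Omega>0" "\<Omega> \<noteq> {}" and p: "1 < p"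
    and \<phi>: "\<And>h. \<phi> h \<in> C1c \<Omega>" and G: "0 \<le> G" "\<And>h::nat. (\<integral>\<^sup>+y. ennreal (norm (Xcl X (\<phi> h) y) powr p) \<partial>lborel) \<le> ennreal G"
    and weak: "\<And>S. S \<in> sets borel \<Longrightarrow> (\<lambda>h. LINT y|lborel. indicator S y * \<phi> h y) \<longlonglongrightarrow> 0"
    and \<epsilon>: "0 < \<epsilon>"
  shows "\<forall>\<^sub>F h in sequentially. (\<integral>\<^sup>+x. indicator \<Omega> x * ennreal (\<bar>\<phi> h x\<bar> powr p) \<partial>lborel) \<le> ennreal \<epsilon>"
proof -
  have \<Omega>sub: "\<Omega> \<subseteq> \<Omega>0" using \<Omega>(3) closure_subset by blast
  have [measurable]: "\<Omega> \<in> sets borel" using \<Omega> by auto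
  note q = C1cD[OF \<phi> \<Omega>sub]
  note [measurable] = q(6) q(7)
  obtain r0 Q where r0: "0 < r0" "0 < Q" and osc:
    "\<And>\<phi> r. \<phi> \<in> C1c \<Omega> \<Longrightarrow> 0 < r \<Longrightarrow> r \<le> r0 \<Longrightarrow>
      (\<integral>\<^sup>+x. indicator \<Omega> x * ennreal (\<bar>\<phi> x - (LINT y|lborel. indicator (B x (ennreal r)) y * \<phi> y) / measure lborel (B x (ennreal r))\<bar> powr p) \<partial>lborel)
      \<le> ennreal (Q * r powr p) * (\<integral>\<^sup>+y. ennreal (norm (Xcl X \<phi> y) powr p) \<partial>lborel)"
    using mean_oscillation_Lp[OF \<Omega>(1-3) p] by blast
  \<comment> \<open>The radius r is fixed here, before h grows, so that 2^p times the oscillation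
    bound Q r^p G is at most \<open>\<epsilon> / 2\<close>. Taking \<open>G + 1\<close> keeps the
    divisor of \<open>\<epsilon>\<close> positive.\<close>
  define D where "D = 2 powr p * (Q * (G + 1))"
  have D: "0 < D" using r0 G by (simp add: D_def)
  define s where "s = \<epsilon> / (2 * D)"
  have s: "0 < s" using \<epsilon> D by (simp add: s_def)
  define r where "r = min r0 (s powr (1/p))"
  have r: "0 < r" "r \<le> r0" using r0 s by (auto simp: r_def)
  have "r powr p \<le> (s powr (1/p)) powr p" using r p by (intro powr_mono2) (auto simp: r_def)
  also have "\<dots> = s" using s p by (simp add: powr_powr)
  finally have "2 powr p * (Q * r powr p * G) \<le> 2 powr p * (Q * s * (G + 1))"
    using r0 G s by (intro mult_left_mono mult_mono) auto
  also have "\<dots> = D * s" by (simp add: D_def)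
  also have "\<dots> = \<epsilon> / 2" using D by (simp add: s_def)
  finally have small: "2 powr p * (Q * r powr p * G) \<le> \<epsilon> / 2" .
  define K where "K = closure \<Omega>"
  have K: "compact K" "K \<subseteq> \<Omega>0" "\<Omega> \<subseteq> K" using \<Omega> closure_subset by (auto simp: K_def)
  obtain m where m: "0 < m" "\<And>x. x \<in> K \<Longrightarrow> ennreal m \<le> emeasure lborel (B x (ennreal r))"
    using emeasure_B_lower_bound[OF K(1,2) r(1)] by blast
  have "emeasure lborel \<Omega> < \<infinity>" using \<Omega>(2) by (rule emeasure_bounded_finite)
  then obtain v where v: "emeasure lborel \<Omega> = ennreal v" "0 \<le> v" by (cases "emeasure lborel \<Omega>") auto
  obtain A where A: "0 < A" "\<And>\<phi>. \<phi> \<in> C1c \<Omega> \<Longrightarrow> (\<integral>\<^sup>+x. indicator \<Omega> x * ennreal \<bar>\<phi> x\<bar> \<partial>lborel) \<le> ennreal A * (\<integral>\<^sup>+y. ennreal (norm (Xcl X \<phi> y)) \<partial>lborel)"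
    using L1_Poincare[OF \<Omega>] by blast
  define N where "N = A * (v + G)"
  have N: "0 \<le> N" using A v G by (simp add: N_def)
  \<comment> \<open>The Poincare inequality bounds the L^1 norms by N; with the volume bound m, all
    means over balls of radius r about points of \<open>\<Omega>\<close> are at most N / m. This
    constant dominates them below.\<close>
  have L1: "(\<integral>\<^sup>+x. ennreal \<bar>\<phi> h x\<bar> \<partial>lborel) \<le> ennreal N" for h
  proof -
    have "(\<integral>\<^sup>+x. ennreal \<bar>\<phi> h x\<bar> \<partial>lborel) = (\<integral>\<^sup>+x. indicator \<Omega> x * ennreal \<bar>\<phi> h x\<bar> \<partial>lborel)"
      using q(8) by (intro nn_integral_cong) (auto split: split_indicator)
    also have "\<dots> \<le> ennreal A * (\<integral>\<^sup>+y. ennreal (norm (Xcl X (\<phi> h) y)) \<partial>lborel)" by (rule A(2)[OF \<phi>])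
    also have "(\<integral>\<^sup>+y. ennreal (norm (Xcl X (\<phi> h) y)) \<partial>lborel) \<le> (\<integral>\<^sup>+y. indicator \<Omega> y + ennreal (norm (Xcl X (\<phi> h) y) powr p) \<partial>lborel)"
    proof (rule nn_integral_mono)
      fix y
      show "ennreal (norm (Xcl X (\<phi> h) y)) \<le> indicator \<Omega> y + ennreal (norm (Xcl X (\<phi> h) y) powr p)"
      proof (cases "y \<in> \<Omega>")
        case True
        have "norm (Xcl X (\<phi> h) y) \<le> 1 + norm (Xcl X (\<phi> h) y) powr p"
          using le_add_powr[of "norm (Xcl X (\<phi> h) y)" 1 p] p by simp
        then have "ennreal (norm (Xcl X (\<phi> h) y)) \<le> ennreal (1 + norm (Xcl X (\<phi> h) y) powr p)" by (rule ennreal_leI)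
        then show ?thesis using True by simp
      next
        case False
        then show ?thesis using q(9) by simp
      qed
    qed
    also have "\<dots> = ennreal v + (\<integral>\<^sup>+y. ennreal (norm (Xcl X (\<phi> h) y) powr p) \<partial>lborel)"
      by (subst nn_integral_add) (auto simp: v(1))
    also have "\<dots> \<le> ennreal v + ennreal G" by (intro add_left_mono G)
    also have "ennreal A * (ennreal v + ennreal G) = ennreal N"
      using A v G by (simp add: N_def ennreal_mult ennreal_plus)
    finally show ?thesis by (simp add: mult_left_mono)
  qed
  have \<phi>i: "integrable lborel (\<phi> h)" for h
    using L1[of h] by (intro integrableI_bounded) (auto simp: le_less_trans)
  have \<phi>n: "(LINT x|lborel. \<bar>\<phi> h x\<bar>) \<le> N" for h
    by (rule integral_real_bounded[OF N]) (rule L1)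
  define a where "a h x = (LINT y|lborel. indicator (B x (ennreal r)) y * \<phi> h y) / measure lborel (B x (ennreal r))" for h x
  have Bb: "B x (ennreal r) \<in> sets borel" if "x \<in> \<Omega>" for x using open_B[of x] that \<Omega>sub by auto
  have a_bound: "\<bar>a h x\<bar> \<le> N / m" if x: "x \<in> \<Omega>" for h x
  proof (cases "emeasure lborel (B x (ennreal r)) = \<infinity>")
    case True
    then have "measure lborel (B x (ennreal r)) = 0" by (simp add: measure_def)
    then show ?thesis using N m by (simp add: a_def)
  next
    case False
    then have fin: "emeasure lborel (B x (ennreal r)) = ennreal (measure lborel (B x (ennreal r)))"
      by (simp add: emeasure_eq_ennreal_measure)
    have "x \<in> K" using x K by auto
    then have m': "m \<le> measure lborel (B x (ennreal r))" using m(2)[of x] m(1) by (simp add: fin ennreal_le_iff)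
    have "\<bar>LINT y|lborel. indicator (B x (ennreal r)) y * \<phi> h y\<bar> \<le> (LINT y|lborel. \<bar>indicator (B x (ennreal r)) y * \<phi> h y\<bar>)"
      by (rule integral_abs_bound)
    also have "\<dots> \<le> (LINT y|lborel. \<bar>\<phi> h y\<bar>)"
      using \<phi>i[of h] Bb[OF x] by (intro integral_mono integrable_abs integrable_real_mult_indicator[where f="\<phi> h", simplified mult.commute[of "\<phi> h _"]])
         (auto simp: abs_mult split: split_indicator)
    also have "\<dots> \<le> N" by (rule \<phi>n)
    finally have "\<bar>LINT y|lborel. indicator (B x (ennreal r)) y * \<phi> h y\<bar> \<le> N" .
    then have "\<bar>LINT y|lborel. indicator (B x (ennreal r)) y * \<phi> h y\<bar> / measure lborel (B x (ennreal r)) \<le> N / m"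
      using m' m N by (intro frac_le) auto
    then show ?thesis using m' m by (simp add: a_def)
  qed
  have a_lim: "(\<lambda>h. a h x) \<longlonglongrightarrow> 0" if x: "x \<in> \<Omega>" for x
    using tendsto_divide_zero[OF weak[OF Bb[OF x]]] by (simp add: a_def)
  \<comment> \<open>A measurable version of the means: it equals \<open>a\<close> on
    \<open>\<Omega>\<close> and is 0 at centres outside \<open>\<Omega>0\<close>.\<close>
  define a' where "a' h x = (LINT y|lborel. indicator {y\<in>\<Omega>0. x \<in> \<Omega>0 \<and> dd x y < ennreal r} y * \<phi> h y) / enn2real (emeasure lborel (B x (ennreal r)) * indicator \<Omega>0 x)" for h x
  have a': "a h x = a' h x" if x: "x \<in> \<Omega>" for h x
  proof -
    have "{y\<in>\<Omega>0. x \<in> \<Omega>0 \<and> dd x y < ennreal r} = B x (ennreal r)" using x \<Omega>sub by (auto simp: cc_ball_def dd_def)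
    then show ?thesis using x \<Omega>sub by (simp add: a_def a'_def measure_def subset_iff)
  qed
  have [measurable]: "a' h \<in> borel_measurable borel" for h
  proof -
    have "(\<lambda>x. LINT y|lborel. indicator {y\<in>\<Omega>0. x \<in> \<Omega>0 \<and> dd x y < ennreal r} y * \<phi> h y) \<in> borel_measurable borel"
    proof (rule lborel.borel_measurable_lebesgue_integral)
      have "(\<lambda>p. indicator {p\<in>space (borel \<Otimes>\<^sub>M lborel). snd p \<in> \<Omega>0 \<and> fst p \<in> \<Omega>0 \<and> dd (fst p) (snd p) < ennreal r} p * \<phi> h (snd p)) \<in> borel_measurable (borel \<Otimes>\<^sub>M lborel)"
        by measurable
      then show "(\<lambda>(x, y). indicator {y\<in>\<Omega>0. x \<in> \<Omega>0 \<and> dd x y < ennreal r} y * \<phi> h y) \<in> borel_measurable (borel \<Otimes>\<^sub>M lborel)"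
        by (rule measurable_cong[THEN iffD1, rotated]) (auto simp: space_pair_measure split: split_indicator)
    qed
    then show ?thesis unfolding a'_def[abs_def] by measurable
  qed
  define b where "b h = (LINT x|lborel. indicator \<Omega> x * (\<bar>a' h x\<bar> powr p))" for h
  have ib: "integrable lborel (\<lambda>x. indicator \<Omega> x * (N / m) powr p)"
    using v by (intro integrable_mult_left integrable_real_indicator) auto
  have bdd: "\<bar>indicator \<Omega> x * (\<bar>a' h x\<bar> powr p)\<bar> \<le> indicator \<Omega> x * (N / m) powr p" for h x
    using a_bound[of x h] a'[of x h] p by (auto split: split_indicator intro!: powr_mono2)
  have "b \<longlonglongrightarrow> (LINT x|lborel. (0::real) * indicator \<Omega> x)"
    unfolding b_def
  proof (rule integral_dominated_convergence[where w="\<lambda>x. indicator \<Omega> x * (N / m) powr p"])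
    show "AE x in lborel. (\<lambda>h. indicator \<Omega> x * (\<bar>a' h x\<bar> powr p)) \<longlonglongrightarrow> 0 * indicator \<Omega> x"
    proof (rule AE_I2)
      fix x
      show "(\<lambda>h. indicator \<Omega> x * (\<bar>a' h x\<bar> powr p)) \<longlonglongrightarrow> 0 * indicator \<Omega> x"
      proof (cases "x \<in> \<Omega>")
        case True
        then have "(\<lambda>h. \<bar>a' h x\<bar>) \<longlonglongrightarrow> 0" using tendsto_rabs_zero[OF a_lim[OF True]] by (simp add: a')
        then have "(\<lambda>h. \<bar>a' h x\<bar> powr p) \<longlonglongrightarrow> 0" using p by (intro tendsto_zero_powrI[where b=p]) auto
        then show ?thesis using True by simp
      qed simp
    qed
    show "AE x in lborel. norm (indicator \<Omega> x * (\<bar>a' h x\<bar> powr p)) \<le> indicator \<Omega> x * (N / m) powr p" for h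
      using bdd by (intro AE_I2) simp
  qed (use ib in auto)
  then have b0: "b \<longlonglongrightarrow> 0" by simp
  have nb: "(\<integral>\<^sup>+x. indicator \<Omega> x * ennreal (\<bar>a' h x\<bar> powr p) \<partial>lborel) = ennreal (b h)" for h
  proof -
    have "(\<integral>\<^sup>+x. indicator \<Omega> x * ennreal (\<bar>a' h x\<bar> powr p) \<partial>lborel) = (\<integral>\<^sup>+x. ennreal (indicator \<Omega> x * (\<bar>a' h x\<bar> powr p)) \<partial>lborel)"
      by (intro nn_integral_cong) (auto split: split_indicator)
    also have "\<dots> = ennreal (b h)" unfolding b_def
    proof (rule nn_integral_eq_integral)
      show "integrable lborel (\<lambda>x. indicator \<Omega> x * (\<bar>a' h x\<bar> powr p))"
        by (rule Bochner_Integration.integrable_bound[OF ib]) (use bdd[of _ h] in \<open>auto intro!: AE_I2 intro: order_trans\<close>)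
    qed simp
    finally show ?thesis .
  qed
  have bn: "0 \<le> b h" for h unfolding b_def by (intro integral_nonneg_AE AE_I2) simp
  have main: "(\<integral>\<^sup>+x. indicator \<Omega> x * ennreal (\<bar>\<phi> h x\<bar> powr p) \<partial>lborel) \<le> ennreal (\<epsilon> / 2 + 2 powr p * b h)" for h
  proof -
    have "(\<integral>\<^sup>+x. indicator \<Omega> x * ennreal (\<bar>\<phi> h x\<bar> powr p) \<partial>lborel)
      \<le> (\<integral>\<^sup>+x. ennreal (2 powr p) * (indicator \<Omega> x * ennreal (\<bar>\<phi> h x - a' h x\<bar> powr p) + indicator \<Omega> x * ennreal (\<bar>a' h x\<bar> powr p)) \<partial>lborel)"
    proof (rule nn_integral_mono)
      fix x
      have "\<bar>\<phi> h x\<bar> powr p \<le> (\<bar>\<phi> h x - a' h x\<bar> + \<bar>a' h x\<bar>) powr p" using p by (intro powr_mono2) auto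
      also have "\<dots> \<le> 2 powr p * (\<bar>\<phi> h x - a' h x\<bar> powr p + \<bar>a' h x\<bar> powr p)" using p by (intro powr_add_le) auto
      finally have "ennreal (\<bar>\<phi> h x\<bar> powr p) \<le> ennreal (2 powr p * (\<bar>\<phi> h x - a' h x\<bar> powr p + \<bar>a' h x\<bar> powr p))" by (rule ennreal_leI)
      also have "\<dots> = ennreal (2 powr p) * (ennreal (\<bar>\<phi> h x - a' h x\<bar> powr p) + ennreal (\<bar>a' h x\<bar> powr p))"
        by (simp add: ennreal_mult ennreal_plus)
      finally show "indicator \<Omega> x * ennreal (\<bar>\<phi> h x\<bar> powr p) \<le>
         ennreal (2 powr p) * (indicator \<Omega> x * ennreal (\<bar>\<phi> h x - a' h x\<bar> powr p) + indicator \<Omega> x * ennreal (\<bar>a' h x\<bar> powr p))"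
        by (cases "x \<in> \<Omega>") auto
    qed
    also have "\<dots> = ennreal (2 powr p) * ((\<integral>\<^sup>+x. indicator \<Omega> x * ennreal (\<bar>\<phi> h x - a' h x\<bar> powr p) \<partial>lborel) + (\<integral>\<^sup>+x. indicator \<Omega> x * ennreal (\<bar>a' h x\<bar> powr p) \<partial>lborel))"
      by (simp add: nn_integral_cmult nn_integral_add)
    also have "(\<integral>\<^sup>+x. indicator \<Omega> x * ennreal (\<bar>\<phi> h x - a' h x\<bar> powr p) \<partial>lborel) = (\<integral>\<^sup>+x. indicator \<Omega> x * ennreal (\<bar>\<phi> h x - a h x\<bar> powr p) \<partial>lborel)"
      by (intro nn_integral_cong) (auto simp: a' split: split_indicator)
    also have "ennreal (2 powr p) * ((\<integral>\<^sup>+x. indicator \<Omega> x * ennreal (\<bar>\<phi> h x - a h x\<bar> powr p) \<partial>lborel) + (\<integral>\<^sup>+x. indicator \<Omega> x * ennreal (\<bar>a' h x\<bar> powr p) \<partial>lborel))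
        \<le> ennreal (2 powr p) * (ennreal (Q * r powr p) * ennreal G + ennreal (b h))"
    proof (intro mult_left_mono add_mono)
      have "(\<integral>\<^sup>+x. indicator \<Omega> x * ennreal (\<bar>\<phi> h x - a h x\<bar> powr p) \<partial>lborel) \<le> ennreal (Q * r powr p) * (\<integral>\<^sup>+y. ennreal (norm (Xcl X (\<phi> h) y) powr p) \<partial>lborel)"
        unfolding a_def by (rule osc[OF \<phi> r])
      also have "\<dots> \<le> ennreal (Q * r powr p) * ennreal G" by (intro mult_left_mono G) simp
      finally show "(\<integral>\<^sup>+x. indicator \<Omega> x * ennreal (\<bar>\<phi> h x - a h x\<bar> powr p) \<partial>lborel) \<le> ennreal (Q * r powr p) * ennreal G" .
    qed (auto simp: nb)
    also have "\<dots> = ennreal (2 powr p * (Q * r powr p * G) + 2 powr p * b h)"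
      using r0 G bn[of h] by (simp add: ennreal_mult ennreal_plus distrib_left)
    also have "\<dots> \<le> ennreal (\<epsilon> / 2 + 2 powr p * b h)" using small by (intro ennreal_leI) auto
    finally show ?thesis .
  qed
  have "(\<lambda>h. 2 powr p * b h) \<longlonglongrightarrow> 0" using tendsto_mult_right_zero[OF b0] .
  from order_tendstoD(2)[OF this, of "\<epsilon> / 2"] \<epsilon>
  have "\<forall>\<^sub>F h in sequentially. 2 powr p * b h < \<epsilon> / 2" by simp
  then show ?thesis
  proof eventually_elim
    case (elim h)
    show ?case by (rule order_trans[OF main]) (use elim in \<open>auto intro!: ennreal_leI\<close>)
  qed
qed

end

section \<open>The space V: approximation, products, duality\<close>

locale sobolev_setting = cc_space +
  fixes \<Omega> :: "(real^'a) set" and p q :: real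
  assumes \<Omega>: "open \<Omega>" "bounded \<Omega>" "closure \<Omega> \<subseteq> \<Omega>0" "\<Omega> \<noteq> {}"
    and pq: "1 < p" "1 < q" "1/p + 1/q = 1"
begin

abbreviation "Xg \<equiv> Xgrad \<Omega> X"

text \<open>Limits and bounds are computed for the p-th power of the norm. There a quasi-triangle
  inequality with constant 2^p follows by integrating a pointwise estimate and takes the place of
  Minkowski's inequality.\<close>

definition Lp_pow :: "(real^'a \<Rightarrow> 'c::euclidean_space) \<Rightarrow> real" where
  "Lp_pow f = (LINT x|lebesgue_on \<Omega>. norm (f x) powr p)"

lemma \<Omega>_sub: "\<Omega> \<subseteq> \<Omega>0" using \<Omega>(3) closure_subset by blast

lemma \<Omega>_lebesgue: "\<Omega> \<in> sets lebesgue" using \<Omega>(1) by simp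

lemma \<Omega>_lmeasurable: "\<Omega> \<in> lmeasurable" using \<Omega>(1,2) by (simp add: lmeasurable_open)

lemma Lp_norm_pow: "Lp_norm p \<Omega> f = Lp_pow f powr (1/p)" by (simp add: Lp_norm_def Lp_pow_def)

lemma Lp_pow_nonneg: "0 \<le> Lp_pow f" by (simp add: Lp_pow_def)

lemma Lp_pow_eq_Lp_norm: "Lp_pow f = Lp_norm p \<Omega> f powr p"
  using pq Lp_pow_nonneg[of f] by (simp add: Lp_norm_pow powr_powr)

lemma Lp_pow_add_le:
  assumes "f \<in> Lp p \<Omega>" "g \<in> Lp p \<Omega>"
  shows "Lp_pow (\<lambda>x. f x + g x) \<le> 2 powr p * (Lp_pow f + Lp_pow g)"
proof -
  note i = Lp_D(2)[OF assms(1)] Lp_D(2)[OF assms(2)] Lp_D(2)[OF Lp_add[OF _ assms]]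
  have "Lp_pow (\<lambda>x. f x + g x) \<le> (LINT x|lebesgue_on \<Omega>. 2 powr p * (norm (f x) powr p + norm (g x) powr p))"
    unfolding Lp_pow_def
  proof (rule integral_mono)
    show "norm (f x + g x) powr p \<le> 2 powr p * (norm (f x) powr p + norm (g x) powr p)" for x
    proof -
      have "norm (f x + g x) powr p \<le> (norm (f x) + norm (g x)) powr p" using pq by (intro powr_mono2 norm_triangle_ineq) auto
      also have "\<dots> \<le> 2 powr p * (norm (f x) powr p + norm (g x) powr p)" using pq by (intro powr_add_le) auto
      finally show ?thesis .
    qed
  qed (use i pq in auto)
  also have "\<dots> = 2 powr p * (Lp_pow f + Lp_pow g)" using i by (simp add: Lp_pow_def)
  finally show ?thesis .
qed

lemma Lp_pow_scaleR: "Lp_pow (\<lambda>x. a *\<^sub>R f x) = \<bar>a\<bar> powr p * Lp_pow f"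
  by (simp add: Lp_pow_def powr_mult)

lemma Lp_pow_cong_AE:
  assumes "f \<in> Lp p \<Omega>" "g \<in> Lp p \<Omega>" "AE x in lebesgue_on \<Omega>. g x = f x"
  shows "Lp_pow g = Lp_pow f"
  using Lp_norm_cong_AE[OF assms] by (simp add: Lp_pow_eq_Lp_norm)

lemma Lp_pow_mono_mult:
  assumes "f \<in> Lp p \<Omega>" "g \<in> Lp p \<Omega>" "0 \<le> C" "\<And>x. norm (g x) \<le> C * norm (f x)"
  shows "Lp_pow g \<le> C powr p * Lp_pow f"
proof -
  have "Lp_pow g \<le> (LINT x|lebesgue_on \<Omega>. C powr p * norm (f x) powr p)"
    unfolding Lp_pow_def
  proof (rule integral_mono)
    show "norm (g x) powr p \<le> C powr p * norm (f x) powr p" for x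
    proof -
      have "norm (g x) powr p \<le> (C * norm (f x)) powr p" using pq assms(4) by (intro powr_mono2) auto
      then show ?thesis using assms(3) by (simp add: powr_mult)
    qed
  qed (use Lp_D(2)[OF assms(1)] Lp_D(2)[OF assms(2)] in auto)
  then show ?thesis by (simp add: Lp_pow_def)
qed

lemma Lp_integrable: "f \<in> Lp p \<Omega> \<Longrightarrow> integrable (lebesgue_on \<Omega>) f"
  using pq by (intro Lp_imp_integrable[OF \<Omega>_lmeasurable]) auto

lemma L1_le_Lp:
  obtains c where "0 \<le> c" "\<And>f :: real^'a \<Rightarrow> 'c::euclidean_space. f \<in> Lp p \<Omega> \<Longrightarrow> (LINT x|lebesgue_on \<Omega>. norm (f x)) \<le> c * Lp_norm p \<Omega> f"
proof -
  have one: "(\<lambda>_. 1::real) \<in> Lp q \<Omega>"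
    using \<Omega>_lmeasurable by (simp add: Lp_def integrable_restrict_space fmeasurableD lmeasurable_iff_integrable)
  show ?thesis
  proof (rule that[of "Lp_norm q \<Omega> (\<lambda>_. 1::real)"])
    fix f :: "real^'a \<Rightarrow> 'c::euclidean_space" assume f: "f \<in> Lp p \<Omega>"
    then have "(\<lambda>x. norm (f x)) \<in> Lp p \<Omega>" by (auto simp: Lp_def)
    from Lp_Holder(2)[OF this one pq] show "(LINT x|lebesgue_on \<Omega>. norm (f x)) \<le> Lp_norm q \<Omega> (\<lambda>_. 1::real) * Lp_norm p \<Omega> f"
      by (simp add: Lp_norm_def mult.commute abs_if split: if_splits)
  qed (rule Lp_norm_nonneg)
qed

lemma W1pD:
  assumes "u \<in> W1p p \<Omega> X"
  shows "u \<in> Lp p \<Omega>" "integrable (lebesgue_on \<Omega>) u" "has_Xgrad \<Omega> X u (Xg u)" "Xg u \<in> Lp p \<Omega>"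
proof -
  obtain G where G: "u \<in> Lp p \<Omega>" "G \<in> Lp p \<Omega>" "has_Xgrad \<Omega> X u G" using assms by (auto simp: W1p_def)
  show "u \<in> Lp p \<Omega>" by fact
  then show "integrable (lebesgue_on \<Omega>) u" by (rule Lp_integrable)
  show "has_Xgrad \<Omega> X u (Xg u)" by (rule has_Xgrad_Xgrad[OF G(3)])
  show "Xg u \<in> Lp p \<Omega>" by (rule Lp_cong_AE[OF \<Omega>_lebesgue G(2) Xgrad_AE_eq[OF \<Omega>(1) G(3)]])
qed

text \<open>Gradients combine only almost everywhere, because \<open>Xgrad\<close> picks a
  representative for each function separately.\<close>

lemma W1p_linear:
  assumes u: "u \<in> W1p p \<Omega> X" and v: "v \<in> W1p p \<Omega> X"
  shows "(\<lambda>x. a * u x + b * v x) \<in> W1p p \<Omega> X"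
    and "AE x in lebesgue_on \<Omega>. Xg (\<lambda>x. a * u x + b * v x) x = a *\<^sub>R Xg u x + b *\<^sub>R Xg v x"
proof -
  have h: "has_Xgrad \<Omega> X (\<lambda>x. a * u x + b * v x) (\<lambda>x. a *\<^sub>R Xg u x + b *\<^sub>R Xg v x)"
    by (rule has_Xgrad_linear[OF \<Omega>(1) \<Omega>_sub W1pD(2,3)[OF u] W1pD(2,3)[OF v]])
  have "(\<lambda>x. a *\<^sub>R u x + b *\<^sub>R v x) \<in> Lp p \<Omega>" "(\<lambda>x. a *\<^sub>R Xg u x + b *\<^sub>R Xg v x) \<in> Lp p \<Omega>"
    using pq by (intro Lp_add Lp_scaleR W1pD[OF u] W1pD[OF v]; simp)+
  then show "(\<lambda>x. a * u x + b * v x) \<in> W1p p \<Omega> X" using h by (auto simp: W1p_def)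
  show "AE x in lebesgue_on \<Omega>. Xg (\<lambda>x. a * u x + b * v x) x = a *\<^sub>R Xg u x + b *\<^sub>R Xg v x"
    by (rule Xgrad_AE_eq[OF \<Omega>(1) h])
qed

lemma W1p_diff:
  assumes u: "u \<in> W1p p \<Omega> X" and v: "v \<in> W1p p \<Omega> X"
  shows "(\<lambda>x. u x - v x) \<in> W1p p \<Omega> X" and "AE x in lebesgue_on \<Omega>. Xg (\<lambda>x. u x - v x) x = Xg u x - Xg v x"
  using W1p_linear[OF assms, of 1 "-1"] by auto

lemma Cinfc_bounds:
  assumes \<phi>: "\<phi> \<in> Cinfc \<Omega>"
  obtains C where "0 < C" "\<And>x. \<bar>\<phi> x\<bar> \<le> C" "\<And>x. norm (Xcl X \<phi> x) \<le> C"
    "\<phi> \<in> borel_measurable lebesgue" "Xcl X \<phi> \<in> borel_measurable lebesgue"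
proof -
  note c = CinfcD[OF \<phi>]
  have sub: "closure {x. \<phi> x \<noteq> 0} \<subseteq> \<Omega>0" using c(5) \<Omega>_sub by blast
  obtain B1 where B1: "0 \<le> B1" "\<And>x. \<bar>\<phi> x\<bar> \<le> B1" using bounded_continuous_compact_support[OF c(3,4,6)] by blast
  obtain B2 where B2: "0 \<le> B2" "\<And>x. norm (Xcl X \<phi> x) \<le> B2" using Xcl_bounded[OF c(1,4) sub] by blast
  show ?thesis
  proof (rule that[of "B1 + B2 + 1"])
    show "\<bar>\<phi> x\<bar> \<le> B1 + B2 + 1" "norm (Xcl X \<phi> x) \<le> B1 + B2 + 1" for x using B1 B2(1) B2(2)[of x] B1(2)[of x] by linarith+
    show "\<phi> \<in> borel_measurable lebesgue" by (rule continuous_lebesgue_measurable[OF c(3)])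
    have "Xcl X \<phi> \<in> borel_measurable borel" by (rule Xcl_borel[OF c(1) sub])
    then show "Xcl X \<phi> \<in> borel_measurable lebesgue" by (intro measurable_completion) simp
  qed (use B1 B2 in auto)
qed

lemma W1p_mult:
  assumes u: "u \<in> W1p p \<Omega> X" and \<phi>: "\<phi> \<in> Cinfc \<Omega>"
  shows "(\<lambda>x. \<phi> x * u x) \<in> W1p p \<Omega> X"
    and "AE x in lebesgue_on \<Omega>. Xg (\<lambda>x. \<phi> x * u x) x = \<phi> x *\<^sub>R Xg u x + u x *\<^sub>R Xcl X \<phi> x"
    and "(\<lambda>x. \<phi> x *\<^sub>R u x) \<in> Lp p \<Omega>" "(\<lambda>x. \<phi> x *\<^sub>R Xg u x) \<in> Lp p \<Omega>" "(\<lambda>x. u x *\<^sub>R Xcl X \<phi> x) \<in> Lp p \<Omega>"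
proof -
  obtain C where C: "0 < C" "\<And>x. \<bar>\<phi> x\<bar> \<le> C" "\<And>x. norm (Xcl X \<phi> x) \<le> C"
    "\<phi> \<in> borel_measurable lebesgue" "Xcl X \<phi> \<in> borel_measurable lebesgue" using Cinfc_bounds[OF \<phi>] by blast
  have h: "has_Xgrad \<Omega> X (\<lambda>x. \<phi> x * u x) (\<lambda>x. \<phi> x *\<^sub>R Xg u x + u x *\<^sub>R Xcl X \<phi> x)"
    by (rule has_Xgrad_mult[OF \<Omega>(1) \<Omega>_sub W1pD(2,3)[OF u] \<phi>])
  have p0: "0 \<le> p" using pq by simp
  show a: "(\<lambda>x. \<phi> x *\<^sub>R u x) \<in> Lp p \<Omega>" by (rule Lp_bounded_scaleR[OF W1pD(1)[OF u] C(4,2) p0])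
  show b: "(\<lambda>x. \<phi> x *\<^sub>R Xg u x) \<in> Lp p \<Omega>" by (rule Lp_bounded_scaleR[OF W1pD(4)[OF u] C(4,2) p0])
  show c: "(\<lambda>x. u x *\<^sub>R Xcl X \<phi> x) \<in> Lp p \<Omega>" by (rule Lp_times_bounded[OF W1pD(1)[OF u] C(5,3) p0])
  show "(\<lambda>x. \<phi> x * u x) \<in> W1p p \<Omega> X"
    using a h Lp_add[OF p0 b c] by (auto simp: W1p_def)
  show "AE x in lebesgue_on \<Omega>. Xg (\<lambda>x. \<phi> x * u x) x = \<phi> x *\<^sub>R Xg u x + u x *\<^sub>R Xcl X \<phi> x"
    by (rule Xgrad_AE_eq[OF \<Omega>(1) h])
qed

text \<open>The p-th power of \<open>W1p_norm\<close>, so that errors of approximation split into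
  integrals.\<close>

definition energy :: "(real^'a \<Rightarrow> real) \<Rightarrow> real" where "energy u = Lp_pow u + Lp_pow (Xg u)"

lemma W1p_norm_energy: "W1p_norm p \<Omega> X u = energy u powr (1/p)"
  by (simp add: W1p_norm_def energy_def Lp_pow_def)

lemma energy_nonneg: "0 \<le> energy u" by (simp add: energy_def Lp_pow_nonneg)

lemma W1p0_iff:
  "u \<in> W1p0 p \<Omega> X \<longleftrightarrow> u \<in> W1p p \<Omega> X \<and> (\<forall>e>0. \<exists>\<psi>\<in>C1c \<Omega> \<inter> W1p p \<Omega> X. energy (\<lambda>x. u x - \<psi> x) < e)"
proof -
  have 1: "energy w powr (1/p) < e \<longleftrightarrow> energy w < e powr p" if "0 < e" for w e
  proof
    assume "energy w powr (1/p) < e"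
    then have "(energy w powr (1/p)) powr p < e powr p" using pq by (intro powr_less_mono2) auto
    then show "energy w < e powr p" using pq energy_nonneg[of w] by (simp add: powr_powr)
  next
    assume "energy w < e powr p"
    then have "energy w powr (1/p) < (e powr p) powr (1/p)" using pq energy_nonneg[of w] by (intro powr_less_mono2) auto
    then show "energy w powr (1/p) < e" using pq that by (simp add: powr_powr)
  qed
  have "(\<forall>e>0. \<exists>\<psi>\<in>C1c \<Omega> \<inter> W1p p \<Omega> X. W1p_norm p \<Omega> X (\<lambda>x. u x - \<psi> x) < e) \<longleftrightarrow>
    (\<forall>e>0. \<exists>\<psi>\<in>C1c \<Omega> \<inter> W1p p \<Omega> X. energy (\<lambda>x. u x - \<psi> x) < e)" (is "?L \<longleftrightarrow> ?R")
  proof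
    assume L: ?L
    show ?R
    proof (intro allI impI)
      fix e :: real assume e: "0 < e"
      then have e': "0 < e powr (1/p)" by simp
      obtain \<psi> where \<psi>: "\<psi> \<in> C1c \<Omega> \<inter> W1p p \<Omega> X" "W1p_norm p \<Omega> X (\<lambda>x. u x - \<psi> x) < e powr (1/p)" using L e' by blast
      then have "energy (\<lambda>x. u x - \<psi> x) < (e powr (1/p)) powr p" using 1[OF e'] by (simp add: W1p_norm_energy)
      also have "\<dots> = e" using e pq by (simp add: powr_powr)
      finally show "\<exists>\<psi>\<in>C1c \<Omega> \<inter> W1p p \<Omega> X. energy (\<lambda>x. u x - \<psi> x) < e" using \<psi>(1) by blast
    qed
  next
    assume R: ?R
    show ?L
    proof (intro allI impI)
      fix e :: real assume e: "0 < e"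
      then have "0 < e powr p" by simp
      then obtain \<psi> where "\<psi> \<in> C1c \<Omega> \<inter> W1p p \<Omega> X" "energy (\<lambda>x. u x - \<psi> x) < e powr p" using R by blast
      then show "\<exists>\<psi>\<in>C1c \<Omega> \<inter> W1p p \<Omega> X. W1p_norm p \<Omega> X (\<lambda>x. u x - \<psi> x) < e" using 1[OF e] by (auto simp: W1p_norm_energy)
    qed
  qed
  then show ?thesis by (simp add: W1p0_def)
qed

lemma W1p0_W1p: "u \<in> W1p0 p \<Omega> X \<Longrightarrow> u \<in> W1p p \<Omega> X" by (simp add: W1p0_iff)

text \<open>The estimate for multiplication by a test function: w' stands for \<phi> w, and G and H
  for the two terms \<phi> X w and w X \<phi> of its gradient.\<close>

lemma energy_bound:
  assumes w: "w \<in> W1p p \<Omega> X" and w': "w' \<in> W1p p \<Omega> X" and C: "0 \<le> C" "0 \<le> D"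
    and le: "\<And>x. \<bar>w' x\<bar> \<le> C * \<bar>w x\<bar>"
    and G: "G \<in> Lp p \<Omega>" "H \<in> Lp p \<Omega>" "AE x in lebesgue_on \<Omega>. Xg w' x = G x + H x"
    and GH: "\<And>x. norm (G x) \<le> C * norm (Xg w x)" "\<And>x. norm (H x) \<le> D * \<bar>w x\<bar>"
  shows "energy w' \<le> (C powr p + 2 powr p * (C powr p + D powr p)) * energy w"
proof -
  have 1: "Lp_pow w' \<le> C powr p * Lp_pow w" using le C by (intro Lp_pow_mono_mult W1pD[OF w] W1pD[OF w']) auto
  have 2: "Lp_pow (Xg w') = Lp_pow (\<lambda>x. G x + H x)" using pq by (intro Lp_pow_cong_AE Lp_add G W1pD[OF w']) auto
  have 3: "Lp_pow (\<lambda>x. G x + H x) \<le> 2 powr p * (Lp_pow G + Lp_pow H)" by (rule Lp_pow_add_le[OF G(1,2)])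
  have 4: "Lp_pow G \<le> C powr p * Lp_pow (Xg w)" by (rule Lp_pow_mono_mult[OF W1pD(4)[OF w] G(1) C(1) GH(1)])
  have 5: "Lp_pow H \<le> D powr p * Lp_pow w" using GH(2) by (intro Lp_pow_mono_mult[OF W1pD(1)[OF w] G(2) C(2)]) auto
  have 6: "2 powr p * (Lp_pow G + Lp_pow H) \<le> 2 powr p * (C powr p * Lp_pow (Xg w) + D powr p * Lp_pow w)"
    by (intro mult_left_mono add_mono 4 5) auto
  have "energy w' \<le> C powr p * Lp_pow w + 2 powr p * (C powr p * Lp_pow (Xg w) + D powr p * Lp_pow w)"
    unfolding energy_def 2 using 1 3 6 by linarith
  also have "\<dots> \<le> (C powr p + 2 powr p * (C powr p + D powr p)) * energy w"
  proof -
    have "0 \<le> C powr p * Lp_pow (Xg w)" "0 \<le> 2 powr p * (C powr p * Lp_pow w)" "0 \<le> 2 powr p * (D powr p * Lp_pow (Xg w))"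
      by (simp_all add: Lp_pow_nonneg)
    then show ?thesis unfolding energy_def by (simp add: algebra_simps)
  qed
  finally show ?thesis .
qed

lemma C1c_mult_Cinfc:
  assumes "\<phi> \<in> Cinfc \<Omega>" "\<psi> \<in> C1c \<Omega>"
  shows "(\<lambda>x. \<phi> x * \<psi> x) \<in> C1c \<Omega>"
proof -
  have s: "closure {x. \<phi> x * \<psi> x \<noteq> 0} \<subseteq> closure {x. \<psi> x \<noteq> 0}" by (intro closure_mono) auto
  have "bounded {x. \<psi> x \<noteq> 0}" using C1cD(2)[OF assms(2) \<Omega>_sub] by simp
  then have "bounded {x. \<phi> x * \<psi> x \<noteq> 0}" by (rule bounded_subset) auto
  then have "compact (closure {x. \<phi> x * \<psi> x \<noteq> 0})" by simp
  then show ?thesis using s C1cD(3)[OF assms(2) \<Omega>_sub] C_k_mult[OF CinfcD(1)[OF assms(1), of 1] C1cD(1)[OF assms(2) \<Omega>_sub]]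
    unfolding C1c_def compact_support_in_def by blast
qed

lemma C1c_diff:
  assumes "\<phi> \<in> C1c \<Omega>" "\<psi> \<in> C1c \<Omega>"
  shows "(\<lambda>x. \<phi> x - \<psi> x) \<in> C1c \<Omega>"
proof -
  have s: "closure {x. \<phi> x - \<psi> x \<noteq> 0} \<subseteq> closure {x. \<phi> x \<noteq> 0} \<union> closure {x. \<psi> x \<noteq> 0}"
    by (subst closure_Un[symmetric], intro closure_mono) auto
  have "bounded {x. \<phi> x \<noteq> 0}" "bounded {x. \<psi> x \<noteq> 0}" using C1cD(2)[OF assms(1) \<Omega>_sub] C1cD(2)[OF assms(2) \<Omega>_sub] by simp_all
  then have "bounded ({x. \<phi> x \<noteq> 0} \<union> {x. \<psi> x \<noteq> 0})" by simp
  then have "bounded {x. \<phi> x - \<psi> x \<noteq> 0}" by (rule bounded_subset) auto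
  then have c: "compact (closure {x. \<phi> x - \<psi> x \<noteq> 0})" by simp
  have "C_k 1 (\<lambda>x. \<phi> x + (-1) * \<psi> x)"
    by (intro C_k_add C_k_mult C_k_const C1cD(1)[OF assms(1) \<Omega>_sub] C1cD(1)[OF assms(2) \<Omega>_sub])
  then have "C_k 1 (\<lambda>x. \<phi> x - \<psi> x)" by simp
  then show ?thesis using s c C1cD(3)[OF assms(1) \<Omega>_sub] C1cD(3)[OF assms(2) \<Omega>_sub]
    unfolding C1c_def compact_support_in_def by blast
qed

text \<open>Needed to insert \<phi> w_h into the divergence equation. If \<psi> approximates u, then
  \<phi> \<psi> approximates \<phi> u, since multiplication by \<phi> enlarges the energy by at most
  a constant factor.\<close>

lemma W1p0_mult:
  assumes u: "u \<in> W1p0 p \<Omega> X" and \<phi>: "\<phi> \<in> Cinfc \<Omega>"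
  shows "(\<lambda>x. \<phi> x * u x) \<in> W1p0 p \<Omega> X"
  unfolding W1p0_iff
proof (intro conjI allI impI)
  note u' = W1p0_W1p[OF u]
  show "(\<lambda>x. \<phi> x * u x) \<in> W1p p \<Omega> X" by (rule W1p_mult(1)[OF u' \<phi>])
  fix e :: real assume e: "0 < e"
  obtain C where C: "0 < C" "\<And>x. \<bar>\<phi> x\<bar> \<le> C" "\<And>x. norm (Xcl X \<phi> x) \<le> C"
    "\<phi> \<in> borel_measurable lebesgue" "Xcl X \<phi> \<in> borel_measurable lebesgue" using Cinfc_bounds[OF \<phi>] by blast
  define D where "D = C powr p + 2 powr p * (C powr p + C powr p)"
  have D: "0 < D" using C(1) by (simp add: D_def add_pos_pos)
  have "0 < e / D" using e D by simp
  then obtain \<psi> where \<psi>: "\<psi> \<in> C1c \<Omega>" "\<psi> \<in> W1p p \<Omega> X" "energy (\<lambda>x. u x - \<psi> x) < e / D"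
    using u unfolding W1p0_iff by blast
  note w = W1p_diff(1)[OF u' \<psi>(2)]
  note mw = W1p_mult[OF w \<phi>]
  have "energy (\<lambda>x. \<phi> x * (u x - \<psi> x)) \<le> D * energy (\<lambda>x. u x - \<psi> x)"
    unfolding D_def
  proof (rule energy_bound[OF w mw(1) _ _ _ mw(4) mw(5) mw(2)])
    show "\<bar>\<phi> x * (u x - \<psi> x)\<bar> \<le> C * \<bar>u x - \<psi> x\<bar>" for x using C by (simp add: abs_mult mult_right_mono)
    show "norm (\<phi> x *\<^sub>R Xg (\<lambda>x. u x - \<psi> x) x) \<le> C * norm (Xg (\<lambda>x. u x - \<psi> x) x)" for x using C by (simp add: mult_right_mono)
    show "norm ((u x - \<psi> x) *\<^sub>R Xcl X \<phi> x) \<le> C * \<bar>u x - \<psi> x\<bar>" for x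
      using C(3)[of x] by (simp add: mult.commute[of C] mult_left_mono)
  qed (use C in auto)
  also have "\<dots> < D * (e / D)" using \<psi>(3) D by (intro mult_strict_left_mono)
  also have "\<dots> = e" using D by simp
  finally have "energy (\<lambda>x. \<phi> x * u x - \<phi> x * \<psi> x) < e" by (simp add: right_diff_distrib)
  moreover have "(\<lambda>x. \<phi> x * \<psi> x) \<in> C1c \<Omega> \<inter> W1p p \<Omega> X" using C1c_mult_Cinfc[OF \<phi> \<psi>(1)] W1p_mult(1)[OF \<psi>(2) \<phi>] by blast
  ultimately show "\<exists>\<psi>\<in>C1c \<Omega> \<inter> W1p p \<Omega> X. energy (\<lambda>x. \<phi> x * u x - \<psi> x) < e" by (rule bexI[where x = "\<lambda>x. \<phi> x * \<psi> x"]) 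
qed

lemma W1p0_diff:
  assumes u: "u \<in> W1p0 p \<Omega> X" and v: "v \<in> W1p0 p \<Omega> X"
  shows "(\<lambda>x. u x - v x) \<in> W1p0 p \<Omega> X"
  unfolding W1p0_iff
proof (intro conjI allI impI)
  note u' = W1p0_W1p[OF u] and v' = W1p0_W1p[OF v]
  show "(\<lambda>x. u x - v x) \<in> W1p p \<Omega> X" by (rule W1p_diff(1)[OF u' v'])
  fix e :: real assume e: "0 < e"
  then have e': "0 < e / (2 * 2 powr p)" by simp
  obtain \<phi> where \<phi>: "\<phi> \<in> C1c \<Omega>" "\<phi> \<in> W1p p \<Omega> X" "energy (\<lambda>x. u x - \<phi> x) < e / (2 * 2 powr p)"
    using u e' unfolding W1p0_iff by blast
  obtain \<psi> where \<psi>: "\<psi> \<in> C1c \<Omega>" "\<psi> \<in> W1p p \<Omega> X" "energy (\<lambda>x. v x - \<psi> x) < e / (2 * 2 powr p)"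
    using v e' unfolding W1p0_iff by blast
  note wu = W1p_diff(1)[OF u' \<phi>(2)] and wv = W1p_diff(1)[OF v' \<psi>(2)]
  let ?w = "\<lambda>x. 1 * (u x - \<phi> x) + (-1) * (v x - \<psi> x)"
  note L = W1p_linear[OF wu wv, of 1 "-1"]
  have s: "(\<lambda>x. (-1) *\<^sub>R f x) \<in> Lp p \<Omega>" "Lp_pow (\<lambda>x. (-1) *\<^sub>R f x) = Lp_pow f" if "f \<in> Lp p \<Omega>" for f :: "real^'a \<Rightarrow> 'c::euclidean_space"
    using Lp_scaleR[OF that, of "-1"] Lp_pow_scaleR[of "-1" f] by simp_all
  have "Lp_pow ?w \<le> 2 powr p * (Lp_pow (\<lambda>x. u x - \<phi> x) + Lp_pow (\<lambda>x. v x - \<psi> x))"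
    using Lp_pow_add_le[OF W1pD(1)[OF wu] s(1)[OF W1pD(1)[OF wv]]] s(2)[OF W1pD(1)[OF wv]] by simp
  moreover have "Lp_pow (Xg ?w) = Lp_pow (\<lambda>x. 1 *\<^sub>R Xg (\<lambda>x. u x - \<phi> x) x + (-1) *\<^sub>R Xg (\<lambda>x. v x - \<psi> x) x)"
    using pq by (intro Lp_pow_cong_AE L W1pD[OF L(1)] Lp_add Lp_scaleR W1pD[OF wu] W1pD[OF wv]) auto
  moreover have "\<dots> \<le> 2 powr p * (Lp_pow (Xg (\<lambda>x. u x - \<phi> x)) + Lp_pow (Xg (\<lambda>x. v x - \<psi> x)))"
    using Lp_pow_add_le[OF W1pD(4)[OF wu] s(1)[OF W1pD(4)[OF wv]]] s(2)[OF W1pD(4)[OF wv]] by simp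
  ultimately have "energy ?w \<le> 2 powr p * (energy (\<lambda>x. u x - \<phi> x) + energy (\<lambda>x. v x - \<psi> x))"
    by (simp add: energy_def algebra_simps)
  also have "\<dots> < 2 powr p * (e / (2 * 2 powr p) + e / (2 * 2 powr p))"
    using \<phi>(3) \<psi>(3) by (intro mult_strict_left_mono add_strict_mono) auto
  also have "\<dots> = e" by (simp add: field_simps)
  finally have "energy (\<lambda>x. (u x - v x) - (\<phi> x - \<psi> x)) < e" by (simp add: algebra_simps)
  moreover have "(\<lambda>x. \<phi> x - \<psi> x) \<in> C1c \<Omega> \<inter> W1p p \<Omega> X" using C1c_diff[OF \<phi>(1) \<psi>(1)] W1p_diff(1)[OF \<phi>(2) \<psi>(2)] by blast
  ultimately show "\<exists>\<psi>\<in>C1c \<Omega> \<inter> W1p p \<Omega> X. energy (\<lambda>x. (u x - v x) - \<psi> x) < e" by (rule bexI[where x = "\<lambda>x. \<phi> x - \<psi> x"])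
qed

lemma nn_integral_lebesgue_on_\<Omega>:
  "(\<integral>\<^sup>+x. indicator \<Omega> x * f x \<partial>lborel) = (\<integral>\<^sup>+x. f x \<partial>lebesgue_on \<Omega>)"
proof -
  have "(\<integral>\<^sup>+x. f x \<partial>lebesgue_on \<Omega>) = (\<integral>\<^sup>+x. f x * indicator \<Omega> x \<partial>lebesgue)"
    using \<Omega>_lebesgue by (subst nn_integral_restrict_space) auto
  also have "\<dots> = (\<integral>\<^sup>+x. f x * indicator \<Omega> x \<partial>lborel)" by (rule nn_integral_completion)
  finally show ?thesis by (simp add: mult.commute)
qed

lemma C1c_Xg_AE: "\<psi> \<in> C1c \<Omega> \<Longrightarrow> AE x in lebesgue_on \<Omega>. Xg \<psi> x = Xcl X \<psi> x"
  using C1cD(1,2)[OF _ \<Omega>_sub] by (intro Xgrad_AE_eq[OF \<Omega>(1)] has_Xgrad_C1[OF \<Omega>(1) \<Omega>_sub])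

lemma C1c_nn_integral:
  assumes \<psi>: "\<psi> \<in> C1c \<Omega>" and g0: "g 0 = (0::ennreal)"
  shows "(\<integral>\<^sup>+x. g (Xcl X \<psi> x) \<partial>lborel) = (\<integral>\<^sup>+x. g (Xg \<psi> x) \<partial>lebesgue_on \<Omega>)"
proof -
  have "(\<integral>\<^sup>+x. g (Xcl X \<psi> x) \<partial>lborel) = (\<integral>\<^sup>+x. indicator \<Omega> x * g (Xcl X \<psi> x) \<partial>lborel)"
    using C1cD(9)[OF \<psi> \<Omega>_sub] g0 by (intro nn_integral_cong) (auto split: split_indicator)
  also have "\<dots> = (\<integral>\<^sup>+x. g (Xcl X \<psi> x) \<partial>lebesgue_on \<Omega>)" by (rule nn_integral_lebesgue_on_\<Omega>)
  also have "\<dots> = (\<integral>\<^sup>+x. g (Xg \<psi> x) \<partial>lebesgue_on \<Omega>)"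
    using C1c_Xg_AE[OF \<psi>] by (intro nn_integral_cong_AE) (auto elim: eventually_mono)
  finally show ?thesis .
qed

text \<open>These functionals serve twice. With B' extremal in Hoelder's inequality they attain the
  norm at a given element, which makes weakly convergent sequences bounded; with B' = \<phi> M_0
  they pass to the limit in the leading term of the div-curl identity.\<close>

lemma dual_Xg:
  fixes B' :: "real^'a \<Rightarrow> real^'b"
  assumes B': "B' \<in> Lp q \<Omega>"
  shows "(\<lambda>u. LINT x|lebesgue_on \<Omega>. Xg u x \<bullet> B' x) \<in> dual_space (W1p0 p \<Omega> X) (W1p0_norm p \<Omega> X)"
  unfolding dual_space_def
proof (intro CollectI conjI ballI allI exI)
  note H = Lp_Holder[OF _ B' pq]
  have I: "(LINT x|lebesgue_on \<Omega>. Xg w x \<bullet> B' x) = a * (LINT x|lebesgue_on \<Omega>. Xg u x \<bullet> B' x) + b * (LINT x|lebesgue_on \<Omega>. Xg v x \<bullet> B' x)"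
    if uv: "u \<in> W1p p \<Omega> X" "v \<in> W1p p \<Omega> X" and w: "w = (\<lambda>x. a * u x + b * v x)" for u v w a b
  proof -
    note L = W1p_linear[OF uv, of a b, folded w]
    have "(LINT x|lebesgue_on \<Omega>. Xg w x \<bullet> B' x) = (LINT x|lebesgue_on \<Omega>. a * (Xg u x \<bullet> B' x) + b * (Xg v x \<bullet> B' x))"
    proof (rule integral_cong_AE)
      show "AE x in lebesgue_on \<Omega>. Xg w x \<bullet> B' x = a * (Xg u x \<bullet> B' x) + b * (Xg v x \<bullet> B' x)"
        using L(2) by eventually_elim (simp add: inner_add_left)
    qed (use H(1)[OF W1pD(4)[OF L(1)]] H(1)[OF W1pD(4)[OF uv(1)]] H(1)[OF W1pD(4)[OF uv(2)]] in auto)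
    then show ?thesis using H(1)[OF W1pD(4)[OF uv(1)]] H(1)[OF W1pD(4)[OF uv(2)]] by simp
  qed
  show "(LINT x|lebesgue_on \<Omega>. Xg (\<lambda>x. u x + v x) x \<bullet> B' x) = (LINT x|lebesgue_on \<Omega>. Xg u x \<bullet> B' x) + (LINT x|lebesgue_on \<Omega>. Xg v x \<bullet> B' x)"
    if "u \<in> W1p0 p \<Omega> X" "v \<in> W1p0 p \<Omega> X" for u v
    using I[OF W1p0_W1p[OF that(1)] W1p0_W1p[OF that(2)], of "\<lambda>x. u x + v x" 1 1] by simp
  show "(LINT x|lebesgue_on \<Omega>. Xg (\<lambda>x. a *\<^sub>R u x) x \<bullet> B' x) = a * (LINT x|lebesgue_on \<Omega>. Xg u x \<bullet> B' x)"
    if "u \<in> W1p0 p \<Omega> X" for a u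
    using I[OF W1p0_W1p[OF that] W1p0_W1p[OF that], of "\<lambda>x. a *\<^sub>R u x" a 0] by simp
  show "\<bar>LINT x|lebesgue_on \<Omega>. Xg u x \<bullet> B' x\<bar> \<le> Lp_norm q \<Omega> B' * W1p0_norm p \<Omega> X u" if "u \<in> W1p0 p \<Omega> X" for u
    using H(2)[OF W1pD(4)[OF W1p0_W1p[OF that]]] by (simp add: W1p0_norm_def mult.commute)
qed

lemma weakly_convergent_W1p0_bounded:
  assumes "weakly_converges (W1p0 p \<Omega> X) (W1p0_norm p \<Omega> X) f g" "\<And>h. f h \<in> W1p0 p \<Omega> X"
  obtains G where "0 \<le> G" "\<And>h. Lp_norm p \<Omega> (Xg (f h)) \<le> G"
proof (rule weakly_convergent_norm_bounded[OF assms])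
  show "0 \<le> W1p0_norm p \<Omega> X u" for u by (simp add: W1p0_norm_def Lp_norm_nonneg)
  fix h
  obtain g where g: "g \<in> Lp q \<Omega>" "Lp_norm q \<Omega> g \<le> 1" "(LINT x|lebesgue_on \<Omega>. Xg (f h) x \<bullet> g x) = Lp_norm p \<Omega> (Xg (f h))"
    using Lp_norming[OF W1pD(4)[OF W1p0_W1p[OF assms(2)]] pq] .
  have "\<bar>LINT x|lebesgue_on \<Omega>. Xg u x \<bullet> g x\<bar> \<le> W1p0_norm p \<Omega> X u" if "u \<in> W1p0 p \<Omega> X" for u
  proof -
    have "\<bar>LINT x|lebesgue_on \<Omega>. Xg u x \<bullet> g x\<bar> \<le> Lp_norm p \<Omega> (Xg u) * Lp_norm q \<Omega> g"
      by (rule Lp_Holder(2)[OF W1pD(4)[OF W1p0_W1p[OF that]] g(1) pq])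
    also have "\<dots> \<le> Lp_norm p \<Omega> (Xg u) * 1" using g(2) Lp_norm_nonneg by (intro mult_left_mono) auto
    finally show ?thesis by (simp add: W1p0_norm_def)
  qed
  then show "\<exists>l\<in>dual_space (W1p0 p \<Omega> X) (W1p0_norm p \<Omega> X). (\<forall>u\<in>W1p0 p \<Omega> X. \<bar>l u\<bar> \<le> W1p0_norm p \<Omega> X u) \<and> l (f h) = W1p0_norm p \<Omega> X (f h)"
    using g(3) dual_Xg[OF g(1)] by (intro bexI[of _ "\<lambda>u. LINT x|lebesgue_on \<Omega>. Xg u x \<bullet> g x"]) (auto simp: W1p0_norm_def)
qed (use that in \<open>auto simp: W1p0_norm_def\<close>)

lemma Lp_norm_le_energy:
  assumes "energy u < \<delta> powr p" "0 < \<delta>"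
  shows "Lp_norm p \<Omega> u \<le> \<delta>" "Lp_norm p \<Omega> (Xg u) \<le> \<delta>"
proof -
  have *: "Lp_pow f powr (1/p) \<le> \<delta>" if "Lp_pow f \<le> \<delta> powr p" for f :: "real^'a \<Rightarrow> 'c::euclidean_space"
  proof -
    have "Lp_pow f powr (1/p) \<le> (\<delta> powr p) powr (1/p)" using that pq Lp_pow_nonneg[of f] by (intro powr_mono2) auto
    then show ?thesis using assms(2) pq by (simp add: powr_powr)
  qed
  show "Lp_norm p \<Omega> u \<le> \<delta>" "Lp_norm p \<Omega> (Xg u) \<le> \<delta>"
    unfolding Lp_norm_pow using assms(1) Lp_pow_nonneg[of u] Lp_pow_nonneg[of "Xg u"] by (auto intro!: * simp: energy_def)
qed

text \<open>Density extends the inequality from C^1_c to V: an approximant changes the left side in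
  L^1 and the right side through its gradient, and both changes are small with the energy.\<close>

lemma Poincare_W1p0:
  obtains c where "0 \<le> c" "\<And>u. u \<in> W1p0 p \<Omega> X \<Longrightarrow> (LINT x|lebesgue_on \<Omega>. \<bar>u x\<bar>) \<le> c * Lp_norm p \<Omega> (Xg u)"
proof -
  obtain A where A: "0 < A" "\<And>\<phi>. \<phi> \<in> C1c \<Omega> \<Longrightarrow> (\<integral>\<^sup>+x. indicator \<Omega> x * ennreal \<bar>\<phi> x\<bar> \<partial>lborel) \<le> ennreal A * (\<integral>\<^sup>+y. ennreal (norm (Xcl X \<phi> y)) \<partial>lborel)"
    using L1_Poincare[OF \<Omega>] by blast
  obtain c1 where c1: "0 \<le> c1" "\<And>f :: real^'a \<Rightarrow> real. f \<in> Lp p \<Omega> \<Longrightarrow> (LINT x|lebesgue_on \<Omega>. norm (f x)) \<le> c1 * Lp_norm p \<Omega> f"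
    using L1_le_Lp by blast
  obtain c2 where c2: "0 \<le> c2" "\<And>f :: real^'a \<Rightarrow> real^'b. f \<in> Lp p \<Omega> \<Longrightarrow> (LINT x|lebesgue_on \<Omega>. norm (f x)) \<le> c2 * Lp_norm p \<Omega> f"
    using L1_le_Lp by blast
  have C1: "(LINT x|lebesgue_on \<Omega>. \<bar>\<psi> x\<bar>) \<le> A * (LINT x|lebesgue_on \<Omega>. norm (Xg \<psi> x))" if \<psi>: "\<psi> \<in> C1c \<Omega>" "\<psi> \<in> W1p p \<Omega> X" for \<psi>
  proof -
    have i: "integrable (lebesgue_on \<Omega>) (Xg \<psi>)" using W1pD(4)[OF \<psi>(2)] by (rule Lp_integrable)
    show ?thesis
    proof (rule integral_real_bounded)
      have "(\<integral>\<^sup>+x. ennreal \<bar>\<psi> x\<bar> \<partial>lebesgue_on \<Omega>) \<le> ennreal A * (\<integral>\<^sup>+y. ennreal (norm (Xcl X \<psi> y)) \<partial>lborel)"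
        using A(2)[OF \<psi>(1)] by (simp only: nn_integral_lebesgue_on_\<Omega>)
      also have "(\<integral>\<^sup>+y. ennreal (norm (Xcl X \<psi> y)) \<partial>lborel) = (\<integral>\<^sup>+y. ennreal (norm (Xg \<psi> y)) \<partial>lebesgue_on \<Omega>)"
        by (rule C1c_nn_integral[OF \<psi>(1), of "\<lambda>y. ennreal (norm y)"]) simp
      also have "\<dots> = ennreal (LINT x|lebesgue_on \<Omega>. norm (Xg \<psi> x))" using i by (intro nn_integral_eq_integral) auto
      finally show "(\<integral>\<^sup>+x. ennreal \<bar>\<psi> x\<bar> \<partial>lebesgue_on \<Omega>) \<le> ennreal (A * (LINT x|lebesgue_on \<Omega>. norm (Xg \<psi> x)))"
        using A(1) by (simp add: ennreal_mult)
    qed (use A(1) in \<open>auto intro!: mult_nonneg_nonneg integral_nonneg_AE\<close>)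
  qed
  show ?thesis
  proof (rule that[of "A * c2"])
    show "0 \<le> A * c2" using A c2 by simp
    fix u assume u: "u \<in> W1p0 p \<Omega> X"
    note u' = W1p0_W1p[OF u]
    show "(LINT x|lebesgue_on \<Omega>. \<bar>u x\<bar>) \<le> A * c2 * Lp_norm p \<Omega> (Xg u)"
    proof (rule field_le_epsilon)
      fix e :: real assume e: "0 < e"
      \<comment> \<open>The total error is (c1 + A c2) \<delta>; the additional 1 keeps the
        denominator positive.\<close>
      define \<delta> where "\<delta> = e / (c1 + A * c2 + 1)"
      have pos: "0 < c1 + A * c2 + 1" using c1 c2 A by (simp add: add_nonneg_pos)
      have \<delta>: "0 < \<delta>" using e pos by (simp add: \<delta>_def)
      then have "0 < \<delta> powr p" by simp
      then obtain \<psi> where \<psi>: "\<psi> \<in> C1c \<Omega>" "\<psi> \<in> W1p p \<Omega> X" "energy (\<lambda>x. u x - \<psi> x) < \<delta> powr p"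
        using u unfolding W1p0_iff by blast
      note w = W1p_diff[OF u' \<psi>(2)]
      note small = Lp_norm_le_energy[OF \<psi>(3) \<delta>]
      have i: "integrable (lebesgue_on \<Omega>) (\<lambda>x. u x - \<psi> x)" "integrable (lebesgue_on \<Omega>) \<psi>" "integrable (lebesgue_on \<Omega>) u"
        "integrable (lebesgue_on \<Omega>) (Xg u)" "integrable (lebesgue_on \<Omega>) (Xg \<psi>)" "integrable (lebesgue_on \<Omega>) (Xg (\<lambda>x. u x - \<psi> x))"
        using W1pD(2)[OF w(1)] W1pD(2)[OF \<psi>(2)] W1pD(2)[OF u'] Lp_integrable[OF W1pD(4)[OF u']]
          Lp_integrable[OF W1pD(4)[OF \<psi>(2)]] Lp_integrable[OF W1pD(4)[OF w(1)]] by blast+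
      have "(LINT x|lebesgue_on \<Omega>. \<bar>u x\<bar>) \<le> (LINT x|lebesgue_on \<Omega>. \<bar>u x - \<psi> x\<bar> + \<bar>\<psi> x\<bar>)"
        using i by (intro integral_mono) auto
      also have "\<dots> = (LINT x|lebesgue_on \<Omega>. norm (u x - \<psi> x)) + (LINT x|lebesgue_on \<Omega>. \<bar>\<psi> x\<bar>)" using i by simp
      also have "\<dots> \<le> c1 * \<delta> + A * (LINT x|lebesgue_on \<Omega>. norm (Xg \<psi> x))"
      proof (intro add_mono C1[OF \<psi>(1,2)])
        have "(LINT x|lebesgue_on \<Omega>. norm (u x - \<psi> x)) \<le> c1 * Lp_norm p \<Omega> (\<lambda>x. u x - \<psi> x)" by (rule c1(2)[OF W1pD(1)[OF w(1)]])
        also have "\<dots> \<le> c1 * \<delta>" using small c1 by (intro mult_left_mono) auto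
        finally show "(LINT x|lebesgue_on \<Omega>. norm (u x - \<psi> x)) \<le> c1 * \<delta>" .
      qed
      also have "(LINT x|lebesgue_on \<Omega>. norm (Xg \<psi> x)) \<le> (LINT x|lebesgue_on \<Omega>. norm (Xg u x) + norm (Xg (\<lambda>x. u x - \<psi> x) x))"
      proof (rule integral_mono_AE)
        show "AE x in lebesgue_on \<Omega>. norm (Xg \<psi> x) \<le> norm (Xg u x) + norm (Xg (\<lambda>x. u x - \<psi> x) x)"
          using w(2)
        proof eventually_elim
          case (elim x)
          have "Xg \<psi> x = Xg u x - Xg (\<lambda>x. u x - \<psi> x) x" using elim by simp
          then show ?case by (metis norm_triangle_ineq4)
        qed
      qed (use i in auto)
      also have "\<dots> = (LINT x|lebesgue_on \<Omega>. norm (Xg u x)) + (LINT x|lebesgue_on \<Omega>. norm (Xg (\<lambda>x. u x - \<psi> x) x))" using i by simp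
      also have "\<dots> \<le> c2 * Lp_norm p \<Omega> (Xg u) + c2 * \<delta>"
      proof (intro add_mono c2(2) W1pD(4)[OF u'])
        have "(LINT x|lebesgue_on \<Omega>. norm (Xg (\<lambda>x. u x - \<psi> x) x)) \<le> c2 * Lp_norm p \<Omega> (Xg (\<lambda>x. u x - \<psi> x))" by (rule c2(2)[OF W1pD(4)[OF w(1)]])
        also have "\<dots> \<le> c2 * \<delta>" using small c2 by (intro mult_left_mono) auto
        finally show "(LINT x|lebesgue_on \<Omega>. norm (Xg (\<lambda>x. u x - \<psi> x) x)) \<le> c2 * \<delta>" .
      qed
      finally have "(LINT x|lebesgue_on \<Omega>. \<bar>u x\<bar>) \<le> c1 * \<delta> + A * (c2 * Lp_norm p \<Omega> (Xg u) + c2 * \<delta>)"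
        using A(1) by (simp add: mult_left_mono)
      also have "\<dots> = A * c2 * Lp_norm p \<Omega> (Xg u) + (c1 + A * c2) * \<delta>" by (simp add: algebra_simps)
      also have "(c1 + A * c2) * \<delta> \<le> (c1 + A * c2 + 1) * \<delta>" using \<delta> by (intro mult_right_mono) auto
      also have "\<dots> = e" using pos by (simp add: \<delta>_def)
      finally show "(LINT x|lebesgue_on \<Omega>. \<bar>u x\<bar>) \<le> A * c2 * Lp_norm p \<Omega> (Xg u) + e" by simp
    qed
  qed
qed

lemma integrable_indicator_mult:
  assumes "S \<in> sets borel" "integrable (lebesgue_on \<Omega>) u"
  shows "integrable (lebesgue_on \<Omega>) (\<lambda>x. indicator S x * u x :: real)"
proof -
  have "(\<lambda>x. indicator S x :: real) \<in> borel_measurable (lebesgue_on \<Omega>)"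
    by (intro measurable_restrict_space1 borel_measurable_indicator) (use assms(1) in auto)
  then show ?thesis
    by (intro Bochner_Integration.integrable_bound[OF assms(2)] borel_measurable_times) (use assms(2) in \<open>auto split: split_indicator\<close>)
qed

lemma integral_indicator_le:
  assumes "S \<in> sets borel" "integrable (lebesgue_on \<Omega>) u"
  shows "\<bar>LINT x|lebesgue_on \<Omega>. indicator S x * u x\<bar> \<le> (LINT x|lebesgue_on \<Omega>. \<bar>u x :: real\<bar>)"
proof -
  have "\<bar>LINT x|lebesgue_on \<Omega>. indicator S x * u x\<bar> \<le> (LINT x|lebesgue_on \<Omega>. \<bar>indicator S x * u x\<bar>)" by (rule integral_abs_bound)
  also have "\<dots> \<le> (LINT x|lebesgue_on \<Omega>. \<bar>u x\<bar>)"
    using integrable_indicator_mult[OF assms] assms(2) by (intro integral_mono) (auto split: split_indicator)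
  finally show ?thesis .
qed

text \<open>The norm on V sees only the gradient, so boundedness of this functional is exactly what
  the Poincare inequality provides.\<close>

lemma dual_set_integral:
  assumes S: "S \<in> sets borel"
  shows "(\<lambda>u. LINT x|lebesgue_on \<Omega>. indicator S x * u x) \<in> dual_space (W1p0 p \<Omega> X) (W1p0_norm p \<Omega> X)"
proof -
  obtain c where c: "0 \<le> c" "\<And>u. u \<in> W1p0 p \<Omega> X \<Longrightarrow> (LINT x|lebesgue_on \<Omega>. \<bar>u x\<bar>) \<le> c * Lp_norm p \<Omega> (Xg u)"
    using Poincare_W1p0 by blast
  note i = integrable_indicator_mult[OF S W1pD(2)[OF W1p0_W1p]]
  show ?thesis
    unfolding dual_space_def
  proof (intro CollectI conjI ballI allI exI)
    show "(LINT x|lebesgue_on \<Omega>. indicator S x * (u x + v x)) = (LINT x|lebesgue_on \<Omega>. indicator S x * u x) + (LINT x|lebesgue_on \<Omega>. indicator S x * v x)"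
      if "u \<in> W1p0 p \<Omega> X" "v \<in> W1p0 p \<Omega> X" for u v
      using i[OF that(1)] i[OF that(2)] by (simp add: distrib_left)
    show "(LINT x|lebesgue_on \<Omega>. indicator S x * (a *\<^sub>R u x)) = a * (LINT x|lebesgue_on \<Omega>. indicator S x * u x)" for a u
      by (simp add: mult.left_commute)
    show "\<bar>LINT x|lebesgue_on \<Omega>. indicator S x * u x\<bar> \<le> c * W1p0_norm p \<Omega> X u" if "u \<in> W1p0 p \<Omega> X" for u
      using order_trans[OF integral_indicator_le[OF S W1pD(2)[OF W1p0_W1p[OF that]]] c(2)[OF that]] by (simp add: W1p0_norm_def)
  qed
qed

text \<open>Passage from V to C^1_c, where (H3) is available. The approximants keep bounded
  gradients and inherit the convergence of integrals over Borel sets; they tend to 0 in L^p, and the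
  w h follow.\<close>

lemma compact_embedding:
  assumes w: "\<And>h::nat. w h \<in> W1p0 p \<Omega> X" and G: "0 \<le> G" "\<And>h. Lp_pow (Xg (w h)) \<le> G"
    and weak: "\<And>S. S \<in> sets borel \<Longrightarrow> (\<lambda>h. LINT x|lebesgue_on \<Omega>. indicator S x * w h x) \<longlonglongrightarrow> 0"
  shows "(\<lambda>h. Lp_norm p \<Omega> (w h)) \<longlonglongrightarrow> 0"
proof -
  \<comment> \<open>The accuracy improves with h: with a fixed accuracy the integrals of the
    approximants could stay away from 0.\<close>
  define \<delta> where "\<delta> h = 1 / real (Suc h)" for h
  have \<delta>: "0 < \<delta> h" "\<delta> h \<le> 1" for h by (auto simp: \<delta>_def)
  have \<delta>0: "\<delta> \<longlonglongrightarrow> 0" unfolding \<delta>_def by (rule LIMSEQ_Suc[OF lim_1_over_n])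
  have "\<exists>\<psi>. \<psi> \<in> C1c \<Omega> \<and> \<psi> \<in> W1p p \<Omega> X \<and> energy (\<lambda>x. w h x - \<psi> x) < \<delta> h powr p" for h
  proof -
    have "0 < \<delta> h powr p" using \<delta>[of h] by simp
    then show ?thesis using w[of h] unfolding W1p0_iff by blast
  qed
  then have "\<forall>h. \<exists>\<psi>. \<psi> \<in> C1c \<Omega> \<and> \<psi> \<in> W1p p \<Omega> X \<and> energy (\<lambda>x. w h x - \<psi> x) < \<delta> h powr p" by blast
  from choice[OF this] obtain \<psi> where \<psi>: "\<And>h. \<psi> h \<in> C1c \<Omega>" "\<And>h. \<psi> h \<in> W1p p \<Omega> X" "\<And>h. energy (\<lambda>x. w h x - \<psi> h x) < \<delta> h powr p"
    by blast
  note w' = W1p0_W1p[OF w]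
  define r where "r h x = w h x - \<psi> h x" for h x
  have r: "r h \<in> W1p p \<Omega> X" "AE x in lebesgue_on \<Omega>. Xg (r h) x = Xg (w h) x - Xg (\<psi> h) x" for h
    using W1p_diff[OF w' \<psi>(2), of h h] by (simp_all add: r_def[abs_def])
  have rs: "Lp_norm p \<Omega> (r h) \<le> \<delta> h" "Lp_norm p \<Omega> (Xg (r h)) \<le> \<delta> h" for h
    using Lp_norm_le_energy[OF \<psi>(3) \<delta>(1), of h] by (simp_all add: r_def[abs_def])
  have P1: "Lp_pow f \<le> 1" if "Lp_norm p \<Omega> f \<le> \<delta> h" for h and f :: "real^'a \<Rightarrow> 'c::euclidean_space"
  proof -
    have "Lp_norm p \<Omega> f powr p \<le> 1 powr p" using that \<delta>(2)[of h] pq Lp_norm_nonneg[of p \<Omega> f] by (intro powr_mono2) auto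
    then show ?thesis by (simp add: Lp_pow_eq_Lp_norm)
  qed
  have neg: "(\<lambda>x. - f x) \<in> Lp p \<Omega>" "Lp_pow (\<lambda>x. - f x) = Lp_pow f" if "f \<in> Lp p \<Omega>" for f :: "real^'a \<Rightarrow> 'c::euclidean_space"
    using Lp_scaleR[OF that, of "-1"] Lp_pow_scaleR[of "-1" f] by simp_all
  define G' where "G' = 2 powr p * (G + 1)"
  have XG: "Lp_pow (Xg (\<psi> h)) \<le> G'" for h
  proof -
    note n = neg[OF W1pD(4)[OF r(1)[of h]]]
    have "Lp_pow (Xg (\<psi> h)) = Lp_pow (\<lambda>x. Xg (w h) x + - Xg (r h) x)"
    proof (rule Lp_pow_cong_AE)
      show "(\<lambda>x. Xg (w h) x + - Xg (r h) x) \<in> Lp p \<Omega>" using pq by (intro Lp_add W1pD[OF w'] n) auto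
      show "AE x in lebesgue_on \<Omega>. Xg (\<psi> h) x = Xg (w h) x + - Xg (r h) x" using r(2)[of h] by eventually_elim simp
    qed (rule W1pD(4)[OF \<psi>(2)])
    also have "\<dots> \<le> 2 powr p * (Lp_pow (Xg (w h)) + Lp_pow (\<lambda>x. - Xg (r h) x))" by (rule Lp_pow_add_le[OF W1pD(4)[OF w'] n(1)])
    also have "\<dots> \<le> G'" unfolding G'_def n(2) by (intro mult_left_mono add_mono G P1[OF rs(2)]) simp
    finally show ?thesis .
  qed
  have nnX: "(\<integral>\<^sup>+y. ennreal (norm (Xcl X (\<psi> h) y) powr p) \<partial>lborel) \<le> ennreal G'" for h
  proof -
    have "(\<integral>\<^sup>+y. ennreal (norm (Xcl X (\<psi> h) y) powr p) \<partial>lborel) = (\<integral>\<^sup>+y. ennreal (norm (Xg (\<psi> h) y) powr p) \<partial>lebesgue_on \<Omega>)"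
      by (rule C1c_nn_integral[OF \<psi>(1), of "\<lambda>y. ennreal (norm y powr p)"]) simp
    also have "\<dots> = ennreal (Lp_pow (Xg (\<psi> h)))"
      unfolding Lp_pow_def by (rule nn_integral_eq_integral[OF Lp_D(2)[OF W1pD(4)[OF \<psi>(2)]]]) simp
    also have "\<dots> \<le> ennreal G'" by (intro ennreal_leI XG)
    finally show ?thesis .
  qed
  obtain c where c: "0 \<le> c" "\<And>f :: real^'a \<Rightarrow> real. f \<in> Lp p \<Omega> \<Longrightarrow> (LINT x|lebesgue_on \<Omega>. norm (f x)) \<le> c * Lp_norm p \<Omega> f"
    using L1_le_Lp by blast
  have weak\<psi>: "(\<lambda>h. LINT y|lborel. indicator S y * \<psi> h y) \<longlonglongrightarrow> 0" if S: "S \<in> sets borel" for S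
  proof -
    have "(\<lambda>h. LINT x|lebesgue_on \<Omega>. indicator S x * r h x) \<longlonglongrightarrow> 0"
    proof (rule Lim_null_comparison)
      show "\<forall>\<^sub>F h in sequentially. norm (LINT x|lebesgue_on \<Omega>. indicator S x * r h x) \<le> c * \<delta> h"
      proof (rule always_eventually, rule allI)
        fix h
        have "norm (LINT x|lebesgue_on \<Omega>. indicator S x * r h x) \<le> (LINT x|lebesgue_on \<Omega>. norm (r h x))"
          using integral_indicator_le[OF S W1pD(2)[OF r(1)]] by simp
        also have "\<dots> \<le> c * Lp_norm p \<Omega> (r h)" by (rule c(2)[OF W1pD(1)[OF r(1)]])
        also have "\<dots> \<le> c * \<delta> h" using rs c by (intro mult_left_mono) auto
        finally show "norm (LINT x|lebesgue_on \<Omega>. indicator S x * r h x) \<le> c * \<delta> h" .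
      qed
      show "(\<lambda>h. c * \<delta> h) \<longlonglongrightarrow> 0" by (rule tendsto_mult_right_zero[OF \<delta>0])
    qed
    then have "(\<lambda>h. (LINT x|lebesgue_on \<Omega>. indicator S x * w h x) - (LINT x|lebesgue_on \<Omega>. indicator S x * r h x)) \<longlonglongrightarrow> 0 - 0"
      by (intro tendsto_diff weak[OF S])
    moreover have "(LINT x|lebesgue_on \<Omega>. indicator S x * w h x) - (LINT x|lebesgue_on \<Omega>. indicator S x * r h x) = (LINT y|lborel. indicator S y * \<psi> h y)" for h
    proof -
      note m\<psi> = C1cD(6)[OF \<psi>(1)[of h] \<Omega>_sub]
      have "(LINT x|lebesgue_on \<Omega>. indicator S x * w h x) - (LINT x|lebesgue_on \<Omega>. indicator S x * r h x) = (LINT x|lebesgue_on \<Omega>. indicator S x * \<psi> h x)"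
        using integrable_indicator_mult[OF S W1pD(2)[OF w']] integrable_indicator_mult[OF S W1pD(2)[OF r(1)]]
        by (subst Bochner_Integration.integral_diff[symmetric]) (auto simp: r_def algebra_simps)
      also have "\<dots> = (LINT x|lebesgue. indicator S x * \<psi> h x)"
        using C1cD(8)[OF \<psi>(1) \<Omega>_sub] by (intro integral_lebesgue_on_eq[OF \<Omega>_lebesgue]) simp
      also have "\<dots> = (LINT x|lborel. indicator S x * \<psi> h x)"
        using S m\<psi> by (intro integral_completion) auto
      finally show ?thesis .
    qed
    ultimately show ?thesis by simp
  qed
  have G'0: "0 \<le> G'" using G by (simp add: G'_def)
  have strong: "\<forall>\<^sub>F h in sequentially. (\<integral>\<^sup>+x. indicator \<Omega> x * ennreal (\<bar>\<psi> h x\<bar> powr p) \<partial>lborel) \<le> ennreal \<epsilon>" if "0 < \<epsilon>" for \<epsilon>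
    by (rule strong_Lp_convergence[OF \<Omega> pq(1) \<psi>(1) G'0 nnX _ that]) (rule weak\<psi>)
  have Pr0: "(\<lambda>h. Lp_pow (r h)) \<longlonglongrightarrow> 0"
  proof (rule tendsto_sandwich[of "\<lambda>_. 0" _ _ "\<lambda>h. \<delta> h powr p"])
    show "\<forall>\<^sub>F h in sequentially. Lp_pow (r h) \<le> \<delta> h powr p"
      using rs(1) pq by (intro always_eventually allI) (auto simp: Lp_pow_eq_Lp_norm intro!: powr_mono2 Lp_norm_nonneg)
    show "(\<lambda>h. \<delta> h powr p) \<longlonglongrightarrow> 0" using \<delta>0 pq \<delta> by (intro tendsto_zero_powrI[where b=p]) (auto simp: less_imp_le)
  qed (auto simp: Lp_pow_nonneg)
  have Lp_pow\<psi>: "(\<lambda>h. Lp_pow (\<psi> h)) \<longlonglongrightarrow> 0"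
  proof (rule order_tendstoI)
    fix a :: real assume "a < 0"
    then show "\<forall>\<^sub>F h in sequentially. a < Lp_pow (\<psi> h)" using Lp_pow_nonneg by (intro always_eventually allI) (auto intro: less_le_trans)
  next
    fix a :: real assume a: "0 < a"
    then have "0 < a / 2" by simp
    from strong[OF this] show "\<forall>\<^sub>F h in sequentially. Lp_pow (\<psi> h) < a"
    proof eventually_elim
      case (elim h)
      have "Lp_pow (\<psi> h) \<le> a / 2" unfolding Lp_pow_def
        by (rule integral_real_bounded) (use elim a in \<open>auto simp: nn_integral_lebesgue_on_\<Omega>\<close>)
      then show ?case using a by simp
    qed
  qed
  have "(\<lambda>h. Lp_pow (w h)) \<longlonglongrightarrow> 0"
  proof (rule tendsto_sandwich[of "\<lambda>_. 0" _ _ "\<lambda>h. 2 powr p * (Lp_pow (\<psi> h) + Lp_pow (r h))"])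
    show "\<forall>\<^sub>F h in sequentially. Lp_pow (w h) \<le> 2 powr p * (Lp_pow (\<psi> h) + Lp_pow (r h))"
    proof (rule always_eventually, rule allI)
      fix h
      have "Lp_pow (\<lambda>x. \<psi> h x + r h x) \<le> 2 powr p * (Lp_pow (\<psi> h) + Lp_pow (r h))" by (rule Lp_pow_add_le[OF W1pD(1)[OF \<psi>(2)] W1pD(1)[OF r(1)]])
      moreover have "(\<lambda>x. \<psi> h x + r h x) = w h" by (simp add: r_def fun_eq_iff)
      ultimately show "Lp_pow (w h) \<le> 2 powr p * (Lp_pow (\<psi> h) + Lp_pow (r h))" by simp
    qed
    show "(\<lambda>h. 2 powr p * (Lp_pow (\<psi> h) + Lp_pow (r h))) \<longlonglongrightarrow> 0"
      using tendsto_mult_right_zero[OF tendsto_add_zero[OF Lp_pow\<psi> Pr0]] .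
  qed (auto simp: Lp_pow_nonneg)
  then show ?thesis
    unfolding Lp_norm_pow by (rule tendsto_zero_powrI[where b="1/p"]) (use pq in \<open>auto simp: Lp_pow_nonneg\<close>)
qed

lemma weakly_convergesD:
  "weakly_converges S N f g \<Longrightarrow> L \<in> dual_space S N \<Longrightarrow> (\<lambda>h. L (f h)) \<longlonglongrightarrow> L g"
  by (simp add: weakly_converges_def)

section \<open>The div-curl argument\<close>

text \<open>With X v_h = X v + X w_h, the first part pairs M_h with the fixed field \<phi> X v,
  where weak convergence of M_h is enough. The work concerns the part with X w_h.\<close>

lemma div_curl:
  fixes M_seq :: "nat \<Rightarrow> real^'a \<Rightarrow> real^'b"
  assumes v_seq: "\<And>h. v_seq h \<in> W1p0 p \<Omega> X" and v: "v \<in> W1p0 p \<Omega> X"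
    and M_seq: "\<And>h. M_seq h \<in> Lp q \<Omega>" and M: "M \<in> Lp q \<Omega>"
    and wv: "weakly_converges (W1p0 p \<Omega> X) (W1p0_norm p \<Omega> X) v_seq v"
    and wM: "weakly_converges (Lp q \<Omega>) (Lp_norm q \<Omega>) M_seq M"
    and div: "\<And>h w. w \<in> W1p0 p \<Omega> X \<Longrightarrow> divX \<Omega> X (M_seq h) w = g w"
  shows "converges_in_distributions \<Omega> (\<lambda>h x. M_seq h x \<bullet> Xg (v_seq h) x) (\<lambda>x. M x \<bullet> Xg v x)"
  unfolding converges_in_distributions_def
proof
  fix \<phi> assume \<phi>: "\<phi> \<in> Cinfc \<Omega>"
  obtain C where C: "0 < C" "\<And>x. \<bar>\<phi> x\<bar> \<le> C" "\<And>x. norm (Xcl X \<phi> x) \<le> C"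
    "\<phi> \<in> borel_measurable lebesgue" "Xcl X \<phi> \<in> borel_measurable lebesgue" using Cinfc_bounds[OF \<phi>] by blast
  have qp: "1 < q" "1 < p" "1/q + 1/p = 1" using pq by simp_all
  have H: "integrable (lebesgue_on \<Omega>) (\<lambda>x. m x \<bullet> f x)"
     "\<bar>LINT x|lebesgue_on \<Omega>. m x \<bullet> f x\<bar> \<le> Lp_norm q \<Omega> m * Lp_norm p \<Omega> f" if "m \<in> Lp q \<Omega>" "f \<in> Lp p \<Omega>" for m f :: "real^'a \<Rightarrow> real^'b"
    using Lp_Holder[OF that qp] by auto
  define w where "w h x = v_seq h x - v x" for h x
  have w0: "w h \<in> W1p0 p \<Omega> X" for h using W1p0_diff[OF v_seq v] by (simp add: w_def[abs_def])
  note w = W1p0_W1p[OF w0]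
  have Xw: "AE x in lebesgue_on \<Omega>. Xg (w h) x = Xg (v_seq h) x - Xg v x" for h
    using W1p_diff(2)[OF W1p0_W1p[OF v_seq] W1p0_W1p[OF v]] by (simp add: w_def[abs_def])
  obtain G where G: "0 \<le> G" "\<And>h. Lp_norm p \<Omega> (Xg (v_seq h)) \<le> G" using weakly_convergent_W1p0_bounded[OF wv v_seq] by blast
  obtain N where N: "0 \<le> N" "\<And>h. Lp_norm q \<Omega> (M_seq h) \<le> N" using weakly_convergent_Lp_bounded[OF wM M_seq qp] by blast
  have strong: "(\<lambda>h. Lp_norm p \<Omega> (w h)) \<longlonglongrightarrow> 0"
  proof (rule compact_embedding[OF w0])
    note Xv = W1pD(4)[OF W1p0_W1p[OF v]] and Xvs = W1pD(4)[OF W1p0_W1p[OF v_seq]]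
    have n: "(\<lambda>x. - Xg v x) \<in> Lp p \<Omega>" "Lp_pow (\<lambda>x. - Xg v x) = Lp_pow (Xg v)"
      using Lp_scaleR[OF Xv, of "-1"] Lp_pow_scaleR[of "-1" "Xg v"] by simp_all
    show "Lp_pow (Xg (w h)) \<le> 2 powr p * (G powr p + Lp_pow (Xg v))" for h
    proof -
      have "Lp_pow (Xg (w h)) = Lp_pow (\<lambda>x. Xg (v_seq h) x + - Xg v x)"
        by (rule Lp_pow_cong_AE[OF Lp_add[OF _ Xvs n(1)] W1pD(4)[OF w]]) (use Xw[of h] pq in \<open>auto elim: eventually_mono\<close>)
      also have "\<dots> \<le> 2 powr p * (Lp_pow (Xg (v_seq h)) + Lp_pow (\<lambda>x. - Xg v x))" by (rule Lp_pow_add_le[OF Xvs n(1)])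
      also have "\<dots> \<le> 2 powr p * (G powr p + Lp_pow (Xg v))"
        unfolding n(2) using G(2)[of h] pq by (intro mult_left_mono add_mono) (auto simp: Lp_pow_eq_Lp_norm intro!: powr_mono2 Lp_norm_nonneg)
      finally show ?thesis .
    qed
    show "0 \<le> 2 powr p * (G powr p + Lp_pow (Xg v))" by (simp add: Lp_pow_nonneg)
    fix S :: "(real^'a) set" assume S: "S \<in> sets borel"
    have "(\<lambda>h. LINT x|lebesgue_on \<Omega>. indicator S x * v_seq h x) \<longlonglongrightarrow> (LINT x|lebesgue_on \<Omega>. indicator S x * v x)"
      by (rule weakly_convergesD[OF wv dual_set_integral[OF S]])
    then have "(\<lambda>h. (LINT x|lebesgue_on \<Omega>. indicator S x * v_seq h x) - (LINT x|lebesgue_on \<Omega>. indicator S x * v x)) \<longlonglongrightarrow> 0"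
      by (rule LIM_zero)
    moreover have "(LINT x|lebesgue_on \<Omega>. indicator S x * v_seq h x) - (LINT x|lebesgue_on \<Omega>. indicator S x * v x) = (LINT x|lebesgue_on \<Omega>. indicator S x * w h x)" for h
      using integrable_indicator_mult[OF S W1pD(2)[OF W1p0_W1p[OF v_seq]]] integrable_indicator_mult[OF S W1pD(2)[OF W1p0_W1p[OF v]]]
      by (subst Bochner_Integration.integral_diff[symmetric]) (auto simp: w_def algebra_simps)
    ultimately show "(\<lambda>h. LINT x|lebesgue_on \<Omega>. indicator S x * w h x) \<longlonglongrightarrow> 0" by simp
  qed
  note mw = W1p_mult[OF w \<phi>] and mv = W1p_mult[OF W1p0_W1p[OF v] \<phi>]
  \<comment> \<open>The product rule moves \<phi> inside the gradient. The identity is stated for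
    any m because it is compared for M_h and for M_0.\<close>
  have split: "(LINT x|lebesgue_on \<Omega>. m x \<bullet> (\<phi> x *\<^sub>R Xg (w h) x)) = divX \<Omega> X m (\<lambda>x. \<phi> x * w h x) - (LINT x|lebesgue_on \<Omega>. m x \<bullet> (w h x *\<^sub>R Xcl X \<phi> x))"
    if m: "m \<in> Lp q \<Omega>" for m h
  proof -
    have "divX \<Omega> X m (\<lambda>x. \<phi> x * w h x) = (LINT x|lebesgue_on \<Omega>. m x \<bullet> (\<phi> x *\<^sub>R Xg (w h) x) + m x \<bullet> (w h x *\<^sub>R Xcl X \<phi> x))"
      unfolding divX_def
    proof (rule integral_cong_AE)
      show "AE x in lebesgue_on \<Omega>. m x \<bullet> Xg (\<lambda>x. \<phi> x * w h x) x = m x \<bullet> (\<phi> x *\<^sub>R Xg (w h) x) + m x \<bullet> (w h x *\<^sub>R Xcl X \<phi> x)"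
        using mw(2)[of h] by eventually_elim (simp add: inner_add_right)
    qed (use H(1)[OF m W1pD(4)[OF mw(1)[of h]]] H(1)[OF m mw(4)[of h]] H(1)[OF m mw(5)[of h]] in auto)
    also have "\<dots> = (LINT x|lebesgue_on \<Omega>. m x \<bullet> (\<phi> x *\<^sub>R Xg (w h) x)) + (LINT x|lebesgue_on \<Omega>. m x \<bullet> (w h x *\<^sub>R Xcl X \<phi> x))"
      by (rule Bochner_Integration.integral_add[OF H(1)[OF m mw(4)] H(1)[OF m mw(5)]])
    finally show ?thesis by simp
  qed
  have "(\<lambda>h. LINT x|lebesgue_on \<Omega>. M_seq h x \<bullet> (\<phi> x *\<^sub>R Xg v x)) \<longlonglongrightarrow> (LINT x|lebesgue_on \<Omega>. M x \<bullet> (\<phi> x *\<^sub>R Xg v x))"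
    by (rule weakly_convergesD[OF wM Lp_inner_dual[OF mv(4) qp]])
  moreover
  \<comment> \<open>A bounded sequence against a strongly convergent one; m is general so as to
    cover both M_h and the constant sequence M_0.\<close>
  have r0: "(\<lambda>h. LINT x|lebesgue_on \<Omega>. m h x \<bullet> (w h x *\<^sub>R Xcl X \<phi> x)) \<longlonglongrightarrow> 0"
    if m: "\<And>h. m h \<in> Lp q \<Omega>" "\<And>h. Lp_norm q \<Omega> (m h) \<le> N" for m :: "nat \<Rightarrow> real^'a \<Rightarrow> real^'b"
  proof (rule Lim_null_comparison)
    show "\<forall>\<^sub>F h in sequentially. norm (LINT x|lebesgue_on \<Omega>. m h x \<bullet> (w h x *\<^sub>R Xcl X \<phi> x)) \<le> N * (C * Lp_norm p \<Omega> (w h))"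
    proof (rule always_eventually, rule allI)
      fix h
      have "Lp_norm p \<Omega> (\<lambda>x. w h x *\<^sub>R Xcl X \<phi> x) \<le> C * Lp_norm p \<Omega> (w h)"
      proof -
        have "Lp_pow (\<lambda>x. w h x *\<^sub>R Xcl X \<phi> x) \<le> C powr p * Lp_pow (w h)"
          using C by (intro Lp_pow_mono_mult W1pD(1)[OF w] mw(5)) (auto simp: mult.commute[of C] intro!: mult_left_mono)
        then have "Lp_pow (\<lambda>x. w h x *\<^sub>R Xcl X \<phi> x) powr (1/p) \<le> (C powr p * Lp_pow (w h)) powr (1/p)"
          using pq by (intro powr_mono2) (auto simp: Lp_pow_nonneg)
        also have "\<dots> = C * Lp_pow (w h) powr (1/p)" using C pq Lp_pow_nonneg[of "w h"] by (simp add: powr_mult powr_powr)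
        finally show ?thesis by (simp add: Lp_norm_pow)
      qed
      then have "Lp_norm q \<Omega> (m h) * Lp_norm p \<Omega> (\<lambda>x. w h x *\<^sub>R Xcl X \<phi> x) \<le> N * (C * Lp_norm p \<Omega> (w h))"
        using m(2) N(1) Lp_norm_nonneg by (intro mult_mono) auto
      then show "norm (LINT x|lebesgue_on \<Omega>. m h x \<bullet> (w h x *\<^sub>R Xcl X \<phi> x)) \<le> N * (C * Lp_norm p \<Omega> (w h))"
        using H(2)[OF m(1)[of h] mw(5)[of h]] by simp
    qed
    show "(\<lambda>h. N * (C * Lp_norm p \<Omega> (w h))) \<longlonglongrightarrow> 0" by (intro tendsto_mult_right_zero strong)
  qed
  \<comment> \<open>In this pairing the fixed field \<open>\<phi> M\<^sub>0\<close> tests the weakly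
    convergent gradients.\<close>
  have \<phi>M: "(\<lambda>x. \<phi> x *\<^sub>R M_seq 0 x) \<in> Lp q \<Omega>" using pq by (intro Lp_bounded_scaleR[OF M_seq C(4,2)]) simp
  have "(\<lambda>h. LINT x|lebesgue_on \<Omega>. M_seq 0 x \<bullet> (\<phi> x *\<^sub>R Xg (w h) x)) \<longlonglongrightarrow> 0"
  proof -
    have "(\<lambda>h. LINT x|lebesgue_on \<Omega>. Xg (v_seq h) x \<bullet> (\<phi> x *\<^sub>R M_seq 0 x)) \<longlonglongrightarrow> (LINT x|lebesgue_on \<Omega>. Xg v x \<bullet> (\<phi> x *\<^sub>R M_seq 0 x))"
      by (rule weakly_convergesD[OF wv dual_Xg[OF \<phi>M]])
    then have "(\<lambda>h. (LINT x|lebesgue_on \<Omega>. Xg (v_seq h) x \<bullet> (\<phi> x *\<^sub>R M_seq 0 x)) - (LINT x|lebesgue_on \<Omega>. Xg v x \<bullet> (\<phi> x *\<^sub>R M_seq 0 x))) \<longlonglongrightarrow> 0"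
      by (rule LIM_zero)
    moreover have "(LINT x|lebesgue_on \<Omega>. Xg (v_seq h) x \<bullet> (\<phi> x *\<^sub>R M_seq 0 x)) - (LINT x|lebesgue_on \<Omega>. Xg v x \<bullet> (\<phi> x *\<^sub>R M_seq 0 x))
       = (LINT x|lebesgue_on \<Omega>. M_seq 0 x \<bullet> (\<phi> x *\<^sub>R Xg (w h) x))" for h
    proof -
      have i1: "integrable (lebesgue_on \<Omega>) (\<lambda>x. Xg (v_seq h) x \<bullet> (\<phi> x *\<^sub>R M_seq 0 x))"
        and i2: "integrable (lebesgue_on \<Omega>) (\<lambda>x. Xg v x \<bullet> (\<phi> x *\<^sub>R M_seq 0 x))"
        by (rule Lp_Holder(1)[OF W1pD(4)[OF W1p0_W1p[OF v_seq]] \<phi>M pq], rule Lp_Holder(1)[OF W1pD(4)[OF W1p0_W1p[OF v]] \<phi>M pq])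
      have "(LINT x|lebesgue_on \<Omega>. Xg (v_seq h) x \<bullet> (\<phi> x *\<^sub>R M_seq 0 x)) - (LINT x|lebesgue_on \<Omega>. Xg v x \<bullet> (\<phi> x *\<^sub>R M_seq 0 x))
        = (LINT x|lebesgue_on \<Omega>. Xg (v_seq h) x \<bullet> (\<phi> x *\<^sub>R M_seq 0 x) - Xg v x \<bullet> (\<phi> x *\<^sub>R M_seq 0 x))"
        by (rule Bochner_Integration.integral_diff[OF i1 i2, symmetric])
      also have "\<dots> = (LINT x|lebesgue_on \<Omega>. M_seq 0 x \<bullet> (\<phi> x *\<^sub>R Xg (w h) x))"
      proof (rule integral_cong_AE)
        show "AE x in lebesgue_on \<Omega>. Xg (v_seq h) x \<bullet> (\<phi> x *\<^sub>R M_seq 0 x) - Xg v x \<bullet> (\<phi> x *\<^sub>R M_seq 0 x) = M_seq 0 x \<bullet> (\<phi> x *\<^sub>R Xg (w h) x)"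
          using Xw[of h]
        proof eventually_elim
          case (elim x)
          show ?case unfolding elim by (simp add: inner_diff_left inner_diff_right inner_commute right_diff_distrib)
        qed
      qed (use i1 i2 H(1)[OF M_seq mw(4)] in auto)
      finally show ?thesis .
    qed
    ultimately show ?thesis by simp
  qed
  \<comment> \<open>At \<phi> w_h the divergences of M_h and M_0 both equal g. Eliminating g from
    the two instances of \<open>split\<close> writes the integral with M_h as the sum of the three
    null sequences combined here.\<close>
  from tendsto_diff[OF tendsto_add[OF this r0[of "\<lambda>_. M_seq 0", OF M_seq N(2)]] r0[of M_seq, OF M_seq N(2)]]
  have "(\<lambda>h. LINT x|lebesgue_on \<Omega>. M_seq h x \<bullet> (\<phi> x *\<^sub>R Xg (w h) x)) \<longlonglongrightarrow> 0"
    using split[OF M_seq] div[OF W1p0_mult[OF w0 \<phi>]] by simp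
  ultimately have "(\<lambda>h. (LINT x|lebesgue_on \<Omega>. M_seq h x \<bullet> (\<phi> x *\<^sub>R Xg v x)) + (LINT x|lebesgue_on \<Omega>. M_seq h x \<bullet> (\<phi> x *\<^sub>R Xg (w h) x)))
     \<longlonglongrightarrow> (LINT x|lebesgue_on \<Omega>. M x \<bullet> (\<phi> x *\<^sub>R Xg v x)) + 0" by (rule tendsto_add)
  moreover have "(LINT x|lebesgue_on \<Omega>. M_seq h x \<bullet> (\<phi> x *\<^sub>R Xg v x)) + (LINT x|lebesgue_on \<Omega>. M_seq h x \<bullet> (\<phi> x *\<^sub>R Xg (w h) x))
     = (LINT x|lebesgue_on \<Omega>. (M_seq h x \<bullet> Xg (v_seq h) x) * \<phi> x)" for h
  proof -
    note i1 = H(1)[OF M_seq[of h] mv(4)] and i2 = H(1)[OF M_seq[of h] mw(4)[of h]]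
      and i3 = H(1)[OF M_seq[of h] W1p_mult(4)[OF W1p0_W1p[OF v_seq[of h]] \<phi>]]
    have i3': "integrable (lebesgue_on \<Omega>) (\<lambda>x. (M_seq h x \<bullet> Xg (v_seq h) x) * \<phi> x)" using i3 by (simp add: mult.commute)
    have "(LINT x|lebesgue_on \<Omega>. M_seq h x \<bullet> (\<phi> x *\<^sub>R Xg v x)) + (LINT x|lebesgue_on \<Omega>. M_seq h x \<bullet> (\<phi> x *\<^sub>R Xg (w h) x))
      = (LINT x|lebesgue_on \<Omega>. M_seq h x \<bullet> (\<phi> x *\<^sub>R Xg v x) + M_seq h x \<bullet> (\<phi> x *\<^sub>R Xg (w h) x))"
      by (rule Bochner_Integration.integral_add[OF i1 i2, symmetric])
    also have "\<dots> = (LINT x|lebesgue_on \<Omega>. (M_seq h x \<bullet> Xg (v_seq h) x) * \<phi> x)"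
    proof (rule integral_cong_AE)
      show "AE x in lebesgue_on \<Omega>. M_seq h x \<bullet> (\<phi> x *\<^sub>R Xg v x) + M_seq h x \<bullet> (\<phi> x *\<^sub>R Xg (w h) x) = (M_seq h x \<bullet> Xg (v_seq h) x) * \<phi> x"
        using Xw[of h]
      proof eventually_elim
        case (elim x)
        show ?case unfolding elim by (simp add: inner_diff_right algebra_simps)
      qed
    qed (use i1 i2 i3' in auto)
    finally show ?thesis .
  qed
  moreover have "(LINT x|lebesgue_on \<Omega>. M x \<bullet> (\<phi> x *\<^sub>R Xg v x)) = (LINT x|lebesgue_on \<Omega>. (M x \<bullet> Xg v x) * \<phi> x)"
    by (simp add: mult.commute)
  ultimately show "(\<lambda>h. LINT x|lebesgue_on \<Omega>. M_seq h x \<bullet> Xg (v_seq h) x * \<phi> x) \<longlonglongrightarrow> (LINT x|lebesgue_on \<Omega>. M x \<bullet> Xg v x * \<phi> x)"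
    by simp
qed

end

theorem theorem3p1:
  fixes \<Omega> \<Omega>0 :: "(real^'n) set"
    and X :: "'m::finite \<Rightarrow> real^'n \<Rightarrow> real^'n"
    and p p' :: real
    and v_seq :: "nat \<Rightarrow> real^'n \<Rightarrow> real" and v :: "real^'n \<Rightarrow> real"
    and M_seq :: "nat \<Rightarrow> real^'n \<Rightarrow> real^'m" and M :: "real^'n \<Rightarrow> real^'m"
    and g :: "(real^'n \<Rightarrow> real) \<Rightarrow> real"
  assumes "open \<Omega>" "connected \<Omega>" "\<Omega> \<noteq> {}" "bounded \<Omega>"
    and "2 \<le> p" and "p' = p / (p - 1)"
    and "CARD('m) \<le> CARD('n)"
    and "open \<Omega>0" "closure \<Omega> \<subseteq> \<Omega>0"
    and "\<forall>j. \<exists>L. L-lipschitz_on \<Omega>0 (X j)"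
    and "hyp_H1 \<Omega>0 X" and "hyp_H2 \<Omega>0 X" and "hyp_H3 \<Omega>0 X" and "hyp_LIC \<Omega> X"
    and "\<forall>h. v_seq h \<in> W1p0 p \<Omega> X" and "v \<in> W1p0 p \<Omega> X"
    and "\<forall>h. M_seq h \<in> Lp p' \<Omega>" and "M \<in> Lp p' \<Omega>"
    and "weakly_converges (W1p0 p \<Omega> X) (W1p0_norm p \<Omega> X) v_seq v"
    and "weakly_converges (Lp p' \<Omega>) (Lp_norm p' \<Omega>) M_seq M"
    and "g \<in> dual_space (W1p0 p \<Omega> X) (W1p0_norm p \<Omega> X)"
    and "\<forall>h. \<forall>w \<in> W1p0 p \<Omega> X. divX \<Omega> X (M_seq h) w = g w"
  shows "converges_in_distributions \<Omega>
           (\<lambda>h x. M_seq h x \<bullet> Xgrad \<Omega> X (v_seq h) x)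
           (\<lambda>x. M x \<bullet> Xgrad \<Omega> X v x)"
proof -
  have p: "1 < p" using assms(5) by simp
  have p': "1 < p'" "1/p + 1/p' = 1" unfolding assms(6) using p by (simp_all add: field_simps)
  interpret sobolev_setting \<Omega>0 X \<Omega> p p'
    by unfold_locales (use assms p p' in auto)
  show ?thesis
    by (rule div_curl[where g = g]) (use assms in auto)
qed

end
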